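(* Let $n\ge 2$ and let $s:\mathrm{Spin}(2,n+1)\to\mathrm{O}^{\uparrow}_{+}(2,n+1)$ be the (connected) $2:1$ spin covering group of $\mathrm{O}^{\uparrow}_{+}(2,n+1)$. Then the universal covering group of $\mathrm{O}^{\uparrow}_{+}(2,n+1)$ is the embedded submanifold of $\mathrm{Spin}(2,n+1)\times\mathbb{R}$ defined by $$\widehat{\mathrm{S}}(2,n+1)=\{(\mathbf{X},\tau)\in\mathrm{Spin}(2,n+1)\times\mathbb{R}\mid\psi(s(\mathbf{X}))=\rho(\tau)\}$$ with the multiplication $(\mathbf{X},\tau)\ast(\mathbf{X}',\tau')=(\mathbf{X}\mathbf{X}',\,\tau+\tau'+\zeta(s(\mathbf{X}),s(\mathbf{X}')))$, where $\psi,\zeta,\rho$ are defined in the context.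
   Context: Fix an integer $n\ge 2$. $\mathbb{R}^{2,n+1}$ is $\mathbb{R}^{n+3}$ with coordinates $x^0,\dots,x^{n+2}$ and scalar product $\langle x,y\rangle=-x^0y^0-x^1y^1+\sum_{j=2}^{n+2}x^jy^j$; $\mathrm{O}^{\uparrow}_{+}(2,n+1)$ is the identity component of its pseudo-orthogonal group. $\mathbb{R}(p,q)$ denotes real $p\times q$ matrices. Write $\mathbf{X}\in\mathrm{O}^{\uparrow}_{+}(2,n+1)$ in blocks $\mathbf{X}=\begin{pmatrix}\mathfrak{a}(\mathbf{X})&\mathfrak{b}(\mathbf{X})\\ \mathfrak{c}(\mathbf{X})&\mathfrak{d}(\mathbf{X})\end{pmatrix}$ with $\mathfrak{a}(\mathbf{X})\in\mathbb{R}(2,2)$ (invertible with positive determinant) and $\mathfrak{d}(\mathbf{X})\in\mathbb{R}(n+1,n+1)$. Let $\Omega_{\mathrm{IV}}=\{\beta\in\mathbb{R}(n+1,2)\mid I_2-{}^t\beta\beta>0\}$, with origin $\mathrm{O}_{\mathrm{IV}}=0$, let $\pi_2^-:\mathrm{O}^{\uparrow}_{+}(2,n+1)\to\Omega_{\mathrm{IV}}$, $\pi_2^-(\mathbf{X})=\mathfrak{c}(\mathbf{X})\mathfrak{a}(\mathbf{X})^{-1}$, let $\mathbf{S}(\mathrm{r},\mathrm{R})=\begin{pmatrix}\mathrm{r}&0\\0&\mathrm{R}\end{pmatrix}$ for $\mathrm{r}\in\mathrm{SO}(2)$, $\mathrm{R}\in\mathrm{SO}(n+1)$, and let $\rho(t)=\begin{pmatrix}\cos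 t&-\sin t\\ \sin t&\cos t\end{pmatrix}$. For $\beta=(\mathrm{u}\,\mathrm{v})\in\Omega_{\mathrm{IV}}$ let $\mathrm{B}(\beta)$ be the matrix with columns ${}^t(1,0,u^1,\dots,u^{n+1})$, ${}^t(0,1,v^1,\dots,v^{n+1})$, and ${}^t(u^j,v^j,\delta_j^1,\dots,\delta_j^{n+1})$, $j=1,\dots,n+1$. There is a unique upper triangular $\mathfrak{T}(\beta)$ with positive diagonal entries such that $\mathrm{P}(\beta):=\mathrm{B}(\beta)\mathfrak{T}(\beta)\in\mathrm{O}^{\uparrow}_{+}(2,n+1)$; $\mathrm{P}$ is a smooth section of $\pi_2^-$. Let $\widehat{\mathfrak{a}}(\beta)$ be the upper-left $2\times2$ block of $\mathrm{P}(\beta)$. Let $\eta:\Omega_{\mathrm{IV}}\times\mathrm{SO}(2)\to\mathbb{R}$ be the unique smooth map with $\rho(\eta(\beta,\mathrm{r}))=\widehat{\mathfrak{a}}(\beta\mathrm{r}^{-1})^{-1}\mathrm{r}\,\widehat{\mathfrak{a}}(\beta)\mathrm{r}^{-1}$ and $\eta(\mathrm{O}_{\mathrm{IV}},I_2)=0$. Define smooth maps $\mathfrak{m},\mathfrak{r},\mathfrak{R}$ on $\Omega_{\mathrm{IV}}\times\Omega_{\mathrm{IV}}$ with values in $\Omega_{\mathrm{IV}}$, $\mathrm{SO}(2)$, $\mathrm{SO}(n+1)$ by $\mathrm{P}(\beta)\mathrm{P}(\beta')=\mathrm{P}(\mathfrak{m}(\beta,\beta'))\mathbf{S}(\mathfrak{r}(\beta,\beta'),\mathfrak{R}(\beta,\beta'))$,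 and let $\Theta:\Omega_{\mathrm{IV}}\times\Omega_{\mathrm{IV}}\to\mathbb{R}$ be the unique smooth map with $\mathfrak{r}=\rho\circ\Theta$ and $\Theta(\mathrm{O}_{\mathrm{IV}},\mathrm{O}_{\mathrm{IV}})=0$. Define $\psi$ and $\Psi$ on $\mathrm{O}^{\uparrow}_{+}(2,n+1)$, with values in $\mathrm{SO}(2)$ and $\mathrm{SO}(n+1)$, by $\mathbf{X}=\mathrm{P}(\pi_2^-(\mathbf{X}))\mathbf{S}(\psi(\mathbf{X}),\Psi(\mathbf{X}))$, and put $\zeta(\mathbf{X},\mathbf{X}')=\Theta\big(\pi_2^-(\mathbf{X}),\Psi(\mathbf{X})\pi_2^-(\mathbf{X}')\psi(\mathbf{X})^{-1}\big)+\eta\big(\pi_2^-(\mathbf{X}'),\psi(\mathbf{X})\big)$. *)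

theory Defs
  imports "HOL-Analysis.Analysis" "HOL-Algebra.Group"
begin

section \<open>Smooth maps, submanifolds and Lie groups in Euclidean spaces\<close>

text \<open>On an open set \<open>U\<close> of a finite-dimensional space this is the usual \<open>C\<^sup>k\<close>: the differential
  is \<open>C\<^sup>k\<close> iff all the directional derivatives are.\<close>

primrec Ck_on :: "nat \<Rightarrow> ('a::euclidean_space \<Rightarrow> 'b::euclidean_space) \<Rightarrow> 'a set \<Rightarrow> bool" where
  "Ck_on 0 f U \<longleftrightarrow> continuous_on U f"
| "Ck_on (Suc k) f U \<longleftrightarrow>
     (\<forall>x\<in>U. f differentiable (at x)) \<and> (\<forall>v. Ck_on k (\<lambda>x. frechet_derivative f (at x) v) U)"

text \<open>Smoothness on an arbitrary subset \<open>S\<close> of a Euclidean space: locally, \<open>f\<close> extends to a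
  smooth map on an open set. For an embedded submanifold \<open>S\<close> this is smoothness on the
  manifold \<open>S\<close>.\<close>

definition smooth_on :: "'a::euclidean_space set \<Rightarrow> ('a \<Rightarrow> 'b::euclidean_space) \<Rightarrow> bool" where
  "smooth_on S f \<longleftrightarrow>
     (\<forall>x\<in>S. \<exists>U g. open U \<and> x \<in> U \<and> (\<forall>k. Ck_on k g U) \<and> (\<forall>y\<in>S \<inter> U. g y = f y))"

definition diffeomorphism ::
    "'a::euclidean_space set \<Rightarrow> 'b::euclidean_space set \<Rightarrow> ('a \<Rightarrow> 'b) \<Rightarrow> ('b \<Rightarrow> 'a) \<Rightarrow> bool" where
  "diffeomorphism S T f g \<longleftrightarrow> homeomorphism S T f g \<and> smooth_on S f \<and> smooth_on T g"

text \<open>\<open>M\<close> is an embedded submanifold of \<open>N\<close>, by slice charts of \<open>N\<close>: the model space of \<open>N\<close> is a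
  subspace \<open>E\<close> of the ambient Euclidean space, and \<open>M\<close> corresponds to a subspace \<open>F\<close> of \<open>E\<close>.
  For \<open>N = UNIV\<close>, necessarily \<open>E = UNIV\<close>.\<close>

definition embedded_submanifold :: "'a::euclidean_space set \<Rightarrow> 'a set \<Rightarrow> bool" where
  "embedded_submanifold M N \<longleftrightarrow> M \<subseteq> N \<and>
     (\<exists>k d. \<forall>x\<in>M. \<exists>U (V :: 'a set) E F \<phi> \<phi>'.
        x \<in> U \<and> openin (top_of_set N) U \<and>
        subspace E \<and> dim E = d \<and> subspace F \<and> dim F = k \<and> F \<subseteq> E \<and>
        openin (top_of_set E) V \<and> diffeomorphism U V \<phi> \<phi>' \<and> \<phi> ` (M \<inter> U) = V \<inter> F)"

definition lie_group :: "'a::euclidean_space monoid \<Rightarrow> bool" where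
  "lie_group G \<longleftrightarrow> group G \<and> embedded_submanifold (carrier G) UNIV \<and>
     smooth_on (carrier G \<times> carrier G) (\<lambda>(x, y). x \<otimes>\<^bsub>G\<^esub> y) \<and>
     smooth_on (carrier G) (\<lambda>x. inv\<^bsub>G\<^esub> x)"

definition universal_covering_group ::
    "'a::euclidean_space monoid \<Rightarrow> ('a \<Rightarrow> 'b) \<Rightarrow> 'b::euclidean_space monoid \<Rightarrow> bool" where
  "universal_covering_group H p G \<longleftrightarrow>
     lie_group H \<and> lie_group G \<and> p \<in> hom H G \<and> smooth_on (carrier H) p \<and>
     covering_space (carrier H) p (carrier G) \<and> simply_connected (carrier H)"


section \<open>The pseudo-orthogonal group\<close>

text \<open>The coordinates of \<open>\<real>\<^bsup>2,n+1\<^esup>\<close> are indexed by \<open>2 + 'm\<close>, where \<open>CARD('m) = n + 1\<close>: \<open>Inl 0\<close> and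
  \<open>Inl 1\<close> stand for the indices \<open>0\<close> and \<open>1\<close> (the elements of the type \<open>2\<close> are \<open>0 < 1\<close>), and the
  elements \<open>Inr j\<close>, in the given linear order of \<open>'m\<close>, for the indices \<open>2, \<dots>, n + 2\<close>.
  A \<open>p \<times> q\<close> matrix has type \<open>real ^ 'q ^ 'p\<close>.\<close>

type_synonym 'm mat_full = "real ^ (2 + 'm) ^ (2 + 'm)"
type_synonym 'm mat_low = "real ^ 2 ^ 'm"  \<comment> \<open>\<open>\<real>(n+1,2)\<close>\<close>
type_synonym 'm mat_d = "real ^ 'm ^ 'm"

fun idx_less :: "2 + 'm::linorder \<Rightarrow> 2 + 'm \<Rightarrow> bool" where
  "idx_less (Inl i) (Inl j) \<longleftrightarrow> i < j"
| "idx_less (Inl i) (Inr j) \<longleftrightarrow> True"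
| "idx_less (Inr i) (Inl j) \<longleftrightarrow> False"
| "idx_less (Inr i) (Inr j) \<longleftrightarrow> i < j"

definition scal :: "real ^ (2 + 'm::finite) \<Rightarrow> real ^ (2 + 'm) \<Rightarrow> real" where
  "scal x y = - x $ Inl 0 * y $ Inl 0 - x $ Inl 1 * y $ Inl 1 + (\<Sum>j\<in>UNIV. x $ Inr j * y $ Inr j)"

definition pseudo_orthogonal :: "('m::finite) mat_full set" where
  "pseudo_orthogonal = {X. \<forall>x y. scal (X *v x) (X *v y) = scal x y}"

definition O_up :: "('m::finite) mat_full set" where
  "O_up = connected_component_set pseudo_orthogonal (mat 1)"

definition O_up_group :: "('m::finite) mat_full monoid" where
  "O_up_group = \<lparr>carrier = O_up, mult = (**), one = mat 1\<rparr>"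

definition block_a :: "('m::finite) mat_full \<Rightarrow> real ^ 2 ^ 2" where
  "block_a X = (\<chi> i j. X $ Inl i $ Inl j)"

definition block_c :: "('m::finite) mat_full \<Rightarrow> 'm mat_low" where
  "block_c X = (\<chi> i j. X $ Inr i $ Inl j)"

definition from_blocks ::
    "real ^ 2 ^ 2 \<Rightarrow> real ^ 'm ^ 2 \<Rightarrow> ('m::finite) mat_low \<Rightarrow> 'm mat_d \<Rightarrow> 'm mat_full" where
  "from_blocks a b c d = (\<chi> i j. case i of
       Inl k \<Rightarrow> (case j of Inl l \<Rightarrow> a $ k $ l | Inr l \<Rightarrow> b $ k $ l)
     | Inr k \<Rightarrow> (case j of Inl l \<Rightarrow> c $ k $ l | Inr l \<Rightarrow> d $ k $ l))"

definition SO :: "(real ^ 'k::finite ^ 'k) set" where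
  "SO = {A. rotation_matrix A}"

definition S_block :: "real ^ 2 ^ 2 \<Rightarrow> ('m::finite) mat_d \<Rightarrow> 'm mat_full" where
  "S_block r R = from_blocks r 0 0 R"

definition rho :: "real \<Rightarrow> real ^ 2 ^ 2" where
  "rho t = (\<chi> i j. if i = 0 then (if j = 0 then cos t else - sin t)
                            else (if j = 0 then sin t else cos t))"


section \<open>The domain \<open>\<Omega>\<^sub>I\<^sub>V\<close>, the section \<open>\<beta> \<mapsto> P_mat \<beta>\<close> and the function \<open>\<zeta>\<close>\<close>

definition Omega :: "('m::finite) mat_low set" where
  "Omega = {\<beta>. \<forall>x. x \<noteq> 0 \<longrightarrow> x \<bullet> ((mat 1 - transpose \<beta> ** \<beta>) *v x) > 0}"

definition pi2 :: "('m::finite) mat_full \<Rightarrow> 'm mat_low" where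
  "pi2 X = block_c X ** matrix_inv (block_a X)"

definition B_mat :: "('m::finite) mat_low \<Rightarrow> 'm mat_full" where
  "B_mat \<beta> = from_blocks (mat 1) (transpose \<beta>) \<beta> (mat 1)"

definition upper_triangular :: "('m::{finite,linorder}) mat_full \<Rightarrow> bool" where
  "upper_triangular T \<longleftrightarrow> (\<forall>i j. idx_less j i \<longrightarrow> T $ i $ j = 0)"

definition T_mat :: "('m::{finite,linorder}) mat_low \<Rightarrow> 'm mat_full" where
  "T_mat \<beta> = (THE T. upper_triangular T \<and> (\<forall>i. T $ i $ i > 0) \<and> B_mat \<beta> ** T \<in> O_up)"

definition P_mat :: "('m::{finite,linorder}) mat_low \<Rightarrow> 'm mat_full" where
  "P_mat \<beta> = B_mat \<beta> ** T_mat \<beta>"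

definition a_hat :: "('m::{finite,linorder}) mat_low \<Rightarrow> real ^ 2 ^ 2" where
  "a_hat \<beta> = block_a (P_mat \<beta>)"

text \<open>Here and for \<open>Theta\<close>, extensionality fixes the (irrelevant) values outside the domain, so
  that the description is unique.\<close>

definition eta :: "('m::{finite,linorder}) mat_low \<times> (real ^ 2 ^ 2) \<Rightarrow> real" where
  "eta = (THE h. h \<in> extensional (Omega \<times> SO) \<and> smooth_on (Omega \<times> SO) h \<and>
     (\<forall>\<beta>\<in>Omega. \<forall>r\<in>SO.
        rho (h (\<beta>, r)) =
          matrix_inv (a_hat (\<beta> ** matrix_inv r)) ** r ** a_hat \<beta> ** matrix_inv r) \<and>
     h (0, mat 1) = 0)"

text \<open>The middle factor of the decomposition
  \<open>P_mat \<beta> ** P_mat \<beta>' = P_mat m ** S_block r R\<close>; the other two are not needed for \<open>zeta\<close>.\<close>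

definition r_frak :: "('m::{finite,linorder}) mat_low \<Rightarrow> 'm mat_low \<Rightarrow> real ^ 2 ^ 2" where
  "r_frak \<beta> \<beta>' = (THE r. r \<in> SO \<and> (\<exists>m\<in>Omega. \<exists>R\<in>SO. P_mat \<beta> ** P_mat \<beta>' = P_mat m ** S_block r R))"

definition Theta :: "('m::{finite,linorder}) mat_low \<times> 'm mat_low \<Rightarrow> real" where
  "Theta = (THE h. h \<in> extensional (Omega \<times> Omega) \<and> smooth_on (Omega \<times> Omega) h \<and>
     (\<forall>\<beta>\<in>Omega. \<forall>\<beta>'\<in>Omega. rho (h (\<beta>, \<beta>')) = r_frak \<beta> \<beta>') \<and>
     h (0, 0) = 0)"

definition psi :: "('m::{finite,linorder}) mat_full \<Rightarrow> real ^ 2 ^ 2" where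
  "psi X = (THE r. r \<in> SO \<and> (\<exists>R\<in>SO. X = P_mat (pi2 X) ** S_block r R))"

definition Psi :: "('m::{finite,linorder}) mat_full \<Rightarrow> 'm mat_d" where
  "Psi X = (THE R. R \<in> SO \<and> (\<exists>r\<in>SO. X = P_mat (pi2 X) ** S_block r R))"

definition zeta :: "('m::{finite,linorder}) mat_full \<Rightarrow> 'm mat_full \<Rightarrow> real" where
  "zeta X X' = Theta (pi2 X, Psi X ** pi2 X' ** matrix_inv (psi X)) + eta (pi2 X', psi X)"


section \<open>The spin covering group\<close>

text \<open>The Clifford algebra of \<open>\<real>\<^bsup>2,n+1\<^esup>\<close>, with \<open>v\<^sup>2 = \<langle>v, v\<rangle>\<close>, on the basis
  \<open>e\<^sub>A = e\<^bsub>i1\<^esub> \<cdots> e\<^bsub>ik\<^esub>\<close> for \<open>A = {i1 < \<dots> < ik}\<close>, so that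
  \<open>e\<^sub>A e\<^sub>B = cl_sign A B e\<^bsub>sym_diff A B\<^esub>\<close>.\<close>

type_synonym 'm clifford = "real ^ ((2 + 'm) set)"

definition cl_sign :: "(2 + 'm::{finite,linorder}) set \<Rightarrow> (2 + 'm) set \<Rightarrow> real" where
  "cl_sign A B = (-1) ^ card {(a, b). a \<in> A \<and> b \<in> B \<and> idx_less b a}
     * (\<Prod>i\<in>A \<inter> B. scal (axis i 1) (axis i 1))"

definition cl_mult ::
    "('m::{finite,linorder}) clifford \<Rightarrow> 'm clifford \<Rightarrow> 'm clifford" (infixl \<open>\<odot>\<close> 70) where
  "x \<odot> y = (\<Sum>A\<in>UNIV. \<Sum>B\<in>UNIV. (x $ A * y $ B * cl_sign A B) *\<^sub>R axis (sym_diff A B) 1)"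

definition cl_one :: "('m::{finite,linorder}) clifford" where
  "cl_one = axis {} 1"

definition cl_vec :: "real ^ (2 + 'm::{finite,linorder}) \<Rightarrow> 'm clifford" where
  "cl_vec v = (\<Sum>i\<in>UNIV. v $ i *\<^sub>R axis {i} 1)"

text \<open>The full spin group consists of the products of an even number of unit vectors; it is not
  connected. The connected spin group is its identity component.\<close>

definition full_spin :: "('m::{finite,linorder}) clifford set" where
  "full_spin = {foldr (\<odot>) (map cl_vec vs) cl_one | vs.
     even (length vs) \<and> (\<forall>v\<in>set vs. scal v v = 1 \<or> scal v v = -1)}"

definition Spin :: "('m::{finite,linorder}) clifford set" where
  "Spin = connected_component_set full_spin cl_one"

text \<open>\<open>spin_cover x\<close> is the map \<open>v \<mapsto> x v x\<^sup>-\<^sup>1\<close>.\<close>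

definition spin_cover :: "('m::{finite,linorder}) clifford \<Rightarrow> 'm mat_full" where
  "spin_cover x = (THE A. \<forall>v. x \<odot> cl_vec v = cl_vec (A *v v) \<odot> x)"


section \<open>The group of the theorem\<close>

definition S_hat :: "(('m::{finite,linorder}) clifford \<times> real) set" where
  "S_hat = {(X, \<tau>). X \<in> Spin \<and> psi (spin_cover X) = rho \<tau>}"

definition S_hat_mult ::
    "('m::{finite,linorder}) clifford \<times> real \<Rightarrow> 'm clifford \<times> real \<Rightarrow> 'm clifford \<times> real" where
  "S_hat_mult = (\<lambda>(X, \<tau>) (X', \<tau>').
     (X \<odot> X', \<tau> + \<tau>' + zeta (spin_cover X) (spin_cover X')))"

definition S_hat_group :: "(('m::{finite,linorder}) clifford \<times> real) monoid" where
  "S_hat_group = \<lparr>carrier = S_hat, mult = S_hat_mult, one = (cl_one, 0)\<rparr>"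

end

theory Submission
  imports Defs "HOL-Algebra.Coset"
begin

text \<open>The Cayley transform gives local inverses of the spin covering and slice charts of all the groups
  involved. By Gram-Schmidt, \<open>P_mat\<close> is a smooth section over the convex set \<open>Omega\<close>, and
  \<open>psi X = rho \<tau>\<close> only says that \<open>\<tau>\<close> is a polar angle of the row \<open>1\<close> of \<open>block_a X\<close>, because \<open>a_hat\<close> is upper
  triangular with positive diagonal. The angles \<open>eta\<close> and \<open>Theta\<close> exist since the maps they lift are
  null-homotopic (\<open>Omega\<close> is star-shaped); uniqueness of continuous lifts makes \<open>zeta\<close> a cocycle, so \<open>S_hat\<close>
  is a group. Lifting \<open>P_mat\<close> to \<open>Spin\<close> shows that \<open>S_hat\<close> is homeomorphic to
  \<open>Omega \<times> \<real> \<times> Spin(n+1)\<close>, where \<open>\<tau>\<close> is the coordinate of the second factor, and \<open>Spin(n+1)\<close> is simply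
  connected by induction from \<open>Spin(3) = S\<^sup>3\<close>.\<close>

text \<open>\<open>eta\<close> and \<open>Theta\<close> are definite descriptions, so nothing is
  known about \<open>zeta\<close> before existence and uniqueness of both lifts are proved. The
  relation \<open>polar\<close> (an angle of a vector, up to a positive factor) carries this: it
  turns membership in \<open>S_hat\<close> into a condition on two entries of a matrix that is
  polynomial in the spinor, and a continuous angle of a smooth vector is automatically smooth. Hence
  continuity of \<open>zeta\<close> is enough, even for smoothness of the group law.

  \<open>Spin\<close> and \<open>O_up\<close> are identity components, so membership is obtained by
  exhibiting a connected set through a known element. Moreover \<open>Spin\<close> is given by
  products of vectors and not by equations: the algebra is done in the group \<open>pspin\<close>,
  defined by equations, and the charts use the lift \<open>j\<close> of the Cayley transform, the
  surplus coordinates of the Clifford algebra being measured as deviation from that lift.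

  The bound on \<open>n\<close> enters through \<open>Spin(n+1)\<close>: with three coordinates it
  is a 3-sphere, while with two it would be a circle.\<close>

section \<open>Differentiability of order k on open sets\<close>

lemma Ck_on_cong:
  assumes "open U" "\<And>x. x \<in> U \<Longrightarrow> f x = g x" "Ck_on k f U"
  shows "Ck_on k g U"
  using assms(2,3)
proof (induction k arbitrary: f g)
  case 0
  then show ?case using continuous_on_cong by (metis Ck_on.simps(1))
next
  case (Suc k)
  have D: "(g has_derivative frechet_derivative f (at x)) (at x)" if "x \<in> U" for x
  proof -
    have "(f has_derivative frechet_derivative f (at x)) (at x)"
      using Suc.prems that by (auto simp: frechet_derivative_works)
    then show ?thesis
      using has_derivative_transform_within_open[OF _ assms(1) that] Suc.prems(1) by blast
  qed
  have "frechet_derivative g (at x) = frechet_derivative f (at x)" if "x \<in> U" for x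
    using D[OF that] frechet_derivative_at by metis
  then have "Ck_on k (\<lambda>x. frechet_derivative g (at x) v) U" for v
    using Suc.IH[of "\<lambda>x. frechet_derivative f (at x) v"] Suc.prems(2) by simp
  then show ?case using D by (auto simp: differentiable_def)
qed

lemma Ck_on_subset: "Ck_on k f U \<Longrightarrow> V \<subseteq> U \<Longrightarrow> Ck_on k f V"
  by (induction k arbitrary: f) (auto intro: continuous_on_subset)

text \<open>Derivatives at a point are unique, so an explicit formula \<open>D\<close> may replace
  the choice term \<open>frechet_derivative\<close>. The closure properties below are proved through
  this rule.\<close>

lemma Ck_on_SucI:
  assumes "open U" "\<And>x. x \<in> U \<Longrightarrow> (f has_derivative D x) (at x)"
    "\<And>v. Ck_on k (\<lambda>x. D x v) U"
  shows "Ck_on (Suc k) f U"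
proof -
  have "frechet_derivative f (at x) = D x" if "x \<in> U" for x
    using assms(2)[OF that] frechet_derivative_at by metis
  then have "Ck_on k (\<lambda>x. frechet_derivative f (at x) v) U" for v
    using Ck_on_cong[OF assms(1) _ assms(3)] by simp
  then show ?thesis using assms(2) by (auto simp: differentiable_def)
qed

lemma Ck_on_SucD:
  assumes "Ck_on (Suc k) f U" "x \<in> U"
  shows "(f has_derivative frechet_derivative f (at x)) (at x)"
  using assms by (auto simp: frechet_derivative_works)

lemma Ck_on_Suc_continuous:
  assumes "Ck_on k f U"
  shows "continuous_on U f"
proof (cases k)
  case 0
  then show ?thesis using assms by simp
next
  case (Suc m)
  then show ?thesis
    using assms by (auto simp: continuous_at_imp_continuous_on differentiable_imp_continuous_within)
qed

lemma Ck_on_down: "Ck_on (Suc k) f U \<Longrightarrow> Ck_on k f U"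
proof (induction k arbitrary: f)
  case 0
  then show ?case using Ck_on_Suc_continuous Ck_on.simps(1) by blast
next
  case (Suc k)
  have "\<forall>v. Ck_on k (\<lambda>x. frechet_derivative f (at x) v) U"
    using Suc.IH Suc.prems by (metis Ck_on.simps(2))
  then show ?case using Suc.prems by simp
qed

lemma Ck_on_const: "open U \<Longrightarrow> Ck_on k (\<lambda>x. c) U"
proof (induction k arbitrary: c)
  case (Suc k)
  show ?case by (rule Ck_on_SucI[where D = "\<lambda>x v. 0"]) (use Suc in auto)
qed simp

lemma Ck_on_bounded_linear:
  assumes "bounded_linear L" "open U" shows "Ck_on k L U"
proof (cases k)
  case 0
  then show ?thesis using assms by (simp add: linear_continuous_on)
next
  case (Suc m)
  show ?thesis unfolding Suc
    by (rule Ck_on_SucI[where D = "\<lambda>x. L"])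
       (use assms Ck_on_const in \<open>auto intro: bounded_linear_imp_has_derivative\<close>)
qed

lemma Ck_on_add:
  assumes "open U" "Ck_on k f U" "Ck_on k g U"
  shows "Ck_on k (\<lambda>x. f x + g x) U"
  using assms(2,3)
proof (induction k arbitrary: f g)
  case 0
  then show ?case by (auto intro: continuous_on_add)
next
  case (Suc k)
  show ?case
    by (rule Ck_on_SucI[where D = "\<lambda>x v. frechet_derivative f (at x) v + frechet_derivative g (at x) v"])
      (use Suc assms(1) in \<open>auto intro!: has_derivative_add dest: Ck_on_SucD simp: frechet_derivative_works\<close>)
qed

lemma Ck_on_sum:
  assumes "open U" "\<And>i. i \<in> I \<Longrightarrow> Ck_on k (f i) U"
  shows "Ck_on k (\<lambda>x. \<Sum>i\<in>I. f i x) U"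
  using assms(2)
  by (induction I rule: infinite_finite_induct) (auto intro!: Ck_on_const Ck_on_add assms(1))

lemma Ck_on_bilinear:
  assumes "bounded_bilinear b" "open U" "Ck_on k f U" "Ck_on k g U"
  shows "Ck_on k (\<lambda>x. b (f x) (g x)) U"
  using assms(3,4)
proof (induction k arbitrary: f g)
  case 0
  then show ?case using bounded_bilinear.continuous_on[OF assms(1)] by auto
next
  case (Suc k)
  show ?case
  proof (rule Ck_on_SucI[where D = "\<lambda>x v. b (f x) (frechet_derivative g (at x) v) + b (frechet_derivative f (at x) v) (g x)"])
    show "open U" by fact
    show "((\<lambda>x. b (f x) (g x)) has_derivative
       (\<lambda>v. b (f x) (frechet_derivative g (at x) v) + b (frechet_derivative f (at x) v) (g x))) (at x)" if "x \<in> U" for x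
      by (rule bounded_bilinear.FDERIV[OF assms(1)]) (use Suc.prems that Ck_on_SucD in auto)
    show "Ck_on k (\<lambda>x. b (f x) (frechet_derivative g (at x) v) + b (frechet_derivative f (at x) v) (g x)) U" for v
      by (intro Ck_on_add Suc.IH assms(2) Ck_on_down[OF Suc.prems(1)] Ck_on_down[OF Suc.prems(2)])
        (use Suc.prems in \<open>simp_all\<close>)
  qed
qed

lemma Ck_on_compose:
  assumes "open U" "open V" "f ` U \<subseteq> V" "Ck_on k f U" "Ck_on k g V"
  shows "Ck_on k (\<lambda>x. g (f x)) U"
  using assms(3-)
proof (induction k arbitrary: g)
  case 0
  then show ?case by (auto intro: continuous_on_compose2)
next
  case (Suc k)
  \<comment> \<open>In the plain chain rule the direction fed to the derivative of \<open>g\<close>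
    varies with \<open>x\<close>, so the induction hypothesis does not apply. Expanding that
    direction in \<open>Basis\<close> leaves directional derivatives of \<open>g\<close> in fixed
    directions, composed with \<open>f\<close>.\<close>
  let ?D = "\<lambda>x v. \<Sum>e\<in>Basis. (frechet_derivative f (at x) v \<bullet> e) *\<^sub>R frechet_derivative g (at (f x)) e"
  show ?case
  proof (rule Ck_on_SucI[where D = ?D])
    show "open U" by fact
    fix x assume x: "x \<in> U"
    have df: "(f has_derivative frechet_derivative f (at x)) (at x)"
      using Suc.prems x Ck_on_SucD by blast
    have dg: "(g has_derivative frechet_derivative g (at (f x))) (at (f x))"
      using Suc.prems x Ck_on_SucD by blast
    have lin: "linear (frechet_derivative g (at (f x)))"
      using dg has_derivative_linear by blast
    have eq: "frechet_derivative g (at (f x)) w = (\<Sum>e\<in>Basis. (w \<bullet> e) *\<^sub>R frechet_derivative g (at (f x)) e)" for w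
      using euclidean_representation[of w] linear_sum[OF lin] linear_scale[OF lin]
      by (metis (no_types, lifting) sum.cong)
    have "((\<lambda>x. g (f x)) has_derivative (\<lambda>v. frechet_derivative g (at (f x)) (frechet_derivative f (at x) v))) (at x)"
      using diff_chain_at[OF df dg] by (simp add: o_def)
    then show "((\<lambda>x. g (f x)) has_derivative ?D x) (at x)"
      by (rule has_derivative_eq_rhs) (rule ext, rule eq)
  next
    fix v
    have "Ck_on k (\<lambda>x. frechet_derivative f (at x) v \<bullet> e) U" for e
      using Suc.prems(2) by (intro Ck_on_bilinear[OF bounded_bilinear_inner] assms(1) Ck_on_const) auto
    moreover have "Ck_on k (\<lambda>x. frechet_derivative g (at (f x)) e) U" for e
      by (intro Suc.IH Ck_on_down[OF Suc.prems(2)] Suc.prems(1)) (use Suc.prems in \<open>simp_all\<close>)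
    ultimately show "Ck_on k (\<lambda>x. ?D x v) U"
      by (intro Ck_on_sum assms(1) Ck_on_bilinear[OF bounded_bilinear_scaleR])
  qed
qed

lemma open_Collect_neq0: "open {x::real. x \<noteq> 0}"
  by (simp add: open_Collect_neq continuous_on_const continuous_on_id)

lemma open_Collect_pos: "open {x::real. x > 0}"
  by (simp add: open_Collect_less continuous_on_const continuous_on_id)

text \<open>The derivative is a polynomial in \<open>inverse\<close> itself, so the induction
  hypothesis for the same function suffices. The proof for \<open>sqrt\<close> below uses the same
  device together with this lemma.\<close>

lemma Ck_on_inverse: "Ck_on k (inverse :: real \<Rightarrow> real) {x. x \<noteq> 0}"
proof (induction k)
  case 0
  then show ?case by (auto intro!: continuous_intros)
next
  case (Suc k)
  show ?case
  proof (rule Ck_on_SucI[where D = "\<lambda>x v. - (inverse x * v * inverse x)"])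
    show "Ck_on k (\<lambda>x. - (inverse x * v * inverse x)) {x::real. x \<noteq> 0}" for v :: real
    proof -
      have "Ck_on k (\<lambda>x. (inverse x * (-v)) * inverse x) {x::real. x \<noteq> 0}"
        by (intro Ck_on_bilinear[OF bounded_bilinear_mult] Ck_on_const Suc open_Collect_neq0)
      then show ?thesis by simp
    qed
  qed (auto intro: open_Collect_neq0 has_derivative_inverse')
qed

lemma Ck_on_sqrt: "Ck_on k sqrt {x. x > 0}"
proof (induction k)
  case 0
  then show ?case by (auto intro!: continuous_intros)
next
  case (Suc k)
  show ?case
  proof (rule Ck_on_SucI[where D = "\<lambda>x v. v * (inverse (sqrt x) / 2)"])
    show "(sqrt has_derivative (\<lambda>v. v * (inverse (sqrt x) / 2))) (at x)" if "x \<in> {x. x > 0}" for x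
      using DERIV_real_sqrt[of x] that unfolding has_field_derivative_def
      by (rule_tac has_derivative_eq_rhs[where f' = "(*) (inverse (sqrt x) / 2)"]) (auto simp: fun_eq_iff)
    show "Ck_on k (\<lambda>x. v * (inverse (sqrt x) / 2)) {x. x > 0}" for v :: real
    proof -
      have "Ck_on k (\<lambda>x. (v/2) * inverse (sqrt x)) {x. x > 0}"
        by (intro Ck_on_bilinear[OF bounded_bilinear_mult] Ck_on_const open_Collect_pos
            Ck_on_compose[OF _ open_Collect_neq0 _ Suc Ck_on_inverse]) auto
      then show ?thesis by simp
    qed
  qed (auto intro: open_Collect_pos)
qed

lemma Ck_on_arctan: "Ck_on k arctan UNIV"
proof (cases k)
  case 0
  then show ?thesis by (auto intro!: continuous_intros)
next
  case (Suc m)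
  show ?thesis unfolding Suc
  proof (rule Ck_on_SucI[where D = "\<lambda>x v. v * inverse (1 + x * x)"])
    show "(arctan has_derivative (\<lambda>v. v * inverse (1 + x * x))) (at x)" for x
      using DERIV_arctan[of x] unfolding has_field_derivative_def
      by (rule_tac has_derivative_eq_rhs[where f' = "(*) (inverse (1 + x\<^sup>2))"]) (auto simp: fun_eq_iff power2_eq_square)
    have nz: "1 + x * x \<noteq> 0" for x :: real
      by (metis add_pos_nonneg less_irrefl zero_le_square zero_less_one)
    show "Ck_on m (\<lambda>x. v * inverse (1 + x * x)) UNIV" for v :: real
      by (intro Ck_on_bilinear[OF bounded_bilinear_mult] Ck_on_const open_UNIV
            Ck_on_compose[OF _ open_Collect_neq0 _ _ Ck_on_inverse] Ck_on_add
            Ck_on_bounded_linear[OF bounded_linear_ident]) (use nz in auto)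
  qed auto
qed

subsection \<open>Smooth maps on subsets\<close>

lemma smooth_onE:
  assumes "smooth_on S f" "x \<in> S"
  obtains U g where "open U" "x \<in> U" "\<And>k. Ck_on k g U" "\<And>y. y \<in> S \<inter> U \<Longrightarrow> g y = f y"
proof -
  have "\<exists>U g. open U \<and> x \<in> U \<and> (\<forall>k. Ck_on k g U) \<and> (\<forall>y\<in>S \<inter> U. g y = f y)"
    using assms(1)[unfolded smooth_on_def] assms(2) by (rule bspec)
  then show ?thesis using that by blast
qed

lemma smooth_onI:
  assumes "\<And>x. x \<in> S \<Longrightarrow> \<exists>U g. open U \<and> x \<in> U \<and> (\<forall>k. Ck_on k g U) \<and> (\<forall>y\<in>S \<inter> U. g y = f y)"
  shows "smooth_on S f"
  unfolding smooth_on_def using assms by (rule ballI)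

lemma smooth_onI_open:
  assumes "open U" "\<And>k. Ck_on k f U" "S \<subseteq> U"
  shows "smooth_on S f"
  unfolding smooth_on_def using assms by blast

lemma smooth_on_subset:
  assumes "smooth_on S f" "T \<subseteq> S" shows "smooth_on T f"
proof (rule smooth_onI)
  fix x assume "x \<in> T"
  then have "x \<in> S" using assms by auto
  from smooth_onE[OF assms(1) this] obtain U g where "open U" "x \<in> U" "\<And>k. Ck_on k g U"
    "\<And>y. y \<in> S \<inter> U \<Longrightarrow> g y = f y" by metis
  then show "\<exists>U g. open U \<and> x \<in> U \<and> (\<forall>k. Ck_on k g U) \<and> (\<forall>y\<in>T \<inter> U. g y = f y)"
    using assms(2) by (intro exI[of _ U] exI[of _ g]) auto
qed

lemma smooth_on_cong:
  assumes "smooth_on S f" "\<And>x. x \<in> S \<Longrightarrow> f x = g x" shows "smooth_on S g"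
proof (rule smooth_onI)
  fix x assume "x \<in> S"
  from smooth_onE[OF assms(1) this] obtain U h where "open U" "x \<in> U" "\<And>k. Ck_on k h U"
    "\<And>y. y \<in> S \<inter> U \<Longrightarrow> h y = f y" by metis
  then show "\<exists>U h. open U \<and> x \<in> U \<and> (\<forall>k. Ck_on k h U) \<and> (\<forall>y\<in>S \<inter> U. h y = g y)"
    using assms(2) by (intro exI[of _ U] exI[of _ h]) auto
qed

lemma smooth_on_imp_continuous_on:
  assumes "smooth_on S f" shows "continuous_on S f"
proof (clarsimp simp: continuous_on_eq_continuous_within)
  fix x assume x: "x \<in> S"
  then obtain U g where U: "open U" "x \<in> U" "\<And>k. Ck_on k g U" "\<And>y. y \<in> S \<inter> U \<Longrightarrow> g y = f y"
    using smooth_onE[OF assms x] by metis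
  have "continuous_on U g" using Ck_on_Suc_continuous U(3) by blast
  then have "isCont g x" using U continuous_on_eq_continuous_at by blast
  then have "continuous (at x within S) g" by (simp add: continuous_at_imp_continuous_at_within)
  then have gl: "(g \<longlongrightarrow> g x) (at x within S)" by (simp add: continuous_within)
  show "continuous (at x within S) f"
    unfolding continuous_within
  proof (rule Lim_transform_eventually)
    show "(g \<longlongrightarrow> f x) (at x within S)" using gl U(2,4) x by auto
    show "\<forall>\<^sub>F y in at x within S. g y = f y"
      unfolding eventually_at_topological using U by blast
  qed
qed

lemma smooth_on_local:
  assumes "\<And>x. x \<in> S \<Longrightarrow> \<exists>U g. open U \<and> x \<in> U \<and> smooth_on (S \<inter> U) g \<and> (\<forall>y\<in>S \<inter> U. g y = f y)"
  shows "smooth_on S f"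
proof (rule smooth_onI)
  fix x assume "x \<in> S"
  then obtain U g where U: "open U" "x \<in> U" "smooth_on (S \<inter> U) g" "\<forall>y\<in>S \<inter> U. g y = f y"
    using assms by blast
  then obtain W h where W: "open W" "x \<in> W" "\<forall>k. Ck_on k h W" "\<forall>y\<in>S \<inter> U \<inter> W. h y = g y"
    using smooth_onE[OF U(3)] \<open>x \<in> S\<close> by (metis IntI)
  then show "\<exists>U g. open U \<and> x \<in> U \<and> (\<forall>k. Ck_on k g U) \<and> (\<forall>y\<in>S \<inter> U. g y = f y)"
    using U by (intro exI[of _ "U \<inter> W"] exI[of _ h]) (auto intro: Ck_on_subset)
qed

lemma smooth_on_compose:
  assumes "smooth_on T g" "smooth_on S f" "f ` S \<subseteq> T"
  shows "smooth_on S (\<lambda>x. g (f x))"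
proof (rule smooth_onI)
  fix x assume x: "x \<in> S"
  obtain U f' where U: "open U" "x \<in> U" "\<And>k. Ck_on k f' U" "\<And>y. y \<in> S \<inter> U \<Longrightarrow> f' y = f y"
    using smooth_onE[OF assms(2) x] by metis
  obtain V g' where V: "open V" "f x \<in> V" "\<And>k. Ck_on k g' V" "\<And>y. y \<in> T \<inter> V \<Longrightarrow> g' y = g y"
    using smooth_onE[OF assms(1), of "f x"] assms(3) x by (metis image_subset_iff)
  have cont: "continuous_on U f'" using U(3) Ck_on_Suc_continuous by blast
  have op: "open (U \<inter> f' -` V)" using cont U(1) V(1) by (simp add: continuous_open_preimage)
  have "Ck_on k (\<lambda>x. g' (f' x)) (U \<inter> f' -` V)" for k
    by (rule Ck_on_compose[OF op V(1) _ Ck_on_subset[OF U(3)] V(3)]) auto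
  moreover have "g' (f' y) = g (f y)" if "y \<in> S \<inter> (U \<inter> f' -` V)" for y
    using that U(4)[of y] V(4) assms(3) by fastforce
  ultimately show "\<exists>U ga. open U \<and> x \<in> U \<and> (\<forall>k. Ck_on k ga U) \<and> (\<forall>y\<in>S \<inter> U. ga y = g (f y))"
    using op U V x by (intro exI[of _ "U \<inter> f' -` V"] exI[of _ "\<lambda>x. g' (f' x)"]) auto
qed

lemma smooth_on_const: "smooth_on S (\<lambda>x. c)"
  by (rule smooth_onI_open[of UNIV]) (auto intro: Ck_on_const)

lemma smooth_on_linear: "bounded_linear L \<Longrightarrow> smooth_on S L"
  by (rule smooth_onI_open[of UNIV]) (auto intro: Ck_on_bounded_linear)

lemma smooth_on_linear_compose: "bounded_linear L \<Longrightarrow> smooth_on S f \<Longrightarrow> smooth_on S (\<lambda>x. L (f x))"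
  by (rule smooth_on_compose[OF smooth_on_linear[of L UNIV]]) auto

lemma smooth_on_id: "smooth_on S (\<lambda>x. x)"
  by (rule smooth_on_linear) (rule bounded_linear_ident)

lemma smooth_on_bilinear:
  assumes "bounded_bilinear b" "smooth_on S f" "smooth_on S g"
  shows "smooth_on S (\<lambda>x. b (f x) (g x))"
proof (rule smooth_onI)
  fix x assume x: "x \<in> S"
  obtain U f' where U: "open U" "x \<in> U" "\<And>k. Ck_on k f' U" "\<And>y. y \<in> S \<inter> U \<Longrightarrow> f' y = f y"
    using smooth_onE[OF assms(2) x] by metis
  obtain V g' where V: "open V" "x \<in> V" "\<And>k. Ck_on k g' V" "\<And>y. y \<in> S \<inter> V \<Longrightarrow> g' y = g y"
    using smooth_onE[OF assms(3) x] by metis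
  have "Ck_on k (\<lambda>x. b (f' x) (g' x)) (U \<inter> V)" for k
    by (rule Ck_on_bilinear[OF assms(1)]) (use U V in \<open>auto intro: Ck_on_subset\<close>)
  then show "\<exists>U ga. open U \<and> x \<in> U \<and> (\<forall>k. Ck_on k ga U) \<and> (\<forall>y\<in>S \<inter> U. ga y = b (f y) (g y))"
    using U V by (intro exI[of _ "U \<inter> V"] exI[of _ "\<lambda>x. b (f' x) (g' x)"]) auto
qed

lemma smooth_on_add:
  assumes "smooth_on S f" "smooth_on S g" shows "smooth_on S (\<lambda>x. f x + g x)"
proof (rule smooth_onI)
  fix x assume x: "x \<in> S"
  obtain U f' where U: "open U" "x \<in> U" "\<And>k. Ck_on k f' U" "\<And>y. y \<in> S \<inter> U \<Longrightarrow> f' y = f y"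
    using smooth_onE[OF assms(1) x] by metis
  obtain V g' where V: "open V" "x \<in> V" "\<And>k. Ck_on k g' V" "\<And>y. y \<in> S \<inter> V \<Longrightarrow> g' y = g y"
    using smooth_onE[OF assms(2) x] by metis
  have "Ck_on k (\<lambda>x. f' x + g' x) (U \<inter> V)" for k
    by (rule Ck_on_add) (use U V in \<open>auto intro: Ck_on_subset\<close>)
  then show "\<exists>U ga. open U \<and> x \<in> U \<and> (\<forall>k. Ck_on k ga U) \<and> (\<forall>y\<in>S \<inter> U. ga y = f y + g y)"
    using U V by (intro exI[of _ "U \<inter> V"] exI[of _ "\<lambda>x. f' x + g' x"]) auto
qed

lemma smooth_on_minus: "smooth_on S f \<Longrightarrow> smooth_on S (\<lambda>x. - f x)"
  by (rule smooth_on_linear_compose[of uminus]) (auto intro: bounded_linear_minus bounded_linear_ident)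

lemma smooth_on_diff:
  assumes "smooth_on S f" "smooth_on S g" shows "smooth_on S (\<lambda>x. f x - g x)"
  using smooth_on_add[OF assms(1) smooth_on_minus[OF assms(2)]] by simp

lemma smooth_on_sum:
  "(\<And>i. i \<in> I \<Longrightarrow> smooth_on S (f i)) \<Longrightarrow> smooth_on S (\<lambda>x. \<Sum>i\<in>I. f i x)"
  by (induction I rule: infinite_finite_induct) (auto intro!: smooth_on_const smooth_on_add)

lemma smooth_on_mult:
  fixes f g :: "'a::euclidean_space \<Rightarrow> real"
  shows "smooth_on S f \<Longrightarrow> smooth_on S g \<Longrightarrow> smooth_on S (\<lambda>x. f x * g x)"
  by (rule smooth_on_bilinear[OF bounded_bilinear_mult])

lemma smooth_on_prod:
  fixes f :: "'i \<Rightarrow> 'a::euclidean_space \<Rightarrow> real"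
  shows "(\<And>i. i \<in> I \<Longrightarrow> smooth_on S (f i)) \<Longrightarrow> smooth_on S (\<lambda>x. \<Prod>i\<in>I. f i x)"
  by (induction I rule: infinite_finite_induct) (auto intro!: smooth_on_const smooth_on_mult)

lemma smooth_on_scaleR:
  "smooth_on S f \<Longrightarrow> smooth_on S g \<Longrightarrow> smooth_on S (\<lambda>x. f x *\<^sub>R g x)"
  by (rule smooth_on_bilinear[OF bounded_bilinear_scaleR])

lemma smooth_on_inverse:
  fixes f :: "'a::euclidean_space \<Rightarrow> real"
  shows "smooth_on S f \<Longrightarrow> (\<And>x. x \<in> S \<Longrightarrow> f x \<noteq> 0) \<Longrightarrow> smooth_on S (\<lambda>x. inverse (f x))"
  by (rule smooth_on_compose[OF smooth_onI_open[OF open_Collect_neq0 Ck_on_inverse order_refl]]) auto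

lemma smooth_on_divide:
  fixes f g :: "'a::euclidean_space \<Rightarrow> real"
  shows "smooth_on S f \<Longrightarrow> smooth_on S g \<Longrightarrow> (\<And>x. x \<in> S \<Longrightarrow> g x \<noteq> 0) \<Longrightarrow> smooth_on S (\<lambda>x. f x / g x)"
  unfolding divide_inverse by (intro smooth_on_mult smooth_on_inverse)

lemma smooth_on_sqrt:
  "smooth_on S f \<Longrightarrow> (\<And>x. x \<in> S \<Longrightarrow> f x > 0) \<Longrightarrow> smooth_on S (\<lambda>x. sqrt (f x))"
  by (rule smooth_on_compose[OF smooth_onI_open[OF open_Collect_pos Ck_on_sqrt order_refl]]) auto

lemma smooth_on_arctan: "smooth_on S f \<Longrightarrow> smooth_on S (\<lambda>x. arctan (f x))"
  by (rule smooth_on_compose[OF smooth_onI_open[OF open_UNIV Ck_on_arctan order_refl]]) auto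

lemma bounded_linear_inl: "bounded_linear (\<lambda>x. (x, 0))"
  by (intro bounded_linear_Pair bounded_linear_ident bounded_linear_zero)

lemma bounded_linear_inr: "bounded_linear (\<lambda>x. (0, x))"
  by (intro bounded_linear_Pair bounded_linear_ident bounded_linear_zero)

lemma smooth_on_Pair:
  assumes "smooth_on S f" "smooth_on S g" shows "smooth_on S (\<lambda>x. (f x, g x))"
  using smooth_on_add[OF smooth_on_linear_compose[OF bounded_linear_inl assms(1)]
      smooth_on_linear_compose[OF bounded_linear_inr assms(2)]] by simp

lemma smooth_on_fst: "smooth_on S f \<Longrightarrow> smooth_on S (\<lambda>x. fst (f x))"
  by (rule smooth_on_linear_compose[OF bounded_linear_fst])

lemma smooth_on_snd: "smooth_on S f \<Longrightarrow> smooth_on S (\<lambda>x. snd (f x))"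
  by (rule smooth_on_linear_compose[OF bounded_linear_snd])

lemma smooth_on_nth: "smooth_on S f \<Longrightarrow> smooth_on S (\<lambda>x. f x $ i)"
  by (rule smooth_on_linear_compose[OF bounded_linear_vec_nth])

lemma bounded_linear_axis: "bounded_linear (axis i :: 'a::euclidean_space \<Rightarrow> 'a ^ 'n::finite)"
  by (intro linear_conv_bounded_linear[THEN iffD1] linearI) (auto simp: axis_def vec_eq_iff)

lemma smooth_on_vec_lambda:
  fixes f :: "'a::euclidean_space \<Rightarrow> 'n::finite \<Rightarrow> 'b::euclidean_space"
  assumes "\<And>i. smooth_on S (\<lambda>x. f x i)"
  shows "smooth_on S (\<lambda>x. \<chi> i. f x i)"
proof -
  have "smooth_on S (\<lambda>x. \<Sum>i\<in>UNIV. axis i (f x i))"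
    by (intro smooth_on_sum smooth_on_linear_compose[OF bounded_linear_axis] assms)
  moreover have "(\<Sum>i\<in>UNIV. axis i (f x i)) = (\<chi> i. f x i)" for x
    by (simp add: vec_eq_iff axis_def if_distrib cong: if_cong)
  ultimately show ?thesis by simp
qed

lemma smooth_on_component_iff:
  "smooth_on S f \<longleftrightarrow> (\<forall>i. smooth_on S (\<lambda>x. f x $ i))"
  using smooth_on_vec_lambda[of S "\<lambda>x i. f x $ i"] smooth_on_nth[of S f] by auto

lemma bilinear_bounded:
  fixes b :: "'a::euclidean_space \<Rightarrow> 'b::euclidean_space \<Rightarrow> 'c::real_normed_vector"
  assumes "\<And>x y z. b (x + y) z = b x z + b y z" "\<And>x y z. b x (y + z) = b x y + b x z"
    "\<And>c x y. b (c *\<^sub>R x) y = c *\<^sub>R b x y" "\<And>c x y. b x (c *\<^sub>R y) = c *\<^sub>R b x y"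
  shows "bounded_bilinear b"
  by (rule bilinear_conv_bounded_bilinear[THEN iffD1])
     (auto simp: bilinear_def assms intro!: linearI)

lemma matrix_add_rdistrib': "((B::real^'n^'m) + C) ** (A::real^'p^'n) = B ** A + C ** A"
  by (vector matrix_matrix_mult_def sum.distrib[symmetric] field_simps)

lemma bounded_bilinear_matrix_mul:
  "bounded_bilinear ((**) :: real^'n^'m \<Rightarrow> real^'p^'n \<Rightarrow> real^'p^'m)"
  by (rule bilinear_bounded)
     (simp_all add: matrix_add_ldistrib matrix_add_rdistrib' scalar_matrix_assoc matrix_scalar_ac)

lemma bounded_bilinear_matrix_vector:
  "bounded_bilinear ((*v) :: real^'n^'m \<Rightarrow> real^'n \<Rightarrow> real^'m)"
  by (rule bilinear_bounded)
     (simp_all add: matrix_vector_mult_add_rdistrib matrix_vector_right_distrib scaleR_matrix_vector_assoc matrix_vector_mult_scaleR)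

lemmas smooth_on_matrix_mul = smooth_on_bilinear[OF bounded_bilinear_matrix_mul]
lemmas smooth_on_matrix_vector = smooth_on_bilinear[OF bounded_bilinear_matrix_vector]
lemmas continuous_on_matrix_mul = bounded_bilinear.continuous_on[OF bounded_bilinear_matrix_mul]

lemma bounded_linear_transpose: "bounded_linear (transpose :: real^'n^'m \<Rightarrow> real^'m^'n)"
  by (intro linear_conv_bounded_linear[THEN iffD1] linearI) (auto simp: transpose_def vec_eq_iff)

lemmas smooth_on_transpose = smooth_on_linear_compose[OF bounded_linear_transpose]

lemma smooth_on_det:
  fixes f :: "'a::euclidean_space \<Rightarrow> real^'n^'n"
  assumes "smooth_on S f" shows "smooth_on S (\<lambda>x. det (f x))"
  unfolding det_def
  by (intro smooth_on_sum smooth_on_mult smooth_on_const smooth_on_prod smooth_on_nth assms)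

lemma matrix_inv_works:
  fixes A :: "real^'n^'n"
  assumes "invertible A"
  shows "A ** matrix_inv A = mat 1" "matrix_inv A ** A = mat 1"
  using someI_ex[OF assms[unfolded invertible_def]] by (simp_all add: matrix_inv_def)

text \<open>Cramer's rule turns the choice term \<open>matrix_inv\<close> into quotients of
  polynomials in the entries, from which smoothness of inversion follows.\<close>

lemma matrix_inv_cramer:
  fixes A :: "real^'n^'n"
  assumes "det A \<noteq> 0"
  shows "matrix_inv A = (\<chi> k l. det (\<chi> i j. if j = k then (mat 1 :: real^'n^'n) $ i $ l else A $ i $ j) / det A)"
proof -
  have inv: "invertible A" using assms invertible_det_nz by blast
  have "A *v column l (matrix_inv A) = column l (mat 1)" for l
    using arg_cong[OF matrix_inv_works(1)[OF inv], of "column l"]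
    by (simp add: column_def matrix_vector_mult_def matrix_matrix_mult_def vec_eq_iff)
  then have "column l (matrix_inv A) = (\<chi> k. det (\<chi> i j. if j = k then column l (mat 1) $ i else A $ i $ j) / det A)" for l
    using cramer[OF assms] by blast
  then have "matrix_inv A $ k $ l = det (\<chi> i j. if j = k then (mat 1 :: real^'n^'n) $ i $ l else A $ i $ j) / det A" for k l
    by (simp add: column_def vec_eq_iff cong: if_cong)
  then show ?thesis by (simp add: vec_eq_iff)
qed

lemma smooth_on_matrix_inv:
  fixes f :: "'a::euclidean_space \<Rightarrow> real^'n^'n"
  assumes "smooth_on S f" "\<And>x. x \<in> S \<Longrightarrow> det (f x) \<noteq> 0"
  shows "smooth_on S (\<lambda>x. matrix_inv (f x))"
proof (rule smooth_on_cong)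
  have "smooth_on S (\<lambda>x. if j = k then (mat 1 :: real^'n^'n) $ i $ l else f x $ i $ j)" for i j k l
    by (cases "j = k") (auto intro!: smooth_on_const smooth_on_nth assms)
  then show "smooth_on S (\<lambda>x. (\<chi> k l. det (\<chi> i j. if j = k then (mat 1 :: real^'n^'n) $ i $ l else f x $ i $ j) / det (f x)))"
    by (intro smooth_on_vec_lambda smooth_on_divide smooth_on_det assms)
qed (simp add: matrix_inv_cramer assms)

section \<open>The order of the indices and the indefinite form\<close>

lemma idx_less_irrefl [simp]: "\<not> idx_less i i" by (cases i) auto

lemma idx_less_total: "i \<noteq> j \<Longrightarrow> idx_less i j \<longleftrightarrow> \<not> idx_less j i"
  by (cases i; cases j) auto

lemma idx_less_trans: "idx_less i j \<Longrightarrow> idx_less j k \<Longrightarrow> idx_less i k"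
  by (cases i; cases j; cases k) auto

text \<open>The sign of a coordinate in the form, that is, the scalar square of the corresponding
  basis vector.\<close>

definition qs :: "2 + 'm \<Rightarrow> real" where
  "qs i = (case i of Inl _ \<Rightarrow> -1 | Inr _ \<Rightarrow> 1)"

lemma qs_simps [simp]: "qs (Inl k) = -1" "qs (Inr j) = 1" "qs i * qs i = 1" "qs i \<noteq> 0"
  "\<bar>qs i\<bar> = 1" "qs i * (qs i * y) = y"
  by (auto simp: qs_def split: sum.splits)

lemma qs_cases: "qs i = 1 \<or> qs i = -1" by (auto simp: qs_def split: sum.splits)

lemma sum_UNIV_Plus:
  fixes f :: "'a::finite + 'b::finite \<Rightarrow> 'c::comm_monoid_add"
  shows "(\<Sum>i\<in>UNIV. f i) = (\<Sum>k\<in>UNIV. f (Inl k)) + (\<Sum>j\<in>UNIV. f (Inr j))"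
  by (simp add: UNIV_Plus_UNIV[symmetric] sum.Plus del: UNIV_Plus_UNIV)

lemma UNIV_2': "(UNIV :: 2 set) = {0, 1}"
  using exhaust_2 by force

lemma zero_neq_one_2 [simp]: "(0::2) \<noteq> 1" "(1::2) \<noteq> 0" by auto

lemma sum_2': "sum f (UNIV :: 2 set) = f 0 + f 1"
  by (simp add: UNIV_2')

lemma less_2 [simp]: "(0::2) < 1" "\<not> (1::2) < 0"
  by (auto simp: less_bit0_def bit0.Rep_0 bit0.Rep_1)

lemma scal_qs: "scal x y = (\<Sum>i\<in>UNIV. qs i * x $ i * y $ i)"
  by (simp add: scal_def sum_UNIV_Plus sum_2' algebra_simps)

lemma scal_axis: "scal (axis i 1) x = qs i * x $ i"
  by (simp add: scal_qs axis_def if_distrib if_distribR cong: if_cong)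

lemma scal_sym: "scal x y = scal y x" by (simp add: scal_qs mult_ac)

lemma scal_linear:
  "scal (x + y) z = scal x z + scal y z" "scal z (x + y) = scal z x + scal z y"
  "scal (c *\<^sub>R x) z = c * scal x z" "scal z (c *\<^sub>R x) = c * scal z x"
  "scal (x - y) z = scal x z - scal y z" "scal z (x - y) = scal z x - scal z y"
  "scal (- x) z = - scal x z" "scal z (- x) = - scal z x" "scal 0 z = 0" "scal z 0 = 0"
  by (simp_all add: scal_qs algebra_simps sum.distrib sum_distrib_left sum_subtractf sum_negf)

section \<open>The Clifford algebra as a twisted algebra of sets\<close>

text \<open>The reordering sign of \<open>cl_sign\<close>, written as a product over all pairs
  instead of a power of -1 with a cardinality as exponent: in this form it is multiplicative in each
  argument, factor by factor.\<close>

definition eps :: "(2 + 'm::{finite,linorder}) set \<Rightarrow> (2 + 'm) set \<Rightarrow> real" where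
  "eps A B = (\<Prod>i\<in>UNIV. \<Prod>j\<in>UNIV. if i \<in> A \<and> j \<in> B \<and> idx_less j i then -1 else 1)"

definition qq :: "(2 + 'm::{finite,linorder}) set \<Rightarrow> real" where
  "qq A = (\<Prod>i\<in>UNIV. if i \<in> A then qs i else 1)"

lemma cl_sign_eq: "cl_sign A B = eps A B * qq (A \<inter> B)"
proof -
  let ?S = "{(a, b). a \<in> A \<and> b \<in> B \<and> idx_less b a}"
  have "eps A B = (\<Prod>p\<in>UNIV. if p \<in> ?S then -1 else 1)"
    unfolding eps_def prod.cartesian_product by (rule prod.cong) (auto split: if_splits)
  also have "\<dots> = (\<Prod>p\<in>?S. -1)"
    by (subst prod.If_cases) (auto simp: Compl_eq split: if_splits)
  also have "\<dots> = (-1) ^ card ?S" by simp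
  finally have 1: "eps A B = (-1) ^ card ?S" .
  have "qq (A \<inter> B) = (\<Prod>i\<in>A \<inter> B. scal (axis i 1) (axis i 1))"
    unfolding qq_def scal_axis by (subst prod.If_cases) (auto simp: axis_def Int_def)
  then show ?thesis using 1 by (simp add: cl_sign_def)
qed

text \<open>An index common to \<open>A\<close> and \<open>B\<close> contributes the square of a
  sign and may therefore be dropped: \<open>eps\<close> is bimultiplicative for symmetric
  difference.\<close>

lemma prod_one_minus_cong:
  "eps (sym_diff A B) C = eps A C * eps B C" "eps C (sym_diff A B) = eps C A * eps C B"
  unfolding eps_def prod.distrib[symmetric] by (auto intro!: prod.cong)

lemma eps_sq [simp]: "eps A B * eps A B = 1" "eps A B * (eps A B * y) = y"
proof -
  show 1: "eps A B * eps A B = 1" unfolding eps_def prod.distrib[symmetric] by (rule prod.neutral) (auto intro!: prod.neutral)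
  show "eps A B * (eps A B * y) = y" by (simp add: 1 mult.assoc[symmetric])
qed

lemma eps_empty [simp]: "eps {} A = 1" "eps A {} = 1" by (simp_all add: eps_def)
lemma qq_empty [simp]: "qq {} = 1" by (simp_all add: qq_def)

lemma qq_sq [simp]: "qq A * qq A = 1"
  unfolding qq_def prod.distrib[symmetric] by (rule prod.neutral) auto

lemma cl_sign_empty [simp]: "cl_sign {} A = 1" "cl_sign A {} = 1" by (simp_all add: cl_sign_eq)

text \<open>Both sides are the product of \<open>qs\<close> over the indices that lie in at least
  two of the three sets.\<close>

lemma qq_cocycle: "qq (A \<inter> B) * qq (sym_diff A B \<inter> C) = qq (A \<inter> sym_diff B C) * qq (B \<inter> C)"
  unfolding qq_def prod.distrib[symmetric]
proof (rule prod.cong)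
  show "(if x \<in> A \<inter> B then qs x else 1) * (if x \<in> sym_diff A B \<inter> C then qs x else 1) =
    (if x \<in> A \<inter> sym_diff B C then qs x else 1) * (if x \<in> B \<inter> C then qs x else 1)" for x
    by (cases "x \<in> A"; cases "x \<in> B"; cases "x \<in> C") simp_all
qed simp

lemma cl_sign_cocycle:
  "cl_sign A B * cl_sign (sym_diff A B) C = cl_sign A (sym_diff B C) * cl_sign B C"
  using qq_cocycle[of A B C] by (simp add: cl_sign_eq prod_one_minus_cong algebra_simps)

text \<open>The sign of reversing a product of k anticommuting factors: \<open>eps A A\<close>
  counts the k(k-1)/2 inverted pairs in \<open>A\<close>.\<close>

definition rsgn :: "(2 + 'm::{finite,linorder}) set \<Rightarrow> real" where "rsgn A = eps A A"

text \<open>Bimultiplicativity expands \<open>rsgn (sym_diff A B)\<close> into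
  \<open>rsgn A * rsgn B * eps A B * eps B A\<close>. This is exactly what makes reversal an
  antiautomorphism.\<close>

lemma rsgn_sign: "rsgn A * rsgn B * cl_sign B A = rsgn (sym_diff A B) * cl_sign A B"
  unfolding rsgn_def cl_sign_eq prod_one_minus_cong by (simp add: Int_commute algebra_simps)

lemma cl_sign_self: "rsgn A * cl_sign A A = qq A"
  by (simp add: rsgn_def cl_sign_eq)

lemma sym_diff_cancel [simp]: "sym_diff A (sym_diff A B) = B" "sym_diff (sym_diff B A) A = B" by auto

lemma sym_diff_assoc': "sym_diff (sym_diff A B) C = sym_diff A (sym_diff B C)" by auto

lemma sym_diff_eq_iff: "sym_diff A B = C \<longleftrightarrow> B = sym_diff A C" by auto
lemma cl_mult_nth: "(x \<odot> y) $ C = (\<Sum>A\<in>UNIV. x $ A * y $ sym_diff A C * cl_sign A (sym_diff A C))"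
proof -
  have "(x \<odot> y) $ C = (\<Sum>A\<in>UNIV. \<Sum>B\<in>UNIV. x $ A * y $ B * cl_sign A B * (if B = sym_diff A C then 1 else 0))"
    unfolding cl_mult_def by (simp add: axis_def sym_diff_eq_iff eq_commute[of C])
  also have "\<dots> = (\<Sum>A\<in>UNIV. x $ A * y $ sym_diff A C * cl_sign A (sym_diff A C))"
    by (simp add: if_distrib cong: if_cong)
  finally show ?thesis .
qed

lemma cl_mult_nth2: "(x \<odot> y) $ C = (\<Sum>B\<in>UNIV. x $ sym_diff C B * y $ B * cl_sign (sym_diff C B) B)"
  unfolding cl_mult_nth
  by (rule sum.reindex_bij_witness[where i = "\<lambda>B. sym_diff C B" and j = "\<lambda>A. sym_diff A C"]) (auto intro!: arg_cong2[where f="(*)"] arg_cong2[where f=cl_sign] arg_cong[where f="vec_nth _"])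

lemma bounded_bilinear_cl: "bounded_bilinear (\<odot>)"
  by (rule bilinear_bounded)
     (simp_all add: vec_eq_iff cl_mult_nth algebra_simps sum.distrib sum_distrib_left)

interpretation cl: bounded_bilinear "(\<odot>)" by (rule bounded_bilinear_cl)

lemmas cl_simps = cl.add_left cl.add_right cl.diff_left cl.diff_right cl.minus_left cl.minus_right
  cl.zero_left cl.zero_right cl.scaleR_left cl.scaleR_right

lemma cl_axis: "axis A 1 \<odot> axis B 1 = cl_sign A B *\<^sub>R axis (sym_diff A B) 1"
proof (unfold vec_eq_iff, rule allI)
  fix C
  have "(axis A 1 \<odot> axis B 1) $ C = (\<Sum>X\<in>UNIV. if X = A then axis B 1 $ sym_diff X C * cl_sign X (sym_diff X C) else 0)"
    unfolding cl_mult_nth by (rule sum.cong) (auto simp: axis_def)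
  also have "\<dots> = axis B 1 $ sym_diff A C * cl_sign A (sym_diff A C)" by simp
  also have "\<dots> = (cl_sign A B *\<^sub>R axis (sym_diff A B) 1) $ C"
  proof (cases "sym_diff A C = B")
    case True
    then have "C = sym_diff A B" by blast
    then show ?thesis by (simp add: True axis_def)
  next
    case False
    then have "C \<noteq> sym_diff A B" by blast
    then show ?thesis using False by (simp add: axis_def)
  qed
  finally show "(axis A 1 \<odot> axis B 1) $ C = (cl_sign A B *\<^sub>R axis (sym_diff A B) 1) $ C" .
qed

lemma cl_ext:
  fixes f g :: "'m::{finite,linorder} clifford \<Rightarrow> 'b::real_vector"
  assumes "linear f" "linear g" "\<And>A. f (axis A 1) = g (axis A 1)"
  shows "f x = g x"
proof -
  have "x = (\<Sum>A\<in>UNIV. x $ A *\<^sub>R axis A 1)"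
    by (simp add: vec_eq_iff axis_def if_distrib cong: if_cong)
  note e = this
  have "f x = (\<Sum>A\<in>UNIV. x $ A *\<^sub>R f (axis A 1))"
    using arg_cong[OF e, of f] by (simp add: linear_sum[OF assms(1)] linear_scale[OF assms(1)])
  moreover have "g x = (\<Sum>A\<in>UNIV. x $ A *\<^sub>R g (axis A 1))"
    using arg_cong[OF e, of g] by (simp add: linear_sum[OF assms(2)] linear_scale[OF assms(2)])
  ultimately show ?thesis using assms(3) by simp
qed

text \<open>The product is that of the group of sets under symmetric difference, twisted by
  \<open>cl_sign\<close>. Associativity on basis elements is therefore
  \<open>cl_sign_cocycle\<close>; it is extended by linearity in one factor at a time.\<close>

lemma cl_assoc: "(x \<odot> y) \<odot> z = x \<odot> (y \<odot> z)"
proof -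
  have 1: "(axis A 1 \<odot> axis B 1) \<odot> axis C 1 = axis A 1 \<odot> (axis B 1 \<odot> axis C 1 :: 'a clifford)" for A B C
    using cl_sign_cocycle[of A B C]
    by (simp add: cl_axis cl_simps sym_diff_assoc' mult.commute)
  have 2: "(axis A 1 \<odot> axis B 1) \<odot> z = axis A 1 \<odot> (axis B 1 \<odot> z)" for A B
    by (rule cl_ext[of "\<lambda>z. (axis A 1 \<odot> axis B 1) \<odot> z" "\<lambda>z. axis A 1 \<odot> (axis B 1 \<odot> z)"])
       (auto simp: 1 cl_simps intro!: linearI)
  have 3: "(axis A 1 \<odot> y) \<odot> z = axis A 1 \<odot> (y \<odot> z)" for A
    by (rule cl_ext[of "\<lambda>y. (axis A 1 \<odot> y) \<odot> z" "\<lambda>y. axis A 1 \<odot> (y \<odot> z)"])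
       (auto simp: 2 cl_simps intro!: linearI)
  show ?thesis
    by (rule cl_ext[of "\<lambda>x. (x \<odot> y) \<odot> z" "\<lambda>x. x \<odot> (y \<odot> z)"])
       (auto simp: 3 cl_simps intro!: linearI)
qed

lemma cl_one_left [simp]: "cl_one \<odot> x = x"
  by (rule cl_ext[of "\<lambda>x. cl_one \<odot> x"]) (auto simp: cl_one_def cl_axis cl_simps intro!: linearI)

lemma cl_one_right [simp]: "x \<odot> cl_one = x"
  by (rule cl_ext[of "\<lambda>x. x \<odot> cl_one"]) (auto simp: cl_one_def cl_axis cl_simps intro!: linearI)

text \<open>Reversal, the antiautomorphism that fixes all vectors. On \<open>pspin\<close> it gives
  the inverse.\<close>

definition clrev :: "'m::{finite,linorder} clifford \<Rightarrow> 'm clifford" where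
  "clrev x = (\<chi> A. rsgn A * x $ A)"

lemma linear_clrev: "linear clrev"
  by (rule linearI) (auto simp: clrev_def vec_eq_iff algebra_simps)

lemmas bounded_linear_clrev = linear_clrev[unfolded linear_conv_bounded_linear]

lemma clrev_axis: "clrev (axis A 1) = rsgn A *\<^sub>R axis A 1"
  by (auto simp: clrev_def vec_eq_iff axis_def)

lemma clrev_simps:
  "clrev (x + y) = clrev x + clrev y" "clrev (x - y) = clrev x - clrev y" "clrev (- x) = - clrev x"
  "clrev (c *\<^sub>R x) = c *\<^sub>R clrev x" "clrev 0 = 0"
  by (auto simp: clrev_def vec_eq_iff algebra_simps)

lemma clrev_clrev [simp]: "clrev (clrev x) = x"
  by (simp add: clrev_def rsgn_def vec_eq_iff)

lemma clrev_one [simp]: "clrev cl_one = cl_one" by (simp add: cl_one_def clrev_axis rsgn_def)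

lemma clrev_mult: "clrev (x \<odot> y) = clrev y \<odot> clrev x"
proof -
  have 1: "clrev (axis A 1 \<odot> axis B 1) = clrev (axis B 1) \<odot> clrev (axis A 1 :: 'a clifford)" for A B
    using rsgn_sign[of A B] by (simp add: cl_axis clrev_axis cl_simps clrev_simps Un_commute[of "B - A"] mult_ac)
  have 2: "clrev (axis A 1 \<odot> y) = clrev y \<odot> clrev (axis A 1)" for A
    by (rule cl_ext[of "\<lambda>y. clrev (axis A 1 \<odot> y)" "\<lambda>y. clrev y \<odot> clrev (axis A 1)"])
       (auto simp: 1 cl_simps clrev_simps intro!: linearI)
  show ?thesis
    by (rule cl_ext[of "\<lambda>x. clrev (x \<odot> y)" "\<lambda>x. clrev y \<odot> clrev x"])
       (auto simp: 2 cl_simps clrev_simps intro!: linearI)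
qed

text \<open>The grade involution; its fixed points are the even elements.\<close>

definition clpar :: "'m::{finite,linorder} clifford \<Rightarrow> 'm clifford" where
  "clpar x = (\<chi> A. (-1) ^ card A * x $ A)"

lemma clpar_simps:
  "clpar (x + y) = clpar x + clpar y" "clpar (x - y) = clpar x - clpar y" "clpar (- x) = - clpar x"
  "clpar (c *\<^sub>R x) = c *\<^sub>R clpar x" "clpar 0 = 0"
  by (auto simp: clpar_def vec_eq_iff algebra_simps)

lemma clpar_axis: "clpar (axis A 1) = (-1) ^ card A *\<^sub>R axis A 1"
  by (auto simp: clpar_def vec_eq_iff axis_def)

lemma card_sym_diff_parity:
  fixes A B :: "'a::finite set"
  shows "(-1::real) ^ card (sym_diff A B) = (-1) ^ card A * (-1) ^ card B"
proof -
  have "(-1::real) ^ card X = (\<Prod>i\<in>UNIV. if i \<in> X then -1 else 1)" for X :: "'a set"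
    by (subst prod.If_cases) auto
  then show ?thesis by (simp add: prod.distrib[symmetric]) (rule prod.cong, auto)
qed

lemma clpar_mult: "clpar (x \<odot> y) = clpar x \<odot> clpar y"
proof -
  have 2: "clpar (axis A 1 \<odot> y) = clpar (axis A 1) \<odot> clpar y" for A
    by (rule cl_ext[of "\<lambda>y. clpar (axis A 1 \<odot> y)" "\<lambda>y. clpar (axis A 1) \<odot> clpar y"])
       (auto simp: cl_simps clpar_simps cl_axis clpar_axis card_sym_diff_parity scaleR_add_right algebra_simps intro!: linearI)
  show ?thesis
    by (rule cl_ext[of "\<lambda>x. clpar (x \<odot> y)" "\<lambda>x. clpar x \<odot> clpar y"])
       (auto simp: 2 cl_simps clpar_simps intro!: linearI)
qed

lemma clpar_one [simp]: "clpar cl_one = cl_one" by (simp add: cl_one_def clpar_axis)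

lemma cl_vec_nth: "cl_vec v $ A = (\<Sum>i\<in>UNIV. if A = {i} then v $ i else 0)"
  by (auto simp: cl_vec_def axis_def intro!: sum.cong)

lemma cl_vec_nth_single [simp]: "cl_vec v $ {i} = v $ i"
  by (simp add: cl_vec_nth eq_commute[of "{i}"])

lemma cl_vec_nth_other: "(\<And>i. A \<noteq> {i}) \<Longrightarrow> cl_vec v $ A = 0"
  by (simp add: cl_vec_nth)

lemma cl_vec_inject [simp]: "cl_vec v = cl_vec w \<longleftrightarrow> v = w"
  by (metis cl_vec_nth_single vec_eq_iff)

lemma cl_vec_simps: "cl_vec (x + y) = cl_vec x + cl_vec y" "cl_vec (x - y) = cl_vec x - cl_vec y"
  "cl_vec (- x) = - cl_vec x" "cl_vec (c *\<^sub>R x) = c *\<^sub>R cl_vec x" "cl_vec 0 = 0"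
  by (auto simp: cl_vec_def vec_eq_iff axis_def algebra_simps sum.distrib sum_subtractf sum_negf sum_distrib_left)

lemma linear_cl_vec: "linear cl_vec" by (rule linearI) (simp_all add: cl_vec_simps)
lemmas bounded_linear_cl_vec = linear_cl_vec[unfolded linear_conv_bounded_linear]

lemma cl_vec_axis: "cl_vec (axis i 1) = axis {i} 1"
  by (auto simp: cl_vec_def axis_def if_distribR if_distrib cong: if_cong)

lemma vec_ext:
  fixes f g :: "real ^ 'n::finite \<Rightarrow> 'b::real_vector"
  assumes "linear f" "linear g" "\<And>A. f (axis A 1) = g (axis A 1)"
  shows "f x = g x"
proof -
  have "x = (\<Sum>A\<in>UNIV. x $ A *\<^sub>R axis A 1)"
    by (simp add: vec_eq_iff axis_def if_distrib cong: if_cong)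
  note e = this
  have "f x = (\<Sum>A\<in>UNIV. x $ A *\<^sub>R f (axis A 1))"
    using arg_cong[OF e, of f] by (simp add: linear_sum[OF assms(1)] linear_scale[OF assms(1)])
  moreover have "g x = (\<Sum>A\<in>UNIV. x $ A *\<^sub>R g (axis A 1))"
    using arg_cong[OF e, of g] by (simp add: linear_sum[OF assms(2)] linear_scale[OF assms(2)])
  ultimately show ?thesis using assms(3) by simp
qed

lemma clrev_vec [simp]: "clrev (cl_vec v) = cl_vec v"
proof (rule vec_ext[of "\<lambda>v. clrev (cl_vec v)"])
  have "rsgn {i} = 1" for i :: "2 + 'a" by (auto simp: rsgn_def eps_def intro!: prod.neutral)
  then show "clrev (cl_vec (axis i 1)) = cl_vec (axis i 1 :: real ^ (2 + 'a))" for i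
    by (simp add: cl_vec_axis clrev_axis)
qed (auto simp: clrev_simps cl_vec_simps intro!: linearI)

lemma clpar_vec [simp]: "clpar (cl_vec v) = - cl_vec v"
  by (rule vec_ext[of "\<lambda>v. clpar (cl_vec v)"])
     (auto simp: clpar_simps cl_vec_simps cl_vec_axis clpar_axis intro!: linearI)

lemma eps_single: "eps {i} {j} = (if idx_less j i then -1 else 1)"
proof -
  have inner: "(\<Prod>j'\<in>UNIV. if j' = j \<and> idx_less j' i then -1 else 1) = (if idx_less j i then -1 else (1::real))"
  proof -
    have "(\<Prod>j'\<in>UNIV. if j' = j \<and> idx_less j' i then -1 else 1)
        = (\<Prod>j'\<in>UNIV. if j' = j then (if idx_less j i then -1 else (1::real)) else 1)"
      by (rule prod.cong) auto
    then show ?thesis by simp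
  qed
  have "eps {i} {j} = (\<Prod>i'\<in>UNIV. if i' = i then (if idx_less j i then -1 else 1) else 1)"
    unfolding eps_def by (intro prod.cong) (auto simp: inner)
  then show ?thesis by simp
qed

lemma qq_single [simp]: "qq {i} = qs i"
  by (simp add: qq_def)

lemma cl_sign_single: "i \<noteq> j \<Longrightarrow> cl_sign {i} {j} = (if idx_less j i then -1 else 1)"
  "cl_sign {i} {i} = qs i"
  by (simp_all add: cl_sign_eq eps_single)

lemma cl_vec_anticomm:
  "cl_vec v \<odot> cl_vec w + cl_vec w \<odot> cl_vec v = (2 * scal v w) *\<^sub>R cl_one"
proof -
  have 1: "cl_vec (axis i 1) \<odot> cl_vec (axis j 1) + cl_vec (axis j 1) \<odot> cl_vec (axis i 1)
     = (2 * scal (axis i 1) (axis j 1)) *\<^sub>R (cl_one :: 'a clifford)" for i j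
  proof (cases "i = j")
    case True
    then show ?thesis by (simp add: cl_vec_axis cl_axis cl_sign_single scal_axis cl_one_def flip: scaleR_2)
  next
    case False
    then have "cl_sign {j} {i} = - cl_sign {i} {j}"
      using idx_less_total[OF False] by (auto simp: cl_sign_single)
    moreover have "scal (axis i 1) (axis j 1 :: real ^ (2 + 'a)) = 0"
      unfolding scal_axis using False by (simp add: axis_def)
    ultimately show ?thesis using False by (simp add: cl_vec_axis cl_axis Un_commute)
  qed
  have 2: "cl_vec (axis i 1) \<odot> cl_vec w + cl_vec w \<odot> cl_vec (axis i 1)
     = (2 * scal (axis i 1) w) *\<^sub>R (cl_one :: 'a clifford)" for i
    by (rule vec_ext[where x = w]) (auto simp: scal_sym 1 cl_simps cl_vec_simps scal_linear algebra_simps intro!: linearI)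
  show ?thesis
    by (rule vec_ext[where x = v]) (auto simp: 2 2[unfolded add.commute[of "cl_vec (axis _ 1) \<odot> _"]] cl_simps cl_vec_simps scal_linear algebra_simps intro!: linearI)
qed

lemma cl_vec_sq: "cl_vec v \<odot> cl_vec v = scal v v *\<^sub>R cl_one"
  using cl_vec_anticomm[of v v] by (simp flip: scaleR_2 scaleR_scaleR)

text \<open>Up to sign this is the reflection in \<open>u\<close> when \<open>scal u u\<close> is 1
  or -1. It is the reason why conjugation by products of unit vectors preserves the space of
  vectors.\<close>

lemma cl_vec_sandwich: "cl_vec u \<odot> cl_vec v \<odot> cl_vec u = cl_vec ((2 * scal u v) *\<^sub>R u - scal u u *\<^sub>R v)"
proof -
  have "cl_vec u \<odot> cl_vec v \<odot> cl_vec u = ((2 * scal u v) *\<^sub>R cl_one - cl_vec v \<odot> cl_vec u) \<odot> cl_vec u"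
    using cl_vec_anticomm[of u v] by (metis add_diff_cancel_right')
  then show ?thesis by (simp add: cl_simps cl_assoc cl_vec_sq cl_vec_simps)
qed

text \<open>The subalgebra generated by the basis vectors with index in \<open>I\<close>, described
  by its coordinates.\<close>

definition clsupp :: "(2 + 'm::{finite,linorder}) set \<Rightarrow> 'm clifford set" where
  "clsupp I = {x. \<forall>A. \<not> A \<subseteq> I \<longrightarrow> x $ A = 0}"

lemma subspace_clsupp: "subspace (clsupp I)"
  by (auto simp: clsupp_def subspace_def)

lemma clsupp_mult:
  assumes "x \<in> clsupp I" "y \<in> clsupp I" shows "x \<odot> y \<in> clsupp I"
proof -
  have "x $ A * y $ sym_diff A C * cl_sign A (sym_diff A C) = 0" if "\<not> C \<subseteq> I" for A C
  proof (cases "A \<subseteq> I")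
    case True
    with that have "\<not> sym_diff A C \<subseteq> I" by blast
    then show ?thesis using assms unfolding clsupp_def by simp
  qed (use assms in \<open>simp add: clsupp_def\<close>)
  then have "(x \<odot> y) $ C = 0" if "\<not> C \<subseteq> I" for C
    unfolding cl_mult_nth using that by (intro sum.neutral ballI) blast
  then show ?thesis unfolding clsupp_def by simp
qed

lemma clsupp_rev: "x \<in> clsupp I \<Longrightarrow> clrev x \<in> clsupp I"
  by (auto simp: clsupp_def clrev_def)

lemma clsupp_one: "cl_one \<in> clsupp I"
  by (auto simp: clsupp_def cl_one_def axis_def)

lemma clsupp_vec: "cl_vec v \<in> clsupp I \<longleftrightarrow> (\<forall>i. i \<notin> I \<longrightarrow> v $ i = 0)"
proof
  assume "cl_vec v \<in> clsupp I"
  then show "\<forall>i. i \<notin> I \<longrightarrow> v $ i = 0" unfolding clsupp_def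
    by (metis (mono_tags, lifting) cl_vec_nth_single insert_subset mem_Collect_eq)
next
  assume *: "\<forall>i. i \<notin> I \<longrightarrow> v $ i = 0"
  have "(if A = {i} then v $ i else 0) = 0" if "\<not> A \<subseteq> I" for A i
    using * that by auto
  then show "cl_vec v \<in> clsupp I" unfolding clsupp_def by (simp add: cl_vec_nth)
qed

lemma norm_part: "(x \<odot> clrev x) $ {} = (\<Sum>A\<in>UNIV. qq A * (x $ A)\<^sup>2)"
  unfolding cl_mult_nth clrev_def
  by (rule sum.cong) (auto simp: power2_eq_square cl_sign_self[symmetric] mult_ac)

text \<open>Moving a basis vector past the monomial of \<open>A\<close> costs one sign for each
  element of \<open>A\<close> other than \<open>i\<close>. For even \<open>card A\<close> the total
  is -1 exactly when \<open>i\<close> belongs to \<open>A\<close>.\<close>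

lemma cl_sign_comm_single:
  assumes "even (card A)"
  shows "cl_sign {i} A = (if i \<in> A then -1 else 1) * cl_sign A {i}"
proof -
  have s: "eps {i} A = (\<Prod>j\<in>UNIV. if j \<in> A \<and> idx_less j i then -1 else 1)"
  proof -
    have "eps {i} A = (\<Prod>i'\<in>UNIV. if i' = i then (\<Prod>j'\<in>UNIV. if j' \<in> A \<and> idx_less j' i then -1 else 1) else 1)"
      unfolding eps_def by (intro prod.cong) auto
    then show ?thesis by simp
  qed
  have t: "eps A {i} = (\<Prod>j\<in>UNIV. if j \<in> A \<and> idx_less i j then -1 else 1)"
    unfolding eps_def
  proof (intro prod.cong refl)
    fix j
    have "(\<Prod>k\<in>UNIV. if j \<in> A \<and> k \<in> {i} \<and> idx_less k j then -1 else 1) = (\<Prod>k\<in>UNIV. if k = i then (if j \<in> A \<and> idx_less i j then -1 else (1::real)) else 1)"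
      by (intro prod.cong) auto
    then show "(\<Prod>k\<in>UNIV. if j \<in> A \<and> k \<in> {i} \<and> idx_less k j then -1 else (1::real)) = (if j \<in> A \<and> idx_less i j then -1 else 1)"
      by simp
  qed
  have "eps {i} A * eps A {i} = (\<Prod>j\<in>UNIV. (if j \<in> A then -1 else 1) * (if j = i then (if i \<in> A then -1 else 1) else 1))"
    unfolding s t prod.distrib[symmetric] using idx_less_total[of i] by (intro prod.cong) auto
  also have "\<dots> = (-1) ^ card A * (if i \<in> A then -1 else 1)"
    unfolding prod.distrib by (subst prod.If_cases) auto
  finally have "eps {i} A * eps A {i} = (if i \<in> A then -1 else 1)" using assms by simp
  then have "(eps {i} A * eps A {i}) * eps A {i} = (if i \<in> A then -1 else 1) * eps A {i}"
    by (rule arg_cong)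
  then have "eps {i} A = (if i \<in> A then -1 else 1) * eps A {i}"
    by (simp add: mult.assoc)
  then show ?thesis by (simp add: cl_sign_eq Int_commute)
qed

lemma cl_one_nth [simp]: "cl_one $ {} = 1" by (simp add: cl_one_def axis_def)

lemma cl_one_nz [simp]: "cl_one \<noteq> 0"
  using cl_one_nth by (metis zero_index zero_neq_one)

lemma eps_nz [simp]: "eps A B \<noteq> 0" "qq A \<noteq> 0"
  using eps_sq(1)[of A B] qq_sq[of A] by fastforce+

section \<open>Connected components under continuous maps\<close>

lemma connected_component_map:
  fixes f :: "'a::topological_space \<Rightarrow> 'b::topological_space"
  assumes "continuous_on S f" "f ` S \<subseteq> T" "x \<in> connected_component_set S a"
  shows "f x \<in> connected_component_set T (f a)"
proof -
  let ?C = "connected_component_set S a"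
  have aS: "a \<in> S" using assms(3) connected_component_in by fastforce
  have "?C \<subseteq> S" by (rule connected_component_subset)
  then have "connected (f ` ?C)" "f ` ?C \<subseteq> T"
    using assms(1,2) by (auto intro!: connected_continuous_image continuous_on_subset[OF assms(1)])
  moreover have "f a \<in> f ` ?C" using aS by (auto intro: connected_component_refl)
  ultimately show ?thesis using connected_component_maximal assms(3) by (metis image_eqI subsetD)
qed

text \<open>The translation \<open>f x\<close> carries the component of \<open>e\<close> into the
  component of \<open>f x e = x\<close>, which is the same component. This closes both
  \<open>O_up\<close> and \<open>Spin\<close> under multiplication.\<close>

lemma connected_component_mult:
  fixes f :: "'a::topological_space \<Rightarrow> 'a \<Rightarrow> 'a"
  assumes "x \<in> connected_component_set S e" "y \<in> connected_component_set S e"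
    "continuous_on S (f x)" "f x ` S \<subseteq> S" "f x e = x"
  shows "f x y \<in> connected_component_set S e"
proof -
  have "f x y \<in> connected_component_set S (f x e)"
    by (rule connected_component_map[OF assms(3,4,2)])
  then show ?thesis using assms(1,5) connected_component_eq by fastforce
qed

subsection \<open>The pseudo-orthogonal group\<close>

text \<open>The adjoint for \<open>scal\<close>: the transpose conjugated by the diagonal matrix of
  signs. On \<open>pseudo_orthogonal\<close> it is the inverse, so inversion there is the
  restriction of a linear map.\<close>

definition padj :: "'m::finite mat_full \<Rightarrow> 'm mat_full" where
  "padj X = (\<chi> i j. qs i * X $ j $ i * qs j)"

lemma bounded_linear_padj: "bounded_linear padj"
  by (intro linear_conv_bounded_linear[THEN iffD1] linearI) (simp_all add: padj_def vec_eq_iff algebra_simps)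

lemma scal_padj: "scal (X *v x) y = scal x (padj X *v y)"
proof -
  have "scal (X *v x) y = (\<Sum>i\<in>UNIV. \<Sum>j\<in>UNIV. qs i * (X $ i $ j * x $ j) * y $ i)"
    unfolding scal_qs matrix_vector_mult_def by (simp add: sum_distrib_left sum_distrib_right)
  also have "\<dots> = (\<Sum>j\<in>UNIV. \<Sum>i\<in>UNIV. qs i * (X $ i $ j * x $ j) * y $ i)"
    by (rule sum.swap)
  also have "\<dots> = scal x (padj X *v y)"
    unfolding scal_qs matrix_vector_mult_def by (simp add: sum_distrib_left padj_def mult_ac)
  finally show ?thesis .
qed

lemma scal_nondeg: assumes "\<And>x. scal x y = scal x z" shows "y = z"
proof (unfold vec_eq_iff, rule allI)
  fix i show "y $ i = z $ i" using assms[of "axis i 1"] by (simp add: scal_axis)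
qed

lemma pseudo_orthogonal_iff: "X \<in> pseudo_orthogonal \<longleftrightarrow> padj X ** X = mat 1"
proof -
  have "X \<in> pseudo_orthogonal \<longleftrightarrow> (\<forall>y. \<forall>x. scal x ((padj X ** X) *v y) = scal x y)"
    unfolding pseudo_orthogonal_def by (auto simp: scal_padj matrix_vector_mul_assoc)
  also have "\<dots> \<longleftrightarrow> (\<forall>y. (padj X ** X) *v y = y)"
    using scal_nondeg by metis
  also have "\<dots> \<longleftrightarrow> padj X ** X = mat 1"
    by (metis matrix_eq matrix_vector_mul_lid)
  finally show ?thesis .
qed

lemma padj_padj [simp]: "padj (padj X) = X"
  by (simp add: padj_def vec_eq_iff mult_ac)

lemma padj_mult: "padj (X ** Y) = padj Y ** padj X"
  by (simp add: padj_def vec_eq_iff matrix_matrix_mult_def sum_distrib_left sum_distrib_right mult_ac)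

lemma padj_one [simp]: "padj (mat 1) = mat 1"
  by (simp add: padj_def vec_eq_iff mat_def)

lemma padj_right: "X \<in> pseudo_orthogonal \<Longrightarrow> X ** padj X = mat 1"
  using pseudo_orthogonal_iff matrix_left_right_inverse by metis

lemma padj_left: "X \<in> pseudo_orthogonal \<Longrightarrow> padj X ** X = mat 1"
  using pseudo_orthogonal_iff by metis

lemma pseudo_orthogonal_one: "mat 1 \<in> pseudo_orthogonal"
  by (simp add: pseudo_orthogonal_iff)

lemma pseudo_orthogonal_mult:
  "X \<in> pseudo_orthogonal \<Longrightarrow> Y \<in> pseudo_orthogonal \<Longrightarrow> X ** Y \<in> pseudo_orthogonal"
  unfolding pseudo_orthogonal_def by (simp add: matrix_vector_mul_assoc[symmetric])

lemma pseudo_orthogonal_padj: "X \<in> pseudo_orthogonal \<Longrightarrow> padj X \<in> pseudo_orthogonal"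
  by (simp add: pseudo_orthogonal_iff padj_right)

lemma O_up_subset: "O_up \<subseteq> pseudo_orthogonal"
  unfolding O_up_def by (rule connected_component_subset)

lemma O_up_one: "mat 1 \<in> O_up"
  unfolding O_up_def using pseudo_orthogonal_one by (simp add: connected_component_refl)

lemma connected_O_up: "connected O_up"
  unfolding O_up_def by (rule connected_connected_component)

lemma O_up_mult: "X \<in> O_up \<Longrightarrow> Y \<in> O_up \<Longrightarrow> X ** Y \<in> O_up"
  unfolding O_up_def
  by (rule connected_component_mult)
     (use O_up_subset[unfolded O_up_def] pseudo_orthogonal_mult in
       \<open>auto intro!: continuous_on_matrix_mul continuous_on_const continuous_on_id\<close>)

lemma O_up_padj: "X \<in> O_up \<Longrightarrow> padj X \<in> O_up"
  using connected_component_map[of pseudo_orthogonal padj pseudo_orthogonal X "mat 1",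
    OF linear_continuous_on[OF bounded_linear_padj] image_subsetI[OF pseudo_orthogonal_padj]]
  by (simp add: O_up_def)

lemma O_up_path:
  assumes "X \<in> O_up" "connected S" "X \<in> S" "Y \<in> S" "S \<subseteq> pseudo_orthogonal"
  shows "Y \<in> O_up"
  using assms connected_component_maximal[OF assms(3,2,5)] connected_component_eq[of X pseudo_orthogonal "mat 1"]
  unfolding O_up_def by auto

lemma group_O_up: "group (O_up_group :: 'm::finite mat_full monoid)"
proof (rule groupI)
  fix x :: "'m mat_full" assume "x \<in> carrier O_up_group"
  then have "x \<in> O_up" by (simp add: O_up_group_def)
  then show "\<exists>y\<in>carrier O_up_group. y \<otimes>\<^bsub>O_up_group\<^esub> x = \<one>\<^bsub>O_up_group\<^esub>"
    using O_up_padj O_up_subset padj_left by (auto simp: O_up_group_def)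
qed (auto simp: O_up_group_def O_up_mult O_up_one matrix_mul_assoc)

lemma inv_O_up: "X \<in> O_up \<Longrightarrow> inv\<^bsub>O_up_group\<^esub> X = padj X"
  using O_up_subset
  by (intro group.inv_equality[OF group_O_up]) (auto simp: O_up_group_def O_up_padj padj_left)

subsection \<open>The group of even units that preserve the space of vectors\<close>

text \<open>Spinor norm 1, even, and stable on vectors. Since the inverse is \<open>clrev x\<close>,
  conjugation is polynomial in \<open>x\<close>. Connectedness is deliberately left out, so that all
  algebra can be done by equations; \<open>Spin\<close> is placed inside later.\<close>

definition pspin :: "'m::{finite,linorder} clifford set" where
  "pspin = {x. clpar x = x \<and> x \<odot> clrev x = cl_one \<and> clrev x \<odot> x = cl_one \<and>
     (\<forall>v. \<exists>w. x \<odot> cl_vec v \<odot> clrev x = cl_vec w)}"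

text \<open>An explicit polynomial formula for \<open>spin_cover\<close>, which is a definite
  description. The two agree on \<open>pspin\<close>.\<close>

definition smat :: "'m::{finite,linorder} clifford \<Rightarrow> 'm mat_full" where
  "smat x = (\<chi> i j. (x \<odot> cl_vec (axis j 1) \<odot> clrev x) $ {i})"

lemma pspinD:
  assumes "x \<in> pspin"
  shows "clpar x = x" "x \<odot> clrev x = cl_one" "clrev x \<odot> x = cl_one" "x \<odot> (clrev x \<odot> y) = y"
    "clrev x \<odot> (x \<odot> y) = y"
  using assms by (auto simp: pspin_def cl_assoc[symmetric])

lemma smat_works:
  assumes "x \<in> pspin" shows "x \<odot> cl_vec v \<odot> clrev x = cl_vec (smat x *v v)"
proof (rule vec_ext[of "\<lambda>v. x \<odot> cl_vec v \<odot> clrev x"])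
  fix j
  obtain w where w: "x \<odot> cl_vec (axis j 1) \<odot> clrev x = cl_vec w"
    using assms by (auto simp: pspin_def)
  have "smat x *v axis j 1 = w"
    by (simp add: matrix_vector_mult_basis column_def smat_def w vec_eq_iff)
  then show "x \<odot> cl_vec (axis j 1) \<odot> clrev x = cl_vec (smat x *v axis j 1)" using w by simp
qed (auto simp: cl_simps cl_vec_simps matrix_vector_right_distrib matrix_vector_mult_scaleR intro!: linearI)

lemma smat_commute:
  assumes "x \<in> pspin" shows "x \<odot> cl_vec v = cl_vec (smat x *v v) \<odot> x"
  unfolding smat_works[OF assms, symmetric] by (simp add: cl_assoc pspinD[OF assms])

lemma smat_unique:
  assumes "x \<in> pspin" "x \<odot> cl_vec v = cl_vec w \<odot> x" shows "w = smat x *v v"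
proof -
  have "cl_vec w = x \<odot> cl_vec v \<odot> clrev x" using assms by (simp add: cl_assoc pspinD)
  then show ?thesis using smat_works[OF assms(1)] by simp
qed

lemma spin_cover_pspin:
  assumes "x \<in> pspin" shows "spin_cover x = smat x"
  unfolding spin_cover_def
proof (rule the_equality)
  fix A assume "\<forall>v. x \<odot> cl_vec v = cl_vec (A *v v) \<odot> x"
  then have "A *v v = smat x *v v" for v using smat_unique[OF assms] by blast
  then show "A = smat x" by (simp add: matrix_eq)
qed (simp add: smat_commute assms)

lemma smooth_on_smat: "smooth_on S smat"
  unfolding smat_def
  by (intro smooth_on_vec_lambda smooth_on_nth smooth_on_bilinear[OF bounded_bilinear_cl] smooth_on_const
      smooth_on_id smooth_on_linear_compose[OF bounded_linear_clrev])

lemma continuous_on_smat: "continuous_on S smat"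
  by (rule smooth_on_imp_continuous_on[OF smooth_on_smat])

lemmas continuous_on_cl = bounded_bilinear.continuous_on[OF bounded_bilinear_cl]
lemmas smooth_on_cl = smooth_on_bilinear[OF bounded_bilinear_cl]
lemmas continuous_on_clrev = bounded_linear.continuous_on[OF bounded_linear_clrev]

lemma pspin_one: "cl_one \<in> pspin" by (auto simp: pspin_def)

lemma pspin_mult:
  assumes "x \<in> pspin" "y \<in> pspin" shows "x \<odot> y \<in> pspin"
proof -
  have "x \<odot> y \<odot> cl_vec v \<odot> clrev (x \<odot> y) = cl_vec (smat x *v (smat y *v v))" for v
    unfolding smat_works[OF assms(1), symmetric] smat_works[OF assms(2), symmetric]
    by (simp add: clrev_mult cl_assoc)
  moreover have "clpar (x \<odot> y) = x \<odot> y" "x \<odot> y \<odot> clrev (x \<odot> y) = cl_one" "clrev (x \<odot> y) \<odot> (x \<odot> y) = cl_one"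
    by (simp_all add: clpar_mult clrev_mult cl_assoc pspinD[OF assms(1)] pspinD[OF assms(2)])
  ultimately show ?thesis unfolding pspin_def by blast
qed

lemma smat_mult:
  assumes "x \<in> pspin" "y \<in> pspin" shows "smat (x \<odot> y) = smat x ** smat y"
proof -
  have "x \<odot> y \<odot> cl_vec v \<odot> clrev (x \<odot> y) = cl_vec (smat x *v (smat y *v v))" for v
    unfolding smat_works[OF assms(1), symmetric] smat_works[OF assms(2), symmetric]
    by (simp add: clrev_mult cl_assoc)
  then have "smat (x \<odot> y) *v v = (smat x ** smat y) *v v" for v
    using smat_works[OF pspin_mult[OF assms]] by (simp add: matrix_vector_mul_assoc)
  then show ?thesis by (simp add: matrix_eq)
qed

lemma smat_one: "smat cl_one = mat 1"
  by (auto simp: smat_def cl_vec_axis vec_eq_iff mat_def axis_def)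

lemma smat_pseudo_orthogonal:
  assumes "x \<in> pspin" shows "smat x \<in> pseudo_orthogonal"
proof -
  have "scal (smat x *v v) (smat x *v w) = scal v w" for v w
  proof -
    have "(2 * scal (smat x *v v) (smat x *v w)) *\<^sub>R (cl_one :: 'a clifford) =
        (x \<odot> cl_vec v \<odot> clrev x) \<odot> (x \<odot> cl_vec w \<odot> clrev x) + (x \<odot> cl_vec w \<odot> clrev x) \<odot> (x \<odot> cl_vec v \<odot> clrev x)"
      unfolding smat_works[OF assms] cl_vec_anticomm ..
    also have "\<dots> = x \<odot> (cl_vec v \<odot> cl_vec w + cl_vec w \<odot> cl_vec v) \<odot> clrev x"
      by (simp add: cl_assoc pspinD[OF assms] cl_simps)
    also have "\<dots> = (2 * scal v w) *\<^sub>R cl_one"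
      unfolding cl_vec_anticomm by (simp add: cl_simps pspinD[OF assms])
    finally show ?thesis by simp
  qed
  then show ?thesis by (simp add: pseudo_orthogonal_def)
qed

text \<open>Stability of vectors under the inverse conjugation needs surjectivity of the direct one:
  \<open>smat x\<close> is pseudo-orthogonal, so \<open>v\<close> is the image of
  \<open>padj (smat x) *v v\<close>.\<close>

lemma pspin_rev:
  assumes "x \<in> pspin" shows "clrev x \<in> pspin"
proof -
  let ?Y = "padj (smat x)"
  have "clrev x \<odot> cl_vec v \<odot> x = cl_vec (?Y *v v)" for v
  proof -
    have "smat x *v (?Y *v v) = v"
      using padj_right[OF smat_pseudo_orthogonal[OF assms]] by (simp add: matrix_vector_mul_assoc)
    then have "cl_vec v = x \<odot> cl_vec (?Y *v v) \<odot> clrev x" using smat_works[OF assms, of "?Y *v v"] by simp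
    then show ?thesis by (simp add: cl_assoc pspinD[OF assms])
  qed
  moreover have "clpar (clrev x) = clrev x"
  proof -
    have "clpar (clrev x) = clrev (clpar x)" by (simp add: clpar_def clrev_def vec_eq_iff mult_ac)
    then show ?thesis using pspinD[OF assms] by simp
  qed
  moreover have "clrev x \<odot> clrev (clrev x) = cl_one" "clrev (clrev x) \<odot> clrev x = cl_one"
    by (simp_all add: pspinD[OF assms])
  moreover from calculation(1) have "\<forall>v. \<exists>w. clrev x \<odot> cl_vec v \<odot> clrev (clrev x) = cl_vec w"
    unfolding clrev_clrev by blast
  ultimately show ?thesis unfolding pspin_def by blast
qed

lemma smat_rev:
  assumes "x \<in> pspin" shows "smat (clrev x) = padj (smat x)"
proof -
  have "smat (clrev x) ** smat x = mat 1"
    using smat_mult[OF pspin_rev[OF assms] assms] pspinD[OF assms] by (simp add: smat_one)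
  then have "smat (clrev x) ** (smat x ** padj (smat x)) = padj (smat x)"
    by (simp add: matrix_mul_assoc)
  then show ?thesis using padj_right[OF smat_pseudo_orthogonal[OF assms]] by simp
qed

text \<open>For even \<open>A\<close> containing \<open>i\<close> the two products of the monomial
  with the basis vector differ by a sign, so commutation forces the coefficient to vanish; for odd
  \<open>A\<close> it vanishes by evenness. This computes both the kernel of \<open>smat\<close> and
  the stabiliser of a basis vector.\<close>

lemma even_commute_support:
  assumes "clpar x = x" "x \<odot> cl_vec (axis i 1) = cl_vec (axis i 1) \<odot> x" "i \<in> A"
  shows "x $ A = 0"
proof (cases "even (card A)")
  case False
  then have "(clpar x) $ A = - x $ A" by (simp add: clpar_def)
  then show ?thesis using assms(1) by simp
next
  case True
  have 1: "(x \<odot> axis {i} 1) $ sym_diff A {i} = x $ A * cl_sign A {i}"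
  proof -
    have "(x \<odot> axis {i} 1) $ sym_diff A {i} = (\<Sum>B\<in>UNIV. if B = {i} then x $ A * cl_sign A {i} else 0)"
      unfolding cl_mult_nth2 by (rule sum.cong) (simp_all add: axis_def sym_diff_assoc')
    then show ?thesis by simp
  qed
  have 2: "(axis {i} 1 \<odot> x) $ sym_diff A {i} = x $ A * cl_sign {i} A"
  proof -
    have e: "sym_diff {i} (sym_diff A {i}) = A" by auto
    have "(axis {i} 1 \<odot> x) $ sym_diff A {i} = (\<Sum>B\<in>UNIV. if B = {i} then x $ A * cl_sign {i} A else 0)"
      unfolding cl_mult_nth by (rule sum.cong) (simp_all add: axis_def e del: sup_set_def)
    then show ?thesis by simp
  qed
  have nz: "cl_sign A {i} \<noteq> 0"
    by (simp add: cl_sign_eq)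
  have "x $ A * cl_sign A {i} = x $ A * cl_sign {i} A"
    using assms(2) 1 2 unfolding cl_vec_axis by metis
  also have "\<dots> = - (x $ A * cl_sign A {i})"
    using cl_sign_comm_single[OF True, of i] assms(3) by simp
  finally show ?thesis using nz by simp
qed

lemma even_supported_commute:
  assumes "clpar x = x" "x \<in> clsupp I" "i \<notin> I"
  shows "x \<odot> cl_vec (axis i 1) = cl_vec (axis i 1) \<odot> x"
proof -
  have "(x $ A) *\<^sub>R (axis A 1 \<odot> axis {i} 1) = (x $ A) *\<^sub>R (axis {i} 1 \<odot> axis A 1 :: 'a clifford)" for A
  proof (cases "x $ A = 0")
    case False
    have "(-1) ^ card A * x $ A = x $ A"
      using arg_cong[OF assms(1), of "\<lambda>y. y $ A"] by (simp add: clpar_def)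
    then have "even (card A)" using False by (cases "even (card A)") simp_all
    moreover have "A \<subseteq> I" using assms(2) False unfolding clsupp_def by blast
    moreover then have "i \<notin> A" using assms(3) by auto
    ultimately show ?thesis by (simp add: cl_axis cl_sign_comm_single Un_commute)
  qed simp
  then have "(\<Sum>A\<in>UNIV. (x $ A) *\<^sub>R axis A 1) \<odot> axis {i} 1 = axis {i} 1 \<odot> (\<Sum>A\<in>UNIV. (x $ A) *\<^sub>R (axis A 1 :: 'a clifford))"
    by (simp only: cl.sum_left cl.sum_right cl.scaleR_left cl.scaleR_right)
  moreover have "(\<Sum>A\<in>UNIV. (x $ A) *\<^sub>R axis A 1) = x"
    by (simp add: vec_eq_iff axis_def if_distrib cong: if_cong)
  ultimately show ?thesis by (simp add: cl_vec_axis)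
qed

text \<open>An element of the kernel commutes with every basis vector, so only its scalar
  coefficient survives; spinor norm 1 makes that coefficient 1 or -1.\<close>

lemma smat_ker:
  assumes "x \<in> pspin" "smat x = mat 1" shows "x = cl_one \<or> x = - cl_one"
proof -
  have "x $ A = 0" if "A \<noteq> {}" for A
  proof -
    obtain i where "i \<in> A" using \<open>A \<noteq> {}\<close> by auto
    then show ?thesis
      using even_commute_support[of x i A] pspinD(1)[OF assms(1)] smat_commute[OF assms(1), of "axis i 1"] assms(2) by simp
  qed
  then have x: "x = x $ {} *\<^sub>R cl_one" by (auto simp: cl_one_def vec_eq_iff axis_def)
  have "x \<odot> clrev x = (x $ {} * x $ {}) *\<^sub>R cl_one"
    using arg_cong[OF x, of "\<lambda>x. x \<odot> clrev x"] by (simp add: cl_simps clrev_simps)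
  then have "x $ {} * x $ {} = 1" using pspinD(2)[OF assms(1)] by (metis cl_one_nth vector_scaleR_component real_scaleR_def mult.right_neutral)
  then have "x $ {} = 1 \<or> x $ {} = -1" by algebra
  then show ?thesis using x by auto
qed

lemma smat_eq_imp:
  assumes "x \<in> pspin" "y \<in> pspin" "smat x = smat y" shows "x = y \<or> x = - y"
proof -
  have "smat (clrev y \<odot> x) = mat 1"
    using assms by (simp add: smat_mult pspin_rev smat_rev padj_left smat_pseudo_orthogonal)
  then have "clrev y \<odot> x = cl_one \<or> clrev y \<odot> x = - cl_one"
    using smat_ker assms pspin_mult pspin_rev by blast
  then have "y \<odot> (clrev y \<odot> x) = y \<odot> cl_one \<or> y \<odot> (clrev y \<odot> x) = y \<odot> (- cl_one)" by metis
  then show ?thesis using pspinD(4)[OF assms(2)] by (simp add: cl_simps)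
qed

subsection \<open>Spin groups\<close>

definition vprod :: "(real ^ (2 + 'm::{finite,linorder})) list \<Rightarrow> 'm clifford" where
  "vprod vs = foldr (\<odot>) (map cl_vec vs) cl_one"

lemma vprod_simps [simp]: "vprod [] = cl_one" "vprod (v # vs) = cl_vec v \<odot> vprod vs"
  by (simp_all add: vprod_def)

lemma vprod_append: "vprod (vs @ ws) = vprod vs \<odot> vprod ws"
  by (induction vs) (auto simp: cl_assoc)

lemma clrev_vprod: "clrev (vprod vs) = vprod (rev vs)"
  by (induction vs) (auto simp: clrev_mult vprod_append)

lemma full_spin_iff: "x \<in> full_spin \<longleftrightarrow>
  (\<exists>vs. x = vprod vs \<and> even (length vs) \<and> (\<forall>v\<in>set vs. scal v v = 1 \<or> scal v v = -1))"
  unfolding full_spin_def vprod_def by auto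

lemma full_spin_mult:
  assumes "x \<in> full_spin" "y \<in> full_spin" shows "x \<odot> y \<in> full_spin"
proof -
  obtain vs ws where "x = vprod vs" "even (length vs)" "\<forall>v\<in>set vs. scal v v = 1 \<or> scal v v = -1"
    "y = vprod ws" "even (length ws)" "\<forall>v\<in>set ws. scal v v = 1 \<or> scal v v = -1"
    using assms by (auto simp: full_spin_iff)
  then show ?thesis unfolding full_spin_iff
    by (intro exI[of _ "vs @ ws"]) (auto simp: vprod_append)
qed

lemma full_spin_one: "cl_one \<in> full_spin" unfolding full_spin_iff by (intro exI[of _ "[]"]) auto

lemma full_spin_rev: "x \<in> full_spin \<Longrightarrow> clrev x \<in> full_spin"
  unfolding full_spin_iff by (metis clrev_vprod length_rev set_rev)

lemma full_spin_pair:
  assumes "scal u u = 1 \<or> scal u u = -1" "scal v v = 1 \<or> scal v v = -1"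
  shows "cl_vec u \<odot> cl_vec v \<in> full_spin"
  unfolding full_spin_iff using assms by (intro exI[of _ "[u, v]"]) auto

text \<open>The number \<open>c\<close> is the product of the scalar squares of the factors;
  conjugation by the product is a composition of the maps in \<open>cl_vec_sandwich\<close>.\<close>

lemma vprod_props:
  assumes "\<forall>v\<in>set vs. scal v v = 1 \<or> scal v v = -1"
  shows "\<exists>c. (c = 1 \<or> c = -1) \<and> vprod vs \<odot> clrev (vprod vs) = c *\<^sub>R cl_one \<and> clrev (vprod vs) \<odot> vprod vs = c *\<^sub>R cl_one \<and>
    clpar (vprod vs) = (-1) ^ length vs *\<^sub>R vprod vs \<and> (\<forall>v. \<exists>w. vprod vs \<odot> cl_vec v \<odot> clrev (vprod vs) = cl_vec w)"
  using assms
proof (induction vs)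
  case Nil
  show ?case by (intro exI[of _ 1]) auto
next
  case (Cons u vs)
  then obtain c where c: "c = 1 \<or> c = -1" "vprod vs \<odot> clrev (vprod vs) = c *\<^sub>R cl_one" "clrev (vprod vs) \<odot> vprod vs = c *\<^sub>R cl_one"
    "clpar (vprod vs) = (-1) ^ length vs *\<^sub>R vprod vs" "\<And>v. \<exists>w. vprod vs \<odot> cl_vec v \<odot> clrev (vprod vs) = cl_vec w" by auto
  let ?x = "vprod vs"
  show ?case
  proof (intro exI[of _ "scal u u * c"] conjI allI)
    show "scal u u * c = 1 \<or> scal u u * c = -1" using c(1) Cons.prems by auto
    have "vprod (u # vs) \<odot> clrev (vprod (u # vs)) = cl_vec u \<odot> (?x \<odot> clrev ?x) \<odot> cl_vec u"
      by (simp add: clrev_mult cl_assoc)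
    then show "vprod (u # vs) \<odot> clrev (vprod (u # vs)) = (scal u u * c) *\<^sub>R cl_one"
      by (simp add: c(2) cl_simps cl_vec_sq mult.commute)
    have "clrev (vprod (u # vs)) \<odot> vprod (u # vs) = clrev ?x \<odot> (cl_vec u \<odot> cl_vec u) \<odot> ?x"
      by (simp add: clrev_mult cl_assoc)
    then show "clrev (vprod (u # vs)) \<odot> vprod (u # vs) = (scal u u * c) *\<^sub>R cl_one"
      by (simp add: c(3) cl_simps cl_vec_sq)
    show "clpar (vprod (u # vs)) = (-1) ^ length (u # vs) *\<^sub>R vprod (u # vs)"
      by (simp add: clpar_mult c(4) cl_simps)
    fix v obtain w where w: "?x \<odot> cl_vec v \<odot> clrev ?x = cl_vec w" using c(5) by blast
    have "vprod (u # vs) \<odot> cl_vec v \<odot> clrev (vprod (u # vs)) = cl_vec u \<odot> (?x \<odot> cl_vec v \<odot> clrev ?x) \<odot> cl_vec u"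
      by (simp add: clrev_mult cl_assoc)
    then show "\<exists>w. vprod (u # vs) \<odot> cl_vec v \<odot> clrev (vprod (u # vs)) = cl_vec w"
      unfolding w cl_vec_sandwich by blast
  qed
qed

lemma full_spin_props:
  assumes "x \<in> full_spin"
  obtains c where "c = 1 \<or> c = -1" "x \<odot> clrev x = c *\<^sub>R cl_one" "clrev x \<odot> x = c *\<^sub>R cl_one" "c = 1 \<longleftrightarrow> x \<in> pspin"
proof -
  obtain vs where vs: "x = vprod vs" "even (length vs)" "\<forall>v\<in>set vs. scal v v = 1 \<or> scal v v = -1"
    using assms by (auto simp: full_spin_iff)
  obtain c where c: "c = 1 \<or> c = -1" "x \<odot> clrev x = c *\<^sub>R cl_one" "clrev x \<odot> x = c *\<^sub>R cl_one"
    "clpar x = (-1) ^ length vs *\<^sub>R x" "\<forall>v. \<exists>w. x \<odot> cl_vec v \<odot> clrev x = cl_vec w"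
    using vprod_props[OF vs(3)] vs(1) by auto
  have "c = 1 \<longleftrightarrow> x \<in> pspin"
    using c vs(2) by (auto simp: pspin_def cl_one_def vec_eq_iff axis_def)
  then show ?thesis using that c by blast
qed

lemma Spin_subset: "Spin \<subseteq> full_spin"
  unfolding Spin_def by (rule connected_component_subset)

lemma connected_Spin: "connected Spin"
  unfolding Spin_def by (rule connected_connected_component)

lemma Spin_one: "cl_one \<in> Spin"
  unfolding Spin_def using full_spin_one by (simp add: connected_component_refl)

text \<open>The spinor norm, read off as the scalar part of \<open>x \<odot> clrev x\<close>, is
  continuous with values 1 and -1 on \<open>full_spin\<close>, hence constantly 1 on the component
  of \<open>cl_one\<close>.\<close>

lemma Spin_pspin: "Spin \<subseteq> pspin"
proof
  fix x :: "'a clifford" assume x: "x \<in> Spin"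
  let ?N = "\<lambda>x :: 'a clifford. (x \<odot> clrev x) $ {}"
  have N: "?N y = 1 \<or> ?N y = -1" "?N y = 1 \<longleftrightarrow> y \<in> pspin" if y: "y \<in> full_spin" for y
  proof -
    obtain c where "c = 1 \<or> c = -1" "y \<odot> clrev y = c *\<^sub>R cl_one" "c = 1 \<longleftrightarrow> y \<in> pspin"
      using full_spin_props[OF y] by metis
    then show "?N y = 1 \<or> ?N y = -1" "?N y = 1 \<longleftrightarrow> y \<in> pspin" by (auto simp: cl_one_def axis_def)
  qed
  have "continuous_on Spin ?N"
    by (intro continuous_on_component continuous_on_cl continuous_on_clrev continuous_on_id)
  moreover have "?N ` Spin \<subseteq> {1, -1}" using N(1) Spin_subset by auto
  ultimately have "?N constant_on Spin"
    using continuous_finite_range_constant[OF connected_Spin] finite_subset by blast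
  then have "?N x = ?N cl_one" using x Spin_one unfolding constant_on_def by metis
  then have "?N x = 1" by simp
  then show "x \<in> pspin" using N(2) x Spin_subset by blast
qed

lemma Spin_mult: "x \<in> Spin \<Longrightarrow> y \<in> Spin \<Longrightarrow> x \<odot> y \<in> Spin"
  unfolding Spin_def
  by (rule connected_component_mult)
     (use Spin_subset[unfolded Spin_def] full_spin_mult in
       \<open>auto intro!: continuous_on_cl continuous_on_const continuous_on_id\<close>)

lemma Spin_rev: "x \<in> Spin \<Longrightarrow> clrev x \<in> Spin"
proof -
  have "clrev ` full_spin \<subseteq> full_spin" by (rule image_subsetI) (rule full_spin_rev)
  then show "x \<in> Spin \<Longrightarrow> clrev x \<in> Spin"
    using connected_component_map[of full_spin clrev full_spin x "cl_one"]
    by (simp add: Spin_def continuous_on_clrev)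
qed

lemma spin_cover_Spin: "x \<in> Spin \<Longrightarrow> spin_cover x = smat x"
  using spin_cover_pspin Spin_pspin by blast

lemma smat_Spin: "x \<in> Spin \<Longrightarrow> smat x \<in> O_up"
proof -
  assume "x \<in> Spin"
  moreover have "smat ` Spin \<subseteq> pseudo_orthogonal" using smat_pseudo_orthogonal Spin_pspin by blast
  moreover have "connected (smat ` Spin)"
    by (rule connected_continuous_image[OF continuous_on_smat connected_Spin])
  moreover have "mat 1 \<in> smat ` Spin" using Spin_one smat_one by (metis image_eqI)
  ultimately show ?thesis using O_up_path[OF O_up_one] by blast
qed

lemma Spin_path:
  assumes "x \<in> Spin" "connected S" "x \<in> S" "y \<in> S" "S \<subseteq> full_spin"
  shows "y \<in> Spin"
  using assms connected_component_maximal[OF assms(3,2,5)] connected_component_eq[of x full_spin cl_one]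
  unfolding Spin_def by auto

lemma cl_mult_axis_right: "(x \<odot> axis S 1) $ C = x $ sym_diff C S * cl_sign (sym_diff C S) S"
proof -
  have "(x \<odot> axis S 1) $ C = (\<Sum>B\<in>UNIV. if B = S then x $ sym_diff C S * cl_sign (sym_diff C S) S else 0)"
    unfolding cl_mult_nth2 by (rule sum.cong) (simp_all add: axis_def)
  then show ?thesis by simp
qed

lemma cl_mult_axis_left: "(axis S 1 \<odot> x) $ C = x $ sym_diff S C * cl_sign S (sym_diff S C)"
proof -
  have "(axis S 1 \<odot> x) $ C = (\<Sum>B\<in>UNIV. if B = S then x $ sym_diff S C * cl_sign S (sym_diff S C) else 0)"
    unfolding cl_mult_nth by (rule sum.cong) (simp_all add: axis_def)
  then show ?thesis by simp
qed

subsection \<open>Rotors\<close>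

text \<open>The product of the reflections in \<open>axis i 1\<close> and in the bisector
  \<open>axis i 1 + f\<close>, which takes \<open>axis i 1\<close> to \<open>f\<close> when both
  have the same scalar square. The factor in front normalises the spinor norm and makes the value
  \<open>cl_one\<close> at \<open>f = axis i 1\<close>.\<close>

definition rot :: "2 + 'm::{finite,linorder} \<Rightarrow> real ^ (2 + 'm) \<Rightarrow> 'm clifford" where
  "rot i f = (qs i / sqrt (qs i * scal (axis i 1 + f) (axis i 1 + f))) *\<^sub>R
     (cl_vec (axis i 1 + f) \<odot> cl_vec (axis i 1))"

lemma scal_axis_self: "scal (axis i 1) (axis i 1) = qs i"
  unfolding scal_axis by (simp add: axis_def)

lemma scal_axis_ne: "i \<noteq> k \<Longrightarrow> scal (axis i 1) (axis k 1) = 0"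
  unfolding scal_axis by (simp add: axis_def)

lemma sqrt_inverse_sq: "q > 0 \<Longrightarrow> 1 / sqrt q * (1 / sqrt q) * q = 1" "q > 0 \<Longrightarrow> sqrt q \<noteq> 0"
  by simp_all

text \<open>The condition \<open>Q\<close> says that the bisector has the same causal sign as
  \<open>axis i 1\<close>; it makes the square root meaningful and the spinor norm equal to
  +1.\<close>

lemma rot_props:
  assumes f: "scal f f = qs i" and Q: "qs i * scal (axis i 1 + f) (axis i 1 + f) > 0"
  shows "rot i f \<in> pspin" "rot i f \<in> full_spin" "smat (rot i f) *v axis i 1 = f"
    "scal g (axis i 1) = 0 \<Longrightarrow> scal g f = 0 \<Longrightarrow> smat (rot i f) *v g = g"
proof -
  let ?e = "axis i 1" let ?u = "?e + f" let ?q = "qs i * scal ?u ?u"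
  define c where "c = 1 / sqrt ?q"
  have ccq: "c * c * ?q = 1" unfolding c_def by (rule sqrt_inverse_sq(1)[OF Q])
  have cc: "c * c * scal ?u ?u = qs i"
  proof -
    have "qs i * (c * c * ?q) = qs i" unfolding ccq by simp
    then show ?thesis by (simp add: mult.left_commute)
  qed
  have eq: "rot i f = cl_vec (c *\<^sub>R ?u) \<odot> cl_vec (qs i *\<^sub>R ?e)"
    unfolding rot_def c_def by (simp add: cl_vec_simps cl_simps)
  show fs: "rot i f \<in> full_spin" unfolding eq
  proof (rule full_spin_pair)
    have "scal (c *\<^sub>R ?u) (c *\<^sub>R ?u) = qs i" using cc by (simp add: scal_linear(3,4) mult.assoc)
    then show "scal (c *\<^sub>R ?u) (c *\<^sub>R ?u) = 1 \<or> scal (c *\<^sub>R ?u) (c *\<^sub>R ?u) = - 1" using qs_cases by metis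
    have "scal (qs i *\<^sub>R ?e) (qs i *\<^sub>R ?e) = qs i" by (simp add: scal_linear scal_axis_self)
    then show "scal (qs i *\<^sub>R ?e) (qs i *\<^sub>R ?e) = 1 \<or> scal (qs i *\<^sub>R ?e) (qs i *\<^sub>R ?e) = - 1" using qs_cases by metis
  qed
  have "rot i f \<odot> clrev (rot i f) = (c * c * qs i * qs i) *\<^sub>R (cl_vec ?u \<odot> (cl_vec ?e \<odot> cl_vec ?e) \<odot> cl_vec ?u)"
    unfolding eq by (simp only: cl_vec_simps(4) clrev_mult clrev_simps(4) clrev_vec cl.scaleR_left cl.scaleR_right cl_assoc scaleR_scaleR mult_ac)
  also have "\<dots> = (c * c * qs i * qs i * qs i * scal ?u ?u) *\<^sub>R cl_one"
    by (simp add: cl_vec_sq cl_simps scal_axis_self)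
  also have "c * c * qs i * qs i * qs i * scal ?u ?u = (qs i * qs i) * (c * c * ?q)" by (simp only: mult_ac)
  also have "\<dots> = 1" unfolding ccq by simp
  finally have one: "rot i f \<odot> clrev (rot i f) = cl_one" by simp
  obtain d where d: "rot i f \<odot> clrev (rot i f) = d *\<^sub>R cl_one" "d = 1 \<longleftrightarrow> rot i f \<in> pspin"
    using full_spin_props[OF fs] by metis
  then have "d = 1" using one by (metis cl_one_nth vector_scaleR_component real_scaleR_def mult.right_neutral)
  with d show ps: "rot i f \<in> pspin" by simp
  \<comment> \<open>With u = e + f this reads (e + f) e = f (e + f), which holds because e and f
    have the same square.\<close>
  have "cl_vec ?u \<odot> cl_vec ?e = cl_vec f \<odot> cl_vec ?u"
    by (simp add: cl_vec_simps cl_simps cl_vec_sq f scal_axis_self add.commute)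
  from arg_cong[OF this, of "\<lambda>z. z \<odot> cl_vec ?e"]
  have "cl_vec ?u \<odot> cl_vec ?e \<odot> cl_vec ?e = cl_vec f \<odot> (cl_vec ?u \<odot> cl_vec ?e)"
    by (simp only: cl_assoc)
  then have "rot i f \<odot> cl_vec ?e = cl_vec f \<odot> rot i f"
    unfolding rot_def by (simp only: cl.scaleR_left cl.scaleR_right)
  then show "smat (rot i f) *v axis i 1 = f" using smat_unique[OF ps] by metis
  assume g: "scal g ?e = 0" "scal g f = 0"
  have a: "cl_vec ?e \<odot> cl_vec g = - (cl_vec g \<odot> cl_vec ?e)"
    using cl_vec_anticomm[of ?e g] g by (simp add: scal_sym add_eq_0_iff2)
  have b: "cl_vec ?u \<odot> cl_vec g = - (cl_vec g \<odot> cl_vec ?u)"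
    using cl_vec_anticomm[of ?u g] g by (simp add: scal_sym scal_linear add_eq_0_iff2)
  have "cl_vec ?u \<odot> cl_vec ?e \<odot> cl_vec g = cl_vec g \<odot> (cl_vec ?u \<odot> cl_vec ?e)"
    unfolding cl_assoc a cl.minus_right
    unfolding cl_assoc[symmetric] b cl.minus_left by simp
  then have "rot i f \<odot> cl_vec g = cl_vec g \<odot> rot i f"
    unfolding rot_def by (simp only: cl.scaleR_left cl.scaleR_right)
  then show "smat (rot i f) *v g = g" using smat_unique[OF ps] by metis
qed

lemma rot_axis: "rot i (axis i 1) = cl_one"
proof -
  have "scal (axis i 1 + axis i 1) (axis i 1 + axis i 1 :: real ^ (2 + 'a)) = 4 * qs i"
    by (simp only: scaleR_2[symmetric] scal_linear scal_axis_self)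
  moreover have "cl_vec (axis i 1 + axis i 1) \<odot> cl_vec (axis i 1) = (2 * qs i) *\<^sub>R (cl_one :: 'a clifford)"
    by (simp add: cl_vec_simps cl_simps cl_vec_sq scal_axis_self scaleR_2[symmetric])
  moreover have "sqrt (qs i * (4 * qs i)) = 2"
  proof -
    have "qs i * (4 * qs i) = 4 * (qs i * qs i)" by (simp only: mult_ac)
    also have "\<dots> = 4" by simp
    finally have e: "qs i * (4 * qs i) = 4" .
    show ?thesis unfolding e by simp
  qed
  ultimately show ?thesis unfolding rot_def by simp
qed

lemma smooth_on_scal:
  "smooth_on S f \<Longrightarrow> smooth_on S g \<Longrightarrow> smooth_on S (\<lambda>x. scal (f x) (g x))"
  unfolding scal_qs by (intro smooth_on_sum smooth_on_mult smooth_on_const smooth_on_nth)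

lemma smooth_on_rot:
  assumes "smooth_on S f" "\<And>x. x \<in> S \<Longrightarrow> qs i * scal (axis i 1 + f x) (axis i 1 + f x) > 0"
  shows "smooth_on S (\<lambda>x. rot i (f x))"
  unfolding rot_def
proof (intro smooth_on_scaleR smooth_on_divide smooth_on_const smooth_on_sqrt smooth_on_mult smooth_on_scal
    smooth_on_add assms smooth_on_cl smooth_on_linear_compose[OF bounded_linear_cl_vec])
  fix x assume "x \<in> S"
  from assms(2)[OF this] show "sqrt (qs i * scal (axis i 1 + f x) (axis i 1 + f x)) \<noteq> 0"
    by (rule sqrt_inverse_sq(2))
qed

text \<open>Columns are matched one at a time. Once \<open>\<sigma> A\<close> is right on
  \<open>I\<close>, the quotient \<open>A'\<close> fixes the vectors of \<open>I\<close>, and the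
  rotor from \<open>axis k 1\<close> to its image under \<open>A'\<close> fixes them as well,
  because that image stays orthogonal to them. So the rotor can be appended without spoiling earlier
  columns.\<close>

lemma local_section_exists:
  fixes I :: "(2 + 'm::{finite,linorder}) set"
  shows "\<exists>U \<sigma>. open U \<and> mat 1 \<in> U \<and> smooth_on U \<sigma> \<and> \<sigma> (mat 1) = cl_one \<and>
    (\<forall>A\<in>U \<inter> pseudo_orthogonal. \<sigma> A \<in> full_spin \<and> \<sigma> A \<in> pspin \<and>
       (\<forall>i\<in>I. smat (\<sigma> A) *v axis i 1 = A *v axis i 1))"
  using finite[of I]
proof (induction I)
  case empty
  show ?case
    by (intro exI[of _ UNIV] exI[of _ "\<lambda>_. cl_one"]) (auto intro: smooth_on_const full_spin_one pspin_one)
next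
  case (insert k I)
  then obtain U \<sigma> where U: "open U" "mat 1 \<in> U" "smooth_on U \<sigma>" "\<sigma> (mat 1) = cl_one"
    and s: "\<And>A. A \<in> U \<inter> pseudo_orthogonal \<Longrightarrow> \<sigma> A \<in> full_spin \<and> \<sigma> A \<in> pspin \<and>
       (\<forall>i\<in>I. smat (\<sigma> A) *v axis i 1 = A *v axis i 1)" by (metis (no_types, lifting))
  define A' where "A' A = padj (smat (\<sigma> A)) ** A" for A
  define f where "f A = A' A *v axis k 1" for A
  have smA': "smooth_on U A'" unfolding A'_def
    by (intro smooth_on_matrix_mul smooth_on_id smooth_on_linear_compose[OF bounded_linear_padj]
        smooth_on_compose[OF smooth_on_smat[of UNIV]] U) auto
  have smf: "smooth_on U f" unfolding f_def
    by (intro smooth_on_matrix_vector smA' smooth_on_const)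
  \<comment> \<open>Positivity of \<open>q\<close> is the hypothesis \<open>Q\<close> of
    \<open>rot_props\<close>; it holds at the identity, where \<open>f\<close> is
    \<open>axis k 1\<close>, hence on a neighbourhood.\<close>
  define q where "q A = qs k * scal (axis k 1 + f A) (axis k 1 + f A)" for A
  have smq: "smooth_on U q" unfolding q_def
    by (intro smooth_on_mult smooth_on_scal smooth_on_add smooth_on_const smf)
  define U' where "U' = {A \<in> U. q A > 0}"
  have "open (U \<inter> q -` {0<..})"
    by (intro continuous_open_preimage smooth_on_imp_continuous_on smq U open_greaterThan)
  then have opU': "open U'" by (simp add: U'_def Int_def vimage_def)
  have f1: "f (mat 1) = axis k 1" by (simp add: f_def A'_def U smat_one)
  have "mat 1 \<in> U'" using U f1 by (simp add: U'_def q_def scal_linear scal_axis_self)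
  define \<sigma>' where "\<sigma>' A = \<sigma> A \<odot> rot k (f A)" for A
  have sm: "smooth_on U' \<sigma>'" unfolding \<sigma>'_def
    by (intro smooth_on_cl smooth_on_rot smooth_on_subset[OF smf] smooth_on_subset[OF U(3)])
       (auto simp: U'_def q_def)
  have "\<sigma>' A \<in> full_spin \<and> \<sigma>' A \<in> pspin \<and> (\<forall>i\<in>insert k I. smat (\<sigma>' A) *v axis i 1 = A *v axis i 1)"
    if A: "A \<in> U' \<inter> pseudo_orthogonal" for A
  proof -
    have sA: "\<sigma> A \<in> full_spin" "\<sigma> A \<in> pspin" "\<And>i. i \<in> I \<Longrightarrow> smat (\<sigma> A) *v axis i 1 = A *v axis i 1"
      using s[of A] A by (auto simp: U'_def)
    have po: "smat (\<sigma> A) \<in> pseudo_orthogonal" by (rule smat_pseudo_orthogonal[OF sA(2)])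
    have A'po: "A' A \<in> pseudo_orthogonal" unfolding A'_def
      using A po by (auto intro!: pseudo_orthogonal_mult pseudo_orthogonal_padj)
    have A's: "smat (\<sigma> A) *v (A' A *v v) = A *v v" for v
      by (simp add: A'_def matrix_vector_mul_assoc matrix_mul_assoc padj_right[OF po])
    have A'e: "A' A *v axis i 1 = axis i 1" if "i \<in> I" for i
    proof -
      have "A' A *v axis i 1 = padj (smat (\<sigma> A)) *v (smat (\<sigma> A) *v axis i 1)"
        unfolding A'_def using sA(3)[OF that] by (simp add: matrix_vector_mul_assoc)
      then show ?thesis by (simp add: matrix_vector_mul_assoc padj_left[OF po])
    qed
    have pres: "scal (A' A *v v) (A' A *v w) = scal v w" for v w
      using A'po by (simp add: pseudo_orthogonal_def)
    have ff: "scal (f A) (f A) = qs k" unfolding f_def pres by (rule scal_axis_self)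
    have Q: "qs k * scal (axis k 1 + f A) (axis k 1 + f A) > 0" using A by (simp add: U'_def q_def)
    note R = rot_props[OF ff Q]
    have "smat (rot k (f A)) *v axis i 1 = axis i 1" if "i \<in> I" for i
    proof (rule R(4))
      have "i \<noteq> k" using that insert by auto
      then show "scal (axis i 1) (axis k 1) = 0" by (rule scal_axis_ne)
      have "scal (axis i 1) (f A) = scal (A' A *v axis i 1) (A' A *v axis k 1)"
        using A'e[OF that] by (simp add: f_def)
      then show "scal (axis i 1) (f A) = 0" using \<open>i \<noteq> k\<close> by (simp add: pres scal_axis_ne)
    qed
    then have "smat (\<sigma>' A) *v axis i 1 = A *v axis i 1" if "i \<in> I" for i
      unfolding \<sigma>'_def smat_mult[OF sA(2) R(1)] using that sA(3)
      by (simp add: matrix_vector_mul_assoc[symmetric])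
    moreover have "smat (\<sigma>' A) *v axis k 1 = A *v axis k 1"
      unfolding \<sigma>'_def smat_mult[OF sA(2) R(1)]
      using R(3) A's by (simp add: matrix_vector_mul_assoc[symmetric] f_def)
    moreover have "\<sigma>' A \<in> full_spin" "\<sigma>' A \<in> pspin"
      unfolding \<sigma>'_def using sA R by (auto intro: full_spin_mult pspin_mult)
    ultimately show ?thesis by auto
  qed
  moreover have "\<sigma>' (mat 1) = cl_one" by (simp add: \<sigma>'_def U f1 rot_axis)
  ultimately show ?case using opU' \<open>mat 1 \<in> U'\<close> sm by (intro exI[of _ U'] exI[of _ \<sigma>']) blast
qed

subsection \<open>The Cayley transform\<close>

definition cay :: "real^'n^'n \<Rightarrow> real^'n^'n" where
  "cay B = (mat 1 - B) ** matrix_inv (mat 1 + B)"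

lemma matrix_diff_ldistrib: "(A :: real^'n^'m) ** (B - C) = A ** B - A ** (C :: real^'p^'n)"
  by (vector matrix_matrix_mult_def sum_subtractf[symmetric] field_simps)

lemma matrix_diff_rdistrib: "((B::real^'n^'m) - C) ** (A::real^'p^'n) = B ** A - C ** A"
  by (vector matrix_matrix_mult_def sum_subtractf[symmetric] field_simps)

lemmas matrix_ring = matrix_add_ldistrib matrix_add_rdistrib' matrix_diff_ldistrib matrix_diff_rdistrib

lemma matrix_inv_mult:
  fixes A :: "real^'n^'n"
  assumes "det A \<noteq> 0"
  shows "A ** matrix_inv A = mat 1" "matrix_inv A ** A = mat 1"
  using matrix_inv_works invertible_det_nz assms by blast+

lemma matrix_inv_unique:
  fixes A :: "real^'n^'n"
  assumes "A ** B = mat 1" shows "matrix_inv A = B"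
proof -
  have "B ** A = mat 1" using assms matrix_left_right_inverse by blast
  then have "invertible A" using assms by (auto simp: invertible_def)
  then have "matrix_inv A = matrix_inv A ** (A ** B)" using assms by simp
  also have "\<dots> = B" using matrix_inv_works[OF \<open>invertible A\<close>] by (simp add: matrix_mul_assoc)
  finally show ?thesis .
qed

text \<open>With S the inverse of 1 + B one has \<open>mat 1 + cay B\<close> = 2 S and
  \<open>mat 1 - cay B\<close> = 2 B S, so the quotient of the two returns B.\<close>

lemma cay_cay:
  fixes B :: "real^'n^'n"
  assumes "det (mat 1 + B) \<noteq> 0"
  shows "det (mat 1 + cay B) \<noteq> 0" "cay (cay B) = B"
proof -
  let ?S = "matrix_inv (mat 1 + B)"
  note S = matrix_inv_mult[OF assms]
  have s: "?S + B ** ?S = mat 1" using S(1) by (simp add: matrix_ring)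
  have "mat 1 + cay B = 2 *\<^sub>R ?S"
    unfolding cay_def using s by (simp add: matrix_ring scaleR_2 algebra_simps)
  then have inv: "(mat 1 + cay B) ** ((1/2) *\<^sub>R (mat 1 + B)) = mat 1"
    using S(2) by (simp add: matrix_scalar_ac scalar_matrix_assoc)
  then have "det (mat 1 + cay B) * det ((1/2) *\<^sub>R (mat 1 + B)) = 1" by (metis det_I det_mul)
  then show "det (mat 1 + cay B) \<noteq> 0" by auto
  have i: "matrix_inv (mat 1 + cay B) = (1/2) *\<^sub>R (mat 1 + B)" by (rule matrix_inv_unique[OF inv])
  have "mat 1 - cay B = 2 *\<^sub>R (B ** ?S)"
    unfolding cay_def using s by (simp add: matrix_ring scaleR_2 algebra_simps)
  then have "cay (cay B) = B ** ?S ** (mat 1 + B)"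
    unfolding cay_def[of "cay B"] i by (simp add: matrix_scalar_ac scalar_matrix_assoc)
  then show "cay (cay B) = B" using S(2) by (simp add: matrix_mul_assoc[symmetric])
qed

lemma cay_0 [simp]: "cay 0 = mat 1"
  by (simp add: cay_def matrix_inv_unique)

lemma cay_mult: "det (mat 1 + B) \<noteq> 0 \<Longrightarrow> cay B ** (mat 1 + B) = mat 1 - B"
  unfolding cay_def by (simp add: matrix_mul_assoc[symmetric] matrix_inv_mult)

lemma smooth_on_cay: "(\<And>x. x \<in> S \<Longrightarrow> det (mat 1 + f x) \<noteq> 0) \<Longrightarrow> smooth_on S f \<Longrightarrow> smooth_on S (\<lambda>x. cay (f x))"
  unfolding cay_def
  by (intro smooth_on_matrix_mul smooth_on_matrix_inv smooth_on_add smooth_on_diff smooth_on_const)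

lemma padj_simps: "padj (X + Y) = padj X + padj Y" "padj (X - Y) = padj X - padj Y" "padj (- X) = - padj X"
  "padj (c *\<^sub>R X) = c *\<^sub>R padj X" "padj 0 = 0"
  using bounded_linear_padj
  by (auto simp: padj_def vec_eq_iff algebra_simps)

lemma cay_skew_pseudo_orthogonal:
  assumes "padj B = - B" "det (mat 1 + B) \<noteq> 0" shows "cay B \<in> pseudo_orthogonal"
proof -
  let ?S = "matrix_inv (mat 1 + B)"
  note S = matrix_inv_mult[OF assms(2)]
  have p: "padj ?S ** (mat 1 - B) = mat 1"
    using arg_cong[OF S(1), of padj] by (simp add: padj_mult padj_simps assms(1))
  have "padj (cay B) ** cay B = padj ?S ** ((mat 1 + B) ** (mat 1 - B)) ** ?S"
    unfolding cay_def padj_mult by (simp add: padj_simps assms(1) matrix_mul_assoc)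
  also have "(mat 1 + B) ** (mat 1 - B) = (mat 1 - B) ** (mat 1 + B)" by (simp add: matrix_ring)
  also have "padj ?S ** ((mat 1 - B) ** (mat 1 + B)) ** ?S = (padj ?S ** (mat 1 - B)) ** ((mat 1 + B) ** ?S)"
    by (simp add: matrix_mul_assoc)
  also have "\<dots> = mat 1" by (simp add: p S)
  finally show ?thesis by (simp add: pseudo_orthogonal_iff)
qed

text \<open>The sum \<open>padj (cay A) + cay A\<close>, multiplied from the left by 1 + A' and from
  the right by 1 + A, with A' the adjoint of A, gives (1 - A')(1 + A) + (1 + A')(1 - A) = 2 - 2 A' A
  = 0. Both factors are invertible.\<close>

lemma cay_pseudo_orthogonal_skew:
  assumes "A \<in> pseudo_orthogonal" "det (mat 1 + A) \<noteq> 0" shows "padj (cay A) = - cay A"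
proof -
  let ?R = "matrix_inv (mat 1 + A)" let ?X = "padj (cay A) + cay A" let ?p = "padj A"
  note R = matrix_inv_mult[OF assms(2)]
  have p: "(mat 1 + ?p) ** padj ?R = mat 1" "padj ?R ** (mat 1 + ?p) = mat 1"
    using arg_cong[OF R(1), of padj] arg_cong[OF R(2), of padj] by (simp_all add: padj_mult padj_simps)
  have 1: "(mat 1 + ?p) ** padj (cay A) = mat 1 - ?p"
    unfolding cay_def padj_mult by (simp add: padj_simps matrix_mul_assoc p)
  have 2: "cay A ** (mat 1 + A) = mat 1 - A" by (rule cay_mult[OF assms(2)])
  have pA: "?p ** A = mat 1" by (rule padj_left[OF assms(1)])
  have "(mat 1 + ?p) ** ?X ** (mat 1 + A) = ((mat 1 + ?p) ** padj (cay A)) ** (mat 1 + A) + (mat 1 + ?p) ** (cay A ** (mat 1 + A))"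
    by (simp only: matrix_add_ldistrib matrix_add_rdistrib' matrix_mul_assoc add_ac)
  also have "\<dots> = (mat 1 - ?p) ** (mat 1 + A) + (mat 1 + ?p) ** (mat 1 - A)" unfolding 1 2 ..
  also have "\<dots> = 0" by (simp add: matrix_ring pA)
  finally have 0: "(mat 1 + ?p) ** ?X ** (mat 1 + A) = 0" .
  have "?X = (padj ?R ** (mat 1 + ?p)) ** ?X ** ((mat 1 + A) ** ?R)" by (simp add: p R)
  also have "\<dots> = padj ?R ** ((mat 1 + ?p) ** ?X ** (mat 1 + A)) ** ?R" by (simp only: matrix_mul_assoc)
  also have "\<dots> = 0" unfolding 0 by simp
  finally show ?thesis by (simp add: eq_neg_iff_add_eq_0)
qed

subsection \<open>Bivector coordinates\<close>

text \<open>The skew matrix of the bivector part of \<open>x\<close>, with signs chosen so that it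
  becomes the Cayley parameter in \<open>bmat_cay\<close>. It depends on the coefficients of
  two-element sets only.\<close>

definition bmat0 :: "'m::{finite,linorder} clifford \<Rightarrow> 'm mat_full" where
  "bmat0 x = (\<chi> i j. if i = j then 0 else - (x $ {i, j} * cl_sign {i, j} {j}))"

text \<open>Division by the scalar part makes this invariant under scaling of \<open>x\<close>, in
  particular under passage to \<open>- x\<close>.\<close>

definition bmat :: "'m::{finite,linorder} clifford \<Rightarrow> 'm mat_full" where
  "bmat x = bmat0 ((1 / x $ {}) *\<^sub>R x)"

lemma bounded_linear_bmat0: "bounded_linear bmat0"
  by (intro linear_conv_bounded_linear[THEN iffD1] linearI) (auto simp: bmat0_def vec_eq_iff algebra_simps)

lemma cl_sign_pair: "i \<noteq> j \<Longrightarrow> cl_sign {i, j} {j} = eps {i} {j} * qs j"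
proof -
  assume ij: "i \<noteq> j"
  have "{i, j} = sym_diff {i} {j}" using ij by auto
  then have "eps {i, j} {j} = eps {i} {j} * eps {j} {j}" using prod_one_minus_cong(1)[of "{i}" "{j}" "{j}"] by simp
  moreover have "{i, j} \<inter> {j} = {j}" by auto
  ultimately show ?thesis by (simp add: cl_sign_eq eps_single)
qed

lemma padj_bmat0: "padj (bmat0 x) = - bmat0 x"
proof -
  have "qs i * - (x $ {j, i} * cl_sign {j, i} {i}) * qs j = x $ {i, j} * cl_sign {i, j} {j}" if "i \<noteq> j" for i j
  proof -
    have x: "x $ {j, i} = x $ {i, j}" by (simp add: insert_commute)
    show ?thesis
      unfolding cl_sign_pair[OF that] cl_sign_pair[OF that[symmetric]] eps_single x idx_less_total[OF that]
      by simp
  qed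
  then show ?thesis by (auto simp: padj_def bmat0_def vec_eq_iff)
qed

lemma bmat0_eqD: "bmat0 x = bmat0 y \<Longrightarrow> card A = 2 \<Longrightarrow> x $ A = y $ A"
proof -
  assume e: "bmat0 x = bmat0 y" and "card A = 2"
  then obtain i j where ij: "A = {i, j}" "i \<noteq> j" by (meson card_2_iff)
  have "bmat0 x $ i $ j = bmat0 y $ i $ j" using e by simp
  then show ?thesis using ij by (simp add: bmat0_def cl_sign_pair)
qed

lemma bmat0_cong: "(\<And>A. card A = 2 \<Longrightarrow> x $ A = y $ A) \<Longrightarrow> bmat0 x = bmat0 y"
  by (simp add: bmat0_def vec_eq_iff)

text \<open>The vector part of the product of an even element with a basis vector comes from grades
  0 and 2. The commutator isolates grade 2 and the anticommutator grade 0.\<close>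

lemma vector_part_comm:
  assumes "clpar x = x"
  shows "(x \<odot> axis {k} 1 - axis {k} 1 \<odot> x) $ {i} = (if i = k then 0 else 2 * x $ {i, k} * cl_sign {i, k} {k})"
    "(x \<odot> axis {k} 1 + axis {k} 1 \<odot> x) $ {i} = (if i = k then 2 * x $ {} else 0)"
proof -
  have "(x \<odot> axis {k} 1) $ {i} = x $ {i, k} * cl_sign {i, k} {k} \<and> (axis {k} 1 \<odot> x) $ {i} = - (x $ {i, k} * cl_sign {i, k} {k})"
    if "i \<noteq> k"
  proof -
    have s: "sym_diff {i} {k} = {i, k}" "sym_diff {k} {i} = {i, k}" using that by auto
    have "cl_sign {k} {i, k} = - cl_sign {i, k} {k}"
      using cl_sign_comm_single[of "{i, k}" k] that by simp
    then show ?thesis unfolding cl_mult_axis_left cl_mult_axis_right s by simp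
  qed
  then show "(x \<odot> axis {k} 1 - axis {k} 1 \<odot> x) $ {i} = (if i = k then 0 else 2 * x $ {i, k} * cl_sign {i, k} {k})"
    "(x \<odot> axis {k} 1 + axis {k} 1 \<odot> x) $ {i} = (if i = k then 2 * x $ {} else 0)"
    by (auto simp: cl_mult_axis_left cl_mult_axis_right)
qed

lemma vector_part_anticomm:
  assumes "clpar x = x" shows "(x \<odot> cl_vec v + cl_vec v \<odot> x) $ {i} = 2 * v $ i * x $ {}"
proof -
  have "(x \<odot> cl_vec v + cl_vec v \<odot> x) $ {i} = (\<Sum>k\<in>UNIV. v $ k * (x \<odot> axis {k} 1 + axis {k} 1 \<odot> x) $ {i})"
    unfolding cl_vec_def by (simp add: cl.sum_left cl.sum_right cl_simps sum.distrib algebra_simps)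
  also have "\<dots> = (\<Sum>k\<in>UNIV. if k = i then 2 * v $ i * x $ {} else 0)"
    unfolding vector_part_comm(2)[OF assms] by (rule sum.cong) auto
  finally show ?thesis by simp
qed

lemma real_quotient_eq: "2 * a * c = - (2 * b * d) \<Longrightarrow> d \<noteq> 0 \<Longrightarrow> 1 / d * a * c = - (b :: real)"
  by (simp add: field_simps)

text \<open>Comparing vector parts in \<open>x (w + B w) = (w - B w) x\<close> expresses the Cayley parameter \<open>B\<close> of
  \<open>smat x\<close> through the bivector part of \<open>x\<close>.\<close>

lemma bmat_cay:
  assumes "x \<in> pspin" "smat x = cay B" "det (mat 1 + B) \<noteq> 0" "x $ {} \<noteq> 0"
  shows "bmat x = B"
proof -
  have par: "clpar x = x" by (rule pspinD[OF assms(1)])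
  have "bmat x $ i $ j = B $ i $ j" for i j
  proof -
    let ?w = "axis j 1" let ?v = "B *v axis j 1"
    have "smat x *v ((mat 1 + B) *v ?w) = (mat 1 - B) *v ?w"
      unfolding assms(2) matrix_vector_mul_assoc cay_mult[OF assms(3)] ..
    then have "smat x *v (?w + ?v) = ?w - ?v"
      by (simp add: matrix_vector_mult_add_rdistrib matrix_vector_mult_diff_rdistrib)
    then have "x \<odot> cl_vec (?w + ?v) = cl_vec (?w - ?v) \<odot> x"
      using smat_commute[OF assms(1), of "?w + ?v"] by simp
    then have "x \<odot> cl_vec ?w - cl_vec ?w \<odot> x = - (x \<odot> cl_vec ?v + cl_vec ?v \<odot> x)"
      by (simp add: cl_vec_simps cl_simps algebra_simps)
    then have "(x \<odot> axis {j} 1 - axis {j} 1 \<odot> x) $ {i} = - (2 * ?v $ i * x $ {})"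
      unfolding cl_vec_axis vector_part_anticomm[OF par, symmetric] by simp
    moreover have "?v $ i = B $ i $ j" by (simp add: matrix_vector_mult_basis column_def)
    ultimately have eq: "(if i = j then 0 else 2 * x $ {i, j} * cl_sign {i, j} {j}) = - (2 * B $ i $ j * x $ {})"
      unfolding vector_part_comm(1)[OF par] by metis
    show ?thesis
    proof (cases "i = j")
      case True
      then show ?thesis using eq assms(4) by (simp add: bmat_def bmat0_def)
    next
      case False
      then have "2 * x $ {i, j} * cl_sign {i, j} {j} = - (2 * B $ i $ j * x $ {})" using eq by argo
      then have "1 / x $ {} * x $ {i, j} * cl_sign {i, j} {j} = - (B $ i $ j)"
        using assms(4) by (rule real_quotient_eq)
      then show ?thesis using False by (simp add: bmat_def bmat0_def)
    qed
  qed
  then show ?thesis by (simp add: vec_eq_iff)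
qed

text \<open>The map \<open>j\<close> is the local section of \<open>smat\<close> after the Cayley
  transform. The radius is small enough for \<open>cay\<close> to be defined and for the scalar part
  to stay positive; the sign condition later separates \<open>j B\<close> from
  \<open>- j B\<close>.\<close>

lemma local_spin_chart:
  obtains \<epsilon> :: real and j :: "'m::{finite,linorder} mat_full \<Rightarrow> 'm clifford" where
    "\<epsilon> > 0" "smooth_on (ball 0 \<epsilon>) j" "j 0 = cl_one"
    "\<And>B :: 'm mat_full. B \<in> ball 0 \<epsilon> \<Longrightarrow> det (mat 1 + B) \<noteq> 0" "\<And>B. B \<in> ball 0 \<epsilon> \<Longrightarrow> j B $ {} > 0"
    "\<And>B. B \<in> ball 0 \<epsilon> \<Longrightarrow> padj B = - B \<Longrightarrow> j B \<in> Spin \<and> smat (j B) = cay B \<and> bmat (j B) = B"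
proof -
  obtain U and \<sigma> :: "'m mat_full \<Rightarrow> 'm clifford" where U: "open U" "mat 1 \<in> U" "smooth_on U \<sigma>" "\<sigma> (mat 1) = cl_one"
    and s: "\<And>A. A \<in> U \<inter> pseudo_orthogonal \<Longrightarrow> \<sigma> A \<in> full_spin \<and> \<sigma> A \<in> pspin \<and>
       (\<forall>i. smat (\<sigma> A) *v axis i 1 = A *v axis i 1)"
    using local_section_exists[of UNIV] by (metis (no_types, lifting) UNIV_I)
  define W1 where "W1 = {B :: 'm mat_full. det (mat 1 + B) \<noteq> 0}"
  have "continuous_on UNIV (\<lambda>B :: 'm mat_full. det (mat 1 + B))"
    by (intro smooth_on_imp_continuous_on smooth_on_det smooth_on_add smooth_on_const smooth_on_id)
  then have W1: "open W1" unfolding W1_def by (intro open_Collect_neq continuous_on_const)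
  have smc: "smooth_on W1 cay" by (rule smooth_on_cay) (auto simp: W1_def smooth_on_id)
  have W2: "open (W1 \<inter> cay -` U)" (is "open ?W2")
    by (intro continuous_open_preimage W1 U smooth_on_imp_continuous_on smc)
  define j where "j = (\<lambda>B. \<sigma> (cay B))"
  have smj: "smooth_on ?W2 j" unfolding j_def
    by (rule smooth_on_compose[OF U(3)]) (auto intro: smooth_on_subset[OF smc])
  have "open (?W2 \<inter> (\<lambda>B. j B $ {}) -` {0<..})"
    by (intro continuous_open_preimage W2 open_greaterThan smooth_on_imp_continuous_on smooth_on_nth smj)
  moreover have "0 \<in> ?W2 \<inter> (\<lambda>B. j B $ {}) -` {0<..}"
    by (simp add: W1_def j_def U)
  ultimately obtain \<epsilon> where e: "\<epsilon> > 0" "ball 0 \<epsilon> \<subseteq> ?W2 \<inter> (\<lambda>B. j B $ {}) -` {0<..}"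
    using open_contains_ball by metis
  have P: "j B \<in> full_spin" "j B \<in> pspin" "smat (j B) = cay B" if "B \<in> ball 0 \<epsilon>" "padj B = - B" for B
  proof -
    have "cay B \<in> U \<inter> pseudo_orthogonal"
      using e that cay_skew_pseudo_orthogonal[OF that(2)] by (auto simp: W1_def)
    note sB = s[OF this]
    show "j B \<in> full_spin" "j B \<in> pspin" using sB by (simp_all add: j_def)
    have "smat (\<sigma> (cay B)) *v v = cay B *v v" for v
      by (rule vec_ext[of "(*v) (smat (\<sigma> (cay B)))" "(*v) (cay B)"])
         (use sB in \<open>simp_all add: matrix_vector_mul_linear\<close>)
    then show "smat (j B) = cay B" unfolding j_def matrix_eq by blast
  qed
  have SpinB: "j B \<in> Spin" if "B \<in> ball 0 \<epsilon>" "padj B = - B" for B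
  proof -
    \<comment> \<open>The skew matrices in the ball form a convex set through 0, so their image is
      connected, contains \<open>cl_one\<close> and lies in \<open>full_spin\<close>. This places
      \<open>j B\<close> in the identity component.\<close>
    let ?S = "j ` (ball 0 \<epsilon> \<inter> {B. padj B = - B})"
    have "convex (ball 0 \<epsilon> \<inter> {B :: 'm mat_full. padj B = - B})"
      by (intro convex_Int convex_ball) (auto simp: convex_def padj_simps)
    then have "connected ?S"
      using smooth_on_imp_continuous_on[OF smj] e(2)
      by (intro connected_continuous_image convex_connected) (auto intro: continuous_on_subset)
    moreover have "cl_one \<in> ?S"
      using e(1) by (intro image_eqI[of _ _ 0]) (auto simp: padj_simps j_def U)
    moreover have "j B \<in> ?S" using that by auto
    moreover have "?S \<subseteq> full_spin" using P by auto
    ultimately show ?thesis by (rule Spin_path[OF Spin_one])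
  qed
  have eB: "det (mat 1 + B) \<noteq> 0" "j B $ {} > 0" if "B \<in> ball 0 \<epsilon>" for B
    using subsetD[OF e(2) that] by (simp_all add: W1_def)
  have bB: "bmat (j B) = B" if "B \<in> ball 0 \<epsilon>" "padj B = - B" for B
    using bmat_cay[OF P(2,3)[OF that] eB(1)] eB(2)[OF that(1)] that(1) by simp
  show ?thesis
  proof (rule that[of \<epsilon> j])
    show "\<epsilon> > 0" by (rule e(1))
    show "smooth_on (ball 0 \<epsilon>) j" using e(2) by (intro smooth_on_subset[OF smj]) blast
    show "j 0 = cl_one" by (simp add: j_def U)
    show "j B \<in> Spin \<and> smat (j B) = cay B \<and> bmat (j B) = B" if "B \<in> ball 0 \<epsilon>" "padj B = - B" for B
      using P(3) SpinB bB that by blast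
    show "det (mat 1 + B) \<noteq> 0" "j B $ {} > 0" if "B \<in> ball 0 \<epsilon>" for B
      using eB[OF that] by simp_all
  qed
qed

section \<open>Covering maps from group homomorphisms\<close>

lemma (in group) mult_inv_cancel:
  assumes "x \<in> carrier G" "y \<in> carrier G"
  shows "x \<otimes> (inv x \<otimes> y) = y" "inv x \<otimes> (x \<otimes> y) = y"
proof -
  have "x \<otimes> (inv x \<otimes> y) = x \<otimes> inv x \<otimes> y" by (rule m_assoc[symmetric]) (use assms in auto)
  then show "x \<otimes> (inv x \<otimes> y) = y" using assms by simp
  have "inv x \<otimes> (x \<otimes> y) = inv x \<otimes> x \<otimes> y" by (rule m_assoc[symmetric]) (use assms in auto)
  then show "inv x \<otimes> (x \<otimes> y) = y" using assms by simp
qed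

lemma continuous_on_binop:
  assumes "continuous_on (S \<times> T) (\<lambda>(x, y). m x y)" "continuous_on A f" "continuous_on A g"
    "\<And>x. x \<in> A \<Longrightarrow> f x \<in> S" "\<And>x. x \<in> A \<Longrightarrow> g x \<in> T"
  shows "continuous_on A (\<lambda>x. m (f x) (g x))"
proof -
  have "(\<lambda>x. (f x, g x)) ` A \<subseteq> S \<times> T" using assms(4,5) by auto
  from continuous_on_compose2[OF assms(1) continuous_on_Pair[OF assms(2,3)] this] show ?thesis by simp
qed

text \<open>A continuous section near the unit can be translated to every point of \<open>G\<close>.
  Discreteness of the kernel then splits each preimage into open sheets, and connectedness of
  \<open>G\<close> gives surjectivity.\<close>

lemma group_covering_space:
  fixes H :: "'a::metric_space monoid" and G :: "'b::metric_space monoid"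
  assumes hom: "group_hom H G p"
    and contH: "continuous_on (carrier H \<times> carrier H) (\<lambda>(x, y). x \<otimes>\<^bsub>H\<^esub> y)" "continuous_on (carrier H) (\<lambda>x. inv\<^bsub>H\<^esub> x)"
    and contG: "continuous_on (carrier G \<times> carrier G) (\<lambda>(x, y). x \<otimes>\<^bsub>G\<^esub> y)"
    and contp: "continuous_on (carrier H) p"
    and conn: "connected (carrier G)"
    and T: "openin (top_of_set (carrier G)) T" "\<one>\<^bsub>G\<^esub> \<in> T" "continuous_on T s" "s ` T \<subseteq> carrier H"
      "\<And>y. y \<in> T \<Longrightarrow> p (s y) = y"
    and disc: "\<And>k. k \<in> kernel H G p \<Longrightarrow> \<exists>W. open W \<and> W \<inter> kernel H G p = {k}"
  shows "covering_space (carrier H) p (carrier G)"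
proof -
  interpret group_hom H G p by (rule hom)
  let ?K = "kernel H G p"
  have TG: "T \<subseteq> carrier G" using T(1) openin_imp_subset by blast
  have contl: "continuous_on (carrier G) (\<lambda>z. inv\<^bsub>G\<^esub> y \<otimes>\<^bsub>G\<^esub> z)" if "y \<in> carrier G" for y
  proof -
    have c: "continuous_on (carrier G) (\<lambda>z. (inv\<^bsub>G\<^esub> y, z))"
      by (intro continuous_on_Pair continuous_on_const continuous_on_id)
    have s: "(\<lambda>z. (inv\<^bsub>G\<^esub> y, z)) ` carrier G \<subseteq> carrier G \<times> carrier G" using that by auto
    from continuous_on_compose2[OF contG c s] show ?thesis by simp
  qed
  define N where "N y = {z \<in> carrier G. inv\<^bsub>G\<^esub> y \<otimes>\<^bsub>G\<^esub> z \<in> T}" for y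
  have opN: "openin (top_of_set (carrier G)) (N y)" if "y \<in> carrier G" for y
  proof -
    have "N y = carrier G \<inter> (\<lambda>z. inv\<^bsub>G\<^esub> y \<otimes>\<^bsub>G\<^esub> z) -` T" by (auto simp: N_def)
    then show ?thesis
      using continuous_openin_preimage[OF contl[OF that] _ T(1)] that by auto
  qed
  have yN: "y \<in> N y" if "y \<in> carrier G" for y using that T by (simp add: N_def)
  \<comment> \<open>The image is a subgroup containing the neighbourhood \<open>T\<close> of the
    unit. Translates of \<open>T\<close> show that it and its complement are open, and a nonempty
    clopen subset of the connected group is everything.\<close>
  have surj: "p ` carrier H = carrier G"
  proof -
    let ?P = "p ` carrier H"
    have P: "?P \<subseteq> carrier G" by auto
    have sub: "subgroup ?P G" by (rule img_is_subgroup)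
    have TP: "T \<subseteq> ?P" using T by (metis image_eqI image_subset_iff subsetI)
    have 1: "N y \<subseteq> ?P" if "y \<in> ?P" for y
    proof
      fix z assume z: "z \<in> N y"
      then have zP: "inv\<^bsub>G\<^esub> y \<otimes>\<^bsub>G\<^esub> z \<in> ?P" and "z \<in> carrier G" using TP by (auto simp: N_def)
      have "y \<otimes>\<^bsub>G\<^esub> (inv\<^bsub>G\<^esub> y \<otimes>\<^bsub>G\<^esub> z) \<in> ?P" by (rule subgroup.m_closed[OF sub that zP])
      moreover have "y \<otimes>\<^bsub>G\<^esub> (inv\<^bsub>G\<^esub> y \<otimes>\<^bsub>G\<^esub> z) = z"
        by (rule H.mult_inv_cancel(1)[OF subsetD[OF P that] \<open>z \<in> carrier G\<close>])
      ultimately show "z \<in> ?P" by simp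
    qed
    have 2: "N y \<inter> ?P = {}" if "y \<in> carrier G - ?P" for y
    proof (rule ccontr)
      assume "N y \<inter> ?P \<noteq> {}"
      then obtain z where z: "z \<in> N y" "z \<in> ?P" by blast
      then have zz: "inv\<^bsub>G\<^esub> y \<otimes>\<^bsub>G\<^esub> z \<in> ?P" "z \<in> carrier G" using TP by (auto simp: N_def)
      then have "z \<otimes>\<^bsub>G\<^esub> inv\<^bsub>G\<^esub> (inv\<^bsub>G\<^esub> y \<otimes>\<^bsub>G\<^esub> z) \<in> ?P"
        by (intro subgroup.m_closed[OF sub] subgroup.m_inv_closed[OF sub] z zz)
      moreover have "z \<otimes>\<^bsub>G\<^esub> inv\<^bsub>G\<^esub> (inv\<^bsub>G\<^esub> y \<otimes>\<^bsub>G\<^esub> z) = y"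
        using that zz(2) by (simp add: H.inv_mult_group H.mult_inv_cancel)
      ultimately show False using that by simp
    qed
    have "openin (top_of_set (carrier G)) ?P"
    proof (subst openin_subopen, intro ballI)
      fix y assume y: "y \<in> ?P"
      then have "y \<in> carrier G" using P by (rule rev_subsetD)
      then show "\<exists>T. openin (top_of_set (carrier G)) T \<and> y \<in> T \<and> T \<subseteq> ?P"
        by (intro exI[of _ "N y"] conjI opN yN 1 y)
    qed
    moreover have "openin (top_of_set (carrier G)) (carrier G - ?P)"
    proof (subst openin_subopen, intro ballI)
      fix y assume y: "y \<in> carrier G - ?P"
      have "N y \<subseteq> carrier G - ?P" using 2[OF y] by (auto simp: N_def)
      then show "\<exists>T. openin (top_of_set (carrier G)) T \<and> y \<in> T \<and> T \<subseteq> carrier G - ?P"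
        using y by (intro exI[of _ "N y"] conjI opN yN) auto
    qed
    then have "closedin (top_of_set (carrier G)) ?P" using P by (simp add: closedin_def)
    ultimately have "?P = {} \<or> ?P = carrier G" using conn connected_clopen by blast
    then show ?thesis using G.one_closed by blast
  qed
  show ?thesis
  proof (rule covering_spaceI[OF contp surj])
    fix y0 assume y0: "y0 \<in> carrier G"
    then obtain h0 where h0: "h0 \<in> carrier H" "p h0 = y0" using surj by (metis imageE)
    \<comment> \<open>The section translated to \<open>y0\<close>, started at a chosen preimage
      \<open>h0\<close>.\<close>
    define s' where "s' z = h0 \<otimes>\<^bsub>H\<^esub> s (inv\<^bsub>G\<^esub> y0 \<otimes>\<^bsub>G\<^esub> z)" for z
    let ?T = "N y0"
    have s'H: "s' z \<in> carrier H" if "z \<in> ?T" for z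
      using that h0 T(4) by (auto simp: s'_def N_def)
    have ps': "p (s' z) = z" if "z \<in> ?T" for z
    proof -
      have z: "inv\<^bsub>G\<^esub> y0 \<otimes>\<^bsub>G\<^esub> z \<in> T" "z \<in> carrier G" using that by (auto simp: N_def)
      then have "p (s' z) = y0 \<otimes>\<^bsub>G\<^esub> (inv\<^bsub>G\<^esub> y0 \<otimes>\<^bsub>G\<^esub> z)"
        unfolding s'_def using h0 T(4,5) by (subst hom_mult) auto
      then show ?thesis using z y0 by (simp add: H.mult_inv_cancel)
    qed
    have cs': "continuous_on ?T s'"
    proof -
      have "continuous_on ?T (\<lambda>z. s (inv\<^bsub>G\<^esub> y0 \<otimes>\<^bsub>G\<^esub> z))"
        by (rule continuous_on_compose2[OF T(3)], rule continuous_on_subset[OF contl[OF y0]]) (auto simp: N_def)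
      then show ?thesis unfolding s'_def
        by (rule continuous_on_binop[OF contH(1) continuous_on_const]) (use h0 T(4) in \<open>auto simp: N_def\<close>)
    qed
    let ?E = "carrier H \<inter> p -` ?T"
    have opE: "openin (top_of_set (carrier H)) ?E"
      using continuous_openin_preimage[OF contp _ opN[OF y0]] by auto
    \<comment> \<open>The kernel component of \<open>h\<close> relative to the section:
      \<open>h\<close> is \<open>s' (p h)\<close> times \<open>d h\<close>. The level sets of
      \<open>d\<close> are the sheets.\<close>
    define d where "d h = inv\<^bsub>H\<^esub> (s' (p h)) \<otimes>\<^bsub>H\<^esub> h" for h
    have dK: "d h \<in> ?K" if "h \<in> ?E" for h
      using that s'H ps' by (auto simp: kernel_def d_def)
    have cd: "continuous_on ?E d"
    proof -
      have "continuous_on ?E (\<lambda>h. s' (p h))"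
        by (rule continuous_on_compose2[OF cs', rotated 2]) (auto intro: continuous_on_subset[OF contp])
      then have "continuous_on ?E (\<lambda>h. inv\<^bsub>H\<^esub> (s' (p h)))"
        by (rule continuous_on_compose2[OF contH(2)]) (auto simp: s'H)
      then show ?thesis unfolding d_def
        by (rule continuous_on_binop[OF contH(1) _ continuous_on_id]) (use s'H in auto)
    qed
    define V where "V k = {h \<in> ?E. d h = k}" for k
    have opV: "openin (top_of_set (carrier H)) (V k)" if "k \<in> ?K" for k
    proof -
      obtain W where W: "open W" "W \<inter> ?K = {k}" using disc[OF \<open>k \<in> ?K\<close>] by (elim exE conjE)
      have "V k = ?E \<inter> d -` W"
      proof -
        have "d h = k \<longleftrightarrow> d h \<in> W" if "h \<in> ?E" for h using dK[OF that] W(2) by blast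
        then show ?thesis unfolding V_def by blast
      qed
      then have "openin (top_of_set ?E) (V k)"
        using continuous_openin_preimage_gen[OF cd W(1)] by simp
      then show ?thesis using openin_trans opE by metis
    qed
    have homV: "homeomorphism (V k) ?T p (\<lambda>z. s' z \<otimes>\<^bsub>H\<^esub> k)" if k: "k \<in> ?K" for k
    proof
      have kH: "k \<in> carrier H" "p k = \<one>\<^bsub>G\<^esub>" using k by (auto simp: kernel_def)
      show "continuous_on (V k) p" by (rule continuous_on_subset[OF contp]) (auto simp: V_def)
      show "continuous_on ?T (\<lambda>z. s' z \<otimes>\<^bsub>H\<^esub> k)"
        by (rule continuous_on_binop[OF contH(1) cs' continuous_on_const]) (use s'H kH in auto)
      show "p ` V k \<subseteq> ?T" by (auto simp: V_def)
      have pk: "p (s' z \<otimes>\<^bsub>H\<^esub> k) = z" if "z \<in> ?T" for z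
        using that s'H ps' kH by (simp add: N_def)
      show "(\<lambda>z. s' z \<otimes>\<^bsub>H\<^esub> k) ` ?T \<subseteq> V k"
      proof safe
        fix z assume z: "z \<in> ?T"
        have "d (s' z \<otimes>\<^bsub>H\<^esub> k) = k"
          unfolding d_def pk[OF z] using s'H[OF z] kH by (simp add: G.mult_inv_cancel)
        moreover have "s' z \<otimes>\<^bsub>H\<^esub> k \<in> carrier H" using s'H[OF z] kH by simp
        moreover have "p (s' z \<otimes>\<^bsub>H\<^esub> k) \<in> ?T" unfolding pk[OF z] by (rule z)
        ultimately show "s' z \<otimes>\<^bsub>H\<^esub> k \<in> V k" unfolding V_def by blast
      qed
      show "s' (p h) \<otimes>\<^bsub>H\<^esub> k = h" if "h \<in> V k" for h
        using that s'H[of "p h"] by (auto simp: V_def d_def G.mult_inv_cancel)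
      show "p (s' z \<otimes>\<^bsub>H\<^esub> k) = z" if "z \<in> ?T" for z using pk that .
    qed
    have dV: "\<Union>(V ` ?K) = ?E"
    proof
      show "\<Union>(V ` ?K) \<subseteq> ?E" by (auto simp: V_def)
      show "?E \<subseteq> \<Union>(V ` ?K)"
      proof
        fix h assume h: "h \<in> ?E"
        then have "h \<in> V (d h)" by (simp add: V_def)
        then show "h \<in> \<Union>(V ` ?K)" using dK[OF h] by (rule UN_I[rotated])
      qed
    qed
    show "\<exists>T. y0 \<in> T \<and> openin (top_of_set (carrier G)) T \<and>
        (\<exists>v. \<Union>v = carrier H \<inter> p -` T \<and> (\<forall>u\<in>v. openin (top_of_set (carrier H)) u) \<and>
          pairwise disjnt v \<and> (\<forall>u\<in>v. \<exists>q. homeomorphism u T p q))"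
    proof (intro exI[of _ ?T] conjI yN y0 opN exI[of _ "V ` ?K"])
      show "\<Union>(V ` ?K) = ?E" by (rule dV)
      show "\<forall>u\<in>V ` ?K. openin (top_of_set (carrier H)) u" using opV by auto
      show "pairwise disjnt (V ` ?K)" by (auto simp: pairwise_def disjnt_def V_def)
      show "\<forall>u\<in>V ` ?K. \<exists>q. homeomorphism u ?T p q" using homV by blast
    qed
  qed
qed

subsection \<open>Angles\<close>

text \<open>\<open>t\<close> is a polar angle of the nonzero vector \<open>(c, s)\<close>. The free
  radius avoids normalising rows by square roots.\<close>

definition polar :: "real \<Rightarrow> real \<Rightarrow> real \<Rightarrow> bool" where
  "polar c s t \<longleftrightarrow> (\<exists>r>0. c = r * cos t \<and> s = r * sin t)"

lemma polar_unique:
  assumes "polar c s t" "polar c s t'" shows "\<exists>n::int. t' = t + 2 * pi * n"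
proof -
  obtain r r' where r: "r > 0" "r' > 0" "r * cos t = r' * cos t'" "r * sin t = r' * sin t'"
    using assms by (auto simp: polar_def)
  have "r\<^sup>2 = (r * cos t)\<^sup>2 + (r * sin t)\<^sup>2"
    by (simp add: power_mult_distrib distrib_left[symmetric])
  also have "\<dots> = (r' * cos t')\<^sup>2 + (r' * sin t')\<^sup>2" using r by simp
  also have "\<dots> = r'\<^sup>2" by (simp add: power_mult_distrib distrib_left[symmetric])
  finally have "r = r'" using r by (simp add: power2_eq_iff_nonneg)
  then have "sin t' = sin t \<and> cos t' = cos t" using r by auto
  then show ?thesis using sin_cos_eq_iff[of t' t] by auto
qed

lemma polar_shift: "polar c s t \<Longrightarrow> polar c s (t + 2 * pi * of_int n)"
  unfolding polar_def using sin_cos_eq_iff[of "t + 2 * pi * of_int n" t] by auto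

lemma polar_rotate: "polar c s t \<Longrightarrow> polar (c * cos u + s * sin u) (s * cos u - c * sin u) (t - u)"
  unfolding polar_def by (auto simp: cos_diff sin_diff algebra_simps)

lemma polar_arctan:
  assumes "polar c s t" "\<bar>t\<bar> < pi / 2" shows "arctan (s / c) = t" "c > 0"
proof -
  obtain r where r: "r > 0" "c = r * cos t" "s = r * sin t" using assms by (auto simp: polar_def)
  have "s / c = tan t" using r by (simp add: tan_def)
  then show "arctan (s / c) = t" using assms(2) arctan_tan[of t] by (auto simp: abs_less_iff)
  show "c > 0" using r assms(2) by (auto simp: abs_less_iff intro!: mult_pos_pos cos_gt_zero_pi)
qed

lemma polar_arctan_ex: assumes "c > 0" shows "polar c s (arctan (s / c))" "\<bar>arctan (s / c)\<bar> < pi / 2"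
proof -
  let ?t = "arctan (s / c)"
  have ct: "cos ?t > 0" by (simp add: cos_arctan add_pos_nonneg)
  have "tan ?t = s / c" by (rule tan_arctan)
  then have "sin ?t = s / c * cos ?t" using ct by (simp add: tan_def field_simps)
  then show "polar c s ?t" unfolding polar_def using assms ct
    by (intro exI[of _ "c / cos ?t"]) (auto simp: field_simps)
  show "\<bar>?t\<bar> < pi / 2" using arctan_bounded[of "s / c"] by linarith
qed

text \<open>Smoothness of an angle is local, and locally an angle is a constant plus
  \<open>arctan\<close> of a quotient. So smoothness of a lift need never be traced through the way
  in which the lift was obtained.\<close>

lemma smooth_on_polar_lift:
  assumes "continuous_on S h" "smooth_on S c" "smooth_on S s" "\<And>x. x \<in> S \<Longrightarrow> polar (c x) (s x) (h x)"
  shows "smooth_on S h"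
proof (rule smooth_on_local)
  fix x0 assume x0: "x0 \<in> S"
  let ?t = "h x0"
  obtain U where U: "open U" "x0 \<in> U" "\<And>y. y \<in> S \<inter> U \<Longrightarrow> \<bar>h y - ?t\<bar> < pi / 2"
  proof -
    have "openin (top_of_set S) (S \<inter> h -` ball ?t (pi / 2))"
      by (rule continuous_openin_preimage_gen[OF assms(1)]) auto
    then obtain U where "open U" "S \<inter> h -` ball ?t (pi / 2) = S \<inter> U"
      by (auto simp: openin_open)
    moreover have "x0 \<in> S \<inter> h -` ball ?t (pi / 2)" using x0 by simp
    moreover have "\<bar>h y - ?t\<bar> < pi / 2" if "y \<in> S \<inter> h -` ball ?t (pi / 2)" for y
      using that by (simp add: dist_real_def abs_minus_commute)
    ultimately show ?thesis using that by blast
  qed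
  \<comment> \<open>The vector rotated back by the angle at \<open>x0\<close>. Near
    \<open>x0\<close> its angle stays within pi/2 of 0, so its first coordinate is positive and
    \<open>arctan\<close> applies.\<close>
  let ?c = "\<lambda>y. c y * cos ?t + s y * sin ?t" let ?s = "\<lambda>y. s y * cos ?t - c y * sin ?t"
  have P: "arctan (?s y / ?c y) = h y - ?t" "?c y > 0" if "y \<in> S \<inter> U" for y
    using polar_arctan[OF polar_rotate[OF assms(4)] U(3)[OF that]] that by auto
  have "smooth_on (S \<inter> U) (\<lambda>y. ?t + arctan (?s y / ?c y))"
    using P(2) by (intro smooth_on_add smooth_on_const smooth_on_arctan smooth_on_divide smooth_on_diff smooth_on_mult
        smooth_on_subset[OF assms(2)] smooth_on_subset[OF assms(3)]) (auto simp: less_le)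
  then show "\<exists>U g. open U \<and> x0 \<in> U \<and> smooth_on (S \<inter> U) g \<and> (\<forall>y\<in>S \<inter> U. g y = h y)"
    using U P(1) by (intro exI[of _ U] exI[of _ "\<lambda>y. ?t + arctan (?s y / ?c y)"]) auto
qed

text \<open>The difference is continuous with values in the integer multiples of 2 pi, hence
  constant on a connected set. This also drives the proof of the cocycle identity.\<close>

lemma angle_unique:
  fixes h h' :: "'a::topological_space \<Rightarrow> real"
  assumes "connected S" "continuous_on S h" "continuous_on S h'"
    "\<And>x. x \<in> S \<Longrightarrow> \<exists>n::int. h' x = h x + 2 * pi * n" "a \<in> S" "h a = h' a" "x \<in> S"
  shows "h x = h' x"
proof -
  let ?d = "\<lambda>x. h' x - h x"
  have "?d constant_on S"
  proof (rule continuous_discrete_range_constant[OF assms(1)])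
    show "continuous_on S ?d" by (intro continuous_intros assms)
    fix x assume x: "x \<in> S"
    show "\<exists>e>0. \<forall>y. y \<in> S \<and> ?d y \<noteq> ?d x \<longrightarrow> e \<le> norm (?d y - ?d x)"
    proof (intro exI[of _ "2 * pi"] conjI allI impI)
      fix y assume y: "y \<in> S \<and> ?d y \<noteq> ?d x"
      obtain m n :: int where mn: "?d y = 2 * pi * m" "?d x = 2 * pi * n"
        using assms(4)[of x] assms(4)[of y] x y by fastforce
      then have "m \<noteq> n" using y by auto
      then have "\<bar>m - n\<bar> \<ge> 1" by auto
      then have "\<bar>real_of_int m - real_of_int n\<bar> \<ge> 1" by linarith
      moreover have "norm (?d y - ?d x) = 2 * pi * \<bar>real_of_int m - real_of_int n\<bar>"
        unfolding mn by (simp add: right_diff_distrib[symmetric] abs_mult)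
      ultimately show "2 * pi \<le> norm (?d y - ?d x)" by simp
    qed simp
  qed
  then have "?d x = ?d a" using assms(5,7) unfolding constant_on_def by metis
  then show ?thesis using assms(6) by simp
qed

lemma polar_Complex: "polar c s t \<longleftrightarrow> (\<exists>r>0. Complex c s = of_real r * exp (\<i> * of_real t))"
  by (auto simp: polar_def complex_eq_iff Re_exp Im_exp)

text \<open>A null-homotopic map into the punctured plane has a continuous logarithm, whose
  imaginary part is an angle. A multiple of 2 pi adjusts its value at \<open>x0\<close>.\<close>

lemma polar_lift_exists:
  fixes c s :: "'a::real_normed_vector \<Rightarrow> real"
  assumes "homotopic_with_canon (\<lambda>h. True) S (-{0}) (\<lambda>x. Complex (c x) (s x)) (\<lambda>t. a)"
    "x0 \<in> S" "polar (c x0) (s x0) t0"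
  obtains h where "continuous_on S h" "h x0 = t0" "\<And>x. x \<in> S \<Longrightarrow> polar (c x) (s x) (h x)"
proof -
  obtain g where g: "continuous_on S g" "\<And>x. x \<in> S \<Longrightarrow> Complex (c x) (s x) = exp (g x)"
    using assms(1) inessential_eq_continuous_logarithm[of S "\<lambda>x. Complex (c x) (s x)"] by blast
  have P: "polar (c x) (s x) (Im (g x))" if "x \<in> S" for x
    unfolding polar_Complex g(2)[OF that]
    by (intro exI[of _ "exp (Re (g x))"]) (auto simp: complex_eq_iff Re_exp Im_exp exp_of_real[symmetric])
  obtain n :: int where n: "t0 = Im (g x0) + 2 * pi * n"
    using polar_unique[OF P[OF assms(2)] assms(3)] by blast
  show ?thesis
  proof (rule that[of "\<lambda>x. Im (g x) + 2 * pi * n"])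
    show "continuous_on S (\<lambda>x. Im (g x) + 2 * pi * n)" by (intro continuous_intros g)
  qed (use n P polar_shift in auto)
qed

section \<open>Rotations of the plane\<close>

lemma rho_eq_iff: "rho t = rho t' \<longleftrightarrow> (\<exists>n::int. t' = t + 2 * pi * n)"
proof -
  have "rho t = rho t' \<longleftrightarrow> sin t' = sin t \<and> cos t' = cos t"
  proof
    assume "rho t = rho t'"
    then have "rho t $ 1 $ 0 = rho t' $ 1 $ 0" "rho t $ 1 $ 1 = rho t' $ 1 $ 1" by simp_all
    then show "sin t' = sin t \<and> cos t' = cos t" by (simp add: rho_def)
  qed (simp add: rho_def vec_eq_iff)
  then show ?thesis using sin_cos_eq_iff[of t' t] by auto
qed

lemma matrix2_eq: "(A :: real^2^2) = B \<longleftrightarrow> A$0$0 = B$0$0 \<and> A$0$1 = B$0$1 \<and> A$1$0 = B$1$0 \<and> A$1$1 = B$1$1"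
proof -
  have "(\<forall>i::2. P i) \<longleftrightarrow> P 0 \<and> P 1" for P
    using UNIV_2' by (metis UNIV_I empty_iff insert_iff)
  then show ?thesis unfolding vec_eq_iff by auto
qed

lemma rho_nth [simp]: "rho t $ 0 $ 0 = cos t" "rho t $ 0 $ 1 = - sin t" "rho t $ 1 $ 0 = sin t" "rho t $ 1 $ 1 = cos t"
  by (auto simp: rho_def)

lemma rho_add: "rho (s + t) = rho s ** rho t"
  by (simp add: matrix2_eq matrix_matrix_mult_def sum_2' sin_add cos_add)

lemma rho_0 [simp]: "rho 0 = mat 1" by (simp add: matrix2_eq mat_def)

text \<open>In the index type \<open>2\<close> the numeral 2 equals 0, so \<open>det_2\<close>,
  stated with indices 1 and 2, is the same formula with the rows and columns renamed.\<close>

lemma det_2': "det (A :: real^2^2) = A$0$0 * A$1$1 - A$0$1 * A$1$0"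
proof -
  have "(2::2) = 0" by simp
  then show ?thesis using det_2[of A] by (metis mult.commute)
qed

lemma rho_SO: "rho t \<in> SO"
proof -
  have "orthogonal_matrix (rho t)"
    by (simp add: orthogonal_matrix matrix2_eq matrix_matrix_mult_def sum_2' transpose_def mat_def flip: power2_eq_square)
  moreover have "det (rho t) = 1" by (simp add: det_2' flip: power2_eq_square)
  ultimately show ?thesis by (simp add: SO_def rotation_matrix_def)
qed

lemma SO_rho:
  assumes "r \<in> SO" obtains t where "r = rho t"
proof -
  have o: "transpose r ** r = mat 1" "r ** transpose r = mat 1" and d: "det r = 1"
    using assms by (auto simp: SO_def rotation_matrix_def orthogonal_matrix_def)
  have e: "(r$1$0)\<^sup>2 + (r$1$1)\<^sup>2 = 1" "(r$0$0) * (r$1$0) + (r$0$1) * (r$1$1) = 0" "(r$0$0) * (r$1$1) - (r$0$1) * (r$1$0) = 1"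
    using o(2) d by (auto simp: matrix2_eq matrix_matrix_mult_def sum_2' transpose_def mat_def det_2' power2_eq_square)
  obtain t where t: "r$1$1 = cos t" "r$1$0 = sin t"
    using sincos_total_2pi[of "r$1$1" "r$1$0"] e by (metis add.commute)
  have "r$0$0 = r$1$1 \<and> r$0$1 = - r$1$0" using e by algebra
  then have "r = rho t" using t by (simp add: matrix2_eq)
  then show ?thesis using that by blast
qed

subsection \<open>Gram-Schmidt with smooth parameters\<close>

lemma linorder_card_less:
  fixes i j :: "'k::{finite,linorder}"
  shows "card {k. k < i} < card {k. k < j} \<longleftrightarrow> i < j"
proof -
  have *: "card {k. k < i} < card {k. k < j}" if "i < j" for i j :: 'k
    using that by (intro psubset_card_mono) auto
  show ?thesis using *[of i j] *[of j i] by (metis less_irrefl less_asym linorder_less_linear)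
qed

text \<open>Orthonormalisation of the standard basis for the varying inner product given by
  \<open>M x\<close>. Only sums, products and roots of positive functions occur, so smoothness in
  \<open>x\<close> is preserved. The injective rank \<open>r\<close> replaces the order on indices,
  so that the induction can run over a number \<open>n\<close>.\<close>

lemma gram_schmidt_step:
  fixes M :: "'a::euclidean_space \<Rightarrow> real^'k^'k" and r :: "'k::finite \<Rightarrow> nat"
  assumes "inj r" and M: "smooth_on S M" "\<And>x. x \<in> S \<Longrightarrow> transpose (M x) = M x"
    "\<And>x v. x \<in> S \<Longrightarrow> v \<noteq> 0 \<Longrightarrow> v \<bullet> (M x *v v) > 0"
  shows "\<exists>q. \<forall>i. r i < n \<longrightarrow> smooth_on S (q i) \<and> (\<forall>x\<in>S. (\<forall>j. r i < r j \<longrightarrow> q i x $ j = 0) \<and> q i x $ i > 0 \<and>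
     (\<forall>j. r j < n \<longrightarrow> q i x \<bullet> (M x *v q j x) = (if i = j then 1 else 0)))"
proof (induction n)
  case (Suc n)
  then obtain q where q: "\<And>i. r i < n \<Longrightarrow> smooth_on S (q i)"
    "\<And>i x j. r i < n \<Longrightarrow> x \<in> S \<Longrightarrow> r i < r j \<Longrightarrow> q i x $ j = 0"
    "\<And>i x. r i < n \<Longrightarrow> x \<in> S \<Longrightarrow> q i x $ i > 0"
    "\<And>i j x. r i < n \<Longrightarrow> r j < n \<Longrightarrow> x \<in> S \<Longrightarrow> q i x \<bullet> (M x *v q j x) = (if i = j then 1 else 0)"
    by blast
  show ?case
  proof (cases "\<exists>i. r i = n")
    case False
    then have "r i < Suc n \<longleftrightarrow> r i < n" for i by (metis less_SucE less_SucI)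
    then show ?thesis using q by (intro exI[of _ q]) auto
  next
    case True
    then obtain k where k: "r k = n" by blast
    have ki: "r i = n \<longleftrightarrow> i = k" for i using k assms(1) by (auto dest: injD)
    define b where "b x v w = v \<bullet> (M x *v w)" for x v w
    have sym: "b x v w = b x w v" if "x \<in> S" for x v w
      using M(2)[OF that] unfolding b_def by (metis dot_lmul_matrix inner_commute transpose_matrix_vector)
    \<comment> \<open>The part of the next basis vector that is orthogonal to all earlier
      \<open>q j\<close>.\<close>
    define w where "w x = axis k 1 - (\<Sum>j\<in>{j. r j < n}. b x (axis k 1) (q j x) *\<^sub>R q j x)" for x
    have bdiff: "b x (u - v) z = b x u z - b x v z" for x u v z by (simp add: b_def inner_diff_left)
    have bsum: "b x (\<Sum>j\<in>J. c j *\<^sub>R f j) z = (\<Sum>j\<in>J. c j * b x (f j) z)" for x J c z and f :: "'k \<Rightarrow> real^'k"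
      by (simp add: b_def inner_sum_left)
    \<comment> \<open>Earlier vectors have no coordinate of rank \<open>n\<close>, so subtracting
      them leaves this coordinate at 1. Hence \<open>w x\<close> is nonzero, can be normalised, and
      yields a positive diagonal entry.\<close>
    have wk: "w x $ k = 1" if "x \<in> S" for x
      unfolding w_def using q(2)[OF _ that, of _ k] k by (simp add: axis_def)
    have wj: "w x $ j = 0" if "x \<in> S" "n < r j" for x j
    proof -
      have "j \<noteq> k" using that k by auto
      then show ?thesis unfolding w_def using q(2)[OF _ that(1), of _ j] that(2) by (simp add: axis_def)
    qed
    have wq: "b x (w x) (q i x) = 0" if "x \<in> S" "r i < n" for x i
    proof -
      have "(\<Sum>j\<in>{j. r j < n}. b x (axis k 1) (q j x) * b x (q j x) (q i x)) =
          (\<Sum>j\<in>{j. r j < n}. if j = i then b x (axis k 1) (q i x) else 0)"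
        by (rule sum.cong) (use q(4) that in \<open>auto simp: b_def\<close>)
      then show ?thesis unfolding w_def bdiff bsum using that by simp
    qed
    have wpos: "b x (w x) (w x) > 0" if "x \<in> S" for x
      unfolding b_def using wk[OF that] by (intro M(3) that) (metis zero_index zero_neq_one)
    have smb: "smooth_on S (\<lambda>x. b x (f x) (g x))" if "smooth_on S f" "smooth_on S g" for f g
      unfolding b_def by (intro smooth_on_bilinear[OF bounded_bilinear_inner] smooth_on_matrix_vector that M)
    have smw: "smooth_on S w" unfolding w_def
      by (intro smooth_on_diff smooth_on_const smooth_on_sum smooth_on_scaleR smb q) auto
    define q' where "q' = q(k := \<lambda>x. (1 / sqrt (b x (w x) (w x))) *\<^sub>R w x)"
    have q'q: "q' i = q i" if "r i < n" for i using that k by (auto simp: q'_def)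
    have q'k: "q' k x = (1 / sqrt (b x (w x) (w x))) *\<^sub>R w x" for x by (simp add: q'_def)
    have smq'k: "smooth_on S (q' k)"
    proof -
      have "smooth_on S (\<lambda>x. (1 / sqrt (b x (w x) (w x))) *\<^sub>R w x)"
        by (intro smooth_on_scaleR smw smooth_on_divide smooth_on_const smooth_on_sqrt smb wpos) (auto dest: wpos)
      then show ?thesis by (simp add: q'_def)
    qed
    have bl: "b x (c *\<^sub>R u) v = c * b x u v" "b x u (c *\<^sub>R v) = c * b x u v" for x c u v
      by (simp_all add: b_def matrix_vector_mult_scaleR)
    have kk: "b x (q' k x) (q' k x) = 1" if "x \<in> S" for x
      unfolding q'k bl using sqrt_inverse_sq(1)[OF wpos[OF that]] by (simp add: mult.assoc)
    have ki0: "b x (q' k x) (q' i x) = 0" "b x (q' i x) (q' k x) = 0" if "x \<in> S" "r i < n" for x i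
    proof -
      show "b x (q' k x) (q' i x) = 0" unfolding q'k bl q'q[OF that(2)] wq[OF that] by simp
      then show "b x (q' i x) (q' k x) = 0" using sym[OF that(1)] by simp
    qed
    have B: "b x (q' i x) (q' j x) = (if i = j then 1 else 0)" if "r i < Suc n" "r j < Suc n" "x \<in> S" for i j x
    proof -
      have "r i < n \<or> i = k" "r j < n \<or> j = k" using that(1,2) ki by (auto simp: less_Suc_eq)
      then consider "r i < n" "r j < n" | "i = k" "r j < n" | "r i < n" "j = k" | "i = k" "j = k" by blast
      then show ?thesis
      proof cases
        case 1 then show ?thesis using q(4)[OF 1 that(3)] by (simp add: q'q b_def)
      qed (use ki0 kk that k in auto)
    qed
    show ?thesis
    proof (intro exI[of _ q'] allI impI conjI ballI)
      fix i assume i: "r i < Suc n"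
      show "smooth_on S (q' i)" using i q'q q(1) smq'k ki by (metis less_SucE)
      fix x assume x: "x \<in> S"
      show "q' i x $ i > 0"
      proof (cases "i = k")
        case True then show ?thesis using wk[OF x] wpos[OF x] by (simp add: q'k)
      next
        case False
        then have "r i < n" using i ki by (metis less_SucE)
        then show ?thesis using q(3) x q'q by simp
      qed
      show "q' i x $ j = 0" if "r i < r j" for j
      proof (cases "i = k")
        case True then show ?thesis using wj[OF x, of j] that k by (simp add: q'k)
      next
        case False
        then have "r i < n" using i ki by (metis less_SucE)
        then show ?thesis using q(2) x q'q that by simp
      qed
      show "q' i x \<bullet> (M x *v q' j x) = (if i = j then 1 else 0)" if "r j < Suc n" for j
        using B[OF i that x] by (simp add: b_def)
    qed
  qed
qed simp

text \<open>The columns of \<open>T x\<close> are the orthonormalised vectors, so \<open>T x\<close>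
  is the inverse of an upper triangular Cholesky factor of \<open>M x\<close>.\<close>

lemma inverse_cholesky_exists:
  fixes M :: "'a::euclidean_space \<Rightarrow> ((real, 'k::{finite,linorder}) vec, 'k) vec"
  assumes M: "smooth_on S M" "\<And>x. x \<in> S \<Longrightarrow> transpose (M x) = M x"
    "\<And>x v. x \<in> S \<Longrightarrow> v \<noteq> 0 \<Longrightarrow> v \<bullet> (M x *v v) > 0"
  obtains T where "smooth_on S T" "\<And>x i j. x \<in> S \<Longrightarrow> j < i \<Longrightarrow> T x $ i $ j = 0"
    "\<And>x i. x \<in> S \<Longrightarrow> T x $ i $ i > 0" "\<And>x. x \<in> S \<Longrightarrow> transpose (T x) ** M x ** T x = mat 1"
proof -
  let ?r = "\<lambda>j :: 'k. card {k. k < j}"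
  have inj: "inj ?r" by (rule injI) (metis linorder_card_less less_irrefl linorder_less_linear)
  define n where "n = Suc (Max (range ?r))"
  have n: "?r i < n" for i unfolding n_def by (simp add: less_Suc_eq_le)
  obtain q where q: "\<And>i. smooth_on S (q i)"
    "\<And>i x j. x \<in> S \<Longrightarrow> i < j \<Longrightarrow> q i x $ j = 0"
    "\<And>i x. x \<in> S \<Longrightarrow> q i x $ i > 0"
    "\<And>i j x. x \<in> S \<Longrightarrow> q i x \<bullet> (M x *v q j x) = (if i = j then 1 else 0)"
    using gram_schmidt_step[OF inj M, of n] n unfolding linorder_card_less by metis
  define T where "T x = (\<chi> i j. q j x $ i)" for x
  have T: "T x *v v = (\<Sum>j\<in>UNIV. v $ j *\<^sub>R q j x)" for x v
    by (simp add: T_def matrix_vector_mult_def vec_eq_iff mult.commute)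
  have "transpose (T x) ** M x ** T x = mat 1" if x: "x \<in> S" for x
  proof -
    have "(transpose (T x) ** M x ** T x) $ i $ j = q i x \<bullet> (M x *v q j x)" for i j
    proof -
      have "(transpose (T x) ** (M x ** T x)) $ i $ j = q i x \<bullet> (M x *v q j x)"
        by (simp add: matrix_matrix_mult_def transpose_def T_def inner_vec_def matrix_vector_mult_def)
      then show ?thesis by (simp add: matrix_mul_assoc)
    qed
    then show ?thesis using q(4)[OF x] by (simp add: vec_eq_iff mat_def)
  qed
  moreover have "smooth_on S T" unfolding T_def
    by (intro smooth_on_vec_lambda smooth_on_nth q)
  ultimately show ?thesis using q that[of T] by (simp add: T_def)
qed

subsection \<open>Block matrices\<close>

definition block_b :: "'m::finite mat_full \<Rightarrow> real ^ 'm ^ 2" where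
  "block_b X = (\<chi> i j. X $ Inl i $ Inr j)"
definition block_d :: "'m::finite mat_full \<Rightarrow> 'm mat_d" where
  "block_d X = (\<chi> i j. X $ Inr i $ Inr j)"

lemma full_eq_iff: "X = (Y :: 'm::finite mat_full) \<longleftrightarrow>
  (\<forall>i j. X $ Inl i $ Inl j = Y $ Inl i $ Inl j) \<and> (\<forall>i j. X $ Inl i $ Inr j = Y $ Inl i $ Inr j) \<and>
  (\<forall>i j. X $ Inr i $ Inl j = Y $ Inr i $ Inl j) \<and> (\<forall>i j. X $ Inr i $ Inr j = Y $ Inr i $ Inr j)"
proof -
  have *: "(\<forall>i. P i) \<longleftrightarrow> (\<forall>i. P (Inl i)) \<and> (\<forall>j. P (Inr j))" for P :: "2 + 'm \<Rightarrow> bool"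
    by (metis sum.exhaust)
  show ?thesis unfolding vec_eq_iff * by blast
qed

lemma from_blocks_nth [simp]:
  "from_blocks a b c d $ Inl i $ Inl j = a $ i $ j" "from_blocks a b c d $ Inl i $ Inr j' = b $ i $ j'"
  "from_blocks a b c d $ Inr i' $ Inl j = c $ i' $ j" "from_blocks a b c d $ Inr i' $ Inr j' = d $ i' $ j'"
  by (simp_all add: from_blocks_def)

lemma blocks_from_blocks [simp]:
  "block_a (from_blocks a b c d) = a" "block_b (from_blocks a b c d) = b"
  "block_c (from_blocks a b c d) = c" "block_d (from_blocks a b c d) = d"
  by (simp_all add: block_a_def block_b_def block_c_def block_d_def vec_eq_iff)

lemma from_blocks_blocks: "from_blocks (block_a X) (block_b X) (block_c X) (block_d X) = X"
  by (simp add: full_eq_iff block_a_def block_b_def block_c_def block_d_def)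

lemma from_blocks_inject [simp]:
  "from_blocks a b c d = from_blocks a' b' c' d' \<longleftrightarrow> a = a' \<and> b = b' \<and> c = c' \<and> d = d'"
  by (metis blocks_from_blocks)

lemma from_blocks_mult:
  "from_blocks a b c d ** from_blocks a' b' c' d' =
    from_blocks (a ** a' + b ** c') (a ** b' + b ** d') (c ** a' + d ** c') (c ** b' + d ** d')"
  by (simp add: full_eq_iff matrix_matrix_mult_def sum_UNIV_Plus)

lemma from_blocks_one: "mat 1 = from_blocks (mat 1) 0 0 (mat 1)"
  by (simp add: full_eq_iff mat_def)

lemma padj_from_blocks: "padj (from_blocks a b c d) = from_blocks (transpose a) (- transpose c) (- transpose b) (transpose d)"
  by (simp add: full_eq_iff padj_def transpose_def)

lemma smooth_on_from_blocks:
  assumes "smooth_on S a" "smooth_on S b" "smooth_on S c" "smooth_on S d"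
  shows "smooth_on S (\<lambda>x. from_blocks (a x) (b x) (c x) (d x))"
proof -
  have "smooth_on S (\<lambda>x. from_blocks (a x) (b x) (c x) (d x) $ i $ j)" for i j
    by (cases i; cases j) (auto intro!: smooth_on_nth assms)
  then show ?thesis
    by (subst smooth_on_component_iff, intro allI, subst smooth_on_component_iff, intro allI)
qed

lemma matrix_zero_mult [simp]: "(0 :: real^'n^'m) ** A = 0" "B ** (0 :: real^'n^'m) = 0"
  by (simp_all add: matrix_matrix_mult_def vec_eq_iff)

lemma matrix_minus_mult: "(- A) ** B = - (A ** (B :: real^'p^'n))" "C ** (- B) = - (C ** (B :: real^'p^'n))"
  by (simp_all add: matrix_matrix_mult_def vec_eq_iff sum_negf)

lemma transpose_zero [simp]: "transpose (0 :: real^'n^'m) = 0"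
  by (simp add: transpose_def vec_eq_iff)

lemma pseudo_orthogonal_blocks:
  "from_blocks a b c d \<in> pseudo_orthogonal \<longleftrightarrow>
    transpose a ** a - transpose c ** c = mat 1 \<and> transpose a ** b = transpose c ** d \<and>
    transpose d ** c = transpose b ** a \<and> transpose d ** d - transpose b ** b = mat 1"
  unfolding pseudo_orthogonal_iff padj_from_blocks from_blocks_mult from_blocks_one[where 'a='a]
  by (auto simp: matrix_minus_mult algebra_simps)

subsection \<open>The bounded domain\<close>

lemma inner_transpose: "x \<bullet> (transpose A *v y) = (A *v x) \<bullet> (y :: real^'m)"
  by (metis dot_lmul_matrix inner_commute transpose_transpose vector_transpose_matrix)

lemma inner_vector_matrix: "x \<bullet> (y v* A) = (A *v x) \<bullet> (y :: real^'m)"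
  by (metis dot_lmul_matrix inner_commute)

lemma Omega_iff: "\<beta> \<in> Omega \<longleftrightarrow> (\<forall>x. x \<noteq> 0 \<longrightarrow> norm (\<beta> *v x) < norm x)"
proof -
  have "x \<bullet> ((mat 1 - transpose \<beta> ** \<beta>) *v x) = (norm x)\<^sup>2 - (norm (\<beta> *v x))\<^sup>2" for x
    by (simp add: matrix_vector_mult_diff_rdistrib inner_diff_right power2_norm_eq_inner
        matrix_vector_mul_assoc[symmetric] inner_transpose inner_vector_matrix)
  moreover have "(norm (\<beta> *v x))\<^sup>2 < (norm x)\<^sup>2 \<longleftrightarrow> norm (\<beta> *v x) < norm x" for x
    using power2_less_imp_less[of "norm (\<beta> *v x)" "norm x"] power_strict_mono[of "norm (\<beta> *v x)" "norm x" 2] by auto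
  ultimately show ?thesis by (simp add: Omega_def)
qed

text \<open>The adjoint of a strict contraction is a strict contraction. It supplies positivity of
  \<open>mat 1 - \<beta> ** transpose \<beta>\<close>, needed for the lower right block of
  \<open>P_mat\<close>.\<close>

lemma Omega_transpose:
  assumes "\<beta> \<in> Omega" "y \<noteq> 0" shows "norm (transpose \<beta> *v y) < norm y"
proof (cases "transpose \<beta> *v y = 0")
  case False
  let ?z = "transpose \<beta> *v y"
  have "(norm ?z)\<^sup>2 = (\<beta> *v ?z) \<bullet> y" by (simp add: power2_norm_eq_inner inner_vector_matrix)
  also have "\<dots> \<le> norm (\<beta> *v ?z) * norm y" by (rule norm_cauchy_schwarz)
  also have "\<dots> < norm ?z * norm y"
    using assms False by (auto simp: Omega_iff)
  finally show ?thesis using False by (simp add: power2_eq_square)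
qed (use assms in simp)

lemma Omega_0: "0 \<in> Omega" by (simp add: Omega_iff)

lemma convex_Omega: "convex Omega"
proof (rule convexI)
  fix \<beta> \<gamma> :: "'a mat_low" and u v :: real
  assume *: "\<beta> \<in> Omega" "\<gamma> \<in> Omega" "0 \<le> u" "0 \<le> v" "u + v = 1"
  show "u *\<^sub>R \<beta> + v *\<^sub>R \<gamma> \<in> Omega"
    unfolding Omega_iff
  proof (intro allI impI)
    fix x :: "real^2" assume x: "x \<noteq> 0"
    have "norm ((u *\<^sub>R \<beta> + v *\<^sub>R \<gamma>) *v x) \<le> u * norm (\<beta> *v x) + v * norm (\<gamma> *v x)"
      using norm_triangle_ineq[of "u *\<^sub>R (\<beta> *v x)" "v *\<^sub>R (\<gamma> *v x)"] *
      by (simp add: matrix_vector_mult_add_rdistrib scaleR_matrix_vector_assoc[symmetric])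
    also have "\<dots> < u * norm x + v * norm x"
    proof (cases "u > 0")
      case True
      moreover have "norm (\<beta> *v x) < norm x" "norm (\<gamma> *v x) < norm x" using * x by (auto simp: Omega_iff)
      ultimately show ?thesis using * by (intro add_less_le_mono mult_strict_left_mono mult_left_mono) auto
    next
      case False
      then have "u = 0" "v = 1" using * by auto
      then show ?thesis using * x by (auto simp: Omega_iff)
    qed
    also have "\<dots> = norm x" using * by (simp add: distrib_right[symmetric])
    finally show "norm ((u *\<^sub>R \<beta> + v *\<^sub>R \<gamma>) *v x) < norm x" .
  qed
qed

lemma Omega_scale: "\<beta> \<in> Omega \<Longrightarrow> 0 \<le> t \<Longrightarrow> t \<le> 1 \<Longrightarrow> t *\<^sub>R \<beta> \<in> Omega"
  using convexD[OF convex_Omega, of \<beta> 0 t "1 - t"] Omega_0 by simp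

subsection \<open>Uniqueness of the triangular factor\<close>

text \<open>The position of an index, as a number; it serves as a measure for induction from the
  last index downwards.\<close>

definition rk :: "2 + 'm::{finite,linorder} \<Rightarrow> nat" where "rk i = card {j. idx_less j i}"

lemma rk_less: "rk i < rk j \<longleftrightarrow> idx_less i j"
proof -
  have *: "rk i < rk j" if "idx_less i j" for i j :: "2 + 'a"
  proof -
    have "{k. idx_less k i} \<subseteq> {k. idx_less k j}" using that by (auto intro: idx_less_trans)
    moreover have "i \<in> {k. idx_less k j}" "i \<notin> {k. idx_less k i}" using that by auto
    ultimately have "{k. idx_less k i} \<subset> {k. idx_less k j}" by blast
    then show ?thesis unfolding rk_def by (intro psubset_card_mono) auto
  qed
  then show ?thesis using *[of i j] *[of j i] idx_less_total[of i j] by (metis less_irrefl less_asym)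
qed

lemma idx_cases: "idx_less i k \<or> k = i \<or> idx_less k i" using idx_less_total by metis

lemma idx_downward_induct:
  fixes P :: "2 + 'm::{finite,linorder} \<Rightarrow> bool"
  assumes "\<And>i. (\<And>k. idx_less i k \<Longrightarrow> P k) \<Longrightarrow> P i"
  shows "P i"
proof (induction i rule: measure_induct_rule[where f = "\<lambda>i :: 2 + 'm. card (UNIV :: (2 + 'm) set) - rk i"])
  case (less i)
  show ?case
  proof (rule assms, rule less)
    fix k assume "idx_less i k"
    then have "rk i < rk k" by (simp add: rk_less)
    moreover have "rk k \<le> card (UNIV :: (2 + 'm) set)" unfolding rk_def by (rule card_mono) auto
    ultimately show "CARD(2 + 'm) - rk k < CARD(2 + 'm) - rk i" by linarith
  qed
qed

text \<open>Rows are treated from the last one upwards. The later rows are already standard basis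
  vectors, so orthogonality to them kills the entries to the right of the diagonal; the diagonal
  entry is then a positive square root of 1.\<close>

lemma triangular_pseudo_orthogonal:
  assumes U: "U \<in> pseudo_orthogonal" "upper_triangular U" "\<And>i. U $ i $ i > 0"
  shows "U = mat 1"
proof -
  have eq: "(\<Sum>k\<in>UNIV. U $ i $ k * (qs k * U $ l $ k * qs l)) = (if i = l then 1 else 0)" for i l
  proof -
    have "(U ** padj U) $ i $ l = mat 1 $ i $ l" using padj_right[OF U(1)] by simp
    then show ?thesis by (simp add: matrix_matrix_mult_def padj_def mat_def)
  qed
  have "\<forall>k. U $ i $ k = (if k = i then 1 else 0)" for i
  proof (induction i rule: idx_downward_induct)
    case (1 i)
    have gt: "U $ i $ l = 0" if "idx_less i l" for l
    proof -
      have "(\<Sum>k\<in>UNIV. U $ i $ k * (qs k * U $ l $ k * qs l)) = (\<Sum>k\<in>UNIV. if k = l then U $ i $ l * (qs l * qs l) else 0)"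
        using 1[OF that] by (intro sum.cong) auto
      then have "U $ i $ l = (if i = l then 1 else 0)" using eq[of i l] by simp
      then show ?thesis using that by auto
    qed
    have lt: "U $ i $ k = 0" if "idx_less k i" for k using U(2) that by (simp add: upper_triangular_def)
    have off: "U $ i $ k = 0" if "k \<noteq> i" for k using gt lt idx_cases[of i k] that by blast
    have "(\<Sum>k\<in>UNIV. U $ i $ k * (qs k * U $ i $ k * qs i)) = (\<Sum>k\<in>UNIV. if k = i then U $ i $ i * U $ i $ i * (qs i * qs i) else 0)"
      using off by (intro sum.cong) auto
    then have "U $ i $ i * U $ i $ i = 1" using eq[of i i] by simp
    then have "U $ i $ i = 1" using U(3)[of i] by (metis mult_cancel_left1 less_le power2_eq_1_iff power2_eq_square abs_of_pos abs_1 abs_minus_cancel)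
    then show ?case using off by auto
  qed
  then show ?thesis by (auto simp: vec_eq_iff mat_def)
qed

text \<open>The pseudo-orthogonal matrix \<open>U\<close> equals the inverse of \<open>T\<close>
  times \<open>T'\<close>. It is shown to be upper triangular with positive diagonal directly from
  \<open>T ** U = T'\<close>, and so it is the identity.\<close>

lemma triangular_factor_unique:
  assumes T: "upper_triangular T" "\<And>i. T $ i $ i > 0" "B ** T \<in> pseudo_orthogonal"
    and T': "upper_triangular T'" "\<And>i. T' $ i $ i > 0" "B ** T' \<in> pseudo_orthogonal"
  shows "T = T'"
proof -
  define U where "U = padj (B ** T) ** (B ** T')"
  have U: "U \<in> pseudo_orthogonal" unfolding U_def
    by (intro pseudo_orthogonal_mult pseudo_orthogonal_padj T T')
  have "B ** T ** U = B ** T'"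
    unfolding U_def matrix_mul_assoc[of "B ** T"] padj_right[OF T(3)] by simp
  then have e: "B ** (T ** U) = B ** T'" by (simp add: matrix_mul_assoc)
  \<comment> \<open>This exhibits a right inverse of the square matrix \<open>B\<close>, so
    \<open>B\<close> can be cancelled on the left in \<open>e\<close>.\<close>
  have "B ** (T ** padj (B ** T)) = mat 1" using padj_right[OF T(3)] by (simp add: matrix_mul_assoc)
  then have "(T ** padj (B ** T)) ** B = mat 1" using matrix_left_right_inverse by blast
  then have TU: "T ** U = T'" using e by (metis matrix_mul_assoc matrix_mul_lid)
  \<comment> \<open>In entry \<open>(i, j)\<close> of \<open>T ** U\<close> the terms before
    \<open>i\<close> vanish since \<open>T\<close> is triangular and those after \<open>i\<close> by
    the induction hypothesis. Only \<open>T $ i $ i * U $ i $ j\<close> is left, and it equals an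
    entry of \<open>T'\<close> below the diagonal.\<close>
  have low: "U $ i $ j = 0" if "idx_less j i" for i j
    using that
  proof (induction i rule: idx_downward_induct)
    case (1 i)
    have "(T ** U) $ i $ j = (\<Sum>k\<in>UNIV. if k = i then T $ i $ i * U $ i $ j else 0)"
      unfolding matrix_matrix_mult_def vec_lambda_beta
    proof (rule sum.cong[OF refl])
      fix k
      show "T $ i $ k * U $ k $ j = (if k = i then T $ i $ i * U $ i $ j else 0)"
        using idx_cases[of i k] 1 T(1) idx_less_trans[of j i k] unfolding upper_triangular_def by auto
    qed
    then have "T $ i $ i * U $ i $ j = 0"
      using TU T'(1) 1(2) by (simp add: upper_triangular_def)
    then show ?case using T(2)[of i] by simp
  qed
  have "U $ i $ i > 0" for i
  proof -
    have "(T ** U) $ i $ i = (\<Sum>k\<in>UNIV. if k = i then T $ i $ i * U $ i $ i else 0)"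
      unfolding matrix_matrix_mult_def vec_lambda_beta
    proof (rule sum.cong[OF refl])
      fix k
      show "T $ i $ k * U $ k $ i = (if k = i then T $ i $ i * U $ i $ i else 0)"
        using idx_cases[of i k] low T(1) unfolding upper_triangular_def by auto
    qed
    then have "T $ i $ i * U $ i $ i > 0" using TU T'(2)[of i] by simp
    then show ?thesis using T(2)[of i] zero_less_mult_pos by blast
  qed
  then have "U = mat 1" using triangular_pseudo_orthogonal[OF U] low by (simp add: upper_triangular_def)
  then show ?thesis using TU by simp
qed

subsection \<open>The section \<open>P_mat\<close>\<close>

lemma one_minus_square_sym: "transpose (mat 1 - transpose A ** A) = mat 1 - transpose A ** (A :: real^'n^'m)"
proof -
  have "transpose (X - Y) = transpose X - transpose Y" for X Y :: "real^'n^'n"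
    by (simp add: transpose_def vec_eq_iff)
  then show ?thesis by (simp add: matrix_transpose_mul transpose_mat)
qed

text \<open>Transforming the form by \<open>B_mat \<beta>\<close> gives the block diagonal matrix
  with blocks \<open>transpose \<beta> ** \<beta> - mat 1\<close> and
  \<open>mat 1 - \<beta> ** transpose \<beta>\<close>. Two separate orthonormalisations therefore
  produce the triangular factor, and uniqueness identifies it with the description
  \<open>T_mat\<close>.\<close>

lemma P_mat_exists:
  obtains T1 :: "'m::{finite,linorder} mat_low \<Rightarrow> real^2^2" and T2 :: "'m mat_low \<Rightarrow> 'm mat_d" where
    "smooth_on Omega T1" "smooth_on Omega T2"
    "\<And>\<beta>. \<beta> \<in> Omega \<Longrightarrow> T1 \<beta> $ 1 $ 0 = 0" "\<And>\<beta>. \<beta> \<in> Omega \<Longrightarrow> T1 \<beta> $ 0 $ 0 > 0" "\<And>\<beta>. \<beta> \<in> Omega \<Longrightarrow> T1 \<beta> $ 1 $ 1 > 0"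
    "\<And>\<beta>. \<beta> \<in> Omega \<Longrightarrow> P_mat \<beta> = from_blocks (T1 \<beta>) (transpose \<beta> ** T2 \<beta>) (\<beta> ** T1 \<beta>) (T2 \<beta>)"
    "\<And>\<beta> :: 'm mat_low. \<beta> \<in> Omega \<Longrightarrow> P_mat \<beta> \<in> O_up" "P_mat 0 = (mat 1 :: 'm mat_full)"
proof -
  have pos1: "v \<bullet> ((mat 1 - transpose \<beta> ** \<beta>) *v v) > 0" if "\<beta> \<in> Omega" "v \<noteq> 0" for \<beta> :: "'m mat_low" and v
    using that by (simp add: Omega_def)
  have pos2: "v \<bullet> ((mat 1 - \<beta> ** transpose \<beta>) *v v) > 0" if "\<beta> \<in> Omega" "v \<noteq> 0" for \<beta> :: "'m mat_low" and v
  proof -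
    have "v \<bullet> ((mat 1 - \<beta> ** transpose \<beta>) *v v) = (norm v)\<^sup>2 - (norm (transpose \<beta> *v v))\<^sup>2"
    proof -
      have 1: "v \<bullet> (\<beta> *v (transpose \<beta> *v v)) = (transpose \<beta> *v v) \<bullet> (transpose \<beta> *v v)"
        using inner_transpose[of v "transpose \<beta>" "transpose \<beta> *v v"] by (simp only: transpose_transpose)
      show ?thesis
        by (simp only: matrix_vector_mult_diff_rdistrib matrix_vector_mul_lid matrix_vector_mul_assoc[symmetric]
            inner_diff_right 1 power2_norm_eq_inner)
    qed
    moreover have "(norm (transpose \<beta> *v v))\<^sup>2 < (norm v)\<^sup>2"
      by (intro power_strict_mono Omega_transpose that) auto
    ultimately show ?thesis by simp
  qed
  have sm1: "smooth_on Omega (\<lambda>\<beta> :: 'm mat_low. mat 1 - transpose \<beta> ** \<beta>)"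
    by (intro smooth_on_diff smooth_on_const smooth_on_matrix_mul smooth_on_transpose smooth_on_id)
  obtain T1 :: "'m mat_low \<Rightarrow> real^2^2" where T1: "smooth_on Omega T1" "\<And>\<beta> i j. \<beta> \<in> Omega \<Longrightarrow> j < i \<Longrightarrow> T1 \<beta> $ i $ j = 0"
    "\<And>\<beta> i. \<beta> \<in> Omega \<Longrightarrow> T1 \<beta> $ i $ i > 0" "\<And>\<beta>. \<beta> \<in> Omega \<Longrightarrow> transpose (T1 \<beta>) ** (mat 1 - transpose \<beta> ** \<beta>) ** T1 \<beta> = mat 1"
    using inverse_cholesky_exists[OF sm1 one_minus_square_sym pos1] by metis
  have sm2: "smooth_on Omega (\<lambda>\<beta> :: 'm mat_low. mat 1 - \<beta> ** transpose \<beta>)"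
    by (intro smooth_on_diff smooth_on_const smooth_on_matrix_mul smooth_on_transpose smooth_on_id)
  have sym2: "transpose (mat 1 - \<beta> ** transpose \<beta>) = mat 1 - \<beta> ** transpose \<beta>" for \<beta> :: "'m mat_low"
    using one_minus_square_sym[of "transpose \<beta>"] by simp
  obtain T2 :: "'m mat_low \<Rightarrow> 'm mat_d" where T2: "smooth_on Omega T2" "\<And>\<beta> i j. \<beta> \<in> Omega \<Longrightarrow> j < i \<Longrightarrow> T2 \<beta> $ i $ j = 0"
    "\<And>\<beta> i. \<beta> \<in> Omega \<Longrightarrow> T2 \<beta> $ i $ i > 0" "\<And>\<beta>. \<beta> \<in> Omega \<Longrightarrow> transpose (T2 \<beta>) ** (mat 1 - \<beta> ** transpose \<beta>) ** T2 \<beta> = mat 1"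
    using inverse_cholesky_exists[OF sm2 sym2 pos2] by metis
  define T where "T \<beta> = from_blocks (T1 \<beta>) 0 0 (T2 \<beta>)" for \<beta>
  have Tup: "upper_triangular (T \<beta>)" if "\<beta> \<in> Omega" for \<beta>
    unfolding upper_triangular_def
  proof (intro allI impI)
    fix i j :: "2 + 'm" assume "idx_less j i"
    then show "T \<beta> $ i $ j = 0" using T1(2) T2(2) that by (cases i; cases j) (auto simp: T_def)
  qed
  have Tpos: "T \<beta> $ i $ i > 0" if "\<beta> \<in> Omega" for \<beta> i
    using T1(3) T2(3) that by (cases i) (auto simp: T_def)
  have BT: "B_mat \<beta> ** T \<beta> = from_blocks (T1 \<beta>) (transpose \<beta> ** T2 \<beta>) (\<beta> ** T1 \<beta>) (T2 \<beta>)" for \<beta>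
    by (simp add: B_mat_def T_def from_blocks_mult)
  have BTpo: "B_mat \<beta> ** T \<beta> \<in> pseudo_orthogonal" if b: "\<beta> \<in> Omega" for \<beta>
    unfolding BT pseudo_orthogonal_blocks
  proof (intro conjI)
    show "transpose (T1 \<beta>) ** T1 \<beta> - transpose (\<beta> ** T1 \<beta>) ** (\<beta> ** T1 \<beta>) = mat 1"
      using T1(4)[OF b] by (simp add: matrix_transpose_mul matrix_ring matrix_mul_assoc)
    show "transpose (T2 \<beta>) ** T2 \<beta> - transpose (transpose \<beta> ** T2 \<beta>) ** (transpose \<beta> ** T2 \<beta>) = mat 1"
      using T2(4)[OF b] by (simp add: matrix_transpose_mul matrix_ring matrix_mul_assoc)
  qed (simp_all add: matrix_transpose_mul matrix_mul_assoc)
  have B0: "B_mat 0 = (mat 1 :: 'm mat_full)" by (simp add: B_mat_def from_blocks_one[symmetric])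
  have T0: "T 0 = mat 1"
  proof (rule triangular_factor_unique[where B = "B_mat 0"])
    show "upper_triangular (mat 1 :: 'm mat_full)" by (auto simp: upper_triangular_def mat_def)
    show "(mat 1 :: 'm mat_full) $ i $ i > 0" for i by (simp add: mat_def)
    show "B_mat 0 ** mat 1 \<in> (pseudo_orthogonal :: 'm mat_full set)" by (simp add: B0 pseudo_orthogonal_one)
  qed (use Tup Tpos BTpo Omega_0 in auto)
  have smBT: "smooth_on Omega (\<lambda>\<beta>. B_mat \<beta> ** T \<beta>)" unfolding BT
    by (intro smooth_on_from_blocks smooth_on_matrix_mul smooth_on_transpose smooth_on_id T1 T2)
  \<comment> \<open>The image of the convex set \<open>Omega\<close> is connected and contains the
    identity, the value at 0.\<close>
  have BTO: "B_mat \<beta> ** T \<beta> \<in> O_up" if "\<beta> \<in> Omega" for \<beta>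
  proof (rule O_up_path[OF O_up_one, where S = "(\<lambda>\<beta>. B_mat \<beta> ** T \<beta>) ` Omega"])
    show "connected ((\<lambda>\<beta>. B_mat \<beta> ** T \<beta>) ` Omega)"
      by (intro connected_continuous_image smooth_on_imp_continuous_on smBT convex_connected convex_Omega)
    show "mat 1 \<in> (\<lambda>\<beta>. B_mat \<beta> ** T \<beta>) ` Omega"
      using Omega_0 by (intro image_eqI[of _ _ 0]) (auto simp: B0 T0)
  qed (use that BTpo in auto)
  have TT: "T_mat \<beta> = T \<beta>" if "\<beta> \<in> Omega" for \<beta>
    unfolding T_mat_def
  proof (rule the_equality)
    fix T' assume "upper_triangular T' \<and> (\<forall>i. T' $ i $ i > 0) \<and> B_mat \<beta> ** T' \<in> O_up"
    then show "T' = T \<beta>" using triangular_factor_unique[of T' "B_mat \<beta>" "T \<beta>"] Tup Tpos BTpo that O_up_subset by blast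
  qed (use Tup Tpos BTO that in auto)
  then have P: "P_mat \<beta> = B_mat \<beta> ** T \<beta>" if "\<beta> \<in> Omega" for \<beta> using that by (simp add: P_mat_def)
  show ?thesis
  proof (rule that[of T1 T2])
    show "P_mat \<beta> = from_blocks (T1 \<beta>) (transpose \<beta> ** T2 \<beta>) (\<beta> ** T1 \<beta>) (T2 \<beta>)" if "\<beta> \<in> Omega" for \<beta>
      using P[OF that] BT by simp
    show "P_mat \<beta> \<in> O_up" if "\<beta> \<in> Omega" for \<beta> :: "'m mat_low" using P[OF that] BTO[OF that] by simp
    show "P_mat 0 = (mat 1 :: 'm mat_full)" using P[OF Omega_0] by (simp add: T0 B0)
  qed (use T1 T2 in auto)
qed

lemma smooth_on_P_mat: "smooth_on Omega P_mat"
proof -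
  obtain T1 :: "'a mat_low \<Rightarrow> real^2^2" and T2 where T: "smooth_on Omega T1" "smooth_on Omega T2"
    "\<And>\<beta>. \<beta> \<in> Omega \<Longrightarrow> P_mat \<beta> = from_blocks (T1 \<beta>) (transpose \<beta> ** T2 \<beta>) (\<beta> ** T1 \<beta>) (T2 \<beta>)"
    using P_mat_exists[where 'm='a] by metis
  have "smooth_on Omega (\<lambda>\<beta>. from_blocks (T1 \<beta>) (transpose \<beta> ** T2 \<beta>) (\<beta> ** T1 \<beta>) (T2 \<beta>))"
    by (intro smooth_on_from_blocks smooth_on_matrix_mul smooth_on_transpose smooth_on_id T)
  then show ?thesis by (rule smooth_on_cong) (simp add: T(3))
qed

lemma P_mat_0: "P_mat 0 = mat 1" using P_mat_exists by metis

lemma P_mat_O_up: "\<beta> \<in> Omega \<Longrightarrow> P_mat \<beta> \<in> O_up" using P_mat_exists by metis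

lemma P_mat_blocks:
  assumes "\<beta> \<in> Omega"
  shows "block_c (P_mat \<beta>) = \<beta> ** a_hat \<beta>" "block_b (P_mat \<beta>) = transpose \<beta> ** block_d (P_mat \<beta>)"
    "a_hat \<beta> $ 1 $ 0 = 0" "a_hat \<beta> $ 1 $ 1 > 0" "det (a_hat \<beta>) \<noteq> 0"
proof -
  obtain T1 :: "'a mat_low \<Rightarrow> real^2^2" and T2 where T: "T1 \<beta> $ 1 $ 0 = 0" "T1 \<beta> $ 0 $ 0 > 0" "T1 \<beta> $ 1 $ 1 > 0"
    "P_mat \<beta> = from_blocks (T1 \<beta>) (transpose \<beta> ** T2 \<beta>) (\<beta> ** T1 \<beta>) (T2 \<beta>)"
    using P_mat_exists[where 'm='a] assms by metis
  show "block_c (P_mat \<beta>) = \<beta> ** a_hat \<beta>" "block_b (P_mat \<beta>) = transpose \<beta> ** block_d (P_mat \<beta>)"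
    "a_hat \<beta> $ 1 $ 0 = 0" "a_hat \<beta> $ 1 $ 1 > 0" "det (a_hat \<beta>) \<noteq> 0"
    using T by (auto simp: a_hat_def det_2')
qed

lemma P_mat_from_blocks: "P_mat \<beta> = from_blocks (a_hat \<beta>) (block_b (P_mat \<beta>)) (block_c (P_mat \<beta>)) (block_d (P_mat \<beta>))"
  unfolding a_hat_def by (rule from_blocks_blocks[symmetric])

lemma smooth_on_a_hat: "smooth_on Omega a_hat"
  unfolding a_hat_def block_a_def by (intro smooth_on_vec_lambda smooth_on_nth smooth_on_P_mat)

lemma a_hat_0: "a_hat 0 = mat 1" by (simp add: a_hat_def P_mat_0 from_blocks_one)

subsection \<open>The decomposition of \<open>O_up\<close>\<close>

lemma connected_positive:
  fixes f :: "'a::topological_space \<Rightarrow> real"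
  assumes "connected S" "continuous_on S f" "\<And>x. x \<in> S \<Longrightarrow> f x \<noteq> 0" "a \<in> S" "f a > 0" "x \<in> S"
  shows "f x > 0"
proof (rule ccontr)
  assume "\<not> f x > 0"
  moreover have "connected (f ` S)" using assms by (intro connected_continuous_image)
  ultimately have "0 \<in> f ` S" using connected_contains_Icc[of "f ` S" "f x" "f a"] assms by force
  then show False using assms(3) by force
qed

text \<open>The hypothesis says that the squared length of \<open>A *v x\<close> is that of
  \<open>x\<close> plus that of \<open>C *v x\<close>, so \<open>A\<close> is injective.\<close>

lemma det_nz_of_gram:
  fixes A :: "real^'n^'n" and C :: "real^'n^'m"
  assumes "transpose A ** A - transpose C ** C = mat 1" shows "det A \<noteq> 0"
proof -
  have "x = 0" if "A *v x = 0" for x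
  proof -
    have "x \<bullet> x = x \<bullet> ((transpose A ** A - transpose C ** C) *v x)" using assms by simp
    also have "\<dots> = (A *v x) \<bullet> (A *v x) - (C *v x) \<bullet> (C *v x)"
      by (simp add: matrix_vector_mult_diff_rdistrib inner_diff_right matrix_vector_mul_assoc[symmetric]
          inner_transpose inner_vector_matrix)
    also have "\<dots> \<le> 0" using that by simp
    finally have "x \<bullet> x \<le> 0" .
    then show ?thesis by (metis inner_ge_zero inner_eq_zero_iff order_antisym)
  qed
  then have "invertible A" using matrix_left_invertible_ker[of A] invertible_left_inverse[of A] by blast
  then show ?thesis by (simp add: invertible_det_nz)
qed

lemma pseudo_orthogonal_blocks':
  assumes "X \<in> pseudo_orthogonal"
  shows "transpose (block_a X) ** block_a X - transpose (block_c X) ** block_c X = mat 1"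
    "transpose (block_d X) ** block_d X - transpose (block_b X) ** block_b X = mat 1"
    "transpose (block_a X) ** block_b X = transpose (block_c X) ** block_d X"
  using assms pseudo_orthogonal_blocks[of "block_a X" "block_b X" "block_c X" "block_d X"]
  by (simp_all add: from_blocks_blocks)

lemma smooth_on_block_a: "smooth_on S f \<Longrightarrow> smooth_on S (\<lambda>x. block_a (f x))"
  unfolding block_a_def by (intro smooth_on_vec_lambda smooth_on_nth)
lemma smooth_on_block_c: "smooth_on S f \<Longrightarrow> smooth_on S (\<lambda>x. block_c (f x))"
  unfolding block_c_def by (intro smooth_on_vec_lambda smooth_on_nth)
lemma smooth_on_block_d: "smooth_on S f \<Longrightarrow> smooth_on S (\<lambda>x. block_d (f x))"
  unfolding block_d_def by (intro smooth_on_vec_lambda smooth_on_nth)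

lemma O_up_det:
  assumes "X \<in> O_up" shows "det (block_a X) > 0" "det (block_d X) > 0"
proof -
  have nz: "det (block_a Y) \<noteq> 0" "det (block_d Y) \<noteq> 0" if "Y \<in> O_up" for Y :: "'a mat_full"
    using that O_up_subset pseudo_orthogonal_blocks' det_nz_of_gram by blast+
  show "det (block_a X) > 0"
    by (rule connected_positive[OF connected_O_up _ _ O_up_one _ assms, where f = "\<lambda>X. det (block_a X)"])
       (auto simp: nz from_blocks_one intro!: smooth_on_imp_continuous_on smooth_on_det smooth_on_block_a smooth_on_id)
  show "det (block_d X) > 0"
    by (rule connected_positive[OF connected_O_up _ _ O_up_one _ assms, where f = "\<lambda>X. det (block_d X)"])
       (auto simp: nz from_blocks_one intro!: smooth_on_imp_continuous_on smooth_on_det smooth_on_block_d smooth_on_id)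
qed

lemma pi2_unique: "X \<in> O_up \<Longrightarrow> block_c X = \<gamma> ** block_a X \<Longrightarrow> pi2 X = \<gamma>"
  using O_up_det[of X] matrix_inv_mult[of "block_a X"] by (simp add: pi2_def matrix_mul_assoc[symmetric])

lemma pi2_works: "X \<in> O_up \<Longrightarrow> block_c X = pi2 X ** block_a X"
  using O_up_det[of X] matrix_inv_mult[of "block_a X"] by (simp add: pi2_def matrix_mul_assoc[symmetric])

lemma pi2_Omega: assumes "X \<in> O_up" shows "pi2 X \<in> Omega"
  unfolding Omega_iff
proof (intro allI impI)
  fix x :: "real^2" assume x: "x \<noteq> 0"
  let ?a = "block_a X" let ?c = "block_c X"
  \<comment> \<open>With \<open>x\<close> written as \<open>block_a X *v y\<close>, the block
    identity reads |y|^2 = |x|^2 - |\<open>pi2 X *v x\<close>|^2, and \<open>y\<close> is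
    nonzero.\<close>
  define y where "y = matrix_inv ?a *v x"
  have ay: "?a *v y = x" using O_up_det[OF assms] matrix_inv_mult[of ?a] by (simp add: y_def matrix_vector_mul_assoc)
  then have "y \<noteq> 0" using x by auto
  have "y \<bullet> y = y \<bullet> ((transpose ?a ** ?a - transpose ?c ** ?c) *v y)"
    using pseudo_orthogonal_blocks'(1)[of X] assms O_up_subset by fastforce
  also have "\<dots> = (?a *v y) \<bullet> (?a *v y) - (?c *v y) \<bullet> (?c *v y)"
    by (simp add: matrix_vector_mult_diff_rdistrib inner_diff_right matrix_vector_mul_assoc[symmetric]
        inner_transpose inner_vector_matrix)
  also have "?c *v y = pi2 X *v x" unfolding pi2_works[OF assms] by (simp add: ay matrix_vector_mul_assoc[symmetric])
  finally have "(norm (pi2 X *v x))\<^sup>2 < (norm x)\<^sup>2"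
    using \<open>y \<noteq> 0\<close> unfolding ay power2_norm_eq_inner by (smt (verit) inner_gt_zero_iff)
  then show "norm (pi2 X *v x) < norm x" using power2_less_imp_less norm_ge_zero by blast
qed

lemma S_block_mult: "S_block r R ** S_block r' R' = S_block (r ** r') (R ** R')"
  by (simp add: S_block_def from_blocks_mult)

lemma S_block_inject: "S_block r R = S_block r' R' \<longleftrightarrow> r = r' \<and> R = R'"
  by (simp add: S_block_def)

lemma S_block_one: "S_block (mat 1) (mat 1) = mat 1"
  by (simp add: S_block_def from_blocks_one)

lemma SO_transpose_mult: "r \<in> SO \<Longrightarrow> r ** transpose r = mat 1" "r \<in> SO \<Longrightarrow> transpose r ** r = mat 1"
  by (simp_all add: SO_def rotation_matrix_def orthogonal_matrix_def)

lemma SO_inv: "r \<in> SO \<Longrightarrow> matrix_inv r = transpose r"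
  by (rule matrix_inv_unique) (rule SO_transpose_mult)

lemma SO_one: "mat 1 \<in> SO" by (simp add: SO_def rotation_matrix_def orthogonal_matrix_id)

lemma SO_mult: "r \<in> SO \<Longrightarrow> r' \<in> SO \<Longrightarrow> r ** r' \<in> SO"
  by (simp add: SO_def rotation_matrix_def orthogonal_matrix_mul det_mul)

lemma SO_transpose: "r \<in> SO \<Longrightarrow> transpose r \<in> SO"
  by (simp add: SO_def rotation_matrix_def orthogonal_matrix_transpose det_transpose)

text \<open>The matrices \<open>X\<close> and \<open>P_mat (pi2 X)\<close> have the same image under
  \<open>pi2\<close>, so the quotient \<open>Y\<close> has a zero lower left block.
  Pseudo-orthogonality makes \<open>Y\<close> block diagonal with orthogonal blocks, and
  \<open>O_up_det\<close> fixes the signs of their determinants.\<close>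

lemma decomposition_exists:
  assumes X: "X \<in> O_up" shows "\<exists>r\<in>SO. \<exists>R\<in>SO. X = P_mat (pi2 X) ** S_block r R"
proof -
  let ?P = "P_mat (pi2 X)"
  have P: "?P \<in> O_up" by (intro P_mat_O_up pi2_Omega X)
  define Y where "Y = padj ?P ** X"
  have Y: "Y \<in> O_up" unfolding Y_def by (intro O_up_mult O_up_padj P X)
  have PY: "X = ?P ** Y" unfolding Y_def using padj_right P O_up_subset by (fastforce simp: matrix_mul_assoc)
  have "Y = from_blocks (transpose (a_hat (pi2 X))) (- transpose (block_c ?P)) (- transpose (block_b ?P)) (transpose (block_d ?P))
      ** from_blocks (block_a X) (block_b X) (block_c X) (block_d X)"
    unfolding Y_def by (subst P_mat_from_blocks, subst (5) from_blocks_blocks[symmetric], subst padj_from_blocks) (rule refl)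
  then have "block_c Y = - transpose (block_b ?P) ** block_a X + transpose (block_d ?P) ** block_c X"
    by (simp add: from_blocks_mult)
  also have "\<dots> = 0"
    unfolding P_mat_blocks(2)[OF pi2_Omega[OF X]] pi2_works[OF X] by (simp add: matrix_transpose_mul matrix_mul_assoc matrix_minus_mult)
  finally have c: "block_c Y = 0" .
  note PO = pseudo_orthogonal_blocks'[OF subsetD[OF O_up_subset Y], unfolded c]
  have a: "transpose (block_a Y) ** block_a Y = mat 1" using PO(1) by simp
  then have a': "block_a Y ** transpose (block_a Y) = mat 1" using matrix_left_right_inverse by blast
  have b: "block_b Y = 0"
  proof -
    have "block_a Y ** (transpose (block_a Y) ** block_b Y) = 0" using PO(3) by simp
    then show ?thesis by (simp add: matrix_mul_assoc a')
  qed
  have d: "transpose (block_d Y) ** block_d Y = mat 1" using PO(2) b by simp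
  have SOI: "A \<in> SO" if "transpose A ** A = mat 1" "det A > 0" for A :: "real^'k^'k"
  proof -
    have "orthogonal_matrix A" using that by (simp add: orthogonal_matrix)
    then show ?thesis using det_orthogonal_matrix[of A] that by (auto simp: SO_def rotation_matrix_def)
  qed
  have "Y = S_block (block_a Y) (block_d Y)"
    unfolding S_block_def using from_blocks_blocks[of Y] b c by simp
  then show ?thesis using SOI[OF a O_up_det(1)[OF Y]] SOI[OF d O_up_det(2)[OF Y]] PY by metis
qed

lemma decomposition_unique:
  assumes "X \<in> O_up" "m \<in> Omega" "r \<in> SO" "R \<in> SO" "X = P_mat m ** S_block r R"
  shows "pi2 X = m" "psi X = r" "Psi X = R" "block_a X = a_hat m ** r"
proof -
  have X: "X = from_blocks (a_hat m ** r) (block_b (P_mat m) ** R) (block_c (P_mat m) ** r) (block_d (P_mat m) ** R)"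
    unfolding assms(5) by (subst P_mat_from_blocks) (simp add: S_block_def from_blocks_mult)
  then show a: "block_a X = a_hat m ** r" by simp
  have "block_c X = m ** block_a X"
    using X a P_mat_blocks(1)[OF assms(2)] by (simp add: matrix_mul_assoc)
  then show pi: "pi2 X = m" using pi2_unique assms(1) by blast
  have PO: "padj (P_mat m) ** P_mat m = mat 1"
    using padj_left P_mat_O_up[OF assms(2)] O_up_subset by blast
  have uniq: "r' = r \<and> R' = R" if "X = P_mat m ** S_block r' R'" for r' R'
  proof -
    have "padj (P_mat m) ** (P_mat m ** S_block r' R') = padj (P_mat m) ** (P_mat m ** S_block r R)"
      using that assms(5) by simp
    then show ?thesis by (simp add: matrix_mul_assoc PO S_block_inject)
  qed
  show "psi X = r" unfolding psi_def pi
    by (rule the_equality) (use assms uniq in blast)+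
  show "Psi X = R" unfolding Psi_def pi
    by (rule the_equality) (use assms uniq in blast)+
qed

lemma decomposition:
  assumes "X \<in> O_up"
  shows "psi X \<in> SO" "Psi X \<in> SO" "X = P_mat (pi2 X) ** S_block (psi X) (Psi X)"
    "block_a X = a_hat (pi2 X) ** psi X" "S_block (psi X) (Psi X) = padj (P_mat (pi2 X)) ** X"
proof -
  obtain r R where r: "r \<in> SO" "R \<in> SO" "X = P_mat (pi2 X) ** S_block r R"
    using decomposition_exists[OF assms] by blast
  note u = decomposition_unique[OF assms pi2_Omega[OF assms] r]
  show "psi X \<in> SO" "Psi X \<in> SO" using u r by simp_all
  show 1: "X = P_mat (pi2 X) ** S_block (psi X) (Psi X)" using u r by simp
  show "block_a X = a_hat (pi2 X) ** psi X" using u by simp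
  have "padj (P_mat (pi2 X)) ** X = padj (P_mat (pi2 X)) ** (P_mat (pi2 X) ** S_block (psi X) (Psi X))"
    using 1 by simp
  also have "\<dots> = S_block (psi X) (Psi X)"
    using padj_left[OF subsetD[OF O_up_subset P_mat_O_up[OF pi2_Omega[OF assms]]]] by (simp add: matrix_mul_assoc)
  finally show "S_block (psi X) (Psi X) = padj (P_mat (pi2 X)) ** X" by simp
qed

text \<open>Row \<open>1\<close> of an upper triangular \<open>T\<close> has only its diagonal
  entry, so row \<open>1\<close> of \<open>A\<close> is a positive multiple of row \<open>1\<close>
  of \<open>r\<close>, which is (sin t, cos t) for \<open>rho t\<close>. Hence the cosine is read
  off column \<open>1\<close> and the sine off column \<open>0\<close>.\<close>

lemma row_polar:
  fixes A T :: "real^2^2"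
  assumes "A = T ** r" "r \<in> SO" "T $ 1 $ 0 = 0" "T $ 1 $ 1 > 0"
  shows "r = rho t \<longleftrightarrow> polar (A $ 1 $ 1) (A $ 1 $ 0) t"
proof -
  have P: "polar (A $ 1 $ 1) (A $ 1 $ 0) u" if "r = rho u" for u
    unfolding polar_def using assms that by (intro exI[of _ "T $ 1 $ 1"]) (simp add: matrix_matrix_mult_def sum_2')
  obtain u where u: "r = rho u" using SO_rho[OF assms(2)] by blast
  show ?thesis using P u polar_unique[OF P[OF u], of t] rho_eq_iff[of u t] by metis
qed

text \<open>It removes \<open>P_mat\<close> and its square roots from the defining condition of
  \<open>S_hat\<close>.\<close>

lemma psi_polar:
  assumes "X \<in> O_up"
  shows "psi X = rho t \<longleftrightarrow> polar (X $ Inl 1 $ Inl 1) (X $ Inl 1 $ Inl 0) t"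
  using row_polar[OF decomposition(4)[OF assms] decomposition(1)[OF assms] P_mat_blocks(3,4)[OF pi2_Omega[OF assms]], of t]
  by (simp add: block_a_def)

lemma psi_one: "psi (mat 1 :: 'm::{finite,linorder} mat_full) = mat 1" "pi2 (mat 1 :: 'm mat_full) = 0"
  "Psi (mat 1 :: 'm mat_full) = mat 1"
  using decomposition_unique[OF O_up_one Omega_0 SO_one SO_one] by (simp_all add: P_mat_0 S_block_one)

lemma smooth_on_pi2: "smooth_on O_up pi2"
  unfolding pi2_def
  by (intro smooth_on_matrix_mul smooth_on_matrix_inv smooth_on_block_a smooth_on_block_c smooth_on_id)
     (use O_up_det in force)

lemma smooth_on_psi: "smooth_on (O_up :: 'a::{finite,linorder} mat_full set) psi"
  "smooth_on (O_up :: 'a mat_full set) Psi"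
proof -
  have sm: "smooth_on O_up (\<lambda>X :: 'a mat_full. padj (P_mat (pi2 X)) ** X)"
    by (intro smooth_on_matrix_mul smooth_on_id smooth_on_linear_compose[OF bounded_linear_padj]
        smooth_on_compose[OF smooth_on_P_mat] smooth_on_pi2) (use pi2_Omega in auto)
  have "block_a (padj (P_mat (pi2 X)) ** X) = psi X" "block_d (padj (P_mat (pi2 X)) ** X) = Psi X"
    if "X \<in> O_up" for X :: "'a mat_full"
    unfolding decomposition(5)[OF that, symmetric] by (simp_all add: S_block_def)
  then show "smooth_on (O_up :: 'a mat_full set) psi" "smooth_on (O_up :: 'a mat_full set) Psi"
    using smooth_on_cong[OF smooth_on_block_a[OF sm]] smooth_on_cong[OF smooth_on_block_d[OF sm]] by auto
qed

lemma continuous_on_rho: "continuous_on S rho"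
  unfolding rho_def
proof (intro continuous_on_vec_lambda)
  fix i j :: 2
  show "continuous_on S (\<lambda>t. if i = 0 then if j = 0 then cos t else - sin t else if j = 0 then sin t else cos t)"
    by (cases "i = 0"; cases "j = 0") (auto intro!: continuous_intros)
qed

lemma S_block_rotation_O_up:
  assumes "r \<in> SO" shows "S_block r (mat 1) \<in> O_up"
proof -
  obtain t where t: "r = rho t" using SO_rho[OF assms] by blast
  show ?thesis
  proof (rule O_up_path[OF O_up_one, where S = "range (\<lambda>t. S_block (rho t) (mat 1))"])
    have "continuous_on UNIV (\<lambda>t. S_block (rho t) (mat 1) :: 'a mat_full)"
      unfolding S_block_def from_blocks_def
    proof (intro continuous_on_vec_lambda)
      fix i j :: "2 + 'a"
      show "continuous_on UNIV (\<lambda>t. case i of Inl k \<Rightarrow> (case j of Inl l \<Rightarrow> rho t $ k $ l | Inr l \<Rightarrow> (0 :: real^'a^2) $ k $ l)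
        | Inr k \<Rightarrow> (case j of Inl l \<Rightarrow> (0 :: real^2^'a) $ k $ l | Inr l \<Rightarrow> (mat 1 :: real^'a^'a) $ k $ l))"
        by (cases i; cases j) (auto intro!: continuous_on_component continuous_on_rho)
    qed
    then show "connected (range (\<lambda>t. S_block (rho t) (mat 1) :: 'a mat_full))"
      by (intro connected_continuous_image) auto
    show "mat 1 \<in> range (\<lambda>t. S_block (rho t) (mat 1) :: 'a mat_full)"
      by (rule range_eqI[of _ _ 0]) (simp add: S_block_one)
    show "range (\<lambda>t. S_block (rho t) (mat 1) :: 'a mat_full) \<subseteq> pseudo_orthogonal"
      using SO_transpose_mult[OF rho_SO] by (auto simp: S_block_def pseudo_orthogonal_blocks)
  qed (use t in auto)
qed

text \<open>Left multiplication by \<open>S_block r R\<close> acts on \<open>Omega\<close> by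
  sending \<open>\<beta>\<close> to \<open>R ** \<beta> ** matrix_inv r\<close>. The upper left
  block does not involve \<open>R\<close>, which is why \<open>eta\<close> depends on
  \<open>r\<close> alone.\<close>

lemma rotate_section:
  assumes "\<beta> \<in> Omega" "r \<in> SO" "S_block r R \<in> O_up" "R \<in> SO"
  shows "S_block r R ** P_mat \<beta> \<in> O_up" "pi2 (S_block r R ** P_mat \<beta>) = R ** \<beta> ** matrix_inv r"
    "block_a (S_block r R ** P_mat \<beta>) = r ** a_hat \<beta>"
proof -
  let ?Z = "S_block r R ** P_mat \<beta>"
  show O: "?Z \<in> O_up" by (intro O_up_mult assms P_mat_O_up)
  have Z: "?Z = from_blocks (r ** a_hat \<beta>) (r ** block_b (P_mat \<beta>)) (R ** block_c (P_mat \<beta>)) (R ** block_d (P_mat \<beta>))"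
    by (subst P_mat_from_blocks) (simp add: S_block_def from_blocks_mult)
  show a: "block_a ?Z = r ** a_hat \<beta>" unfolding Z by simp
  have "block_c ?Z = R ** \<beta> ** matrix_inv r ** block_a ?Z"
  proof -
    have "R ** \<beta> ** matrix_inv r ** block_a ?Z = R ** \<beta> ** (transpose r ** r) ** a_hat \<beta>"
      unfolding a SO_inv[OF assms(2)] by (simp add: matrix_mul_assoc)
    also have "\<dots> = block_c ?Z" unfolding Z using P_mat_blocks(1)[OF assms(1)]
      by (simp add: SO_transpose_mult[OF assms(2)] matrix_mul_assoc)
    finally show ?thesis by simp
  qed
  then show "pi2 ?Z = R ** \<beta> ** matrix_inv r" by (rule pi2_unique[OF O])
qed

section \<open>The angle lifts \<open>eta\<close> and \<open>Theta\<close>\<close>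

definition eta_matrix :: "('m::{finite,linorder}) mat_low \<Rightarrow> real^2^2 \<Rightarrow> real^2^2" where
  "eta_matrix \<beta> r = matrix_inv (a_hat (\<beta> ** matrix_inv r)) ** r ** a_hat \<beta> ** matrix_inv r"

text \<open>The first formula explains \<open>eta\<close>: it measures how far \<open>psi\<close> of
  the rotated section is from \<open>r\<close>. The third replaces the matrix by a vector that
  depends smoothly on both arguments and whose angle can be lifted.\<close>

lemma eta_matrix_char:
  assumes b: "\<beta> \<in> Omega" and r: "r \<in> SO"
  shows "eta_matrix \<beta> r = psi (S_block r (mat 1) ** P_mat \<beta>) ** matrix_inv r"
    "eta_matrix \<beta> r \<in> SO"
    "eta_matrix \<beta> r = rho t \<longleftrightarrow> polar ((r ** a_hat \<beta> ** transpose r) $ 1 $ 1) ((r ** a_hat \<beta> ** transpose r) $ 1 $ 0) t"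
proof -
  let ?Z = "S_block r (mat 1) ** P_mat \<beta>"
  note Z = rotate_section[OF b r S_block_rotation_O_up[OF r] SO_one]
  let ?m = "\<beta> ** matrix_inv r"
  have m: "pi2 ?Z = ?m" using Z(2) by simp
  then have mO: "?m \<in> Omega" using pi2_Omega[OF Z(1)] by simp
  have e: "r ** a_hat \<beta> = a_hat ?m ** psi ?Z" using decomposition(4)[OF Z(1)] Z(3) m by simp
  have "eta_matrix \<beta> r = matrix_inv (a_hat ?m) ** (r ** a_hat \<beta>) ** matrix_inv r"
    unfolding eta_matrix_def by (simp add: matrix_mul_assoc)
  also have "\<dots> = psi ?Z ** matrix_inv r"
    unfolding e using matrix_inv_mult(2)[OF P_mat_blocks(5)[OF mO]] by (simp add: matrix_mul_assoc)
  finally show em: "eta_matrix \<beta> r = psi ?Z ** matrix_inv r" .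
  show SOe: "eta_matrix \<beta> r \<in> SO"
    unfolding em SO_inv[OF r] by (intro SO_mult SO_transpose decomposition(1) Z r)
  have "r ** a_hat \<beta> ** transpose r = a_hat ?m ** eta_matrix \<beta> r"
    unfolding em e SO_inv[OF r] by (simp add: matrix_mul_assoc)
  then show "eta_matrix \<beta> r = rho t \<longleftrightarrow> polar ((r ** a_hat \<beta> ** transpose r) $ 1 $ 1) ((r ** a_hat \<beta> ** transpose r) $ 1 $ 0) t"
    using row_polar[OF _ SOe P_mat_blocks(3,4)[OF mO]] by blast
qed

lemma polar_nz: "polar c s t \<Longrightarrow> Complex c s \<noteq> 0"
  unfolding polar_def using sin_zero_abs_cos_one[of t] by (auto simp: complex_eq_iff)

lemma connected_SO2: "connected (SO :: (real^2^2) set)"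
proof -
  have "SO = range rho" using SO_rho rho_SO by (metis UNIV_I image_eqI image_subsetI subsetI subset_antisym)
  then show ?thesis using connected_continuous_image[OF continuous_on_rho connected_UNIV] by simp
qed

lemma continuous_on_Complex:
  "continuous_on S f \<Longrightarrow> continuous_on S g \<Longrightarrow> continuous_on S (\<lambda>x. Complex (f x) (g x))"
  unfolding Complex_eq by (intro continuous_intros)

text \<open>This is the shape of the descriptions of \<open>eta\<close> and \<open>Theta\<close>.
  Extensionality upgrades uniqueness on \<open>S\<close> to uniqueness of the function.\<close>

lemma smooth_lift_ex1:
  fixes c s :: "'a::euclidean_space \<Rightarrow> real"
  assumes "connected S" "smooth_on S c" "smooth_on S s" "a \<in> S" "polar (c a) (s a) 0"
    "homotopic_with_canon (\<lambda>h. True) S (-{0}) (\<lambda>x. Complex (c x) (s x)) (\<lambda>t. z)"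
  shows "\<exists>!h. h \<in> extensional S \<and> smooth_on S h \<and> (\<forall>x\<in>S. polar (c x) (s x) (h x)) \<and> h a = 0"
proof -
  obtain h where h: "continuous_on S h" "h a = 0" "\<And>x. x \<in> S \<Longrightarrow> polar (c x) (s x) (h x)"
    using polar_lift_exists[OF assms(6,4,5)] by blast
  have sm: "smooth_on S h" by (rule smooth_on_polar_lift[OF h(1) assms(2,3) h(3)])
  show ?thesis
  proof (rule ex1I[of _ "restrict h S"], intro conjI)
    show "smooth_on S (restrict h S)" by (rule smooth_on_cong[OF sm]) simp
    fix h' assume h': "h' \<in> extensional S \<and> smooth_on S h' \<and> (\<forall>x\<in>S. polar (c x) (s x) (h' x)) \<and> h' a = 0"
    show "h' = restrict h S"
    proof (rule extensionalityI)
      fix x assume x: "x \<in> S"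
      have "h x = h' x"
      proof (rule angle_unique[OF assms(1) h(1) _ _ assms(4) _ x])
        show "continuous_on S h'" using h' smooth_on_imp_continuous_on by blast
        show "\<exists>n::int. h' y = h y + 2 * pi * n" if "y \<in> S" for y
          using polar_unique[OF h(3)[OF that], of "h' y"] h' that by blast
        show "h a = h' a" using h' h by simp
      qed
      then show "h' x = restrict h S x" using x by simp
    qed (use h' in auto)
  qed (use h assms(4) in auto)
qed

lemma eta_props:
  shows "continuous_on (Omega \<times> SO) (eta :: 'm::{finite,linorder} mat_low \<times> (real^2^2) \<Rightarrow> real)"
    "(\<beta> :: 'm mat_low) \<in> Omega \<Longrightarrow> r \<in> SO \<Longrightarrow> rho (eta (\<beta>, r)) = eta_matrix \<beta> r"
    "eta (0 :: 'm mat_low, mat 1) = 0"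
proof -
  let ?S = "Omega \<times> SO :: ('m mat_low \<times> (real^2^2)) set"
  define A where "A = (\<lambda>p :: 'm mat_low \<times> (real^2^2). snd p ** a_hat (fst p) ** transpose (snd p))"
  define c where "c = (\<lambda>p. A p $ 1 $ 1)"
  define s where "s = (\<lambda>p. A p $ 1 $ 0)"
  have smA: "smooth_on ?S A" unfolding A_def
    by (intro smooth_on_matrix_mul smooth_on_transpose smooth_on_snd smooth_on_id
        smooth_on_compose[OF smooth_on_a_hat smooth_on_fst[OF smooth_on_id]]) auto
  have smcs: "smooth_on ?S c" "smooth_on ?S s" unfolding c_def s_def by (intro smooth_on_nth smA)+
  have P: "rho t = eta_matrix (fst p) (snd p) \<longleftrightarrow> polar (c p) (s p) t" if "p \<in> ?S" for p t
    using eta_matrix_char(3)[of "fst p" "snd p" t] that by (auto simp: c_def s_def A_def mem_Times_iff)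
  have a0: "c (0, r) = 1" "s (0, r) = 0" if "r \<in> SO" for r
    using SO_transpose_mult[OF that] by (simp_all add: c_def s_def A_def a_hat_0) (simp_all add: mat_def)
  have nz: "Complex (c p) (s p) \<noteq> 0" if p: "p \<in> ?S" for p
  proof -
    obtain t where "eta_matrix (fst p) (snd p) = rho t"
      using SO_rho eta_matrix_char(2) p by (metis mem_Times_iff)
    then have "polar (c p) (s p) t" using P[OF p] by metis
    then show ?thesis by (rule polar_nz)
  qed
  have sub: "(t *\<^sub>R fst p, snd p) \<in> ?S" if "t \<in> {0..1}" "p \<in> ?S" for t p
    using that Omega_scale by (auto simp: mem_Times_iff)
  \<comment> \<open>Because of the factor \<open>SO\<close> the domain is not contractible, so the
    null-homotopy is explicit: shrink \<beta> to 0. There \<open>a_hat\<close> is the identity,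
    conjugation by \<open>r\<close> does nothing, and the vector is constantly (1, 0).\<close>
  define H where "H = (\<lambda>q :: real \<times> ('m mat_low \<times> (real^2^2)). Complex (c (fst q *\<^sub>R fst (snd q), snd (snd q))) (s (fst q *\<^sub>R fst (snd q), snd (snd q))))"
  have contH: "continuous_on ({0..1} \<times> ?S) H"
  proof -
    have k: "continuous_on ({0..1} \<times> ?S) (\<lambda>q. (fst q *\<^sub>R fst (snd q), snd (snd q)))"
      by (intro continuous_intros)
    have im: "(\<lambda>q. (fst q *\<^sub>R fst (snd q), snd (snd q))) ` ({0..1} \<times> ?S) \<subseteq> ?S"
      using sub by (auto simp: mem_Times_iff)
    show ?thesis unfolding H_def
      by (intro continuous_on_Complex continuous_on_compose2[OF smooth_on_imp_continuous_on[OF smcs(1)] k im]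
          continuous_on_compose2[OF smooth_on_imp_continuous_on[OF smcs(2)] k im])
  qed
  have hom0: "homotopic_with_canon (\<lambda>h. True) ?S (-{0}) (\<lambda>p. H (0, p)) (\<lambda>p. H (1, p))"
    unfolding homotopic_with_def
  proof (intro exI[of _ H] conjI allI ballI)
    show "continuous_map (prod_topology (top_of_set {0..1}) (top_of_set ?S)) (top_of_set (-{0})) H"
      using contH nz sub by (auto simp: H_def mem_Times_iff)
  qed auto
  have "homotopic_with_canon (\<lambda>h. True) ?S (-{0}) (\<lambda>x. 1) (\<lambda>x. Complex (c x) (s x))"
    by (rule homotopic_with_eq[OF hom0]) (auto simp: H_def a0 complex_eq_iff)
  then have hom: "homotopic_with_canon (\<lambda>h. True) ?S (-{0}) (\<lambda>x. Complex (c x) (s x)) (\<lambda>x. 1)"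
    by (rule homotopic_with_symD)
  have "connected ?S" by (intro connected_Times convex_connected convex_Omega connected_SO2)
  then have ex1: "\<exists>!h. h \<in> extensional ?S \<and> smooth_on ?S h \<and> (\<forall>x\<in>?S. polar (c x) (s x) (h x)) \<and> h (0, mat 1) = 0"
    by (rule smooth_lift_ex1[OF _ smcs _ _ hom])
       (use Omega_0 SO_one a0 in \<open>auto simp: polar_def intro!: exI[of _ 1]\<close>)
  \<comment> \<open>Pointwise the equation for \<open>rho\<close> is equivalent to
    \<open>polar\<close>, so both descriptions have the same predicate and \<open>ex1\<close>
    applies to \<open>eta\<close>.\<close>
  have "eta = (THE h. h \<in> extensional ?S \<and> smooth_on ?S h \<and> (\<forall>x\<in>?S. polar (c x) (s x) (h x)) \<and> h (0, mat 1) = 0)"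
    unfolding eta_def
  proof (rule arg_cong[where f = The], rule ext)
    fix h :: "'m mat_low \<times> (real^2^2) \<Rightarrow> real"
    have "(\<forall>\<beta>\<in>Omega. \<forall>r\<in>SO. rho (h (\<beta>, r)) = matrix_inv (a_hat (\<beta> ** matrix_inv r)) ** r ** a_hat \<beta> ** matrix_inv r)
       \<longleftrightarrow> (\<forall>x\<in>?S. polar (c x) (s x) (h x))"
      using P unfolding eta_matrix_def by fastforce
    then show "(h \<in> extensional ?S \<and> smooth_on ?S h \<and>
        (\<forall>\<beta>\<in>Omega. \<forall>r\<in>SO. rho (h (\<beta>, r)) = matrix_inv (a_hat (\<beta> ** matrix_inv r)) ** r ** a_hat \<beta> ** matrix_inv r) \<and>
        h (0, mat 1) = 0) =
      (h \<in> extensional ?S \<and> smooth_on ?S h \<and> (\<forall>x\<in>?S. polar (c x) (s x) (h x)) \<and> h (0, mat 1) = 0)" by simp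
  qed
  then have E: "smooth_on ?S eta" "\<forall>x\<in>?S. polar (c x) (s x) (eta x)" "eta (0 :: 'm mat_low, mat 1) = 0"
    using theI'[OF ex1] by simp_all
  show "continuous_on ?S eta" by (rule smooth_on_imp_continuous_on[OF E(1)])
  show "eta (0 :: 'm mat_low, mat 1) = 0" by (rule E(3))
  show "rho (eta (\<beta>, r)) = eta_matrix \<beta> r" if "\<beta> \<in> Omega" "r \<in> SO" for \<beta> :: "'m mat_low" and r
    using P[of "(\<beta>, r)" "eta (\<beta>, r)"] E(2) that by auto
qed

lemma r_frak_eq: assumes "\<beta> \<in> Omega" "\<beta>' \<in> Omega" shows "r_frak \<beta> \<beta>' = psi (P_mat \<beta> ** P_mat \<beta>')"
proof -
  let ?X = "P_mat \<beta> ** P_mat \<beta>'"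
  have X: "?X \<in> O_up" by (intro O_up_mult P_mat_O_up assms)
  show ?thesis unfolding r_frak_def
  proof (rule the_equality)
    show "psi ?X \<in> SO \<and> (\<exists>m\<in>Omega. \<exists>R\<in>SO. ?X = P_mat m ** S_block (psi ?X) R)"
      using decomposition(1-3)[OF X] pi2_Omega[OF X] by blast
  qed (use decomposition_unique(2)[OF X] in metis)
qed

text \<open>Here the domain is convex, so null-homotopy comes from contractibility; otherwise the
  argument is that for \<open>eta\<close>.\<close>

lemma Theta_props:
  shows "continuous_on (Omega \<times> Omega) (Theta :: 'm::{finite,linorder} mat_low \<times> 'm mat_low \<Rightarrow> real)"
    "(\<beta> :: 'm mat_low) \<in> Omega \<Longrightarrow> \<beta>' \<in> Omega \<Longrightarrow> rho (Theta (\<beta>, \<beta>')) = psi (P_mat \<beta> ** P_mat \<beta>')"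
    "Theta (0 :: 'm mat_low, 0) = 0"
proof -
  let ?S = "Omega \<times> Omega :: ('m mat_low \<times> 'm mat_low) set"
  define A where "A = (\<lambda>p :: 'm mat_low \<times> 'm mat_low. P_mat (fst p) ** P_mat (snd p))"
  define c where "c = (\<lambda>p. A p $ Inl 1 $ Inl 1)"
  define s where "s = (\<lambda>p. A p $ Inl 1 $ Inl 0)"
  have smA: "smooth_on ?S A" unfolding A_def
    by (intro smooth_on_matrix_mul smooth_on_compose[OF smooth_on_P_mat smooth_on_fst[OF smooth_on_id]]
        smooth_on_compose[OF smooth_on_P_mat smooth_on_snd[OF smooth_on_id]]) auto
  have smcs: "smooth_on ?S c" "smooth_on ?S s" unfolding c_def s_def by (intro smooth_on_nth smA)+
  have AO: "A p \<in> O_up" if "p \<in> ?S" for p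
    using that unfolding A_def by (auto intro!: O_up_mult P_mat_O_up)
  have P: "rho t = r_frak (fst p) (snd p) \<longleftrightarrow> polar (c p) (s p) t" if "p \<in> ?S" for p t
    using psi_polar[OF AO[OF that], of t] r_frak_eq[of "fst p" "snd p"] that
    by (auto simp: c_def s_def A_def mem_Times_iff)
  have a0: "c (0, 0) = 1" "s (0, 0) = 0"
    by (simp_all add: c_def s_def A_def P_mat_0) (simp_all add: mat_def)
  have nz: "Complex (c p) (s p) \<noteq> 0" if p: "p \<in> ?S" for p
  proof -
    obtain t where "psi (A p) = rho t" using SO_rho decomposition(1)[OF AO[OF p]] by metis
    then have "polar (c p) (s p) t" using psi_polar[OF AO[OF p]] by (simp add: c_def s_def)
    then show ?thesis by (rule polar_nz)
  qed
  have conv: "convex ?S" by (intro convex_Times convex_Omega)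
  have c1: "continuous_on ?S (\<lambda>x. Complex (c x) (s x))"
    by (intro continuous_on_Complex smooth_on_imp_continuous_on smcs)
  have c2: "(\<lambda>x. Complex (c x) (s x)) \<in> ?S \<rightarrow> -{0}" using nz by auto
  obtain z where hom: "homotopic_with_canon (\<lambda>h. True) ?S (-{0}) (\<lambda>x. Complex (c x) (s x)) (\<lambda>x. z)"
    using nullhomotopic_from_contractible[OF c1 c2 convex_imp_contractible[OF conv]] by blast
  have ex1: "\<exists>!h. h \<in> extensional ?S \<and> smooth_on ?S h \<and> (\<forall>x\<in>?S. polar (c x) (s x) (h x)) \<and> h (0, 0) = 0"
    by (rule smooth_lift_ex1[OF convex_connected[OF conv] smcs _ _ hom])
       (use Omega_0 a0 in \<open>auto simp: polar_def intro!: exI[of _ 1]\<close>)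
  have "Theta = (THE h. h \<in> extensional ?S \<and> smooth_on ?S h \<and> (\<forall>x\<in>?S. polar (c x) (s x) (h x)) \<and> h (0, 0) = 0)"
    unfolding Theta_def
  proof (rule arg_cong[where f = The], rule ext)
    fix h :: "'m mat_low \<times> 'm mat_low \<Rightarrow> real"
    have "(\<forall>\<beta>\<in>Omega. \<forall>\<beta>'\<in>Omega. rho (h (\<beta>, \<beta>')) = r_frak \<beta> \<beta>')
       \<longleftrightarrow> (\<forall>x\<in>?S. polar (c x) (s x) (h x))"
      using P by fastforce
    then show "(h \<in> extensional ?S \<and> smooth_on ?S h \<and>
        (\<forall>\<beta>\<in>Omega. \<forall>\<beta>'\<in>Omega. rho (h (\<beta>, \<beta>')) = r_frak \<beta> \<beta>') \<and> h (0, 0) = 0) =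
      (h \<in> extensional ?S \<and> smooth_on ?S h \<and> (\<forall>x\<in>?S. polar (c x) (s x) (h x)) \<and> h (0, 0) = 0)" by simp
  qed
  then have E: "smooth_on ?S Theta" "\<forall>x\<in>?S. polar (c x) (s x) (Theta x)" "Theta (0 :: 'm mat_low, 0) = 0"
    using theI'[OF ex1] by simp_all
  show "continuous_on ?S Theta" by (rule smooth_on_imp_continuous_on[OF E(1)])
  show "Theta (0 :: 'm mat_low, 0) = 0" by (rule E(3))
  show "rho (Theta (\<beta>, \<beta>')) = psi (P_mat \<beta> ** P_mat \<beta>')" if "\<beta> \<in> Omega" "\<beta>' \<in> Omega" for \<beta> \<beta>' :: "'m mat_low"
    using P[of "(\<beta>, \<beta>')" "Theta (\<beta>, \<beta>')"] E(2) that r_frak_eq[OF that] by auto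
qed

subsection \<open>The function \<open>zeta\<close>\<close>

lemma psi_row_cong:
  assumes "X \<in> O_up" "Y \<in> O_up" "block_a X = block_a Y" shows "psi X = psi Y"
proof -
  obtain t where t: "psi X = rho t" using SO_rho[OF decomposition(1)[OF assms(1)]] by blast
  have "X $ Inl 1 $ Inl k = Y $ Inl 1 $ Inl k" for k
    using arg_cong[OF assms(3), of "\<lambda>A. A $ 1 $ k"] by (simp add: block_a_def)
  then have "psi Y = rho t" using t psi_polar[OF assms(1), of t] psi_polar[OF assms(2), of t] by simp
  then show ?thesis using t by simp
qed

lemma zeta_arg_Omega:
  assumes "X \<in> O_up" "X' \<in> O_up" shows "Psi X ** pi2 X' ** matrix_inv (psi X) \<in> Omega"
proof -
  have "S_block (psi X) (Psi X) \<in> O_up" unfolding decomposition(5)[OF assms(1)]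
    by (intro O_up_mult O_up_padj P_mat_O_up pi2_Omega assms)
  then show ?thesis
    using rotate_section(1,2)[OF pi2_Omega[OF assms(2)] decomposition(1)[OF assms(1)] _ decomposition(2)[OF assms(1)]]
      pi2_Omega by metis
qed

text \<open>In the product \<open>P S P' S'\<close> of the two decompositions, the inner factor
  \<open>S P'\<close> is decomposed again as \<open>?Z\<close>, at the base point \<open>?m\<close>,
  and then the product of the two sections as \<open>?V\<close>. The rotations collected on the way
  are those of \<open>eta\<close> and \<open>Theta\<close>, and plane rotations combine by adding
  angles.\<close>

lemma rho_zeta:
  assumes X: "X \<in> O_up" and X': "X' \<in> O_up"
  shows "rho (zeta X X') ** psi X ** psi X' = psi (X ** X')"
proof -
  let ?r = "psi X" let ?R = "Psi X" let ?b = "pi2 X" let ?b' = "pi2 X'"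
  have SO: "S_block ?r ?R \<in> O_up" unfolding decomposition(5)[OF X]
    by (intro O_up_mult O_up_padj P_mat_O_up pi2_Omega X)
  let ?Z = "S_block ?r ?R ** P_mat ?b'"
  note Z = rotate_section[OF pi2_Omega[OF X'] decomposition(1)[OF X] SO decomposition(2)[OF X]]
  let ?m = "?R ** ?b' ** matrix_inv ?r"
  have m: "?m \<in> Omega" by (rule zeta_arg_Omega[OF X X'])
  let ?V = "P_mat ?b ** P_mat ?m"
  have V: "?V \<in> O_up" by (intro O_up_mult P_mat_O_up m pi2_Omega X)
  have "X ** X' = P_mat ?b ** (S_block ?r ?R ** P_mat ?b') ** S_block (psi X') (Psi X')"
    using decomposition(3)[OF X] decomposition(3)[OF X'] by (metis matrix_mul_assoc)
  also have "?Z = P_mat ?m ** S_block (psi ?Z) (Psi ?Z)"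
    using decomposition(3)[OF Z(1)] Z(2) by simp
  also have "P_mat ?b ** (P_mat ?m ** S_block (psi ?Z) (Psi ?Z)) = ?V ** S_block (psi ?Z) (Psi ?Z)"
    by (simp add: matrix_mul_assoc)
  also have "?V = P_mat (pi2 ?V) ** S_block (psi ?V) (Psi ?V)" by (rule decomposition(3)[OF V])
  finally have XX: "X ** X' = P_mat (pi2 ?V) ** S_block (psi ?V ** psi ?Z ** psi X') (Psi ?V ** Psi ?Z ** Psi X')"
    by (simp only: matrix_mul_assoc[symmetric] S_block_mult)
  have "psi (X ** X') = psi ?V ** psi ?Z ** psi X'"
    by (rule decomposition_unique(2)[OF O_up_mult[OF X X'] pi2_Omega[OF V] _ _ XX])
       (intro SO_mult decomposition(1,2) V Z X')+
  moreover have "psi ?V = rho (Theta (?b, ?m))"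
    using Theta_props(2)[OF pi2_Omega[OF X] m] by simp
  \<comment> \<open>Since \<open>psi\<close> sees only the upper left block, \<open>Psi X\<close>
    may be replaced by the identity here, which brings \<open>?Z\<close> into the form covered by
    \<open>eta_matrix_char\<close>.\<close>
  moreover have "psi ?Z = rho (eta (?b', ?r)) ** ?r"
  proof -
    note r = decomposition(1)[OF X]
    note Z1 = rotate_section[OF pi2_Omega[OF X'] r S_block_rotation_O_up[OF r] SO_one]
    have "psi ?Z = psi (S_block ?r (mat 1) ** P_mat ?b')"
      by (rule psi_row_cong[OF Z(1) Z1(1)]) (simp add: Z(3) Z1(3))
    also have "\<dots> = \<dots> ** (transpose ?r ** ?r)" by (simp add: SO_transpose_mult[OF r])
    also have "\<dots> = rho (eta (?b', ?r)) ** ?r"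
      unfolding eta_props(2)[OF pi2_Omega[OF X'] r] eta_matrix_char(1)[OF pi2_Omega[OF X'] r] SO_inv[OF r]
      by (simp add: matrix_mul_assoc)
    finally show ?thesis .
  qed
  ultimately show ?thesis by (simp add: zeta_def rho_add matrix_mul_assoc)
qed

lemma zeta_one: "zeta (mat 1) (mat 1) = 0"
proof -
  have "matrix_inv (mat 1 :: real^2^2) = mat 1" by (rule matrix_inv_unique) simp
  then show ?thesis by (simp add: zeta_def psi_one Theta_props(3) eta_props(3))
qed

lemma continuous_on_zeta: "continuous_on (O_up \<times> O_up) (\<lambda>(X, X'). zeta X X')"
proof -
  let ?S = "O_up \<times> O_up :: ('a mat_full \<times> 'a mat_full) set"
  note c = smooth_on_imp_continuous_on[OF smooth_on_pi2] smooth_on_imp_continuous_on[OF smooth_on_psi(1)]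
    smooth_on_imp_continuous_on[OF smooth_on_psi(2)]
  have cf: "continuous_on ?S (\<lambda>p. f (fst p))" "continuous_on ?S (\<lambda>p. f (snd p))"
    if "continuous_on O_up f" for f :: "'a mat_full \<Rightarrow> 'c::euclidean_space"
    using that by (auto intro!: continuous_on_compose2[OF that] continuous_intros)
  have 1: "continuous_on ?S (\<lambda>p. (pi2 (fst p), Psi (fst p) ** pi2 (snd p) ** transpose (psi (fst p))))"
    by (intro continuous_on_Pair continuous_on_matrix_mul cf c bounded_linear.continuous_on[OF bounded_linear_transpose])
  have 2: "continuous_on ?S (\<lambda>p. (pi2 (snd p), psi (fst p)))"
    by (intro continuous_on_Pair cf c)
  have inv: "matrix_inv (psi (fst p)) = transpose (psi (fst p))" if "p \<in> ?S" for p
    using that decomposition(1) by (intro SO_inv) (auto simp: mem_Times_iff)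
  have "continuous_on ?S (\<lambda>p. Theta (pi2 (fst p), Psi (fst p) ** pi2 (snd p) ** transpose (psi (fst p))) + eta (pi2 (snd p), psi (fst p)))"
  proof (intro continuous_on_add continuous_on_compose2[OF Theta_props(1) 1] continuous_on_compose2[OF eta_props(1) 2])
    show "(\<lambda>p. (pi2 (fst p), Psi (fst p) ** pi2 (snd p) ** transpose (psi (fst p)))) ` ?S \<subseteq> Omega \<times> Omega"
      using zeta_arg_Omega pi2_Omega inv by fastforce
    show "(\<lambda>p. (pi2 (snd p), psi (fst p))) ` ?S \<subseteq> Omega \<times> SO"
      using pi2_Omega decomposition(1) by auto
  qed
  then show ?thesis
    by (rule continuous_on_cong[THEN iffD1, rotated 2]) (use inv in \<open>auto simp: zeta_def\<close>)
qed

subsection \<open>The cocycle \<open>zeta\<close>\<close>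

lemma zeta_angle:
  assumes "X \<in> O_up" "Y \<in> O_up" "psi X = rho a" "psi Y = rho b" "psi (X ** Y) = rho c"
  shows "\<exists>n::int. zeta X Y + a + b = c + 2 * pi * n"
proof -
  have "rho (zeta X Y + a + b) = rho c"
    using rho_zeta[OF assms(1,2)] assms(3-) by (simp add: rho_add)
  then show ?thesis using rho_eq_iff by metis
qed

lemma continuous_on_zeta2:
  assumes "continuous_on S f" "continuous_on S g" "f ` S \<subseteq> O_up" "g ` S \<subseteq> O_up"
  shows "continuous_on S (\<lambda>x. zeta (f x) (g x))"
  by (rule continuous_on_binop[OF continuous_on_zeta assms(1,2)]) (use assms in auto)

text \<open>Let a, b, c be angles of \<open>psi\<close> at the three arguments. By
  \<open>zeta_angle\<close>, either side plus a + b + c is an angle of \<open>psi\<close> at the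
  triple product, so the sides differ by a multiple of 2 pi. They are continuous on a connected set
  and agree at the identity.\<close>

lemma zeta_cocycle:
  assumes "X \<in> O_up" "Y \<in> O_up" "Z \<in> O_up"
  shows "zeta X Y + zeta (X ** Y) Z = zeta Y Z + zeta X (Y ** Z)"
proof -
  let ?S = "O_up \<times> O_up \<times> O_up :: ('a mat_full \<times> 'a mat_full \<times> 'a mat_full) set"
  let ?h = "\<lambda>p. zeta (fst p) (fst (snd p)) + zeta (fst p ** fst (snd p)) (snd (snd p))"
  let ?h' = "\<lambda>p. zeta (fst (snd p)) (snd (snd p)) + zeta (fst p) (fst (snd p) ** snd (snd p))"
  have "?h (X, Y, Z) = ?h' (X, Y, Z)"
  proof (rule angle_unique[of ?S ?h ?h'])
    show "connected ?S" by (intro connected_Times connected_O_up)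
    show "continuous_on ?S ?h" "continuous_on ?S ?h'"
      by (intro continuous_intros continuous_on_zeta2 continuous_on_matrix_mul; auto simp: O_up_mult)+
    show "(mat 1, mat 1, mat 1) \<in> ?S" by (simp add: O_up_one)
    show "(X, Y, Z) \<in> ?S" using assms by simp
    fix p assume "p \<in> ?S"
    then obtain A B C where p: "p = (A, B, C)" "A \<in> O_up" "B \<in> O_up" "C \<in> O_up" by auto
    obtain a b c ab bc abc where t: "psi A = rho a" "psi B = rho b" "psi C = rho c" "psi (A ** B) = rho ab"
      "psi (B ** C) = rho bc" "psi (A ** B ** C) = rho abc"
      using p SO_rho decomposition(1) O_up_mult by (metis (no_types, lifting))
    obtain n1 n2 n3 n4 :: int where "zeta A B + a + b = ab + 2 * pi * n1" "zeta (A ** B) C + ab + c = abc + 2 * pi * n2"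
      "zeta B C + b + c = bc + 2 * pi * n3" "zeta A (B ** C) + a + bc = abc + 2 * pi * n4"
      using zeta_angle[OF p(2,3) t(1,2,4)] zeta_angle[OF O_up_mult[OF p(2,3)] p(4) t(4,3,6)]
        zeta_angle[OF p(3,4) t(2,3,5)] zeta_angle[OF p(2) O_up_mult[OF p(3,4)] t(1,5)] t(6)
      by (metis matrix_mul_assoc)
    then have "?h' p = ?h p + 2 * pi * of_int (n3 + n4 - n1 - n2)"
      using p(1) by (simp add: algebra_simps)
    then show "\<exists>n::int. ?h' p = ?h p + 2 * pi * n" by blast
  qed simp
  then show ?thesis by simp
qed

lemma zeta_unit:
  assumes "X \<in> O_up" shows "zeta (mat 1) X = 0" "zeta X (mat 1) = 0"
proof -
  have one: "psi (mat 1 :: 'a mat_full) = rho 0" by (simp add: psi_one)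
  have z: "\<exists>n::int. 0 = zeta (mat 1) Y + 2 * pi * n" "\<exists>n::int. 0 = zeta Y (mat 1) + 2 * pi * n"
    if "Y \<in> O_up" for Y :: "'a mat_full"
  proof -
    obtain t where t: "psi Y = rho t" using SO_rho[OF decomposition(1)[OF \<open>Y \<in> O_up\<close>]] by blast
    obtain m n :: int where "zeta (mat 1) Y + 0 + t = t + 2 * pi * m" "zeta Y (mat 1) + t + 0 = t + 2 * pi * n"
      using zeta_angle[OF O_up_one \<open>Y \<in> O_up\<close> one t, of t] zeta_angle[OF \<open>Y \<in> O_up\<close> O_up_one t one, of t] t
      by (metis matrix_mul_lid matrix_mul_rid)
    then have "0 = zeta (mat 1) Y + 2 * pi * of_int (-m)" "0 = zeta Y (mat 1) + 2 * pi * of_int (-n)" by simp_all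
    then show "\<exists>n::int. 0 = zeta (mat 1) Y + 2 * pi * n" "\<exists>n::int. 0 = zeta Y (mat 1) + 2 * pi * n" by blast+
  qed
  show "zeta (mat 1) X = 0"
    by (rule angle_unique[where S = O_up and h = "\<lambda>X. zeta (mat 1) X" and h' = "\<lambda>_. 0" and a = "mat 1"])
       (use z(1) assms in \<open>auto intro!: continuous_on_zeta2 continuous_intros simp: O_up_one zeta_one connected_O_up\<close>)
  show "zeta X (mat 1) = 0"
    by (rule angle_unique[where S = O_up and h = "\<lambda>X. zeta X (mat 1)" and h' = "\<lambda>_. 0" and a = "mat 1"])
       (use z(2) assms in \<open>auto intro!: continuous_on_zeta2 continuous_intros simp: O_up_one zeta_one connected_O_up\<close>)
qed

subsection \<open>The groups\<close>

definition spin_group :: "('m::{finite,linorder}) clifford monoid" where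
  "spin_group = \<lparr>carrier = Spin, mult = (\<odot>), one = cl_one\<rparr>"

lemma Spin_simps:
  assumes "x \<in> Spin" shows "x \<odot> clrev x = cl_one" "clrev x \<odot> x = cl_one" "x \<odot> (clrev x \<odot> y) = y" "clrev x \<odot> (x \<odot> y) = y"
  using pspinD[of x] assms Spin_pspin by blast+

lemma smat_Spin_mult: "x \<in> Spin \<Longrightarrow> y \<in> Spin \<Longrightarrow> smat (x \<odot> y) = smat x ** smat y"
  using smat_mult Spin_pspin by blast

lemma smat_Spin_rev: "x \<in> Spin \<Longrightarrow> smat (clrev x) = padj (smat x)"
  using smat_rev Spin_pspin by blast

lemma group_spin: "group (spin_group :: 'm::{finite,linorder} clifford monoid)"
proof (rule groupI)
  fix x :: "'m clifford" assume "x \<in> carrier spin_group"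
  then show "\<exists>y\<in>carrier spin_group. y \<otimes>\<^bsub>spin_group\<^esub> x = \<one>\<^bsub>spin_group\<^esub>"
    by (intro bexI[of _ "clrev x"]) (auto simp: spin_group_def Spin_simps Spin_rev)
qed (auto simp: spin_group_def Spin_mult Spin_one cl_assoc)

lemma inv_spin: "x \<in> Spin \<Longrightarrow> inv\<^bsub>spin_group\<^esub> x = clrev x"
  by (intro group.inv_equality[OF group_spin]) (auto simp: spin_group_def Spin_rev Spin_simps)

lemma S_hat_iff: "(x, \<tau>) \<in> S_hat \<longleftrightarrow> x \<in> Spin \<and> psi (smat x) = rho \<tau>"
  by (auto simp: S_hat_def spin_cover_Spin)

lemma S_hat_polar: "(x, \<tau>) \<in> S_hat \<longleftrightarrow> x \<in> Spin \<and> polar (smat x $ Inl 1 $ Inl 1) (smat x $ Inl 1 $ Inl 0) \<tau>"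
  using psi_polar[OF smat_Spin] S_hat_iff by blast

lemma S_hat_mult_simp: "x \<in> Spin \<Longrightarrow> y \<in> Spin \<Longrightarrow> S_hat_mult (x, s) (y, t) = (x \<odot> y, s + t + zeta (smat x) (smat y))"
  by (simp add: S_hat_mult_def spin_cover_Spin)

lemma S_hat_mult_closed:
  assumes "(x, s) \<in> S_hat" "(y, t) \<in> S_hat" shows "S_hat_mult (x, s) (y, t) \<in> S_hat"
proof -
  have xy: "x \<in> Spin" "y \<in> Spin" "psi (smat x) = rho s" "psi (smat y) = rho t" using assms by (auto simp: S_hat_iff)
  have "rho (s + t + zeta (smat x) (smat y)) = rho (zeta (smat x) (smat y) + s + t)" by (simp add: ac_simps)
  also have "\<dots> = psi (smat (x \<odot> y))"
    using rho_zeta[OF smat_Spin smat_Spin, of x y] xy by (simp add: rho_add smat_Spin_mult)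
  finally show ?thesis using xy by (simp add: S_hat_mult_simp S_hat_iff Spin_mult)
qed

text \<open>The second component is the solution of the equation saying that the product with
  \<open>p\<close> from the right has second component 0.\<close>

definition S_hat_inv :: "('m::{finite,linorder}) clifford \<times> real \<Rightarrow> 'm clifford \<times> real" where
  "S_hat_inv p = (clrev (fst p), - snd p - zeta (smat (clrev (fst p))) (smat (fst p)))"

lemma S_hat_one: "(cl_one, 0) \<in> S_hat"
  by (simp add: S_hat_iff Spin_one smat_one psi_one)

lemma S_hat_inv_closed:
  assumes "p \<in> S_hat" shows "S_hat_inv p \<in> S_hat"
proof -
  obtain x t where p: "p = (x, t)" "x \<in> Spin" "psi (smat x) = rho t" using assms by (cases p) (auto simp: S_hat_iff)
  have x': "clrev x \<in> Spin" by (rule Spin_rev[OF p(2)])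
  obtain u where u: "psi (smat (clrev x)) = rho u" using SO_rho[OF decomposition(1)[OF smat_Spin[OF x']]] by blast
  have "smat (clrev x) ** smat x = mat 1" using smat_Spin_mult[OF x' p(2)] p(2) by (simp add: Spin_simps smat_one)
  then obtain n :: int where "zeta (smat (clrev x)) (smat x) + u + t = 0 + 2 * pi * n"
    using zeta_angle[OF smat_Spin[OF x'] smat_Spin[OF p(2)] u p(3), of 0] by (auto simp: psi_one)
  then have "- t - zeta (smat (clrev x)) (smat x) = u + 2 * pi * of_int (- n)" by simp
  then have "rho u = rho (- t - zeta (smat (clrev x)) (smat x))" unfolding rho_eq_iff by blast
  then show ?thesis using p x' u by (simp add: S_hat_inv_def S_hat_iff)
qed

lemma S_hat_inv_left: "p \<in> S_hat \<Longrightarrow> S_hat_mult (S_hat_inv p) p = (cl_one, 0)"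
  by (cases p) (simp add: S_hat_inv_def S_hat_iff S_hat_mult_simp Spin_rev Spin_simps)

lemma group_S_hat: "group (S_hat_group :: ('m::{finite,linorder} clifford \<times> real) monoid)"
proof (rule groupI)
  fix p :: "'m clifford \<times> real" assume "p \<in> carrier S_hat_group"
  then show "\<exists>q\<in>carrier S_hat_group. q \<otimes>\<^bsub>S_hat_group\<^esub> p = \<one>\<^bsub>S_hat_group\<^esub>"
    by (intro bexI[of _ "S_hat_inv p"]) (auto simp: S_hat_group_def S_hat_inv_left S_hat_inv_closed)
next
  fix p q r :: "'m clifford \<times> real"
  assume "p \<in> carrier S_hat_group" "q \<in> carrier S_hat_group" "r \<in> carrier S_hat_group"
  then obtain x s y t z u where p: "p = (x, s)" "q = (y, t)" "r = (z, u)" "x \<in> Spin" "y \<in> Spin" "z \<in> Spin"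
    by (cases p; cases q; cases r) (auto simp: S_hat_group_def S_hat_iff)
  have "S_hat_mult (S_hat_mult p q) r = S_hat_mult p (S_hat_mult q r)"
    using p zeta_cocycle[OF smat_Spin[OF p(4)] smat_Spin[OF p(5)] smat_Spin[OF p(6)]]
    by (simp add: S_hat_mult_simp Spin_mult smat_Spin_mult cl_assoc)
  then show "p \<otimes>\<^bsub>S_hat_group\<^esub> q \<otimes>\<^bsub>S_hat_group\<^esub> r = p \<otimes>\<^bsub>S_hat_group\<^esub> (q \<otimes>\<^bsub>S_hat_group\<^esub> r)"
    by (simp add: S_hat_group_def)
next
  fix p q :: "'m clifford \<times> real"
  assume "p \<in> carrier S_hat_group" "q \<in> carrier S_hat_group"
  then show "p \<otimes>\<^bsub>S_hat_group\<^esub> q \<in> carrier S_hat_group"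
    by (cases p; cases q) (simp add: S_hat_group_def S_hat_mult_closed)
next
  fix p :: "'m clifford \<times> real" assume "p \<in> carrier S_hat_group"
  then show "\<one>\<^bsub>S_hat_group\<^esub> \<otimes>\<^bsub>S_hat_group\<^esub> p = p"
    by (cases p) (simp add: S_hat_group_def S_hat_iff S_hat_mult_simp Spin_one smat_one zeta_unit smat_Spin)
qed (simp add: S_hat_group_def S_hat_one)

lemma inv_S_hat: "p \<in> S_hat \<Longrightarrow> inv\<^bsub>S_hat_group\<^esub> p = S_hat_inv p"
  by (intro group.inv_equality[OF group_S_hat]) (auto simp: S_hat_group_def S_hat_inv_left S_hat_inv_closed)

lemma smooth_on_smat_entry:
  "smooth_on S f \<Longrightarrow> smooth_on S (\<lambda>x. smat (f x) $ i $ j)"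
  by (intro smooth_on_nth smooth_on_compose[OF smooth_on_smat[of UNIV]]) auto

text \<open>The second component of the product is continuous and is an angle of two entries of
  \<open>smat\<close> of the first component. Hence \<open>smooth_on_polar_lift\<close> gives its
  smoothness from continuity of \<open>zeta\<close>.\<close>

lemma smooth_on_S_hat_mult: "smooth_on (S_hat \<times> S_hat) (\<lambda>(p, q). S_hat_mult p q)"
proof -
  let ?S = "S_hat \<times> S_hat :: (('a clifford \<times> real) \<times> ('a clifford \<times> real)) set"
  let ?x = "\<lambda>pq :: ('a clifford \<times> real) \<times> ('a clifford \<times> real). fst (fst pq)" let ?y = "\<lambda>pq :: ('a clifford \<times> real) \<times> ('a clifford \<times> real). fst (snd pq)"
  let ?h = "\<lambda>pq. snd (fst pq) + snd (snd pq) + zeta (smat (?x pq)) (smat (?y pq))"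
  have sp: "?x pq \<in> Spin" "?y pq \<in> Spin" if "pq \<in> ?S" for pq using that by (auto simp: S_hat_def)
  have eq: "(case pq of (p, q) \<Rightarrow> S_hat_mult p q) = (?x pq \<odot> ?y pq, ?h pq)" if "pq \<in> ?S" for pq
    using sp[OF that] by (cases pq; cases "fst pq"; cases "snd pq") (simp add: S_hat_mult_simp)
  have smxy: "smooth_on ?S (\<lambda>pq. ?x pq \<odot> ?y pq)"
    by (intro smooth_on_cl smooth_on_fst smooth_on_snd smooth_on_id)
  have "smooth_on ?S ?h"
  proof (rule smooth_on_polar_lift[OF _ smooth_on_smat_entry[OF smxy] smooth_on_smat_entry[OF smxy]])
    show "continuous_on ?S ?h"
      by (intro continuous_intros continuous_on_zeta2 continuous_on_compose2[OF continuous_on_smat[of UNIV]])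
         (auto simp: smat_Spin sp S_hat_def)
    fix pq assume pq: "pq \<in> ?S"
    have "(?x pq \<odot> ?y pq, ?h pq) \<in> S_hat"
    proof -
      have "S_hat_mult (fst pq) (snd pq) \<in> S_hat"
        using pq S_hat_mult_closed by (metis mem_Times_iff prod.collapse)
      then show ?thesis using eq[OF pq] by (simp add: case_prod_beta)
    qed
    then show "polar (smat (?x pq \<odot> ?y pq) $ Inl 1 $ Inl 1) (smat (?x pq \<odot> ?y pq) $ Inl 1 $ Inl 0) (?h pq)"
      by (simp add: S_hat_polar)
  qed
  then have "smooth_on ?S (\<lambda>pq. (?x pq \<odot> ?y pq, ?h pq))" by (rule smooth_on_Pair[OF smxy])
  then show ?thesis by (rule smooth_on_cong) (simp only: eq)
qed

lemma smooth_on_S_hat_inv: "smooth_on S_hat S_hat_inv"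
proof -
  let ?S = "S_hat :: ('a clifford \<times> real) set"
  let ?h = "\<lambda>p. - snd p - zeta (smat (clrev (fst p))) (smat (fst p))"
  have smr: "smooth_on ?S (\<lambda>p. clrev (fst p))"
    by (intro smooth_on_linear_compose[OF bounded_linear_clrev] smooth_on_fst smooth_on_id)
  have "smooth_on ?S ?h"
  proof (rule smooth_on_polar_lift[OF _ smooth_on_smat_entry[OF smr] smooth_on_smat_entry[OF smr]])
    show "continuous_on ?S ?h"
      by (intro continuous_intros continuous_on_zeta2 continuous_on_compose2[OF continuous_on_smat[of UNIV]] continuous_on_clrev)
         (auto simp: smat_Spin Spin_rev S_hat_def)
    fix p assume "p \<in> ?S"
    from S_hat_inv_closed[OF this]
    show "polar (smat (clrev (fst p)) $ Inl 1 $ Inl 1) (smat (clrev (fst p)) $ Inl 1 $ Inl 0) (?h p)"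
      by (simp add: S_hat_inv_def S_hat_polar)
  qed
  then show ?thesis unfolding S_hat_inv_def by (rule smooth_on_Pair[OF smr])
qed

subsection \<open>Charts\<close>

text \<open>One ambient chart that straightens \<open>N\<close> to \<open>E\<close> and
  \<open>M\<close> to \<open>F\<close> at once. Its domains are open in the whole space; the
  relatively open sets demanded by the definition arise by intersecting with \<open>N\<close> and
  \<open>E\<close>.\<close>

lemma embedded_submanifoldI:
  fixes M N E F :: "'a::euclidean_space set"
  assumes "M \<subseteq> N" "subspace E" "subspace F" "F \<subseteq> E"
    "\<And>x. x \<in> M \<Longrightarrow> \<exists>U V \<phi> \<phi>'. open U \<and> x \<in> U \<and> open V \<and> smooth_on U \<phi> \<and> smooth_on V \<phi>' \<and>
       (\<forall>x\<in>U. \<phi> x \<in> V \<and> \<phi>' (\<phi> x) = x \<and> (x \<in> N \<longrightarrow> \<phi> x \<in> E) \<and> (x \<in> M \<longrightarrow> \<phi> x \<in> F)) \<and>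
       (\<forall>y\<in>V. \<phi>' y \<in> U \<and> \<phi> (\<phi>' y) = y \<and> (y \<in> E \<longrightarrow> \<phi>' y \<in> N) \<and> (y \<in> F \<longrightarrow> \<phi>' y \<in> M))"
  shows "embedded_submanifold M N"
  unfolding embedded_submanifold_def
proof (rule conjI, rule assms, rule exI[of _ "dim F"], rule exI[of _ "dim E"], rule ballI)
  fix x assume x: "x \<in> M"
  obtain U V \<phi> \<phi>' where c: "open U" "x \<in> U" "open V" "smooth_on U \<phi>" "smooth_on V \<phi>'"
    and f: "\<And>x. x \<in> U \<Longrightarrow> \<phi> x \<in> V \<and> \<phi>' (\<phi> x) = x \<and> (x \<in> N \<longrightarrow> \<phi> x \<in> E) \<and> (x \<in> M \<longrightarrow> \<phi> x \<in> F)"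
    and b: "\<And>y. y \<in> V \<Longrightarrow> \<phi>' y \<in> U \<and> \<phi> (\<phi>' y) = y \<and> (y \<in> E \<longrightarrow> \<phi>' y \<in> N) \<and> (y \<in> F \<longrightarrow> \<phi>' y \<in> M)"
    using assms(5)[OF x] by (elim exE conjE) blast
  have s: "smooth_on (N \<inter> U) \<phi>" "smooth_on (E \<inter> V) \<phi>'"
    using c smooth_on_subset by blast+
  have hom: "homeomorphism (N \<inter> U) (E \<inter> V) \<phi> \<phi>'"
    by (rule homeomorphismI) (use f b s smooth_on_imp_continuous_on in auto)
  have im: "\<phi> ` (M \<inter> (N \<inter> U)) = (E \<inter> V) \<inter> F"
  proof
    show "\<phi> ` (M \<inter> (N \<inter> U)) \<subseteq> (E \<inter> V) \<inter> F" using f assms(4) by blast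
    show "(E \<inter> V) \<inter> F \<subseteq> \<phi> ` (M \<inter> (N \<inter> U))"
    proof
      fix y assume y: "y \<in> (E \<inter> V) \<inter> F"
      then have "\<phi>' y \<in> M \<inter> (N \<inter> U)" using b by auto
      moreover have "\<phi> (\<phi>' y) = y" using b y by blast
      ultimately show "y \<in> \<phi> ` (M \<inter> (N \<inter> U))" by force
    qed
  qed
  show "\<exists>U (V :: 'a set) E' F' \<phi> \<phi>'. x \<in> U \<and> openin (top_of_set N) U \<and> subspace E' \<and> dim E' = dim E \<and> subspace F' \<and> dim F' = dim F \<and>
     F' \<subseteq> E' \<and> openin (top_of_set E') V \<and> diffeomorphism U V \<phi> \<phi>' \<and> \<phi> ` (M \<inter> U) = V \<inter> F'"
  proof (rule exI[of _ "N \<inter> U"], rule exI[of _ "E \<inter> V"], rule exI[of _ E], rule exI[of _ F],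
      rule exI[of _ \<phi>], rule exI[of _ \<phi>'], intro conjI)
    show "x \<in> N \<inter> U" using x c assms(1) by blast
    show "openin (top_of_set N) (N \<inter> U)" by (rule openin_open_Int[OF c(1)])
    show "openin (top_of_set E) (E \<inter> V)" by (rule openin_open_Int[OF c(3)])
    show "diffeomorphism (N \<inter> U) (E \<inter> V) \<phi> \<phi>'" using hom s by (simp add: diffeomorphism_def)
  qed (rule assms refl im)+
qed

text \<open>The chart is the Cayley transform of the left translate by the inverse of
  \<open>X0\<close>; the model subspace consists of the skew matrices. That \<open>cay B\<close>
  lies in the identity component for small skew \<open>B\<close> follows from its lift
  \<open>j B\<close> in \<open>Spin\<close>.\<close>

lemma embedded_O_up: "embedded_submanifold (O_up :: 'm::{finite,linorder} mat_full set) UNIV"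
proof (rule embedded_submanifoldI[where E = UNIV and F = "{B. padj B = - B}"])
  show "subspace {B :: 'm mat_full. padj B = - B}" by (auto simp: subspace_def padj_simps)
  obtain \<epsilon> and j :: "'m mat_full \<Rightarrow> 'm clifford" where e: "\<epsilon> > 0"
    "\<And>B :: 'm mat_full. B \<in> ball 0 \<epsilon> \<Longrightarrow> det (mat 1 + B) \<noteq> 0"
    "\<And>B. B \<in> ball 0 \<epsilon> \<Longrightarrow> padj B = - B \<Longrightarrow> j B \<in> Spin \<and> smat (j B) = cay B \<and> bmat (j B) = B"
    using local_spin_chart by metis
  fix X0 :: "'m mat_full" assume X0: "X0 \<in> O_up"
  then have po: "X0 \<in> pseudo_orthogonal" using O_up_subset by blast
  define z where "z X = padj X0 ** X" for X :: "'m mat_full"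
  define U1 where "U1 = {X. det (mat 1 + z X) \<noteq> 0}"
  define U where "U = U1 \<inter> (\<lambda>X. cay (z X)) -` ball 0 \<epsilon>"
  have smz: "smooth_on S z" for S unfolding z_def by (intro smooth_on_matrix_mul smooth_on_const smooth_on_id)
  have opU1: "open U1" unfolding U1_def
    by (intro open_Collect_neq continuous_on_const smooth_on_imp_continuous_on smooth_on_det smooth_on_add smooth_on_const smz)
  have smc: "smooth_on U1 (\<lambda>X. cay (z X))" by (intro smooth_on_cay smz) (simp add: U1_def)
  have opU: "open U" unfolding U_def
    by (intro continuous_open_preimage opU1 open_ball smooth_on_imp_continuous_on smc)
  have zX0: "z X0 = mat 1" by (simp add: z_def padj_left po)
  have cay1: "cay (mat 1 :: 'm mat_full) = 0" by (simp add: cay_def)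
  have X0z: "X0 ** z X = X" for X by (simp add: z_def matrix_mul_assoc padj_right po)
  have zX: "z (X0 ** A) = A" for A by (simp add: z_def matrix_mul_assoc padj_left po)
  have d1: "det (mat 1 + mat 1 :: 'm mat_full) \<noteq> 0"
    using cay_cay(1)[OF e(2)[of 0]] e(1) by simp
  show "\<exists>U (V :: 'm mat_full set) \<phi> \<phi>'. open U \<and> X0 \<in> U \<and> open V \<and> smooth_on U \<phi> \<and> smooth_on V \<phi>' \<and>
       (\<forall>x\<in>U. \<phi> x \<in> V \<and> \<phi>' (\<phi> x) = x \<and> (x \<in> UNIV \<longrightarrow> \<phi> x \<in> UNIV) \<and> (x \<in> O_up \<longrightarrow> \<phi> x \<in> {B. padj B = - B})) \<and>
       (\<forall>y\<in>V. \<phi>' y \<in> U \<and> \<phi> (\<phi>' y) = y \<and> (y \<in> UNIV \<longrightarrow> \<phi>' y \<in> UNIV) \<and> (y \<in> {B. padj B = - B} \<longrightarrow> \<phi>' y \<in> O_up))"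
  proof (rule exI[of _ U], rule exI[of _ "ball 0 \<epsilon> :: 'm mat_full set"], rule exI[of _ "\<lambda>X. cay (z X)"],
      rule exI[of _ "\<lambda>B. X0 ** cay B"], intro conjI ballI impI)
    show "X0 \<in> U" using d1 e(1) by (simp add: U_def U1_def zX0 cay1)
    show "smooth_on U (\<lambda>X. cay (z X))" by (rule smooth_on_subset[OF smc]) (simp add: U_def)
    show "smooth_on (ball 0 \<epsilon>) (\<lambda>B. X0 ** cay B)"
      using e(2) by (intro smooth_on_matrix_mul smooth_on_const smooth_on_cay smooth_on_id) simp
    fix X assume X: "X \<in> U"
    show "cay (z X) \<in> ball 0 \<epsilon>" using X by (simp add: U_def)
    show "X0 ** cay (cay (z X)) = X" using X cay_cay(2)[of "z X"] by (simp add: U_def U1_def X0z)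
    assume "X \<in> O_up"
    then have zpo: "z X \<in> pseudo_orthogonal" unfolding z_def
      using O_up_subset po by (blast intro: pseudo_orthogonal_mult pseudo_orthogonal_padj)
    have "det (mat 1 + z X) \<noteq> 0" using X by (simp add: U_def U1_def)
    then show "cay (z X) \<in> {B. padj B = - B}" using cay_pseudo_orthogonal_skew[OF zpo] by simp
  next
    fix B :: "'m mat_full" assume B: "B \<in> ball 0 \<epsilon>"
    show "X0 ** cay B \<in> U" using B cay_cay[OF e(2)[OF B]] by (simp add: U_def U1_def zX)
    show "cay (z (X0 ** cay B)) = B" using cay_cay[OF e(2)[OF B]] by (simp add: zX)
    assume "B \<in> {B. padj B = - B}"
    then have "padj B = - B" by simp
    from e(3)[OF B this] have "j B \<in> Spin" "smat (j B) = cay B" by simp_all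
    then have "cay B \<in> O_up" using smat_Spin[of "j B"] by simp
    then show "X0 ** cay B \<in> O_up" by (rule O_up_mult[OF X0])
  qed (use opU in auto)
qed auto

lemma polar_rotate_back:
  assumes "polar (c * cos u + s * sin u) (s * cos u - c * sin u) t" shows "polar c s (u + t)"
proof -
  obtain r where r: "r > 0" "c * cos u + s * sin u = r * cos t" "s * cos u - c * sin u = r * sin t"
    using assms by (auto simp: polar_def)
  have u: "(cos u)\<^sup>2 + (sin u)\<^sup>2 = 1" by simp
  have "r * cos (u + t) = cos u * (r * cos t) - sin u * (r * sin t)" by (simp add: cos_add algebra_simps)
  also have "\<dots> = c * ((cos u)\<^sup>2 + (sin u)\<^sup>2)" unfolding r(2,3)[symmetric] power2_eq_square by algebra
  finally have 1: "c = r * cos (u + t)" by simp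
  have "r * sin (u + t) = sin u * (r * cos t) + cos u * (r * sin t)" by (simp add: sin_add algebra_simps)
  also have "\<dots> = s * ((cos u)\<^sup>2 + (sin u)\<^sup>2)" unfolding r(2,3)[symmetric] power2_eq_square by algebra
  finally show ?thesis using 1 r(1) by (auto simp: polar_def)
qed

lemma smooth_on_bmat:
  "smooth_on S f \<Longrightarrow> (\<And>x. x \<in> S \<Longrightarrow> f x $ {} \<noteq> 0) \<Longrightarrow> smooth_on S (\<lambda>x. bmat (f x))"
  unfolding bmat_def
  by (intro smooth_on_linear_compose[OF bounded_linear_bmat0] smooth_on_scaleR smooth_on_divide smooth_on_const smooth_on_nth)

text \<open>By \<open>bmat_cay\<close> the matrix \<open>smat z\<close> is the Cayley transform of
  \<open>bmat z\<close>, so \<open>z\<close> and \<open>j (bmat z)\<close> lie over the same matrix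
  and agree up to sign. Both have positive scalar part, which excludes the minus sign.\<close>

lemma spin_chart_recover:
  assumes j: "\<And>B. B \<in> ball 0 \<epsilon> \<Longrightarrow> j B $ {} > 0"
    "\<And>B. B \<in> ball 0 \<epsilon> \<Longrightarrow> padj B = - B \<Longrightarrow> j B \<in> Spin \<and> smat (j B) = cay B \<and> bmat (j B) = B"
    and z: "z \<in> Spin" "z $ {} > 0" "det (mat 1 + smat z) \<noteq> 0" "bmat z \<in> ball 0 \<epsilon>"
  shows "z = j (bmat z)" "smat z = cay (bmat z)"
proof -
  let ?B = "cay (smat z)"
  have po: "smat z \<in> pseudo_orthogonal" using smat_Spin[OF z(1)] O_up_subset by blast
  have c: "det (mat 1 + ?B) \<noteq> 0" "cay ?B = smat z" by (rule cay_cay[OF z(3)])+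
  have b: "bmat z = ?B"
    by (rule bmat_cay) (use z c Spin_pspin in auto)
  have B: "bmat z \<in> ball 0 \<epsilon>" "padj (bmat z) = - bmat z"
    using z(4) cay_pseudo_orthogonal_skew[OF po z(3)] unfolding b by auto
  note jB = j(2)[OF B]
  show s: "smat z = cay (bmat z)" unfolding b by (rule c(2)[symmetric])
  have "z = j (bmat z) \<or> z = - j (bmat z)"
    by (rule smat_eq_imp) (use jB z(1) s Spin_pspin in auto)
  then show "z = j (bmat z)"
  proof
    assume "z = - j (bmat z)"
    then have "z $ {} = (- j (bmat z)) $ {}" by (rule arg_cong)
    also have "\<dots> = - (j (bmat z) $ {})" by simp
    finally have "z $ {} = - (j (bmat z) $ {})" .
    then show ?thesis using j(1)[OF B(1)] z(2) by linarith
  qed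
qed

text \<open>After left translation to \<open>cl_one\<close>, \<open>Spin\<close> is locally the
  image of \<open>j\<close> over the skew matrices. The coordinates are the bivector coefficients
  relative to the scalar part, the deviation of the other coefficients from those of
  \<open>j\<close>, and the deviation of \<tau> from a local angle function. The last two kinds
  vanish on \<open>S_hat\<close>.\<close>

lemma S_hat_chart:
  fixes x0 :: "'m::{finite,linorder} clifford"
  assumes xt: "(x0, \<tau>0) \<in> S_hat"
  shows "\<exists>U (V :: ('m clifford \<times> real) set) \<phi> \<phi>'. open U \<and> (x0, \<tau>0) \<in> U \<and> open V \<and> smooth_on U \<phi> \<and> smooth_on V \<phi>' \<and>
       (\<forall>x\<in>U. \<phi> x \<in> V \<and> \<phi>' (\<phi> x) = x \<and> (x \<in> Spin \<times> UNIV \<longrightarrow> \<phi> x \<in> {p. \<forall>A. card A \<noteq> 2 \<longrightarrow> fst p $ A = 0}) \<and>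
          (x \<in> S_hat \<longrightarrow> \<phi> x \<in> {p. (\<forall>A. card A \<noteq> 2 \<longrightarrow> fst p $ A = 0) \<and> snd p = 0})) \<and>
       (\<forall>y\<in>V. \<phi>' y \<in> U \<and> \<phi> (\<phi>' y) = y \<and> (y \<in> {p. \<forall>A. card A \<noteq> 2 \<longrightarrow> fst p $ A = 0} \<longrightarrow> \<phi>' y \<in> Spin \<times> UNIV) \<and>
          (y \<in> {p. (\<forall>A. card A \<noteq> 2 \<longrightarrow> fst p $ A = 0) \<and> snd p = 0} \<longrightarrow> \<phi>' y \<in> S_hat))"
proof -
  have x0: "x0 \<in> Spin" "polar (smat x0 $ Inl 1 $ Inl 1) (smat x0 $ Inl 1 $ Inl 0) \<tau>0"
    using xt by (simp_all add: S_hat_polar)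
  obtain e1 and j :: "'m mat_full \<Rightarrow> 'm clifford" where e1: "e1 > 0" "smooth_on (ball 0 e1) j" "j 0 = cl_one"
    "\<And>B :: 'm mat_full. B \<in> ball 0 e1 \<Longrightarrow> det (mat 1 + B) \<noteq> 0" "\<And>B. B \<in> ball 0 e1 \<Longrightarrow> j B $ {} > 0"
    "\<And>B. B \<in> ball 0 e1 \<Longrightarrow> padj B = - B \<Longrightarrow> j B \<in> Spin \<and> smat (j B) = cay B \<and> bmat (j B) = B"
    using local_spin_chart by metis
  define row where "row k B = (smat x0 ** cay B) $ Inl 1 $ Inl k" for k B
  \<comment> \<open>The pair \<open>c\<close>, \<open>s\<close> is the relevant row of the
    translated matrix, rotated back by \<open>\<tau>0\<close>. It points to the positive axis at 0,
    so \<open>arctan\<close> gives the local angle \<open>h\<close> with value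
    \<open>\<tau>0\<close> there.\<close>
  define c where "c B = row 1 B * cos \<tau>0 + row 0 B * sin \<tau>0" for B
  define s where "s B = row 0 B * cos \<tau>0 - row 1 B * sin \<tau>0" for B
  have smrow: "smooth_on (ball 0 e1) (row k)" for k unfolding row_def
    by (intro smooth_on_nth smooth_on_matrix_mul smooth_on_const smooth_on_cay smooth_on_id e1(4))
  have smc: "smooth_on (ball 0 e1) c" "smooth_on (ball 0 e1) s" unfolding c_def s_def
    by (intro smooth_on_add smooth_on_diff smooth_on_mult smooth_on_const smrow)+
  have c0: "c 0 > 0"
    using polar_arctan(2)[OF polar_rotate[OF x0(2), of \<tau>0]] by (simp add: c_def row_def)
  have "open (ball 0 e1 \<inter> c -` {0<..})"
    by (intro continuous_open_preimage open_ball open_greaterThan smooth_on_imp_continuous_on smc)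
  moreover have "0 \<in> ball 0 e1 \<inter> c -` {0<..}" using e1(1) c0 by simp
  ultimately obtain \<epsilon> where e: "\<epsilon> > 0" "ball 0 \<epsilon> \<subseteq> ball 0 e1 \<inter> c -` {0<..}"
    using open_contains_ball by metis
  have cpos: "c B > 0" if "B \<in> ball 0 \<epsilon>" for B using e(2) that by auto
  have j: "det (mat 1 + B) \<noteq> 0" "j B $ {} > 0" if "B \<in> ball 0 \<epsilon>" for B using e(2) e1(4,5) that by auto
  have jS: "j B \<in> Spin \<and> smat (j B) = cay B \<and> bmat (j B) = B" if "B \<in> ball 0 \<epsilon>" "padj B = - B" for B
    using e(2) e1(6) that by blast
  have smj: "smooth_on (ball 0 \<epsilon>) j" using e(2) smooth_on_subset[OF e1(2)] by blast
  define h where "h B = \<tau>0 + arctan (s B / c B)" for B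
  have smh: "smooth_on (ball 0 \<epsilon>) h" unfolding h_def
    by (intro smooth_on_add smooth_on_const smooth_on_arctan smooth_on_divide)
       (use e(2) cpos smooth_on_subset[OF smc(1)] smooth_on_subset[OF smc(2)] in \<open>auto simp: less_le\<close>)
  have hpol: "polar (row 1 B) (row 0 B) (h B)" if "B \<in> ball 0 \<epsilon>" for B
    unfolding h_def
    by (rule polar_rotate_back) (use polar_arctan_ex(1)[OF cpos[OF that]] in \<open>simp add: c_def s_def\<close>)
  have j0: "bmat cl_one = (0 :: 'm mat_full)" using jS[of 0] e(1) e1(3) by (simp add: padj_simps)
  define W where "W = {z :: 'm clifford. z $ {} > 0} \<inter> bmat -` ball 0 \<epsilon>"
  have opW0: "open {z :: 'm clifford. z $ {} > 0}"
    by (intro open_Collect_less continuous_on_const continuous_on_component continuous_on_id)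
  have smb: "smooth_on {z :: 'm clifford. z $ {} > 0} bmat"
    by (rule smooth_on_bmat[OF smooth_on_id]) auto
  have opW: "open W" unfolding W_def
    by (intro continuous_open_preimage opW0 open_ball smooth_on_imp_continuous_on smb)
  have smbW: "smooth_on W bmat" by (rule smooth_on_subset[OF smb]) (auto simp: W_def)
  have smjW: "smooth_on W (\<lambda>z. j (bmat z))" by (rule smooth_on_compose[OF smj smbW]) (auto simp: W_def)
  have smhW: "smooth_on W (\<lambda>z. h (bmat z))" by (rule smooth_on_compose[OF smh smbW]) (auto simp: W_def)
  have Wpos: "z $ {} > 0" "j (bmat z) $ {} > 0" "bmat z \<in> ball 0 \<epsilon>" if "z \<in> W" for z
    using that j(2) by (auto simp: W_def)
  define Q where "Q = {z :: 'm clifford. det (mat 1 + smat z) \<noteq> 0}"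
  have opQ: "open Q" unfolding Q_def
    by (intro open_Collect_neq continuous_on_const smooth_on_imp_continuous_on smooth_on_det smooth_on_add smooth_on_const smooth_on_smat)
  define zz where "zz p = clrev x0 \<odot> fst p" for p :: "'m clifford \<times> real"
  have smzz: "smooth_on S zz" for S unfolding zz_def by (intro smooth_on_cl smooth_on_const smooth_on_fst smooth_on_id)
  define U1 where "U1 = zz -` (W \<inter> Q)"
  have opU1: "open U1" unfolding U1_def
    using continuous_open_preimage[OF smooth_on_imp_continuous_on[OF smzz] open_UNIV open_Int[OF opW opQ]] by simp
  \<comment> \<open>Angles of one vector differ by multiples of 2 pi, so the window of half-width pi
    keeps only the sheet through \<open>\<tau>0\<close>.\<close>
  define U where "U = U1 \<inter> (\<lambda>p. snd p - h (bmat (zz p))) -` {- pi<..<pi}"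
  have smhU: "smooth_on U1 (\<lambda>p. snd p - h (bmat (zz p)))"
    by (intro smooth_on_diff smooth_on_snd smooth_on_id smooth_on_compose[OF smhW smzz]) (auto simp: U1_def)
  have opU: "open U" unfolding U_def
    by (intro continuous_open_preimage opU1 open_greaterThanLessThan smooth_on_imp_continuous_on smhU)
  \<comment> \<open>On \<open>Spin\<close> near \<open>cl_one\<close> one has z =
    \<open>j (bmat z)\<close>, so every slot outside the two-element sets vanishes there. Dividing
    by the scalar part lets the two-element slots determine \<open>bmat z\<close>.\<close>
  define \<phi>1 where "\<phi>1 z = (\<chi> A. if A = {} then z $ {} - j (bmat z) $ {} else
     if card A = 2 then z $ A / z $ {} else z $ A / z $ {} - j (bmat z) $ A / j (bmat z) $ {})" for z
  define \<phi> where "\<phi> p = (\<phi>1 (zz p), snd p - h (bmat (zz p)))" for p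
  \<comment> \<open>The inverse can be written down because the two-element slots alone give the
    Cayley parameter \<open>bmat0 w\<close>. That yields \<open>j\<close>, then the scalar part, and
    then the remaining coefficients.\<close>
  define \<psi>1 where "\<psi>1 w = (\<chi> A. if A = {} then w $ {} + j (bmat0 w) $ {} else
     (w $ {} + j (bmat0 w) $ {}) * (w $ A + (if card A = 2 then 0 else j (bmat0 w) $ A / j (bmat0 w) $ {})))" for w
  define \<psi> where "\<psi> q = (x0 \<odot> \<psi>1 (fst q), snd q + h (bmat0 (fst q)))" for q
  define D where "D = bmat0 -` ball (0 :: 'm mat_full) \<epsilon>"
  have opD: "open D" unfolding D_def
    by (rule open_vimage[OF open_ball linear_continuous_on[OF bounded_linear_bmat0]])
  have smbD: "smooth_on D bmat0" by (rule smooth_on_linear[OF bounded_linear_bmat0])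
  have smjD: "smooth_on D (\<lambda>w. j (bmat0 w))" by (rule smooth_on_compose[OF smj smbD]) (auto simp: D_def)
  have smhD: "smooth_on D (\<lambda>w. h (bmat0 w))" by (rule smooth_on_compose[OF smh smbD]) (auto simp: D_def)
  have Dpos: "j (bmat0 w) $ {} > 0" if "w \<in> D" for w using that j(2) by (auto simp: D_def)
  have smpsi1: "smooth_on D \<psi>1" unfolding \<psi>1_def
  proof (rule smooth_on_vec_lambda)
    fix A :: "(2 + 'm) set"
    show "smooth_on D (\<lambda>w. if A = {} then w $ {} + j (bmat0 w) $ {} else
     (w $ {} + j (bmat0 w) $ {}) * (w $ A + (if card A = 2 then 0 else j (bmat0 w) $ A / j (bmat0 w) $ {})))"
      by (cases "A = {}"; cases "card A = 2")
         (auto intro!: smooth_on_add smooth_on_mult smooth_on_nth smooth_on_divide smjD smooth_on_id smooth_on_const dest: Dpos)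
  qed
  have smphi1: "smooth_on W \<phi>1" unfolding \<phi>1_def
  proof (rule smooth_on_vec_lambda)
    fix A :: "(2 + 'm) set"
    show "smooth_on W (\<lambda>z. if A = {} then z $ {} - j (bmat z) $ {} else
     if card A = 2 then z $ A / z $ {} else z $ A / z $ {} - j (bmat z) $ A / j (bmat z) $ {})"
      by (cases "A = {}"; cases "card A = 2")
         (auto intro!: smooth_on_diff smooth_on_nth smooth_on_divide smjW smooth_on_id dest: Wpos)
  qed
  have c2: "card ({} :: (2 + 'm) set) \<noteq> 2" by simp
  have b1: "bmat0 (\<phi>1 z) = bmat z" for z unfolding bmat_def
    by (rule bmat0_cong) (auto simp: \<phi>1_def)
  have b2: "bmat (\<psi>1 w) = bmat0 w" if "\<psi>1 w $ {} > 0" for w unfolding bmat_def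
    by (rule bmat0_cong) (use that in \<open>auto simp: \<psi>1_def\<close>)
  have phin: "\<phi>1 z $ {} = z $ {} - j (bmat z) $ {}" "card A = 2 \<Longrightarrow> \<phi>1 z $ A = z $ A / z $ {}"
    "A \<noteq> {} \<Longrightarrow> card A \<noteq> 2 \<Longrightarrow> \<phi>1 z $ A = z $ A / z $ {} - j (bmat z) $ A / j (bmat z) $ {}" for z A
    by (auto simp: \<phi>1_def)
  have psin: "\<psi>1 w $ {} = w $ {} + j (bmat0 w) $ {}" "card A = 2 \<Longrightarrow> \<psi>1 w $ A = (w $ {} + j (bmat0 w) $ {}) * w $ A"
    "A \<noteq> {} \<Longrightarrow> card A \<noteq> 2 \<Longrightarrow> \<psi>1 w $ A = (w $ {} + j (bmat0 w) $ {}) * (w $ A + j (bmat0 w) $ A / j (bmat0 w) $ {})" for w A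
    by (auto simp: \<psi>1_def)
  have inv1: "\<psi>1 (\<phi>1 z) = z" if "z \<in> W" for z
  proof (unfold vec_eq_iff, rule allI)
    fix A show "\<psi>1 (\<phi>1 z) $ A = z $ A"
      using Wpos[OF that] by (cases "A = {}"; cases "card A = 2") (simp_all add: phin psin b1)
  qed
  have inv2: "\<phi>1 (\<psi>1 w) = w" if "w \<in> D" "\<psi>1 w $ {} > 0" for w
  proof (unfold vec_eq_iff, rule allI)
    have "w $ {} + j (bmat0 w) $ {} > 0" using that(2) by (simp add: psin)
    then show "\<phi>1 (\<psi>1 w) $ A = w $ A" for A
      using Dpos[OF that(1)] by (cases "A = {}"; cases "card A = 2") (simp_all add: phin psin b2)
  qed
  define V where "V = (D \<inter> \<psi>1 -` (W \<inter> Q)) \<times> {- pi<..<pi}"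
  have opV: "open V" unfolding V_def
    by (intro open_Times continuous_open_preimage opD open_Int opW opQ open_greaterThanLessThan smooth_on_imp_continuous_on smpsi1)
  have zpsi: "zz (\<psi> q) = \<psi>1 (fst q)" for q by (simp add: zz_def \<psi>_def Spin_simps x0(1))
  have x0zz: "x0 \<odot> zz p = fst p" for p by (simp add: zz_def Spin_simps x0(1))
  have zSpin: "zz p \<in> Spin" if "fst p \<in> Spin" for p
    unfolding zz_def by (intro Spin_mult Spin_rev x0(1) that)
  have rec: "zz p = j (bmat (zz p))" "smat (zz p) = cay (bmat (zz p))" if "p \<in> U" "fst p \<in> Spin" for p
  proof -
    have zW: "zz p \<in> W \<inter> Q" using that(1) by (auto simp: U_def U1_def)
    have q: "det (mat 1 + smat (zz p)) \<noteq> 0" using zW by (auto simp: Q_def)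
    show "zz p = j (bmat (zz p))" "smat (zz p) = cay (bmat (zz p))"
      using spin_chart_recover[OF j(2) jS zSpin[OF that(2)] _ q] Wpos[of "zz p"] zW by blast+
  qed
  have E: "\<forall>A. card A \<noteq> 2 \<longrightarrow> fst (\<phi> p) $ A = 0" if "p \<in> U" "fst p \<in> Spin" for p
    using rec(1)[OF that] by (auto simp: \<phi>_def \<phi>1_def)
  \<comment> \<open>With all surplus slots zero, the two-element slots of \<open>w\<close> are those
    of \<open>j\<close> divided by its scalar part, by \<open>bmat (j B) = B\<close>. So
    \<open>\<psi>1 w\<close> reproduces \<open>j (bmat0 w)\<close> coefficient by
    coefficient.\<close>
  have E': "\<psi>1 w = j (bmat0 w) \<and> \<psi>1 w \<in> Spin" if w: "w \<in> D" "\<forall>A. card A \<noteq> 2 \<longrightarrow> w $ A = 0" for w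
  proof -
    let ?y = "j (bmat0 w)"
    have B: "bmat0 w \<in> ball 0 \<epsilon>" using w by (auto simp: D_def)
    note jB = jS[OF B padj_bmat0]
    have "bmat0 ((1 / ?y $ {}) *\<^sub>R ?y) = bmat0 w" using jB by (simp add: bmat_def)
    then have "((1 / ?y $ {}) *\<^sub>R ?y) $ A = w $ A" if "card A = 2" for A using bmat0_eqD that by blast
    then have "?y $ A = ?y $ {} * w $ A" if "card A = 2" for A
      using that Dpos[OF w(1)] by (auto simp: field_simps)
    then have "\<psi>1 w = ?y" using w(2) c2 Dpos[OF w(1)] unfolding \<psi>1_def vec_eq_iff by auto
    then show ?thesis using jB by simp
  qed
  show ?thesis
  proof (rule exI[of _ U], rule exI[of _ V], rule exI[of _ \<phi>], rule exI[of _ \<psi>], intro conjI ballI impI)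
    show "open U" "open V" by (rule opU opV)+
    show "(x0, \<tau>0) \<in> U"
    proof -
      have zx: "zz (x0, \<tau>0) = cl_one" using x0 by (simp add: zz_def Spin_simps)
      have cc: "cay (cay (0 :: 'm mat_full)) = 0" using cay_cay(2)[of "0 :: 'm mat_full"] by simp
      have "det (mat 1 + mat 1 :: 'm mat_full) \<noteq> 0" using cay_cay(1)[of "0 :: 'm mat_full"] by simp
      then have 1: "(x0, \<tau>0) \<in> U1" using e(1) by (simp add: U1_def zx W_def j0 Q_def smat_one)
      have "s 0 / c 0 = tan 0"
      proof -
        have "arctan (s 0 / c 0) = 0"
          using polar_arctan(1)[OF polar_rotate[OF x0(2), of \<tau>0]] by (simp add: c_def s_def row_def)
        then show ?thesis by (metis tan_arctan)
      qed
      then have "h 0 = \<tau>0" by (simp add: h_def)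
      then show ?thesis using 1 by (simp add: U_def zx j0)
    qed
    show "smooth_on U \<phi>" unfolding \<phi>_def
      by (intro smooth_on_Pair smooth_on_compose[OF smphi1 smzz] smooth_on_subset[OF smhU]) (auto simp: U_def U1_def)
    show "smooth_on V \<psi>" unfolding \<psi>_def
      by (intro smooth_on_Pair smooth_on_cl smooth_on_const smooth_on_add smooth_on_snd smooth_on_id
          smooth_on_compose[OF smpsi1 smooth_on_fst[OF smooth_on_id]] smooth_on_compose[OF smhD smooth_on_fst[OF smooth_on_id]])
         (auto simp: V_def)
  next
    fix p assume p: "p \<in> U"
    then have zW: "zz p \<in> W \<inter> Q" "snd p - h (bmat (zz p)) \<in> {- pi<..<pi}" by (auto simp: U_def U1_def)
    show "\<phi> p \<in> V" using zW inv1 Wpos by (auto simp: \<phi>_def V_def D_def b1)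
    show "\<psi> (\<phi> p) = p" using zW inv1 x0zz by (auto simp: \<psi>_def \<phi>_def b1 intro: prod_eqI)
    show "\<phi> p \<in> {p. \<forall>A. card A \<noteq> 2 \<longrightarrow> fst p $ A = 0}" if "p \<in> Spin \<times> UNIV" using E[OF p] that by auto
    assume "p \<in> S_hat"
    then have ps: "fst p \<in> Spin" "polar (smat (fst p) $ Inl 1 $ Inl 1) (smat (fst p) $ Inl 1 $ Inl 0) (snd p)"
      using S_hat_polar[of "fst p" "snd p"] by auto
    let ?B = "bmat (zz p)"
    have "smat (fst p) = smat x0 ** cay ?B"
      using smat_Spin_mult[OF x0(1) zSpin[OF ps(1)]] x0zz rec(2)[OF p ps(1)] by simp
    then have "polar (row 1 ?B) (row 0 ?B) (snd p)" using ps(2) by (simp add: row_def)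
    then obtain n :: int where n: "snd p = h ?B + 2 * pi * n"
      using polar_unique[OF hpol] Wpos zW by blast
    have "- pi < snd p - h ?B" "snd p - h ?B < pi" using zW(2) by simp_all
    then have "- pi < 2 * pi * n" "2 * pi * n < pi" using n by linarith+
    then have "\<bar>2 * pi * n\<bar> < pi" by linarith
    then have "\<bar>real_of_int n\<bar> < 1" by (simp add: abs_mult)
    then have "n = 0" by linarith
    then show "\<phi> p \<in> {p. (\<forall>A. card A \<noteq> 2 \<longrightarrow> fst p $ A = 0) \<and> snd p = 0}"
      using E[OF p ps(1)] n by (auto simp: \<phi>_def)
  next
    fix q assume q: "q \<in> V"
    then have qD: "fst q \<in> D" "\<psi>1 (fst q) \<in> W \<inter> Q" "snd q \<in> {- pi<..<pi}" by (auto simp: V_def)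
    have pos: "\<psi>1 (fst q) $ {} > 0" using qD Wpos by blast
    show "\<psi> q \<in> U" using qD pos b2 by (simp add: U_def U1_def zpsi) (simp add: \<psi>_def)
    show "\<phi> (\<psi> q) = q" unfolding \<phi>_def zpsi inv2[OF qD(1) pos] b2[OF pos] by (simp add: \<psi>_def)
    show "\<psi> q \<in> Spin \<times> UNIV" if "q \<in> {p. \<forall>A. card A \<noteq> 2 \<longrightarrow> fst p $ A = 0}"
      using E'[OF qD(1)] that x0(1) by (auto simp: \<psi>_def intro!: Spin_mult)
    assume qF: "q \<in> {p. (\<forall>A. card A \<noteq> 2 \<longrightarrow> fst p $ A = 0) \<and> snd p = 0}"
    then have e: "\<psi>1 (fst q) = j (bmat0 (fst q))" "\<psi>1 (fst q) \<in> Spin" using E'[OF qD(1)] by auto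
    have B: "bmat0 (fst q) \<in> ball 0 \<epsilon>" using qD by (auto simp: D_def)
    have "smat (x0 \<odot> \<psi>1 (fst q)) = smat x0 ** cay (bmat0 (fst q))"
      using smat_Spin_mult[OF x0(1) e(2)] jS[OF B padj_bmat0] e(1) by simp
    then show "\<psi> q \<in> S_hat"
      using hpol[OF B] qF e(2) x0(1) by (auto simp: \<psi>_def S_hat_polar row_def intro!: Spin_mult)
  qed
qed

text \<open>The same chart serves both claims. Relative to \<open>Spin \<times> UNIV\<close> the
  model of the larger manifold is \<open>?E\<close>; for \<open>S_hat\<close> in the whole space, as
  \<open>lie_group\<close> requires, only \<open>?F\<close> matters.\<close>

lemma embedded_S_hat:
  "embedded_submanifold (S_hat :: ('m::{finite,linorder} clifford \<times> real) set) (Spin \<times> UNIV)"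
  "embedded_submanifold (S_hat :: ('m clifford \<times> real) set) UNIV"
proof -
  let ?E = "{p :: 'm clifford \<times> real. \<forall>A. card A \<noteq> 2 \<longrightarrow> fst p $ A = 0}"
  let ?F = "{p :: 'm clifford \<times> real. (\<forall>A. card A \<noteq> 2 \<longrightarrow> fst p $ A = 0) \<and> snd p = 0}"
  have sub: "subspace ?E" "subspace ?F" by (auto simp: subspace_def)
  show "embedded_submanifold (S_hat :: ('m clifford \<times> real) set) (Spin \<times> UNIV)"
  proof (rule embedded_submanifoldI[where E = ?E and F = ?F])
    fix p :: "'m clifford \<times> real" assume "p \<in> S_hat"
    then show "\<exists>U V \<phi> \<phi>'. open U \<and> p \<in> U \<and> open V \<and> smooth_on U \<phi> \<and> smooth_on V \<phi>' \<and>
       (\<forall>x\<in>U. \<phi> x \<in> V \<and> \<phi>' (\<phi> x) = x \<and> (x \<in> Spin \<times> UNIV \<longrightarrow> \<phi> x \<in> ?E) \<and> (x \<in> S_hat \<longrightarrow> \<phi> x \<in> ?F)) \<and>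
       (\<forall>y\<in>V. \<phi>' y \<in> U \<and> \<phi> (\<phi>' y) = y \<and> (y \<in> ?E \<longrightarrow> \<phi>' y \<in> Spin \<times> UNIV) \<and> (y \<in> ?F \<longrightarrow> \<phi>' y \<in> S_hat))"
      using S_hat_chart[of "fst p" "snd p"] by simp
  qed (use sub in \<open>auto simp: S_hat_def\<close>)
  show "embedded_submanifold (S_hat :: ('m clifford \<times> real) set) UNIV"
  proof (rule embedded_submanifoldI[where E = UNIV and F = ?F])
    fix p :: "'m clifford \<times> real" assume "p \<in> S_hat"
    then have "\<exists>U (V :: ('m clifford \<times> real) set) \<phi> \<phi>'. open U \<and> p \<in> U \<and> open V \<and> smooth_on U \<phi> \<and> smooth_on V \<phi>' \<and>
       (\<forall>x\<in>U. \<phi> x \<in> V \<and> \<phi>' (\<phi> x) = x \<and> (x \<in> Spin \<times> UNIV \<longrightarrow> \<phi> x \<in> ?E) \<and> (x \<in> S_hat \<longrightarrow> \<phi> x \<in> ?F)) \<and>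
       (\<forall>y\<in>V. \<phi>' y \<in> U \<and> \<phi> (\<phi>' y) = y \<and> (y \<in> ?E \<longrightarrow> \<phi>' y \<in> Spin \<times> UNIV) \<and> (y \<in> ?F \<longrightarrow> \<phi>' y \<in> S_hat))"
      using S_hat_chart[of "fst p" "snd p"] by simp
    then show "\<exists>U V \<phi> \<phi>'. open U \<and> p \<in> U \<and> open (V :: ('m clifford \<times> real) set) \<and> smooth_on U \<phi> \<and> smooth_on V \<phi>' \<and>
       (\<forall>x\<in>U. \<phi> x \<in> V \<and> \<phi>' (\<phi> x) = x \<and> (x \<in> UNIV \<longrightarrow> \<phi> x \<in> UNIV) \<and> (x \<in> S_hat \<longrightarrow> \<phi> x \<in> ?F)) \<and>
       (\<forall>y\<in>V. \<phi>' y \<in> U \<and> \<phi> (\<phi>' y) = y \<and> (y \<in> UNIV \<longrightarrow> \<phi>' y \<in> UNIV) \<and> (y \<in> ?F \<longrightarrow> \<phi>' y \<in> S_hat))"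
      by (elim ex_forward conjE) (intro conjI; blast)
  qed (use sub in auto)
qed

subsection \<open>Coverings\<close>

lemma local_continuous_section:
  obtains W and s :: "'m::{finite,linorder} mat_full \<Rightarrow> 'm clifford" where "open W" "mat 1 \<in> W"
    "continuous_on (W \<inter> O_up) s" "\<And>A. A \<in> W \<inter> O_up \<Longrightarrow> s A \<in> Spin \<and> smat (s A) = A"
proof -
  obtain e and j :: "'m mat_full \<Rightarrow> 'm clifford" where e: "e > 0" "smooth_on (ball 0 e) j"
    "\<And>B :: 'm mat_full. B \<in> ball 0 e \<Longrightarrow> det (mat 1 + B) \<noteq> 0"
    "\<And>B. B \<in> ball 0 e \<Longrightarrow> padj B = - B \<Longrightarrow> j B \<in> Spin \<and> smat (j B) = cay B \<and> bmat (j B) = B"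
    using local_spin_chart by metis
  define Q where "Q = {A :: 'm mat_full. det (mat 1 + A) \<noteq> 0}"
  have opQ: "open Q" unfolding Q_def
    by (intro open_Collect_neq continuous_on_const smooth_on_imp_continuous_on smooth_on_det smooth_on_add smooth_on_const smooth_on_id)
  have smc: "smooth_on Q cay" by (rule smooth_on_cay[OF _ smooth_on_id]) (simp add: Q_def)
  define W where "W = Q \<inter> cay -` ball 0 e"
  have opW: "open W" unfolding W_def
    by (intro continuous_open_preimage opQ open_ball smooth_on_imp_continuous_on smc)
  have c0: "cay (mat 1 :: 'm mat_full) = 0" by (simp add: cay_def)
  have d: "det (mat 1 + mat 1 :: 'm mat_full) \<noteq> 0" using cay_cay(1)[of "0 :: 'm mat_full"] by simp
  show ?thesis
  proof (rule that[of W "\<lambda>A. j (cay A)"])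
    show "mat 1 \<in> W" using d e(1) by (simp add: W_def Q_def c0)
    have "smooth_on W (\<lambda>A. j (cay A))"
      by (rule smooth_on_compose[OF e(2) smooth_on_subset[OF smc]]) (auto simp: W_def)
    then show "continuous_on (W \<inter> O_up) (\<lambda>A. j (cay A))"
      by (intro smooth_on_imp_continuous_on) (rule smooth_on_subset, auto)
    fix A assume A: "A \<in> W \<inter> O_up"
    then have dA: "det (mat 1 + A) \<noteq> 0" by (simp add: W_def Q_def)
    have "padj (cay A) = - cay A" using A O_up_subset by (intro cay_pseudo_orthogonal_skew dA) auto
    then show "j (cay A) \<in> Spin \<and> smat (j (cay A)) = A"
      using e(4)[of "cay A"] A cay_cay(2)[OF dA] by (simp add: W_def)
  qed (rule opW)
qed

lemma O_up_group_simps: "carrier O_up_group = O_up" "x \<otimes>\<^bsub>O_up_group\<^esub> y = x ** y" "\<one>\<^bsub>O_up_group\<^esub> = mat 1"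
  by (simp_all add: O_up_group_def)
lemma spin_group_simps: "carrier spin_group = Spin" "x \<otimes>\<^bsub>spin_group\<^esub> y = x \<odot> y" "\<one>\<^bsub>spin_group\<^esub> = cl_one"
  by (simp_all add: spin_group_def)
lemma S_hat_group_simps: "carrier S_hat_group = S_hat" "x \<otimes>\<^bsub>S_hat_group\<^esub> y = S_hat_mult x y" "\<one>\<^bsub>S_hat_group\<^esub> = (cl_one, 0)"
  by (simp_all add: S_hat_group_def)

lemma group_hom_spin: "group_hom spin_group O_up_group (smat :: 'm::{finite,linorder} clifford \<Rightarrow> _)"
  by (intro group_hom.intro group_hom_axioms.intro group_spin group_O_up homI)
     (auto simp: O_up_group_simps spin_group_simps smat_Spin smat_Spin_mult)

lemma group_hom_S_hat: "group_hom S_hat_group O_up_group (\<lambda>p :: 'm::{finite,linorder} clifford \<times> real. smat (fst p))"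
proof (intro group_hom.intro group_hom_axioms.intro group_S_hat group_O_up homI)
  fix p q :: "'m clifford \<times> real"
  assume "p \<in> carrier S_hat_group" "q \<in> carrier S_hat_group"
  then show "smat (fst (p \<otimes>\<^bsub>S_hat_group\<^esub> q)) = smat (fst p) \<otimes>\<^bsub>O_up_group\<^esub> smat (fst q)"
    by (cases p; cases q) (simp add: S_hat_group_simps O_up_group_simps S_hat_iff S_hat_mult_simp smat_Spin_mult)
qed (auto simp: O_up_group_simps S_hat_group_simps S_hat_def smat_Spin)

lemma continuous_on_O_up_mult: "continuous_on (carrier O_up_group \<times> carrier O_up_group) (\<lambda>(x, y). x \<otimes>\<^bsub>O_up_group\<^esub> y)"
  unfolding O_up_group_simps case_prod_beta by (intro continuous_on_matrix_mul continuous_intros)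

lemma norm_cl_one: "norm (cl_one :: 'm::{finite,linorder} clifford) = 1"
  by (simp add: cl_one_def norm_axis_1)

text \<open>The kernel consists of \<open>cl_one\<close> and \<open>- cl_one\<close>, which are at
  distance 2.\<close>

lemma kernel_isolated:
  fixes x y :: "'m::{finite,linorder} clifford"
  assumes "x \<in> Spin" "y \<in> Spin" "smat x = mat 1" "smat y = mat 1" "dist x y < 1" shows "x = y"
proof -
  have "x = cl_one \<or> x = - cl_one" "y = cl_one \<or> y = - cl_one"
    using smat_ker assms Spin_pspin by blast+
  moreover have "dist (cl_one :: 'm clifford) (- cl_one) = 2"
    using norm_scaleR[of 2 "cl_one :: 'm clifford"] by (simp add: dist_norm norm_cl_one scaleR_2)
  ultimately show ?thesis using assms(5) by (auto simp: dist_commute)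
qed

lemma covering_Spin: "covering_space Spin smat (O_up :: 'm::{finite,linorder} mat_full set)"
proof -
  obtain W and s :: "'m mat_full \<Rightarrow> 'm clifford" where W: "open W" "mat 1 \<in> W"
    "continuous_on (W \<inter> O_up) s" "\<And>A. A \<in> W \<inter> O_up \<Longrightarrow> s A \<in> Spin \<and> smat (s A) = A"
    using local_continuous_section by metis
  have "covering_space (carrier spin_group) smat (carrier (O_up_group :: 'm mat_full monoid))"
  proof (rule group_covering_space[where T = "O_up \<inter> W" and s = s, OF group_hom_spin])
    show "continuous_on (carrier spin_group \<times> carrier spin_group) (\<lambda>(x, y). x \<otimes>\<^bsub>spin_group\<^esub> y :: 'm clifford)"
      unfolding spin_group_simps case_prod_beta by (intro continuous_on_cl continuous_intros)
    show "continuous_on (carrier spin_group) (\<lambda>x. inv\<^bsub>spin_group\<^esub> x :: 'm clifford)"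
      by (rule continuous_on_cong[THEN iffD2, OF refl, of _ _ clrev])
         (auto simp: spin_group_simps inv_spin intro!: continuous_on_clrev continuous_on_id)
    show "\<exists>V. open V \<and> V \<inter> kernel spin_group O_up_group smat = {k}"
      if k: "k \<in> kernel spin_group O_up_group (smat :: 'm clifford \<Rightarrow> 'm mat_full)" for k
    proof (intro exI[of _ "ball k 1"] conjI open_ball)
      have "k' = k" if "k' \<in> kernel spin_group O_up_group (smat :: 'm clifford \<Rightarrow> 'm mat_full)" "dist k k' < 1" for k'
        using kernel_isolated[of k k'] k that by (simp add: kernel_def spin_group_simps O_up_group_simps)
      then show "ball k 1 \<inter> kernel spin_group O_up_group smat = {k}" using k by auto
    qed
  qed (use W O_up_one connected_O_up continuous_on_O_up_mult in
      \<open>auto simp: O_up_group_simps spin_group_simps Int_commute openin_open_Int continuous_on_smat\<close>)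
  then show ?thesis by (simp add: O_up_group_simps spin_group_simps)
qed

lemma lie_group_S_hat: "lie_group (S_hat_group :: ('m::{finite,linorder} clifford \<times> real) monoid)"
  unfolding lie_group_def S_hat_group_simps
proof (intro conjI group_S_hat embedded_S_hat smooth_on_S_hat_mult)
  show "smooth_on S_hat (\<lambda>x. inv\<^bsub>S_hat_group\<^esub> x :: 'm clifford \<times> real)"
    by (rule smooth_on_cong[OF smooth_on_S_hat_inv]) (simp add: inv_S_hat)
qed

lemma lie_group_O_up: "lie_group (O_up_group :: 'm::{finite,linorder} mat_full monoid)"
  unfolding lie_group_def O_up_group_simps
proof (intro conjI group_O_up embedded_O_up)
  show "smooth_on O_up (\<lambda>x. inv\<^bsub>O_up_group\<^esub> x :: 'm mat_full)"
    by (rule smooth_on_cong[OF smooth_on_linear[OF bounded_linear_padj]]) (simp add: inv_O_up)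
  show "smooth_on (O_up \<times> O_up) (\<lambda>(x, y). x ** y :: 'm mat_full)"
    unfolding case_prod_beta by (intro smooth_on_matrix_mul smooth_on_fst smooth_on_snd smooth_on_id)
qed

lemma covering_S_hat: "covering_space S_hat (\<lambda>p. smat (fst p)) (O_up :: 'm::{finite,linorder} mat_full set)"
proof -
  obtain W and s :: "'m mat_full \<Rightarrow> 'm clifford" where W: "open W" "mat 1 \<in> W"
    "continuous_on (W \<inter> O_up) s" "\<And>A. A \<in> W \<inter> O_up \<Longrightarrow> s A \<in> Spin \<and> smat (s A) = A"
    using local_continuous_section by metis
  \<comment> \<open>In the right half-plane \<open>arctan\<close> is an angle of the row, so the
    section of \<open>Spin\<close> extends to one with values in \<open>S_hat\<close>.\<close>
  define Y where "Y = W \<inter> {A :: 'm mat_full. A $ Inl 1 $ Inl 1 > 0}"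
  have opY: "open Y" unfolding Y_def
    by (intro open_Int W open_Collect_less continuous_on_const continuous_on_component continuous_on_id)
  let ?s = "\<lambda>A. (s A, arctan (A $ Inl 1 $ Inl 0 / A $ Inl 1 $ Inl 1))"
  have "covering_space (carrier S_hat_group) (\<lambda>p. smat (fst p)) (carrier (O_up_group :: 'm mat_full monoid))"
  proof (rule group_covering_space[where T = "O_up \<inter> Y" and s = ?s, OF group_hom_S_hat])
    show "continuous_on (carrier S_hat_group \<times> carrier S_hat_group) (\<lambda>(x, y). x \<otimes>\<^bsub>S_hat_group\<^esub> y :: 'm clifford \<times> real)"
      "continuous_on (carrier S_hat_group) (\<lambda>x. inv\<^bsub>S_hat_group\<^esub> x :: 'm clifford \<times> real)"
      using lie_group_S_hat[where 'm='m] smooth_on_imp_continuous_on unfolding lie_group_def by blast+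
    show "\<one>\<^bsub>O_up_group\<^esub> \<in> O_up \<inter> (Y :: 'm mat_full set)" using O_up_one W by (simp add: O_up_group_simps Y_def mat_def)
    have "continuous_on (O_up \<inter> Y) (\<lambda>A. arctan (A $ Inl 1 $ Inl 0 / A $ Inl 1 $ Inl 1))"
      by (intro continuous_intros) (auto simp: Y_def)
    moreover have "continuous_on (O_up \<inter> Y) s" by (rule continuous_on_subset[OF W(3)]) (auto simp: Y_def)
    ultimately show "continuous_on (O_up \<inter> Y) ?s" by (intro continuous_on_Pair)
    show "?s ` (O_up \<inter> Y) \<subseteq> carrier S_hat_group"
      using W(4) polar_arctan_ex(1) by (auto simp: S_hat_group_simps S_hat_polar Y_def)
    show "smat (fst (?s A)) = A" if "A \<in> O_up \<inter> Y" for A using W(4) that by (auto simp: Y_def)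
    \<comment> \<open>Over the identity the second components lie in the multiples of 2 pi and the
      first components are 1 or -1, so balls of radius 1 isolate the kernel elements.\<close>
    show "\<exists>V. open V \<and> V \<inter> kernel S_hat_group O_up_group (\<lambda>p. smat (fst p)) = {k}"
      if k: "k \<in> kernel S_hat_group O_up_group (\<lambda>p :: 'm clifford \<times> real. smat (fst p))" for k
    proof (intro exI[of _ "ball k 1"] conjI open_ball)
      have "k' = k" if k': "k' \<in> kernel S_hat_group O_up_group (\<lambda>p :: 'm clifford \<times> real. smat (fst p))" "dist k k' < 1" for k'
      proof -
        obtain x t x' t' where kk: "k = (x, t)" "k' = (x', t')" by (cases k; cases k')
        have d: "dist x x' < 1" "dist t t' < 1"
          using dist_fst_le[of k k'] dist_snd_le[of k k'] k'(2) kk by auto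
        have m: "x \<in> Spin" "x' \<in> Spin" "smat x = mat 1" "smat x' = mat 1" "psi (smat x) = rho t" "psi (smat x') = rho t'"
          using k k'(1) kk by (auto simp: kernel_def S_hat_group_simps O_up_group_simps S_hat_iff)
        then have "x = x'" using kernel_isolated d(1) by blast
        moreover have "t = t'"
        proof -
          have "rho t = rho t'" using m by simp
          then obtain n :: int where n: "t' = t + 2 * pi * n" using rho_eq_iff by blast
          then have "\<bar>2 * pi * n\<bar> < 1" using d(2) by (simp add: dist_real_def)
          then have "2 * pi * \<bar>real_of_int n\<bar> < 1" by (simp add: abs_mult)
          moreover have "2 * pi \<ge> 1" using pi_gt3 by simp
          ultimately have "\<bar>real_of_int n\<bar> < 1" by (smt (verit) mult_le_cancel_left1 mult_left_mono)
          then show ?thesis using n by simp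
        qed
        ultimately show ?thesis using kk by simp
      qed
      then show "ball k 1 \<inter> kernel S_hat_group O_up_group (\<lambda>p. smat (fst p)) = {k}" using k by auto
    qed
    show "continuous_on (carrier S_hat_group) (\<lambda>p :: 'm clifford \<times> real. smat (fst p))"
      by (intro continuous_on_compose2[OF continuous_on_smat[of UNIV]] continuous_intros) auto
    show "openin (top_of_set (carrier O_up_group)) (O_up \<inter> Y)" by (simp add: O_up_group_simps openin_open_Int opY)
    show "continuous_on (carrier O_up_group \<times> carrier O_up_group) (\<lambda>(x, y). x \<otimes>\<^bsub>O_up_group\<^esub> y :: 'm mat_full)"
      by (rule continuous_on_O_up_mult)
  qed (simp_all add: O_up_group_simps connected_O_up)
  then show ?thesis by (simp add: O_up_group_simps S_hat_group_simps)
qed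

subsection \<open>A union of two simply connected open sets with path-connected intersection\<close>

text \<open>The simply connected case of van Kampen's theorem. Every point has a unique homotopy
  class of paths from \<open>x0\<close> that stay in one piece, and every path from
  \<open>x0\<close> is followed along these classes.\<close>

lemma simply_connected_Un_open:
  fixes S :: "'a::real_normed_vector set"
  assumes S: "S = U \<union> V" and op: "openin (top_of_set S) U" "openin (top_of_set S) V"
    and sc: "simply_connected U" "simply_connected V" and pc: "path_connected (U \<inter> V)" "U \<inter> V \<noteq> {}"
  shows "simply_connected S"
proof -
  obtain x0 where x0: "x0 \<in> U" "x0 \<in> V" using pc by blast
  have pcUV: "path_connected U" "path_connected V" using sc simply_connected_imp_path_connected by auto
  \<comment> \<open>A canonical path to \<open>y\<close> runs from \<open>x0\<close> inside
    \<open>U\<close> alone or inside \<open>V\<close> alone.\<close>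
  define canon where "canon y q \<longleftrightarrow> path q \<and> pathstart q = x0 \<and> pathfinish q = y \<and> (path_image q \<subseteq> U \<or> path_image q \<subseteq> V)" for y q
  have U1: "homotopic_paths S q q'" if "path q" "path q'" "pathstart q = x0" "pathstart q' = x0" "pathfinish q = y" "pathfinish q' = y"
      "path_image q \<subseteq> A" "path_image q' \<subseteq> A" "A = U \<or> A = V" for q q' y A
  proof -
    have "homotopic_paths A q q'" using sc that unfolding simply_connected_eq_homotopic_paths by metis
    then show ?thesis by (rule homotopic_paths_subset) (use that S in auto)
  qed
  have uniq: "homotopic_paths S q q'" if c: "canon y q" "canon y q'" for y q q'
  proof (cases "\<exists>A. (A = U \<or> A = V) \<and> path_image q \<subseteq> A \<and> path_image q' \<subseteq> A")
    case True
    then show ?thesis using U1 c unfolding canon_def by blast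
  next
    case False
    then obtain A B where AB: "A = U \<and> B = V \<or> A = V \<and> B = U" "path_image q \<subseteq> A" "path_image q' \<subseteq> B"
      using c unfolding canon_def by blast
    have "y = pathfinish q" "y = pathfinish q'" using c by (simp_all add: canon_def)
    then have "y \<in> A" "y \<in> B"
      using AB(2,3) pathfinish_in_path_image[of q] pathfinish_in_path_image[of q'] by auto
    then have y: "y \<in> U \<inter> V" using AB(1) by auto
    \<comment> \<open>For canonical paths in different pieces the endpoint lies in the intersection.
      A path \<open>r\<close> there is canonical for both pieces and links the two classes.\<close>
    then obtain r where r: "path r" "path_image r \<subseteq> U \<inter> V" "pathstart r = x0" "pathfinish r = y"
      using pc(1) x0 unfolding path_connected_def by blast
    have "homotopic_paths S q r" by (rule U1[where A = A]) (use c r AB in \<open>auto simp: canon_def\<close>)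
    moreover have "homotopic_paths S r q'" by (rule U1[where A = B]) (use c r AB in \<open>auto simp: canon_def\<close>)
    ultimately show ?thesis by (rule homotopic_paths_trans)
  qed
  have pcS: "path_connected S" unfolding S by (rule path_connected_Un[OF pcUV pc(2)])
  have "homotopic_paths S p (linepath x0 x0)"
    if p: "path p" "path_image p \<subseteq> S" "pathstart p = x0" "pathfinish p = x0" for p
  proof -
    \<comment> \<open>The initial part of \<open>p\<close> up to \<open>t\<close> lies in the
      canonical class of its endpoint. At \<open>t = 1\<close> this contracts the loop.\<close>
    define Q where "Q t \<longleftrightarrow> (\<forall>q. canon (p t) q \<longrightarrow> homotopic_paths S (subpath 0 t p) q)" for t
    have contp: "continuous_on {0..1} p" using p(1) by (simp add: path_def)
    have pS: "p t \<in> S" if "t \<in> {0..1}" for t using p(2) that by (auto simp: path_image_def)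
    have step: "Q t" if st: "0 \<le> s" "s \<le> t" "t \<le> 1" "p ` {s..t} \<subseteq> A" "A = U \<or> A = V" "Q s" for s t A
    proof -
      have "path_connected A" "x0 \<in> A" "A \<subseteq> S" using st pcUV x0 S by auto
      moreover have "p s \<in> A" using st by auto
      ultimately obtain q where q: "path q" "path_image q \<subseteq> A" "pathstart q = x0" "pathfinish q = p s"
        unfolding path_connected_def by blast
      have cq: "canon (p s) q" using q st by (auto simp: canon_def)
      have sub: "path (subpath s t p)" "path_image (subpath s t p) \<subseteq> A" "pathstart (subpath s t p) = p s" "pathfinish (subpath s t p) = p t"
        using p(1) st by (auto simp: path_image_subpath)
      have c2: "canon (p t) (q +++ subpath s t p)"
        using q sub st(5) path_image_join_subset[of q "subpath s t p"] unfolding canon_def by auto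
      have h1: "homotopic_paths S (subpath 0 t p) (subpath 0 s p +++ subpath s t p)"
        by (rule homotopic_paths_sym, rule homotopic_join_subpaths1) (use p st in auto)
      have h2: "homotopic_paths S (subpath 0 s p +++ subpath s t p) (q +++ subpath s t p)"
      proof (rule homotopic_paths_join)
        show "homotopic_paths S (subpath 0 s p) q" using st(6) cq unfolding Q_def by blast
        show "homotopic_paths S (subpath s t p) (subpath s t p)"
          using sub \<open>A \<subseteq> S\<close> by (simp add: homotopic_paths_refl)
      qed (use sub in auto)
      have h: "homotopic_paths S (subpath 0 t p) (q +++ subpath s t p)"
        by (rule homotopic_paths_trans[OF h1 h2])
      show "Q t" unfolding Q_def
        by (intro allI impI) (rule homotopic_paths_trans[OF h uniq[OF c2]])
    qed
    have Q0: "Q 0"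
    proof -
      have "p 0 = x0" using p(3) by (simp add: pathstart_def)
      moreover have "subpath 0 0 p = linepath x0 x0"
        using \<open>p 0 = x0\<close> by (auto simp: subpath_def linepath_def fun_eq_iff algebra_simps)
      moreover have "canon x0 (linepath x0 x0)" using x0 by (auto simp: canon_def)
      ultimately show ?thesis unfolding Q_def using uniq by auto
    qed
    \<comment> \<open>Bisection takes the place of a Lebesgue number: near each parameter the path
      stays in one piece, where \<open>step\<close> propagates \<open>Q\<close>.\<close>
    have "0 \<le> (0::real) \<longrightarrow> 1 \<le> (1::real) \<longrightarrow> Q 0 \<longrightarrow> Q 1"
    proof (rule Bolzano[of 0 1 "\<lambda>a b. 0 \<le> a \<longrightarrow> b \<le> 1 \<longrightarrow> Q a \<longrightarrow> Q b"])
      fix x :: real assume x: "0 \<le> x" "x \<le> 1"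
      then obtain A where A: "A = U \<or> A = V" "p x \<in> A" "openin (top_of_set S) A"
        using pS[of x] S op by auto
      have "openin (top_of_set {0..1}) ({0..1} \<inter> p -` A)"
        by (rule continuous_openin_preimage[OF contp _ A(3)]) (use pS in auto)
      then have "\<forall>x\<in>{0..1} \<inter> p -` A. \<exists>e>0. \<forall>x'\<in>{0..1}. dist x' x < e \<longrightarrow> x' \<in> {0..1} \<inter> p -` A"
        unfolding openin_euclidean_subtopology_iff by (rule conjunct2)
      moreover have "x \<in> {0..1} \<inter> p -` A" using x A by auto
      ultimately obtain d where d: "d > 0" "\<And>y. y \<in> {0..1} \<Longrightarrow> dist y x < d \<Longrightarrow> p y \<in> A"
        by blast
      show "\<exists>d>0. \<forall>a b. a \<le> x \<and> x \<le> b \<and> b - a < d \<longrightarrow> 0 \<le> a \<longrightarrow> b \<le> 1 \<longrightarrow> Q a \<longrightarrow> Q b"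
      proof (intro exI[of _ d] conjI allI impI d(1))
        fix a b assume ab: "a \<le> x \<and> x \<le> b \<and> b - a < d" "0 \<le> a" "b \<le> 1" "Q a"
        show "Q b"
        proof (rule step[of a b A])
          show "p ` {a..b} \<subseteq> A" using ab d(2) by (auto simp: dist_real_def)
        qed (use ab A in auto)
      qed
    qed auto
    then have "Q 1" using Q0 by simp
    moreover have "p 1 = x0" using p(4) by (simp add: pathfinish_def)
    moreover have "canon x0 (linepath x0 x0)" using x0 by (auto simp: canon_def)
    ultimately show ?thesis unfolding Q_def by auto
  qed
  note base = this
  show ?thesis
    unfolding simply_connected_eq_contractible_loop_some
  proof (intro conjI pcS allI impI exI[of _ x0])
    show "x0 \<in> S" using x0 S by auto
    fix p assume p: "path p \<and> path_image p \<subseteq> S \<and> pathfinish p = pathstart p"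
    have "pathstart p \<in> S" using p pathstart_in_path_image by blast
    then obtain r where r: "path r" "path_image r \<subseteq> S" "pathstart r = x0" "pathfinish r = pathstart p"
      using pcS \<open>x0 \<in> S\<close> unfolding path_connected_def by blast
    \<comment> \<open>The preceding claim concerns loops at \<open>x0\<close>; a loop with another
      base point is conjugated by a path from \<open>x0\<close>, which does not change its free
      homotopy class.\<close>
    let ?L = "r +++ p +++ reversepath r"
    have "homotopic_paths S ?L (linepath x0 x0)"
      by (rule base) (use p r in \<open>auto simp: path_image_join\<close>)
    then have "homotopic_loops S ?L (linepath x0 x0)"
      by (rule homotopic_paths_imp_homotopic_loops) (use r in auto)
    moreover have "homotopic_loops S ?L p"
      by (rule homotopic_loops_conjugate) (use p r in auto)
    ultimately show "homotopic_loops S p (linepath x0 x0)"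
      using homotopic_loops_sym homotopic_loops_trans by blast
  qed
qed

subsection \<open>Spheres in coordinate subspaces\<close>

text \<open>The index set runs over positive coordinates only, so that \<open>scal\<close> restricts
  to the Euclidean inner product and the norm is the right one.\<close>

definition unit_sphere :: "'m::{finite,linorder} set \<Rightarrow> (real ^ (2 + 'm)) set" where
  "unit_sphere I = {v. (\<forall>k. k \<notin> Inr ` I \<longrightarrow> v $ k = 0) \<and> norm v = 1}"

lemma scal_positive:
  assumes "\<forall>k. k \<notin> Inr ` I \<longrightarrow> v $ k = 0" shows "scal v w = v \<bullet> w"
proof -
  have "qs i * v $ i * w $ i = v $ i * w $ i" for i
    using assms by (cases i) auto
  then show ?thesis unfolding scal_qs inner_vec_def inner_real_def by (intro sum.cong refl)
qed

lemma unit_sphere_scal: "v \<in> unit_sphere I \<Longrightarrow> scal v v = 1"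
  by (subst scal_positive[of I]) (auto simp: unit_sphere_def norm_eq_1)

lemma axis_unit_sphere: "i \<in> I \<Longrightarrow> axis (Inr i) 1 \<in> unit_sphere I"
  by (auto simp: unit_sphere_def axis_def norm_axis_1[unfolded axis_def])

lemma sgn_unit_sphere:
  assumes "\<forall>k. k \<notin> Inr ` I \<longrightarrow> v $ k = 0" "v \<noteq> 0" shows "(1 / norm v) *\<^sub>R v \<in> unit_sphere I"
  using assms by (auto simp: unit_sphere_def)

lemma segment_nz:
  fixes v w :: "'a::real_normed_vector"
  assumes "norm v = 1" "norm w = 1" "w \<noteq> - v" "0 \<le> t" "t \<le> 1"
  shows "(1 - t) *\<^sub>R v + t *\<^sub>R w \<noteq> 0"
proof
  assume 0: "(1 - t) *\<^sub>R v + t *\<^sub>R w = 0"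
  then have e: "(1 - t) *\<^sub>R v = - (t *\<^sub>R w)" by (simp add: eq_neg_iff_add_eq_0)
  have "norm ((1 - t) *\<^sub>R v) = norm (t *\<^sub>R w)" unfolding e by simp
  then have "1 - t = t" using assms by simp
  then have t: "t = 1 / 2" by simp
  then have "(1/2) *\<^sub>R (v + w) = 0" using 0 unfolding t by (simp add: scaleR_add_right)
  then show False using assms(3) by (simp add: add_eq_0_iff)
qed

text \<open>The point at parameter \<open>t\<close> of the segment from \<open>v\<close> to
  \<open>w\<close>, projected to the unit sphere; meaningful for unit vectors that are not
  antipodal.\<close>

definition slide :: "real \<Rightarrow> 'a::real_normed_vector \<Rightarrow> 'a \<Rightarrow> 'a" where
  "slide t v w = (1 / norm ((1 - t) *\<^sub>R v + t *\<^sub>R w)) *\<^sub>R ((1 - t) *\<^sub>R v + t *\<^sub>R w)"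

lemma slide_unit_sphere:
  assumes "v \<in> unit_sphere I" "w \<in> unit_sphere I" "w \<noteq> - v" "0 \<le> t" "t \<le> 1"
  shows "slide t v w \<in> unit_sphere I"
  unfolding slide_def
  by (rule sgn_unit_sphere) (use assms segment_nz[of v w t] in \<open>auto simp: unit_sphere_def\<close>)

lemma slide_ends: "norm v = 1 \<Longrightarrow> slide 0 v w = v" "norm w = 1 \<Longrightarrow> slide 1 v w = w"
  by (simp_all add: slide_def)

lemma unit_sphere_path:
  assumes "v \<in> unit_sphere I" "w \<in> unit_sphere I" "w \<noteq> - v"
  shows "path_component (unit_sphere I) v w"
proof -
  have n: "norm v = 1" "norm w = 1" using assms by (auto simp: unit_sphere_def)
  have "continuous_on {0..1} (\<lambda>t. slide t v w)" unfolding slide_def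
    by (intro continuous_intros) (use segment_nz[OF n assms(3)] in auto)
  then have "path (\<lambda>t. slide t v w)" by (simp add: path_def)
  moreover have "path_image (\<lambda>t. slide t v w) \<subseteq> unit_sphere I"
    using slide_unit_sphere[OF assms] by (auto simp: path_image_def)
  moreover have "pathstart (\<lambda>t. slide t v w) = v" "pathfinish (\<lambda>t. slide t v w) = w"
    using slide_ends n by (auto simp: pathstart_def pathfinish_def)
  ultimately show ?thesis unfolding path_component_def by blast
qed

text \<open>Antipodal points cannot be joined by \<open>slide\<close> directly and are joined
  through a third point, which exists because there are two distinct axes.\<close>

lemma path_connected_unit_sphere:
  assumes "i \<in> I" "j \<in> I" "i \<noteq> j" shows "path_connected (unit_sphere I)"
  unfolding path_connected_component
proof (intro ballI)
  fix v w assume vw: "v \<in> unit_sphere I" "w \<in> unit_sphere I"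
  show "path_component (unit_sphere I) v w"
  proof (cases "w = - v")
    case True
    let ?e = "axis (Inr i) 1 :: real ^ (2 + 'a)" let ?f = "axis (Inr j) 1 :: real ^ (2 + 'a)"
    have "\<exists>u\<in>unit_sphere I. u \<noteq> v \<and> u \<noteq> - v"
    proof (cases "?e = v \<or> ?e = - v")
      case True
      have f0: "?f $ Inr i = 0" using assms(3) by (simp add: axis_def)
      have e1: "?e $ Inr i = 1" by (simp add: axis_def)
      have "?f \<noteq> ?e" "?f \<noteq> - ?e"
        using f0 e1 arg_cong[of ?f ?e "\<lambda>u. u $ Inr i"] arg_cong[of ?f "- ?e" "\<lambda>u. u $ Inr i"] by auto
      then have "?f \<noteq> v \<and> ?f \<noteq> - v" using True by auto
      then show ?thesis using axis_unit_sphere[OF assms(2)] by blast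
    qed (use axis_unit_sphere[OF assms(1)] in blast)
    then obtain u where u: "u \<in> unit_sphere I" "u \<noteq> v" "u \<noteq> - v" by blast
    have "path_component (unit_sphere I) v u" by (rule unit_sphere_path[OF vw(1) u(1,3)])
    moreover have "path_component (unit_sphere I) u w"
      by (rule unit_sphere_path[OF u(1) vw(2)]) (use u True in auto)
    ultimately show ?thesis by (rule path_component_trans)
  qed (use unit_sphere_path vw in auto)
qed

lemma contractible_punctured_sphere:
  assumes "e \<in> unit_sphere I" shows "contractible (unit_sphere I - {- e})"
proof -
  let ?S = "unit_sphere I - {- e}"
  have n: "norm v = 1" if "v \<in> ?S" for v using that by (auto simp: unit_sphere_def)
  have ne: "norm e = 1" using assms by (auto simp: unit_sphere_def)
  have nz: "(1 - t) *\<^sub>R v + t *\<^sub>R e \<noteq> 0" if "v \<in> ?S" "t \<in> {0..1}" for v t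
  proof -
    have "e \<noteq> - v" using that(1) by auto
    then show ?thesis using segment_nz[OF n[OF that(1)] ne] that by auto
  qed
  have in_S: "slide t v e \<in> ?S" if v: "v \<in> ?S" and t: "t \<in> {0..1}" for v t
  proof -
    have "e \<noteq> - v" using v by auto
    then have "slide t v e \<in> unit_sphere I" using slide_unit_sphere[OF _ assms] that by auto
    moreover have "slide t v e \<noteq> - e"
    proof
      assume a: "slide t v e = - e"
      let ?x = "(1 - t) *\<^sub>R v + t *\<^sub>R e"
      have "norm ?x *\<^sub>R slide t v e = ?x" using nz[OF that] by (simp add: slide_def)
      \<comment> \<open>If the slide reached \<open>- e\<close>, then \<open>v\<close> scaled by 1 -
        t would be a negative multiple of \<open>e\<close>; comparing norms gives v = - e, which is
        excluded.\<close>
      then have e1: "(1 - t) *\<^sub>R v = - ((norm ?x + t) *\<^sub>R e)" unfolding a by (simp add: algebra_simps)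
      have "norm ((1 - t) *\<^sub>R v) = norm (- ((norm ?x + t) *\<^sub>R e))" by (rule arg_cong[OF e1])
      then have "\<bar>1 - t\<bar> = \<bar>norm ?x + t\<bar>" by (simp only: norm_minus_cancel norm_scaleR n[OF v] ne mult_1_right)
      then have h: "1 - t = norm ?x + t" using t by simp
      have "norm ?x > 0" using nz[OF that] by simp
      then have "1 - t \<noteq> 0" using h atLeastAtMost_iff[THEN iffD1, OF t] by linarith
      moreover have "(1 - t) *\<^sub>R v = (1 - t) *\<^sub>R (- e)" using e1 unfolding h[symmetric] by simp
      ultimately have "v = - e" using scaleR_left_imp_eq by blast
      then show False using v by simp
    qed
    ultimately show ?thesis by simp
  qed
  define H where "H = (\<lambda>q. slide (fst q) (snd q) e)"
  have "homotopic_with_canon (\<lambda>x. True) ?S ?S (\<lambda>v. H (0, v)) (\<lambda>v. H (1, v))"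
    unfolding homotopic_with_def
  proof (intro exI[of _ H] conjI allI ballI)
    have "continuous_on ({0..1} \<times> ?S) H" unfolding H_def slide_def
      by (intro continuous_intros) (use nz in auto)
    then show "continuous_map (prod_topology (top_of_set {0..1}) (top_of_set ?S)) (top_of_set ?S) H"
      using in_S by (auto simp: H_def)
  qed auto
  note hom = this
  have ends: "slide 0 v e = v" "slide 1 v e = e" if "v \<in> ?S" for v
    by (rule slide_ends, rule n[OF that], rule slide_ends, rule ne)
  have "homotopic_with_canon (\<lambda>x. True) ?S ?S id (\<lambda>v. e)"
    by (rule homotopic_with_eq[OF hom]) (simp_all add: H_def ends)
  then show ?thesis unfolding contractible_def by blast
qed

subsection \<open>Compact spin groups\<close>

text \<open>The compact spin group of the positive coordinates in \<open>I\<close>, defined by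
  equations. That it lies in \<open>Spin\<close> for at least three coordinates is a consequence of
  its simple connectedness, so it cannot be built into the definition.\<close>

definition cspin :: "'m::{finite,linorder} set \<Rightarrow> 'm clifford set" where
  "cspin I = pspin \<inter> clsupp (Inr ` I)"

lemma cspin_mult: "x \<in> cspin I \<Longrightarrow> y \<in> cspin I \<Longrightarrow> x \<odot> y \<in> cspin I"
  by (simp add: cspin_def pspin_mult clsupp_mult)

lemma cspin_rev: "x \<in> cspin I \<Longrightarrow> clrev x \<in> cspin I"
  by (simp add: cspin_def pspin_rev clsupp_rev)

lemma cspin_one: "cl_one \<in> cspin I" by (simp add: cspin_def pspin_one clsupp_one)

lemma cspin_simps:
  assumes "x \<in> cspin I" shows "x \<odot> (clrev x \<odot> y) = y" "clrev x \<odot> (x \<odot> y) = y"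
  using assms pspinD by (auto simp: cspin_def)

lemma cspin_mono: assumes "I \<subseteq> J" shows "cspin I \<subseteq> cspin J"
proof -
  have "Inr ` I \<subseteq> Inr ` J" using assms by (rule image_mono)
  then have "\<not> A \<subseteq> Inr ` I" if "\<not> A \<subseteq> Inr ` J" for A :: "(2 + 'a) set" using that by (meson order_trans)
  then have "clsupp (Inr ` I) \<subseteq> (clsupp (Inr ` J) :: 'a clifford set)" unfolding clsupp_def by blast
  then show ?thesis unfolding cspin_def by blast
qed

lemma qq_positive: "A \<subseteq> Inr ` I \<Longrightarrow> qq A = 1"
  unfolding qq_def by (rule prod.neutral) auto

text \<open>All signs \<open>qq A\<close> are +1 on positive coordinates, so the spinor norm is the
  squared Euclidean norm.\<close>

lemma norm_clsupp:
  assumes "x \<in> clsupp (Inr ` I)" shows "(x \<odot> clrev x) $ {} = (norm x)\<^sup>2"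
proof -
  have "qq A * (x $ A)\<^sup>2 = x $ A * x $ A" for A
    using assms qq_positive[of A I] by (cases "A \<subseteq> Inr ` I") (auto simp: clsupp_def power2_eq_square)
  then show ?thesis unfolding norm_part by (simp add: power2_norm_eq_inner inner_vec_def)
qed

text \<open>The orbit map to the sphere. Its fibre over the base vector is the smaller spin group,
  by \<open>cspin_stabilizer\<close>.\<close>

definition spin_vec :: "'m::{finite,linorder} \<Rightarrow> 'm clifford \<Rightarrow> real ^ (2 + 'm)" where
  "spin_vec i x = smat x *v axis (Inr i) 1"

lemma spin_vec_unit_sphere:
  assumes "x \<in> cspin I" "i \<in> I" shows "spin_vec i x \<in> unit_sphere I"
proof -
  have x: "x \<in> pspin" "x \<in> clsupp (Inr ` I)" using assms by (auto simp: cspin_def)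
  have "cl_vec (spin_vec i x) \<in> clsupp (Inr ` I)"
    unfolding spin_vec_def smat_works[OF x(1), symmetric]
    by (intro clsupp_mult clsupp_rev x) (use assms(2) in \<open>auto simp: clsupp_vec axis_def\<close>)
  then have s: "\<forall>k. k \<notin> Inr ` I \<longrightarrow> spin_vec i x $ k = 0" by (simp add: clsupp_vec)
  have "scal (spin_vec i x) (spin_vec i x) = 1"
    using smat_pseudo_orthogonal[OF x(1)] by (simp add: pseudo_orthogonal_def spin_vec_def scal_axis_self)
  then show ?thesis using s scal_positive[OF s] by (simp add: unit_sphere_def norm_eq_1)
qed

lemma spin_vec_mult: "x \<in> pspin \<Longrightarrow> y \<in> pspin \<Longrightarrow> spin_vec i (x \<odot> y) = smat x *v spin_vec i y"
  by (simp add: spin_vec_def smat_mult matrix_vector_mul_assoc)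

lemma cspin_fixes:
  assumes "x \<in> cspin I" "k \<notin> Inr ` I" shows "smat x *v axis k 1 = axis k 1"
proof -
  have x: "x \<in> pspin" "x \<in> clsupp (Inr ` I)" using assms by (auto simp: cspin_def)
  show ?thesis
    using smat_unique[OF x(1) even_supported_commute[OF pspinD(1)[OF x(1)] x(2) assms(2)]] by simp
qed

text \<open>An even element that fixes a basis vector commutes with it, so every coefficient whose
  set contains that index is zero.\<close>

lemma cspin_stabilizer:
  assumes "x \<in> cspin (insert i I)" "spin_vec i x = axis (Inr i) 1" shows "x \<in> cspin I"
proof -
  have x: "x \<in> pspin" "x \<in> clsupp (Inr ` insert i I)" using assms by (auto simp: cspin_def)
  have c: "x \<odot> cl_vec (axis (Inr i) 1) = cl_vec (axis (Inr i) 1) \<odot> x"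
    using smat_commute[OF x(1), of "axis (Inr i) 1"] assms(2) by (simp add: spin_vec_def)
  have "x $ A = 0" if "\<not> A \<subseteq> Inr ` I" for A
  proof (cases "Inr i \<in> A")
    case True
    then show ?thesis by (rule even_commute_support[OF pspinD(1)[OF x(1)] c])
  next
    case False
    then have "\<not> A \<subseteq> Inr ` insert i I" using that by auto
    then show ?thesis using x(2) by (simp add: clsupp_def)
  qed
  then show ?thesis using x(1) by (simp add: cspin_def clsupp_def)
qed

lemma rot_cspin:
  assumes "f \<in> unit_sphere J" "i \<in> J" "f \<noteq> - axis (Inr i) 1"
  shows "rot (Inr i) f \<in> cspin J" "rot (Inr i) f \<in> full_spin" "spin_vec i (rot (Inr i) f) = f"
    "qs (Inr i) * scal (axis (Inr i) 1 + f) (axis (Inr i) 1 + f) > 0"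
proof -
  let ?e = "axis (Inr i) 1 :: real ^ (2 + 'a)"
  have s: "\<forall>k. k \<notin> Inr ` J \<longrightarrow> (?e + f) $ k = 0"
    using assms axis_unit_sphere[OF assms(2)] by (auto simp: unit_sphere_def)
  have nz: "?e + f \<noteq> 0" using assms(3) by (metis add.commute add_eq_0_iff)
  show Q: "qs (Inr i) * scal (?e + f) (?e + f) > 0" unfolding scal_positive[OF s] using nz by simp
  have f: "scal f f = qs (Inr i)" using unit_sphere_scal[OF assms(1)] by simp
  note R = rot_props[OF f Q]
  have "rot (Inr i) f \<in> clsupp (Inr ` J)"
    unfolding rot_def
    by (intro subspace_scale[OF subspace_clsupp] clsupp_mult)
       (use s assms(2) in \<open>auto simp: clsupp_vec axis_def\<close>)
  then show "rot (Inr i) f \<in> cspin J" using R(1) by (simp add: cspin_def)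
  show "rot (Inr i) f \<in> full_spin" by (rule R(2))
  show "spin_vec i (rot (Inr i) f) = f" unfolding spin_vec_def by (rule R(3))
qed

lemma flip_exists:
  assumes "i \<noteq> j" "i \<in> J" "j \<in> J"
  obtains g where "g \<in> cspin J" "g \<in> full_spin" "smat g *v axis (Inr i) 1 = - axis (Inr i) 1"
proof -
  let ?e = "axis (Inr i) 1 :: real ^ (2 + 'a)" let ?f = "axis (Inr j) 1 :: real ^ (2 + 'a)"
  let ?g = "cl_vec ?e \<odot> cl_vec ?f"
  have ef: "scal ?e ?f = 0" using assms by (simp add: scal_axis_ne)
  have fs: "?g \<in> full_spin" by (rule full_spin_pair) (simp_all add: scal_axis_self)
  have "?g \<odot> clrev ?g = cl_vec ?e \<odot> (cl_vec ?f \<odot> cl_vec ?f) \<odot> cl_vec ?e" by (simp add: clrev_mult cl_assoc)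
  also have "\<dots> = cl_one" by (simp add: cl_vec_sq scal_axis_self)
  finally have one: "?g \<odot> clrev ?g = cl_one" .
  obtain d where d: "?g \<odot> clrev ?g = d *\<^sub>R cl_one" "d = 1 \<longleftrightarrow> ?g \<in> pspin"
    using full_spin_props[OF fs] by metis
  then have "d = 1" using one by (metis cl_one_nth vector_scaleR_component real_scaleR_def mult.right_neutral)
  with d have ps: "?g \<in> pspin" by simp
  have "?g \<in> clsupp (Inr ` J)"
    by (intro clsupp_mult) (use assms in \<open>auto simp: clsupp_vec axis_def\<close>)
  then have cs: "?g \<in> cspin J" using ps by (simp add: cspin_def)
  have ac: "cl_vec ?f \<odot> cl_vec ?e = - (cl_vec ?e \<odot> cl_vec ?f)"
    using cl_vec_anticomm[of ?f ?e] ef by (simp add: scal_sym add_eq_0_iff2)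
  have "?g \<odot> cl_vec ?e = cl_vec (- ?e) \<odot> ?g"
    unfolding cl_assoc ac cl_vec_simps by (simp add: cl.minus_left cl.minus_right)
  then have "smat ?g *v ?e = - ?e" using smat_unique[OF ps] by metis
  then show ?thesis using that cs fs by blast
qed

text \<open>Divide by an element of \<open>full_spin\<close> that moves the basis vector to the same
  place as \<open>x\<close> does; the quotient stabilises that vector and falls under the induction
  hypothesis.\<close>

lemma cspin_full_spin: "cspin I \<subseteq> (full_spin :: 'm::{finite,linorder} clifford set)"
  using finite[of I]
proof (induction I)
  case empty
  show ?case
  proof
    fix x :: "'m clifford" assume x: "x \<in> cspin {}"
    have "smat x *v v = v" for v
      by (rule vec_ext[of "(*v) (smat x)" "\<lambda>v. v"]) (use cspin_fixes[OF x] in \<open>simp_all add: linear_iff matrix_vector_right_distrib matrix_vector_mult_scaleR\<close>)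
    then have "smat x = mat 1" by (simp add: matrix_eq)
    then consider "x = cl_one" | "x = - cl_one" using smat_ker x by (auto simp: cspin_def)
    then show "x \<in> full_spin"
    proof cases
      case 2
      \<comment> \<open>Any positive unit vector would do: with its negative it writes
        \<open>- cl_one\<close> as a product of two unit vectors.\<close>
      let ?e = "axis (Inr undefined) 1 :: real ^ (2 + 'm)"
      have "cl_vec ?e \<odot> cl_vec (- ?e) \<in> full_spin"
        by (rule full_spin_pair) (simp_all add: scal_linear scal_axis_self)
      moreover have "cl_vec ?e \<odot> cl_vec (- ?e) = - cl_one" by (simp add: cl_vec_simps cl_simps cl_vec_sq scal_axis_self)
      ultimately show ?thesis using 2 by simp
    qed (simp add: full_spin_one)
  qed
next
  case (insert i I)
  show ?case
  proof
    fix x assume x: "x \<in> cspin (insert i I)"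
    then have xp: "x \<in> pspin" by (simp add: cspin_def)
    let ?v = "spin_vec i x" let ?e = "axis (Inr i) 1 :: real ^ (2 + 'm)"
    have v: "?v \<in> unit_sphere (insert i I)" by (rule spin_vec_unit_sphere[OF x]) simp
    have *: "x \<in> full_spin" if g: "g \<in> cspin (insert i I)" "g \<in> full_spin" "spin_vec i (clrev g \<odot> x) = ?e" for g
    proof -
      have "clrev g \<odot> x \<in> cspin I"
        by (rule cspin_stabilizer[OF cspin_mult[OF cspin_rev[OF g(1)] x] g(3)])
      then have "g \<odot> (clrev g \<odot> x) \<in> full_spin" using insert.IH g(2) full_spin_mult by blast
      then show ?thesis by (simp add: cspin_simps[OF g(1)])
    qed
    have rv: "spin_vec i (clrev g \<odot> x) = ?e" if "g \<in> cspin (insert i I)" "smat g *v ?e = ?v" for g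
    proof -
      have gp: "g \<in> pspin" using that by (simp add: cspin_def)
      have "spin_vec i (clrev g \<odot> x) = padj (smat g) *v ?v"
        by (simp add: spin_vec_mult pspin_rev gp xp smat_rev)
      also have "\<dots> = (padj (smat g) ** smat g) *v ?e" unfolding that(2)[symmetric] by (simp add: matrix_vector_mul_assoc)
      also have "\<dots> = ?e" by (simp add: padj_left smat_pseudo_orthogonal gp)
      finally show ?thesis .
    qed
    show "x \<in> full_spin"
    proof (cases "?v = - ?e")
      case False
      note R = rot_cspin[OF v _ False]
      show ?thesis by (rule *[OF R(1,2) rv]) (use R in \<open>auto simp: spin_vec_def\<close>)
    next
      case True
      show ?thesis
      proof (cases "I = {}")
        case True
        have "x $ A = 0" if "A \<noteq> {}" for A
        proof (cases "A = {Inr i}")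
          case True
          then show ?thesis using arg_cong[OF pspinD(1)[OF xp], of "\<lambda>y. y $ A"] by (simp add: clpar_def)
        next
          case False
          then have "\<not> A \<subseteq> Inr ` {i}" using that by auto
          then show ?thesis using x True by (simp add: cspin_def clsupp_def)
        qed
        then have "x \<in> cspin {}" using xp by (auto simp: cspin_def clsupp_def)
        then show ?thesis using insert.IH True by auto
      next
        case False
        then obtain j where j: "j \<in> I" by auto
        then have "i \<noteq> j" using insert by auto
        then obtain g where g: "g \<in> cspin (insert i I)" "g \<in> full_spin" "smat g *v ?e = - ?e"
          using flip_exists[of i j "insert i I"] j by blast
        show ?thesis by (rule *[OF g(1,2) rv]) (use g True in auto)
      qed
    qed
  qed
qed

subsection \<open>The base case: the three-sphere\<close>

lemma eps_swap: "a \<noteq> b \<Longrightarrow> eps {a} {b} * eps {b} {a} = -1"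
  using idx_less_total[of a b] by (auto simp: eps_single)

lemma rsgn_pair: assumes "a \<noteq> b" shows "rsgn {a, b} = -1"
proof -
  have "{a, b} = sym_diff {a} {b}" using assms by auto
  then have "rsgn {a, b} = eps {a} {a} * eps {b} {b} * (eps {a} {b} * eps {b} {a})"
    unfolding rsgn_def by (simp add: prod_one_minus_cong)
  then show ?thesis using eps_swap[OF assms] by (simp add: eps_single)
qed

lemma rsgn_triple: assumes "a \<noteq> b" "a \<noteq> c" "b \<noteq> c" shows "rsgn {a, b, c} = -1"
proof -
  have bc: "{b, c} = sym_diff {b} {c}" using assms by auto
  have "{a, b, c} = sym_diff {a} {b, c}" using assms by auto
  then have "rsgn {a, b, c} = eps {a} {a} * rsgn {b, c} * (eps {a} {b, c} * eps {b, c} {a})"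
    unfolding rsgn_def by (simp add: prod_one_minus_cong)
  also have "eps {a} {b, c} * eps {b, c} {a} = (eps {a} {b} * eps {b} {a}) * (eps {a} {c} * eps {c} {a})"
    unfolding bc by (simp add: prod_one_minus_cong)
  finally show ?thesis
    unfolding eps_swap[OF assms(1)] eps_swap[OF assms(2)] rsgn_pair[OF assms(3)] by (simp add: eps_single)
qed

lemma clpar_fixed_iff: "clpar x = x \<longleftrightarrow> (\<forall>A. odd (card A) \<longrightarrow> x $ A = 0)"
  unfolding clpar_def vec_eq_iff by (auto simp: minus_one_power_iff)

lemma clpar_neg_iff: "clpar x = - x \<longleftrightarrow> (\<forall>A. even (card A) \<longrightarrow> x $ A = 0)"
  unfolding clpar_def vec_eq_iff by (auto simp: minus_one_power_iff)

lemma clrev_fixed_nth: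
  assumes "clrev x = x" "rsgn A = -1" shows "x $ A = 0"
proof -
  have "clrev x $ A = - x $ A" using assms(2) by (simp add: clrev_def)
  then show ?thesis unfolding assms(1) by simp
qed

lemma clpar_clrev: "clpar (clrev x) = clrev (clpar x)"
  by (simp add: clpar_def clrev_def vec_eq_iff mult_ac)

lemma norm_clrev: "norm (clrev x) = norm x"
proof -
  have "(clrev x $ A)\<^sup>2 = (x $ A)\<^sup>2" for A
    by (simp add: clrev_def rsgn_def power2_eq_square mult_ac)
  then show ?thesis by (simp add: norm_vec_def L2_set_def)
qed

text \<open>In three dimensions the even part is a copy of the quaternions, and unit norm alone
  suffices. Reversal negates grades 2 and 3. So \<open>x \<odot> clrev x\<close>, even and fixed by
  reversal, is a scalar, and the conjugate of a vector, odd and fixed by reversal, is a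
  vector.\<close>

lemma cspin_three:
  fixes I :: "'m::{finite,linorder} set"
  assumes "card I = 3"
  shows "cspin I = {x. (\<forall>A. \<not> (A \<subseteq> Inr ` I \<and> even (card A)) \<longrightarrow> x $ A = 0) \<and> norm x = 1}"
    (is "_ = {x. ?E x \<and> _}")
proof (intro equalityI subsetI)
  fix x assume "x \<in> cspin I"
  then have x: "clpar x = x" "x \<odot> clrev x = cl_one" "x \<in> clsupp (Inr ` I)" using pspinD by (auto simp: cspin_def)
  have "(norm x)\<^sup>2 = 1" using norm_clsupp[OF x(3)] x(2) by simp
  then have "norm x = 1" using norm_ge_zero[of x] by (simp add: power2_eq_1_iff)
  moreover have "?E x" using x unfolding clpar_fixed_iff clsupp_def by blast
  ultimately show "x \<in> {x. ?E x \<and> norm x = 1}" by blast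
next
  have card3: "card (Inr ` I :: (2 + 'm) set) = 3" using assms by (simp add: card_image)
  have r2: "rsgn A = -1" if "A \<subseteq> Inr ` I" "card A = 2" for A
    using that(2) rsgn_pair by (metis card_2_iff)
  have r3: "rsgn A = -1" if "A \<subseteq> Inr ` I" "card A = 3" for A
    using that(2) rsgn_triple by (metis card_3_iff)
  have le3: "card A \<le> 3" if "A \<subseteq> Inr ` I" for A :: "(2 + 'm) set"
    using card_mono[OF _ that] card3 by simp
  have key: "y \<odot> clrev y = cl_one \<and> clpar y = y \<and> y \<in> clsupp (Inr ` I)" if y: "?E y" "norm y = 1" for y
  proof -
    have ys: "y \<in> clsupp (Inr ` I)" using y(1) unfolding clsupp_def by blast
    have yp: "clpar y = y" using y(1) unfolding clpar_fixed_iff by blast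
    let ?z = "y \<odot> clrev y"
    have zs: "?z \<in> clsupp (Inr ` I)" by (intro clsupp_mult clsupp_rev ys)
    have zr: "clrev ?z = ?z" by (simp add: clrev_mult)
    have zp: "clpar ?z = ?z" by (simp add: clpar_mult clpar_clrev yp)
    have "?z $ A = cl_one $ A" for A
    proof (cases "A = {}")
      case True
      then show ?thesis using norm_clsupp[OF ys] y(2) by simp
    next
      case False
      have "?z $ A = 0"
      proof (cases "A \<subseteq> Inr ` I \<and> even (card A)")
        case True
        then have "card A \<le> 3" "card A \<noteq> 0" using le3 False by auto
        then have "card A = 2" using True by (auto simp: le_Suc_eq numeral_3_eq_3)
        then show ?thesis using clrev_fixed_nth[OF zr] r2 True by blast
      next
        case False
        then show ?thesis using zs zp unfolding clsupp_def clpar_fixed_iff by blast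
      qed
      then show ?thesis using False by (simp add: cl_one_def axis_def)
    qed
    then show ?thesis using ys yp by (simp add: vec_eq_iff)
  qed
  fix x assume "x \<in> {x. ?E x \<and> norm x = 1}"
  then have x: "?E x" "norm x = 1" by auto
  note kx = key[OF x]
  have "?E (clrev x)" using x(1) by (simp add: clrev_def)
  then have kr: "clrev x \<odot> x = cl_one" using key[of "clrev x"] x(2) norm_clrev[of x] by simp
  have basis: "\<exists>w. x \<odot> axis {k} 1 \<odot> clrev x = cl_vec w" for k
  proof (cases "k \<in> Inr ` I")
    case True
    let ?u = "x \<odot> axis {k} 1 \<odot> clrev x"
    have es: "axis {k} 1 \<in> (clsupp (Inr ` I) :: 'm clifford set)" using True by (auto simp: clsupp_def axis_def)
    have us: "?u \<in> clsupp (Inr ` I)" using kx es by (intro clsupp_mult clsupp_rev) auto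
    have er: "clrev (axis {k} 1) = (axis {k} 1 :: 'm clifford)" using clrev_vec[of "axis k 1"] by (simp add: cl_vec_axis)
    have ur: "clrev ?u = ?u" by (simp add: clrev_mult er cl_assoc)
    have ep: "clpar (axis {k} 1) = - (axis {k} 1 :: 'm clifford)" using clpar_vec[of "axis k 1"] by (simp add: cl_vec_axis)
    have up: "clpar ?u = - ?u" using kx by (simp add: clpar_mult clpar_clrev ep cl.minus_left cl.minus_right)
    have "?u $ A = cl_vec (\<chi> i. ?u $ {i}) $ A" for A
    proof (cases "\<exists>i. A = {i}")
      case False
      have "?u $ A = 0"
      proof (cases "A \<subseteq> Inr ` I \<and> odd (card A)")
        case True
        then have "card A \<le> 3" "card A \<noteq> 1" using le3 False by (auto simp: card_1_singleton_iff)
        then have "card A = 3" using True by (auto simp: le_Suc_eq numeral_3_eq_3)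
        then show ?thesis using clrev_fixed_nth[OF ur] r3 True by blast
      next
        case False
        then show ?thesis using us up unfolding clsupp_def clpar_neg_iff by blast
      qed
      then show ?thesis using False by (simp add: cl_vec_nth_other)
    qed auto
    then have "?u = cl_vec (\<chi> i. ?u $ {i})" unfolding vec_eq_iff by blast
    then show ?thesis by blast
  next
    case False
    have "x \<odot> axis {k} 1 = axis {k} 1 \<odot> x"
      using even_supported_commute[of x "Inr ` I" k] kx False by (simp add: cl_vec_axis)
    then have "x \<odot> axis {k} 1 \<odot> clrev x = axis {k} 1" using kx by (simp add: cl_assoc)
    then show ?thesis by (intro exI[of _ "axis k 1"]) (simp add: cl_vec_axis)
  qed
  then obtain w where w: "\<And>k. x \<odot> axis {k} 1 \<odot> clrev x = cl_vec (w k)" by metis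
  have "x \<odot> cl_vec v \<odot> clrev x = cl_vec (\<Sum>k\<in>UNIV. v $ k *\<^sub>R w k)" for v
  proof -
    have "x \<odot> cl_vec v \<odot> clrev x = (\<Sum>k\<in>UNIV. v $ k *\<^sub>R (x \<odot> axis {k} 1 \<odot> clrev x))"
      unfolding cl_vec_def by (simp only: cl.sum_left cl.sum_right cl.scaleR_left cl.scaleR_right)
    then show ?thesis unfolding w by (simp add: linear_sum[OF linear_cl_vec] cl_vec_simps)
  qed
  then have "x \<in> pspin" unfolding pspin_def using kx kr by blast
  then show "x \<in> cspin I" using kx by (simp add: cspin_def)
qed

lemma simply_connected_unit_sphere_subspace:
  fixes E :: "'a::euclidean_space set"
  assumes "subspace E" "dim E = 4" shows "simply_connected (E \<inter> sphere 0 1)"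
proof -
  have d: "dim E = dim (UNIV :: (real^4) set)" using assms by simp
  obtain f :: "'a \<Rightarrow> real^4" and g where fg: "linear f" "linear g" "f ` E = UNIV" "g ` UNIV = E"
    "\<And>x. x \<in> E \<Longrightarrow> norm (f x) = norm x" "\<And>x. norm (g x) = norm x"
    "\<And>x. x \<in> E \<Longrightarrow> g (f x) = x" "\<And>x. f (g x) = x"
    using isometries_subspaces[OF assms(1) subspace_UNIV d] by (metis UNIV_I)
  have "homeomorphism (sphere 0 1) (E \<inter> sphere 0 1) g f"
  proof (rule homeomorphismI)
    show "continuous_on (sphere 0 1) g" "continuous_on (E \<inter> sphere 0 1) f"
      using fg(1,2) by (simp_all add: linear_continuous_on linear_conv_bounded_linear)
  qed (use fg in auto)
  then have "sphere (0 :: real^4) 1 homeomorphic (E \<inter> sphere 0 1)" unfolding homeomorphic_def by blast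
  then show ?thesis using homeomorphic_simply_connected simply_connected_sphere[of "0 :: real^4" 1] by simp
qed

lemma simply_connected_cspin_three:
  fixes I :: "'m::{finite,linorder} set"
  assumes "card I = 3" shows "simply_connected (cspin I)"
proof -
  let ?D = "{A :: (2 + 'm) set. A \<subseteq> Inr ` I \<and> even (card A)}"
  let ?E = "{x :: 'm clifford. \<forall>A. \<not> (A \<subseteq> Inr ` I \<and> even (card A)) \<longrightarrow> x $ A = 0}"
  obtain a b c :: "2 + 'm" where abc: "Inr ` I = {a, b, c}" "a \<noteq> b" "a \<noteq> c" "b \<noteq> c"
    using assms card_3_iff[of "Inr ` I :: (2 + 'm) set"] by (auto simp: card_image)
  \<comment> \<open>A set of three elements has four subsets of even size; they give the four
    coordinates of the 3-sphere.\<close>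
  have "?D = {{}, {a, b}, {a, c}, {b, c}}"
  proof
    show "{{}, {a, b}, {a, c}, {b, c}} \<subseteq> ?D" using abc by auto
    show "?D \<subseteq> {{}, {a, b}, {a, c}, {b, c}}"
    proof
      fix A assume A: "A \<in> ?D"
      then have "A \<in> Pow {a, b, c}" using abc by auto
      then have "A \<in> {{}, {a}, {b}, {c}, {a, b}, {a, c}, {b, c}, {a, b, c}}" by (auto simp: Pow_insert)
      moreover have "even (card A)" using A by blast
      ultimately show "A \<in> {{}, {a, b}, {a, c}, {b, c}}" using abc(2-4) by (elim insertE emptyE) simp_all
    qed
  qed
  then have cD: "card ?D = 4" using abc(2-4) by (simp add: doubleton_eq_iff card_insert_if)
  let ?d = "(\<lambda>A. axis A (1::real)) ` ?D"
  have dB: "?d \<subseteq> Basis" by (auto simp: Basis_vec_def)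
  have mem: "axis A (1::real) \<in> ?d \<longleftrightarrow> A \<in> ?D" for A by (auto simp: axis_eq_axis)
  have "(\<forall>i\<in>Basis. i \<notin> ?d \<longrightarrow> x \<bullet> i = 0) \<longleftrightarrow> (\<forall>A. A \<notin> ?D \<longrightarrow> x $ A = 0)" for x
    by (simp only: Basis_vec_def Basis_real_def UN_simps ball_UN ball_simps mem inner_axis inner_real_def mult_1_right UNIV_I simp_thms)
  then have "?E = {x. \<forall>i\<in>Basis. i \<notin> ?d \<longrightarrow> x \<bullet> i = 0}" by simp
  then have "dim ?E = card ?d" using dim_substandard[OF dB] by simp
  also have "\<dots> = 4" unfolding cD[symmetric] by (rule card_image) (auto simp: inj_on_def axis_eq_axis)
  finally have "dim ?E = 4" .
  moreover have "subspace ?E" by (auto simp: subspace_def)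
  ultimately have "simply_connected (?E \<inter> sphere 0 1)" by (intro simply_connected_unit_sphere_subspace)
  moreover have "cspin I = ?E \<inter> sphere 0 1" unfolding cspin_three[OF assms] by auto
  ultimately show ?thesis by simp
qed

subsection \<open>The induction step\<close>

lemma continuous_on_rot:
  assumes "i \<in> J" shows "continuous_on (unit_sphere J - {- axis (Inr i) 1}) (rot (Inr i))"
  by (intro smooth_on_imp_continuous_on smooth_on_rot[OF smooth_on_id])
     (use rot_cspin(4)[OF _ assms] in auto)

lemma continuous_on_spin_vec: "continuous_on S (spin_vec i)"
  unfolding spin_vec_def
  by (intro bounded_bilinear.continuous_on[OF bounded_bilinear_matrix_vector] continuous_on_smat continuous_on_const)

lemma spin_vec_rot_mult:
  assumes "v \<in> unit_sphere (insert i I)" "v \<noteq> - axis (Inr i) 1" "i \<notin> I" "k \<in> cspin I"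
  shows "spin_vec i (rot (Inr i) v \<odot> k) = v" "rot (Inr i) v \<odot> k \<in> cspin (insert i I)"
proof -
  note R = rot_cspin[OF assms(1) insertI1 assms(2)]
  have kp: "k \<in> pspin" using assms(4) by (simp add: cspin_def)
  have "Inr i \<notin> Inr ` I" using assms(3) by auto
  then have "spin_vec i k = axis (Inr i) 1" unfolding spin_vec_def by (rule cspin_fixes[OF assms(4)])
  then show "spin_vec i (rot (Inr i) v \<odot> k) = v"
    using R(1,3) kp by (simp add: spin_vec_mult cspin_def) (simp add: spin_vec_def)
  show "rot (Inr i) v \<odot> k \<in> cspin (insert i I)"
    using cspin_mono[of I "insert i I"] assms(4) by (intro cspin_mult R(1)) auto
qed

lemma rot_rev_cspin:
  assumes "x \<in> cspin (insert i I)" "spin_vec i x \<noteq> - axis (Inr i) 1"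
  shows "clrev (rot (Inr i) (spin_vec i x)) \<odot> x \<in> cspin I"
proof (rule cspin_stabilizer)
  let ?v = "spin_vec i x" let ?g = "rot (Inr i) ?v"
  have v: "?v \<in> unit_sphere (insert i I)" by (rule spin_vec_unit_sphere[OF assms(1)]) simp
  note R = rot_cspin[OF v insertI1 assms(2)]
  show "clrev ?g \<odot> x \<in> cspin (insert i I)" by (intro cspin_mult cspin_rev R assms)
  have gp: "?g \<in> pspin" and xp: "x \<in> pspin" using R(1) assms(1) by (auto simp: cspin_def)
  have "spin_vec i (clrev ?g \<odot> x) = padj (smat ?g) *v spin_vec i ?g"
    by (simp add: spin_vec_mult pspin_rev gp xp smat_rev R(3))
  also have "\<dots> = (padj (smat ?g) ** smat ?g) *v axis (Inr i) 1"
    by (simp add: spin_vec_def matrix_vector_mul_assoc)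
  also have "\<dots> = axis (Inr i) 1" by (simp add: padj_left smat_pseudo_orthogonal gp)
  finally show "spin_vec i (clrev ?g \<odot> x) = axis (Inr i) 1" .
qed

text \<open>Over the sphere minus a point \<open>cspin (insert i I)\<close> is a product with fibre \<open>cspin I\<close>; two such
  pieces cover the group.\<close>

lemma simply_connected_cspin_insert:
  fixes I :: "'m::{finite,linorder} set"
  assumes i: "i \<notin> I" and jk: "j \<in> I" "k \<in> I" "j \<noteq> k" and sc: "simply_connected (cspin I)"
  shows "simply_connected (cspin (insert i I))"
proof -
  let ?J = "insert i I" let ?e = "axis (Inr i) 1 :: real ^ (2 + 'm)" let ?p = "spin_vec i"
  \<comment> \<open>The pieces lie over the sphere without \<open>- ?e\<close> and over the sphere
    without \<open>?e\<close>.\<close>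
  define U where "U = {x \<in> cspin ?J. ?p x \<noteq> - ?e}"
  define V where "V = {x \<in> cspin ?J. ?p x \<noteq> ?e}"
  have ee: "?e \<noteq> - ?e"
    using arg_cong[of ?e "- ?e" "\<lambda>v. v $ Inr i"] by (auto simp: axis_def)
  have eJ: "?e \<in> unit_sphere ?J" by (rule axis_unit_sphere) simp
  have UV: "cspin ?J = U \<union> V" using ee by (auto simp: U_def V_def)
  have "U = cspin ?J \<inter> ?p -` (- {- ?e})" "V = cspin ?J \<inter> ?p -` (- {?e})" by (auto simp: U_def V_def)
  then have op: "openin (top_of_set (cspin ?J)) U" "openin (top_of_set (cspin ?J)) V"
    using continuous_openin_preimage_gen[OF continuous_on_spin_vec, of "- {- ?e}" "cspin ?J" i]
      continuous_openin_preimage_gen[OF continuous_on_spin_vec, of "- {?e}" "cspin ?J" i] by auto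
  let ?S = "unit_sphere ?J - {- ?e}"
  have controt: "continuous_on A (\<lambda>q. rot (Inr i) (f q))" if "continuous_on A f" "f ` A \<subseteq> ?S"
    for A and f :: "'z::topological_space \<Rightarrow> _"
    by (rule continuous_on_compose2[OF continuous_on_rot that]) simp
  \<comment> \<open>Over the first punctured sphere \<open>rot\<close> is a section of the orbit
    map, and dividing by it leaves an element of the stabiliser \<open>cspin I\<close>.\<close>
  have homU: "homeomorphism (?S \<times> cspin I) U (\<lambda>q. rot (Inr i) (fst q) \<odot> snd q) (\<lambda>x. (?p x, clrev (rot (Inr i) (?p x)) \<odot> x))"
  proof (rule homeomorphismI)
    show "continuous_on (?S \<times> cspin I) (\<lambda>q. rot (Inr i) (fst q) \<odot> snd q)"
      by (intro continuous_on_cl controt continuous_intros) auto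
    have "?p ` U \<subseteq> ?S" using spin_vec_unit_sphere[of _ ?J i] by (auto simp: U_def)
    then show "continuous_on U (\<lambda>x. (?p x, clrev (rot (Inr i) (?p x)) \<odot> x))"
      by (intro continuous_on_Pair continuous_on_cl continuous_on_clrev controt continuous_on_spin_vec continuous_on_id)
    show "(\<lambda>q. rot (Inr i) (fst q) \<odot> snd q) ` (?S \<times> cspin I) \<subseteq> U"
      using spin_vec_rot_mult[OF _ _ i] by (auto simp: U_def)
    show "(\<lambda>x. (?p x, clrev (rot (Inr i) (?p x)) \<odot> x)) ` U \<subseteq> ?S \<times> cspin I"
      using spin_vec_unit_sphere[of _ ?J i] rot_rev_cspin by (auto simp: U_def)
    show "(?p (rot (Inr i) (fst q) \<odot> snd q), clrev (rot (Inr i) (?p (rot (Inr i) (fst q) \<odot> snd q))) \<odot> (rot (Inr i) (fst q) \<odot> snd q)) = q"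
      if "q \<in> ?S \<times> cspin I" for q
    proof -
      have q: "fst q \<in> unit_sphere ?J" "fst q \<noteq> - ?e" "snd q \<in> cspin I" using that by auto
      show ?thesis unfolding spin_vec_rot_mult(1)[OF q(1,2) i q(3)]
        using cspin_simps(2)[OF rot_cspin(1)[OF q(1) insertI1 q(2)]] by simp
    qed
    show "rot (Inr i) (fst (?p x, clrev (rot (Inr i) (?p x)) \<odot> x)) \<odot> snd (?p x, clrev (rot (Inr i) (?p x)) \<odot> x) = x"
      if "x \<in> U" for x
    proof -
      have x: "x \<in> cspin ?J" "?p x \<noteq> - ?e" using that by (auto simp: U_def)
      have "?p x \<in> unit_sphere ?J" by (rule spin_vec_unit_sphere[OF x(1)]) simp
      then show ?thesis using cspin_simps(1)[OF rot_cspin(1)[OF _ insertI1 x(2)]] by simp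
    qed
  qed
  have scS: "simply_connected ?S" by (rule contractible_imp_simply_connected[OF contractible_punctured_sphere[OF eJ]])
  have scU: "simply_connected U"
    using homeomorphic_simply_connected[of "?S \<times> cspin I" U] homU simply_connected_Times[OF scS sc]
    unfolding homeomorphic_def by blast
  have "i \<noteq> j" using i jk by auto
  then obtain g where g: "g \<in> cspin ?J" "smat g *v ?e = - ?e"
    using flip_exists[of i j ?J] jk by blast
  have gp: "g \<in> pspin" using g by (simp add: cspin_def)
  have gi: "smat g *v v = smat g *v w \<longleftrightarrow> v = w" for v w
  proof
    assume "smat g *v v = smat g *v w"
    then have "padj (smat g) *v (smat g *v v) = padj (smat g) *v (smat g *v w)" by simp
    then show "v = w" by (simp add: matrix_vector_mul_assoc padj_left smat_pseudo_orthogonal gp)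
  qed simp
  have gme: "smat g *v (- ?e) = ?e" using g(2) by (simp add: linear_neg[OF matrix_vector_mul_linear])
  have pg: "?p (g \<odot> x) = smat g *v ?p x" if "x \<in> cspin ?J" for x
    using that gp by (simp add: spin_vec_mult cspin_def)
  \<comment> \<open>Left translation by an element that sends \<open>?e\<close> to
    \<open>- ?e\<close> exchanges the two pieces, so \<open>V\<close> needs no trivialisation of its
    own.\<close>
  have homV: "homeomorphism U V (\<lambda>x. g \<odot> x) (\<lambda>x. clrev g \<odot> x)"
  proof (rule homeomorphismI)
    show "(\<lambda>x. g \<odot> x) ` U \<subseteq> V"
    proof (rule image_subsetI)
      fix x assume "x \<in> U"
      then have x: "x \<in> cspin ?J" "?p x \<noteq> - ?e" by (auto simp: U_def)
      have "?p (g \<odot> x) \<noteq> ?e" using gi[of "?p x" "- ?e"] x(2) unfolding pg[OF x(1)] gme by blast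
      then show "g \<odot> x \<in> V" using cspin_mult[OF g(1) x(1)] by (simp add: V_def)
    qed
    show "(\<lambda>x. clrev g \<odot> x) ` V \<subseteq> U"
    proof (rule image_subsetI)
      fix x assume "x \<in> V"
      then have x: "x \<in> cspin ?J" "?p x \<noteq> ?e" by (auto simp: V_def)
      have gx: "clrev g \<odot> x \<in> cspin ?J" by (intro cspin_mult cspin_rev g x)
      have "?p (clrev g \<odot> x) \<noteq> - ?e"
      proof
        assume "?p (clrev g \<odot> x) = - ?e"
        then have "?p (g \<odot> (clrev g \<odot> x)) = ?e" unfolding pg[OF gx] using gme by simp
        then show False using x(2) cspin_simps(1)[OF g(1)] by simp
      qed
      then show "clrev g \<odot> x \<in> U" using gx by (simp add: U_def)
    qed
  qed (auto intro!: continuous_on_cl continuous_on_const continuous_on_id simp: cspin_simps[OF g(1)])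
  have scV: "simply_connected V"
    using homeomorphic_simply_connected[of U V] homV scU unfolding homeomorphic_def by blast
  \<comment> \<open>Polar coordinates on the sphere without both poles: angle to \<open>?e\<close>
    and a point of the equator. The equator is \<open>unit_sphere I\<close>, path-connected thanks
    to the two indices \<open>j\<close> and \<open>k\<close>, so the intersection of the pieces is a
    continuous image of the path-connected set \<open>?Q\<close>.\<close>
  let ?f = "\<lambda>\<theta> w. cos \<theta> *\<^sub>R ?e + sin \<theta> *\<^sub>R w"
  let ?Q = "({0<..<pi} \<times> unit_sphere I) \<times> cspin I"
  have ei: "v \<bullet> ?e = v $ Inr i" for v :: "real ^ (2 + 'm)" by (simp add: inner_axis)
  have f: "?f \<theta> w \<in> unit_sphere ?J" "?f \<theta> w \<noteq> ?e" "?f \<theta> w \<noteq> - ?e" if "\<theta> \<in> {0<..<pi}" "w \<in> unit_sphere I" for \<theta> w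
  proof -
    have w0: "w $ Inr i = 0" "norm w = 1" "\<And>k. k \<notin> Inr ` ?J \<Longrightarrow> w $ k = 0" using that(2) i by (auto simp: unit_sphere_def)
    have fi: "?f \<theta> w $ Inr i = cos \<theta>" using w0 by (simp add: axis_def)
    have "?f \<theta> w \<bullet> ?f \<theta> w = (cos \<theta>)\<^sup>2 * (?e \<bullet> ?e) + 2 * cos \<theta> * sin \<theta> * (w \<bullet> ?e) + (sin \<theta>)\<^sup>2 * (w \<bullet> w)"
      by (simp add: inner_add_left inner_add_right inner_commute power2_eq_square algebra_simps)
    also have "\<dots> = 1" using w0 by (simp add: ei norm_eq_1)
    finally have "norm (?f \<theta> w) = 1" by (simp add: norm_eq_1)
    then show "?f \<theta> w \<in> unit_sphere ?J" using w0 by (auto simp: unit_sphere_def axis_def)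
    have c: "cos \<theta> < 1" "cos \<theta> > -1"
      using cos_monotone_0_pi[of 0 \<theta>] cos_monotone_0_pi[of \<theta> pi] that by auto
    have "?e $ Inr i = 1" "(- ?e) $ Inr i = -1" by (simp_all add: axis_def)
    then show "?f \<theta> w \<noteq> ?e" "?f \<theta> w \<noteq> - ?e" using fi c by (metis less_irrefl)+
  qed
  have "(\<lambda>q. rot (Inr i) (?f (fst (fst q)) (snd (fst q))) \<odot> snd q) ` ?Q = U \<inter> V"
  proof
    show "(\<lambda>q. rot (Inr i) (?f (fst (fst q)) (snd (fst q))) \<odot> snd q) ` ?Q \<subseteq> U \<inter> V"
    proof (rule image_subsetI)
      fix q assume "q \<in> ?Q"
      then have q: "fst (fst q) \<in> {0<..<pi}" "snd (fst q) \<in> unit_sphere I" "snd q \<in> cspin I" by auto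
      note fq = f[OF q(1,2)]
      show "rot (Inr i) (?f (fst (fst q)) (snd (fst q))) \<odot> snd q \<in> U \<inter> V"
        using spin_vec_rot_mult[OF fq(1,3) i q(3)] fq by (simp add: U_def V_def)
    qed
    show "U \<inter> V \<subseteq> (\<lambda>q. rot (Inr i) (?f (fst (fst q)) (snd (fst q))) \<odot> snd q) ` ?Q"
    proof
      fix x assume "x \<in> U \<inter> V"
      then have x: "x \<in> cspin ?J" "?p x \<noteq> - ?e" "?p x \<noteq> ?e" by (auto simp: U_def V_def)
      define v where "v = ?p x"
      have v: "v \<in> unit_sphere ?J" unfolding v_def by (rule spin_vec_unit_sphere[OF x(1)]) simp
      then have vn: "v \<bullet> v = 1" and vk: "\<And>k. k \<notin> Inr ` ?J \<Longrightarrow> v $ k = 0" by (auto simp: unit_sphere_def norm_eq_1)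
      define c where "c = v $ Inr i"
      define u where "u = v - c *\<^sub>R ?e"
      have e1: "?e \<bullet> ?e = 1" by (simp add: inner_axis_axis)
      have uu: "u \<bullet> u = 1 - c\<^sup>2"
        unfolding u_def using vn e1 ei[of v]
        by (simp add: inner_diff_left inner_diff_right inner_commute[of ?e v] c_def power2_eq_square)
      have "u \<noteq> 0"
      proof
        assume "u = 0"
        then have "v = c *\<^sub>R ?e" "c\<^sup>2 = 1" using uu by (auto simp: u_def)
        then show False using x(2,3) v_def by (auto simp: power2_eq_1_iff)
      qed
      then have "u \<bullet> u > 0" by simp
      then have c1: "\<bar>c\<bar> < 1" unfolding uu by (simp add: abs_square_less_1)
      define \<theta> where "\<theta> = arccos c"
      have th: "0 < \<theta>" "\<theta> < pi" "cos \<theta> = c" using c1 arccos_lt_bounded[of c] by (auto simp: \<theta>_def)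
      have st: "sin \<theta> > 0" using th by (simp add: sin_gt_zero)
      have s2: "(sin \<theta>)\<^sup>2 = u \<bullet> u" unfolding uu using sin_squared_eq[of \<theta>] th by simp
      then have nu: "norm u = sin \<theta>" unfolding norm_eq_sqrt_inner s2[symmetric] using st by simp
      define w where "w = (1 / sin \<theta>) *\<^sub>R u"
      have "w $ k = 0" if "k \<notin> Inr ` I" for k
        using vk[of k] that by (cases "k = Inr i") (auto simp: w_def u_def c_def axis_def)
      then have w: "w \<in> unit_sphere I" using st nu by (simp add: unit_sphere_def w_def)
      have fv: "?f \<theta> w = v" using st th by (simp add: w_def u_def)
      have "x = rot (Inr i) v \<odot> (clrev (rot (Inr i) v) \<odot> x)"
        using cspin_simps(1)[OF rot_cspin(1)[OF v insertI1]] x(2) by (simp add: v_def)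
      moreover have "clrev (rot (Inr i) v) \<odot> x \<in> cspin I" unfolding v_def by (rule rot_rev_cspin[OF x(1,2)])
      ultimately show "x \<in> (\<lambda>q. rot (Inr i) (?f (fst (fst q)) (snd (fst q))) \<odot> snd q) ` ?Q"
        using th w fv by (intro image_eqI[of _ _ "((\<theta>, w), clrev (rot (Inr i) v) \<odot> x)"]) auto
    qed
  qed
  note im = this
  have "path_connected ?Q"
    by (intro path_connected_Times path_connected_unit_sphere[OF jk] simply_connected_imp_path_connected[OF sc]
        convex_imp_path_connected) auto
  moreover have "continuous_on ?Q (\<lambda>q. rot (Inr i) (?f (fst (fst q)) (snd (fst q))) \<odot> snd q)"
  proof (intro continuous_on_cl controt continuous_intros)
    show "(\<lambda>q. ?f (fst (fst q)) (snd (fst q))) ` ?Q \<subseteq> ?S"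
    proof (rule image_subsetI)
      fix q assume "q \<in> ?Q"
      then have q: "fst (fst q) \<in> {0<..<pi}" "snd (fst q) \<in> unit_sphere I" by (simp_all only: mem_Times_iff)
      show "?f (fst (fst q)) (snd (fst q)) \<in> ?S" using f(1)[OF q] f(3)[OF q] by blast
    qed
  qed
  ultimately have "path_connected ((\<lambda>q. rot (Inr i) (?f (fst (fst q)) (snd (fst q))) \<odot> snd q) ` ?Q)"
    by (rule path_connected_continuous_image[rotated])
  then have pc: "path_connected (U \<inter> V)" unfolding im .
  have "((pi / 2, axis (Inr j) 1), cl_one) \<in> ?Q" using axis_unit_sphere[OF jk(1)] cspin_one by simp
  then have ne: "U \<inter> V \<noteq> {}" unfolding im[symmetric] by (rule imageI[THEN ex_in_conv[THEN iffD1, OF exI]])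
  show ?thesis by (rule simply_connected_Un_open[OF UV op scU scV pc ne])
qed

lemma simply_connected_cspin:
  fixes I :: "'m::{finite,linorder} set"
  assumes "3 \<le> card I" shows "simply_connected (cspin I)"
proof -
  have "simply_connected (cspin I)" if "card I = n + 3" for n and I :: "'m set"
    using that
  proof (induction n arbitrary: I)
    case 0
    then show ?case by (intro simply_connected_cspin_three) simp
  next
    case (Suc n)
    then obtain i I' where I: "I = insert i I'" "i \<notin> I'" "card I' = n + 3"
      by (metis add_Suc card_Suc_eq)
    then obtain j I'' where j: "I' = insert j I''" "j \<notin> I''" "card I'' = n + 2"
      by (metis add_Suc_right card_Suc_eq numeral_3_eq_3 numeral_2_eq_2)
    then have "I'' \<noteq> {}" by auto
    then obtain k where "k \<in> I''" by auto
    then show ?case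
      unfolding I(1) using j I Suc.IH by (intro simply_connected_cspin_insert[where j = j and k = k]) auto
  qed
  then show ?thesis using assms by (metis le_add_diff_inverse2)
qed

subsection \<open>Rotations of the negative definite plane\<close>

text \<open>The half-angle spinor of a rotation of the negative plane. Writing it as a product of
  two vectors of scalar square -1 puts it in \<open>full_spin\<close>; the minus sign compensates
  for the square -1 of the first axis.\<close>

definition plane_rot :: "real \<Rightarrow> 'm::{finite,linorder} clifford" where
  "plane_rot t = cl_vec (- axis (Inl 0) 1) \<odot>
     cl_vec (cos (t / 2) *\<^sub>R axis (Inl 0) 1 - sin (t / 2) *\<^sub>R axis (Inl 1) 1)"

lemma plane_rot_eq:
  "plane_rot t = cos (t / 2) *\<^sub>R cl_one + sin (t / 2) *\<^sub>R (cl_vec (axis (Inl 0) 1) \<odot> cl_vec (axis (Inl 1) 1))"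
  by (simp add: plane_rot_def cl_vec_simps cl_simps cl_vec_sq scal_axis_self)

lemma continuous_on_plane_rot: "continuous_on S plane_rot"
  unfolding plane_rot_eq by (intro continuous_intros) auto

lemma plane_rot_full_spin: "plane_rot t \<in> full_spin"
proof -
  have "- (cos (t / 2))\<^sup>2 - (sin (t / 2))\<^sup>2 = -1" using sin_cos_squared_add[of "t / 2"] by linarith
  then show ?thesis unfolding plane_rot_def
    by (intro full_spin_pair) (simp_all add: scal_linear scal_axis_self scal_axis_ne flip: power2_eq_square)
qed

lemma plane_rot_Spin: "plane_rot t \<in> Spin"
proof (rule Spin_path[OF Spin_one])
  show "connected (range plane_rot :: 'a clifford set)"
    by (rule connected_continuous_image[OF continuous_on_plane_rot connected_UNIV])
  have "plane_rot 0 = cl_one" by (simp add: plane_rot_eq)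
  then show "cl_one \<in> range plane_rot" by (metis rangeI)
qed (use plane_rot_full_spin in auto)

lemma smat_plane_rot: "smat (plane_rot t) = (S_block (rho t) (mat 1) :: 'm::{finite,linorder} mat_full)"
proof -
  let ?a = "axis (Inl 0) 1 :: real ^ (2 + 'm)" let ?b = "axis (Inl 1) 1 :: real ^ (2 + 'm)"
  let ?A = "cl_vec ?a" let ?B = "cl_vec ?b" let ?x = "plane_rot t :: 'm clifford"
  have x: "?x \<in> pspin" using plane_rot_Spin Spin_pspin by blast
  have sq: "?A \<odot> ?A = - cl_one" "?B \<odot> ?B = - cl_one" by (simp_all add: cl_vec_sq scal_axis_self)
  have ba: "?B \<odot> ?A = - (?A \<odot> ?B)"
    using cl_vec_anticomm[of ?b ?a] by (simp add: scal_axis_ne eq_neg_iff_add_eq_0)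
  have prods: "?A \<odot> ?B \<odot> ?A = ?B" "?A \<odot> ?B \<odot> ?B = - ?A" "?A \<odot> (?A \<odot> ?B) = - ?B" "?B \<odot> (?A \<odot> ?B) = ?A"
    using sq ba by (simp_all add: cl_assoc[of ?A ?B] cl_assoc[of ?A ?A ?B, symmetric] cl_assoc[of ?B ?A ?B, symmetric] cl.minus_left cl.minus_right)
  \<comment> \<open>The half-angle t/2 written as t - t/2; the right-hand sides then factor through
    \<open>plane_rot t\<close>.\<close>
  have h: "cos t * cos (t / 2) + sin t * sin (t / 2) = cos (t / 2)" "sin t * cos (t / 2) - cos t * sin (t / 2) = sin (t / 2)"
    using cos_diff[of t "t / 2"] sin_diff[of t "t / 2"] by simp_all
  have "?x \<odot> ?A = cos (t / 2) *\<^sub>R ?A + sin (t / 2) *\<^sub>R ?B"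
    by (simp add: plane_rot_eq cl_simps prods)
  also have "\<dots> = (cos t * cos (t / 2) + sin t * sin (t / 2)) *\<^sub>R ?A + (sin t * cos (t / 2) - cos t * sin (t / 2)) *\<^sub>R ?B"
    unfolding h ..
  also have "\<dots> = cl_vec (cos t *\<^sub>R ?a + sin t *\<^sub>R ?b) \<odot> ?x"
    by (simp add: plane_rot_eq cl_simps prods cl_vec_simps algebra_simps)
  finally have ca: "smat ?x *v ?a = cos t *\<^sub>R ?a + sin t *\<^sub>R ?b" using smat_unique[OF x] by metis
  have "?x \<odot> ?B = cos (t / 2) *\<^sub>R ?B - sin (t / 2) *\<^sub>R ?A"
    by (simp add: plane_rot_eq cl_simps prods)
  also have "\<dots> = (cos t * cos (t / 2) + sin t * sin (t / 2)) *\<^sub>R ?B - (sin t * cos (t / 2) - cos t * sin (t / 2)) *\<^sub>R ?A"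
    unfolding h ..
  also have "\<dots> = cl_vec (- sin t *\<^sub>R ?a + cos t *\<^sub>R ?b) \<odot> ?x"
    by (simp add: plane_rot_eq cl_simps prods cl_vec_simps algebra_simps)
  finally have cb: "smat ?x *v ?b = - sin t *\<^sub>R ?a + cos t *\<^sub>R ?b" using smat_unique[OF x] by metis
  have s: "?x \<in> clsupp {Inl 0, Inl 1}" unfolding plane_rot_def
    by (intro clsupp_mult) (auto simp: clsupp_vec axis_def)
  have cr: "smat ?x *v axis (Inr j) 1 = axis (Inr j) 1" for j
    using smat_unique[OF x even_supported_commute[OF pspinD(1)[OF x] s, of "Inr j"]] by simp
  have two: "k = 0 \<or> k = 1" for k :: 2 using exhaust_2[of k] by auto
  have col: "A $ i $ k = (A *v axis k 1) $ i" for A :: "'m mat_full" and i k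
    by (simp add: matrix_vector_mult_basis column_def)
  have "smat ?x $ i $ k = S_block (rho t) (mat 1) $ i $ k" for i k
  proof (cases k)
    case (Inr j)
    show ?thesis unfolding col[of "smat ?x"] Inr cr by (cases i) (auto simp: S_block_def mat_def axis_def)
  next
    case (Inl l)
    show ?thesis
    proof (cases "l = 0")
      case True
      show ?thesis unfolding col[of "smat ?x"] Inl True ca
        by (cases i) (use two[of "projl i"] in \<open>auto simp: S_block_def axis_def\<close>)
    next
      case False
      then have l: "l = 1" using two[of l] by simp
      show ?thesis unfolding col[of "smat ?x"] Inl l cb
        by (cases i) (use two[of "projl i"] in \<open>auto simp: S_block_def axis_def\<close>)
    qed
  qed
  then show ?thesis by (simp add: vec_eq_iff)
qed

text \<open>Elements of \<open>cspin UNIV\<close> fix the two negative axes, so multiplication by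
  them from the right changes neither \<open>pi2\<close> nor \<open>psi\<close>.\<close>

lemma cspin_mult_columns:
  assumes "k \<in> cspin UNIV"
  shows "block_a (X ** smat k) = block_a X" "block_c (X ** smat k) = block_c X"
proof -
  have "(X ** smat k) $ i $ Inl l = X $ i $ Inl l" for i l
  proof -
    have "(X ** smat k) *v axis (Inl l) 1 = X *v axis (Inl l) 1"
      using cspin_fixes[OF assms, of "Inl l"] by (simp add: image_iff matrix_vector_mul_assoc[symmetric])
    from arg_cong[OF this, of "\<lambda>v. v $ i"] show ?thesis by (simp add: matrix_vector_mult_basis column_def)
  qed
  then show "block_a (X ** smat k) = block_a X" "block_c (X ** smat k) = block_c X"
    by (simp_all add: block_a_def block_c_def)
qed

text \<open>Fixing both negative axes kills every coefficient whose set contains one of their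
  indices, as in \<open>cspin_stabilizer\<close>.\<close>

lemma fixing_columns_cspin:
  assumes x: "x \<in> pspin" and S: "smat x = S_block (mat 1) R"
  shows "x \<in> cspin UNIV"
proof -
  have "smat x *v axis (Inl l) 1 = axis (Inl l) 1" for l
  proof -
    have "(smat x *v axis (Inl l) 1) $ i = axis (Inl l) 1 $ i" for i
      unfolding matrix_vector_mult_basis column_def by (cases i) (auto simp: S S_block_def axis_def mat_def)
    then show ?thesis unfolding vec_eq_iff by blast
  qed
  then have c: "x \<odot> cl_vec (axis (Inl l) 1) = cl_vec (axis (Inl l) 1) \<odot> x" for l
    using smat_commute[OF x, of "axis (Inl l) 1"] by simp
  have "x $ A = 0" if "\<not> A \<subseteq> range Inr" for A
  proof -
    obtain l where "Inl l \<in> A" using \<open>\<not> A \<subseteq> range Inr\<close> by (metis obj_sumE rangeI subsetI)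
    then show ?thesis by (rule even_commute_support[OF pspinD(1)[OF x] c])
  qed
  then show ?thesis using x by (simp add: cspin_def clsupp_def)
qed

lemma cspin_Spin:
  assumes "3 \<le> CARD('m)" shows "cspin UNIV \<subseteq> (Spin :: 'm::{finite,linorder} clifford set)"
proof
  fix x :: "'m clifford" assume x: "x \<in> cspin UNIV"
  show "x \<in> Spin"
    using simply_connected_imp_connected[OF simply_connected_cspin[OF assms]]
    by (rule Spin_path[OF Spin_one _ cspin_one x cspin_full_spin])
qed

subsection \<open>Simple connectedness\<close>

text \<open>\<open>Omega\<close> is convex, hence simply connected and locally path-connected, so
  the section lifts through the covering.\<close>

lemma Spin_section:
  obtains p :: "'m::{finite,linorder} mat_low \<Rightarrow> 'm clifford" where
    "continuous_on Omega p" "\<And>\<beta>. \<beta> \<in> Omega \<Longrightarrow> p \<beta> \<in> Spin" "\<And>\<beta>. \<beta> \<in> Omega \<Longrightarrow> smat (p \<beta>) = P_mat \<beta>"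
proof -
  have "(P_mat :: 'm mat_low \<Rightarrow> _) \<in> Omega \<rightarrow> O_up" using P_mat_O_up by auto
  then obtain p :: "'m mat_low \<Rightarrow> 'm clifford" where "continuous_on Omega p" "p \<in> Omega \<rightarrow> Spin"
    "\<And>\<beta>. \<beta> \<in> Omega \<Longrightarrow> smat (p \<beta>) = P_mat \<beta>"
    using covering_space_lift[OF covering_Spin convex_imp_simply_connected[OF convex_Omega]
        convex_imp_locally_path_connected[OF convex_Omega] smooth_on_imp_continuous_on[OF smooth_on_P_mat]] by metis
  then show ?thesis using that by blast
qed

text \<open>The decomposition of \<open>O_up\<close>, lifted to \<open>Spin\<close>, writes
  \<open>x\<close> as a product of a section value, a plane rotor and an element of
  \<open>cspin UNIV\<close>. In \<open>Spin\<close> alone the angle is not determined, since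
  \<open>plane_rot (2 * pi)\<close> is \<open>- cl_one\<close>; in \<open>S_hat\<close> it is
  recorded as \<tau>, which makes the map a homeomorphism.\<close>

lemma simply_connected_S_hat:
  assumes "3 \<le> CARD('m)"
  shows "simply_connected (S_hat :: ('m::{finite,linorder} clifford \<times> real) set)"
proof -
  obtain p :: "'m mat_low \<Rightarrow> 'm clifford" where p: "continuous_on Omega p" "\<And>\<beta>. \<beta> \<in> Omega \<Longrightarrow> p \<beta> \<in> Spin"
    "\<And>\<beta>. \<beta> \<in> Omega \<Longrightarrow> smat (p \<beta>) = P_mat \<beta>" using Spin_section by metis
  let ?K = "cspin UNIV :: 'm clifford set"
  let ?Q = "(Omega :: 'm mat_low set) \<times> (UNIV :: real set) \<times> ?K"
  let ?F = "\<lambda>q :: 'm mat_low \<times> real \<times> 'm clifford. (p (fst q) \<odot> (plane_rot (fst (snd q)) \<odot> snd (snd q)), fst (snd q))"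
  let ?G = "\<lambda>z :: 'm clifford \<times> real. (pi2 (smat (fst z)), snd z, clrev (plane_rot (snd z)) \<odot> (clrev (p (pi2 (smat (fst z)))) \<odot> fst z))"
  have F: "?F (\<beta>, t, k) \<in> S_hat" "pi2 (smat (p \<beta> \<odot> (plane_rot t \<odot> k))) = \<beta>"
    if b: "\<beta> \<in> Omega" and k: "k \<in> ?K" for \<beta> t k
  proof -
    let ?x = "p \<beta> \<odot> (plane_rot t \<odot> k)" let ?Y = "P_mat \<beta> ** S_block (rho t) (mat 1)"
    have kS: "k \<in> Spin" using k cspin_Spin[OF assms] by blast
    have xS: "?x \<in> Spin" by (intro Spin_mult p b kS plane_rot_Spin)
    have X: "smat ?x = ?Y ** smat k"
      by (simp add: smat_Spin_mult Spin_mult p b kS plane_rot_Spin smat_plane_rot matrix_mul_assoc)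
    have Y: "?Y \<in> O_up" by (intro O_up_mult P_mat_O_up b S_block_rotation_O_up rho_SO)
    note D = decomposition_unique[OF Y b rho_SO SO_one refl]
    have XO: "?Y ** smat k \<in> O_up" using smat_Spin[OF xS] X by simp
    note c = cspin_mult_columns[OF k, of ?Y]
    have "psi (smat ?x) = rho t" using psi_row_cong[OF XO Y c(1)] D(2) X by simp
    then show "?F (\<beta>, t, k) \<in> S_hat" using xS by (simp add: S_hat_iff)
    show "pi2 (smat ?x) = \<beta>" using D(1) unfolding X pi2_def c .
  qed
  have G: "?G z \<in> ?Q" "?F (?G z) = z" if z: "z \<in> S_hat" for z
  proof -
    obtain x t where zx: "z = (x, t)" by (cases z)
    have x: "x \<in> Spin" "psi (smat x) = rho t" using z by (auto simp: zx S_hat_iff)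
    let ?X = "smat x" let ?y = "clrev (plane_rot t) \<odot> (clrev (p (pi2 ?X)) \<odot> x)"
    have X: "?X \<in> O_up" by (rule smat_Spin[OF x(1)])
    have b: "pi2 ?X \<in> Omega" by (rule pi2_Omega[OF X])
    have pS: "p (pi2 ?X) \<in> Spin" by (rule p(2)[OF b])
    have yS: "?y \<in> Spin" by (intro Spin_mult Spin_rev plane_rot_Spin pS x)
    have "smat ?y = padj (S_block (rho t) (mat 1)) ** (padj (P_mat (pi2 ?X)) ** ?X)"
      by (simp add: smat_Spin_mult smat_Spin_rev Spin_mult Spin_rev plane_rot_Spin pS x smat_plane_rot p(3)[OF b])
    also have "\<dots> = S_block (transpose (rho t)) (mat 1) ** S_block (rho t) (Psi ?X)"
      unfolding decomposition(5)[OF X, symmetric] x(2) by (simp add: S_block_def padj_from_blocks)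
    also have "\<dots> = S_block (mat 1) (Psi ?X)" by (simp add: S_block_mult SO_transpose_mult rho_SO)
    finally have "?y \<in> ?K" using fixing_columns_cspin yS Spin_pspin by blast
    then show "?G z \<in> ?Q" using b by (simp add: zx)
    show "?F (?G z) = z" by (simp add: zx Spin_simps plane_rot_Spin pS)
  qed
  have "homeomorphism ?Q S_hat ?F ?G"
  proof (rule homeomorphismI)
    have "continuous_on ?Q (\<lambda>q. p (fst q))" by (rule continuous_on_compose2[OF p(1)]) (auto intro!: continuous_intros)
    moreover have "continuous_on ?Q (\<lambda>q. plane_rot (fst (snd q)) :: 'm clifford)"
      by (rule continuous_on_compose2[OF continuous_on_plane_rot]) (auto intro!: continuous_intros)
    ultimately show "continuous_on ?Q ?F" by (intro continuous_on_Pair continuous_on_cl continuous_intros)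
    have s: "continuous_on S_hat (\<lambda>z :: 'm clifford \<times> real. smat (fst z))"
      by (rule continuous_on_compose2[OF continuous_on_smat[of UNIV]]) (auto intro!: continuous_intros)
    have b: "continuous_on S_hat (\<lambda>z :: 'm clifford \<times> real. pi2 (smat (fst z)))"
      by (rule continuous_on_compose2[OF smooth_on_imp_continuous_on[OF smooth_on_pi2] s]) (auto simp: S_hat_def smat_Spin)
    moreover have "continuous_on S_hat (\<lambda>z :: 'm clifford \<times> real. p (pi2 (smat (fst z))))"
      by (rule continuous_on_compose2[OF p(1) b]) (auto simp: S_hat_def smat_Spin pi2_Omega)
    moreover have "continuous_on S_hat (\<lambda>z. plane_rot (snd z) :: 'm clifford)"
      by (rule continuous_on_compose2[OF continuous_on_plane_rot]) (auto intro!: continuous_intros)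
    ultimately show "continuous_on S_hat ?G" by (intro continuous_on_Pair continuous_on_cl continuous_on_clrev continuous_intros)
    show "?F ` ?Q \<subseteq> S_hat" using F(1) by auto
    show "?G ` S_hat \<subseteq> ?Q" using G(1) by blast
    show "?F (?G z) = z" if "z \<in> S_hat" for z by (rule G(2)[OF that])
    show "?G (?F q) = q" if "q \<in> ?Q" for q
    proof -
      obtain \<beta> t k where q: "q = (\<beta>, t, k)" "\<beta> \<in> Omega" "k \<in> ?K" using \<open>q \<in> ?Q\<close> by auto
      have "?G (?F q) = (\<beta>, t, clrev (plane_rot t) \<odot> (clrev (p \<beta>) \<odot> (p \<beta> \<odot> (plane_rot t \<odot> k))))"
        unfolding q(1) fst_conv snd_conv F(2)[OF q(2,3)] ..
      then show ?thesis by (simp only: q(1) Spin_simps(4)[OF p(2)[OF q(2)]] Spin_simps(4)[OF plane_rot_Spin])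
    qed
  qed
  then have "?Q homeomorphic (S_hat :: ('m clifford \<times> real) set)" unfolding homeomorphic_def by (intro exI)
  moreover have "simply_connected ?Q"
    by (intro simply_connected_Times simply_connected_cspin[OF assms] convex_imp_simply_connected convex_Omega convex_UNIV)
  ultimately show ?thesis using homeomorphic_simply_connected by blast
qed

text \<open>\<open>spin_cover\<close> is a description that is identified with \<open>smat\<close>
  on \<open>Spin\<close> only, so the covering property has to be transferred between maps that
  agree on the total space.\<close>

lemma covering_space_cong:
  assumes "covering_space C p S" "\<And>x. x \<in> C \<Longrightarrow> q x = p x"
  shows "covering_space C q S"
  unfolding covering_space_def
proof (intro conjI ballI)
  show "continuous_on C q" "q ` C = S"
    using assms unfolding covering_space_def by (auto cong: continuous_on_cong)
  fix x assume "x \<in> S"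
  obtain T v where T: "x \<in> T" "openin (top_of_set S) T" "\<Union>v = C \<inter> p -` T"
    "\<forall>u\<in>v. openin (top_of_set C) u" "pairwise disjnt v" "\<forall>u\<in>v. \<exists>g. homeomorphism u T p g"
    using bspec[OF assms(1)[unfolded covering_space_def, THEN conjunct2, THEN conjunct2] \<open>x \<in> S\<close>]
    by (elim exE conjE) (rule that)
  have "\<exists>g. homeomorphism u T q g" if "u \<in> v" for u
  proof -
    obtain g where g: "homeomorphism u T p g" using bspec[OF T(6) \<open>u \<in> v\<close>] by (elim exE)
    have "q y = p y" if "y \<in> u" for y
      using UnionI[OF \<open>u \<in> v\<close> that] unfolding T(3) by (intro assms(2)) (rule IntD1)
    then have "homeomorphism u T q g" by (rule homeomorphism_cong[OF g refl refl _ refl])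
    then show ?thesis by (intro exI)
  qed
  note hom = this
  have pre: "C \<inter> q -` T = C \<inter> p -` T" using assms(2) by auto
  show "\<exists>T. x \<in> T \<and> openin (top_of_set S) T \<and>
      (\<exists>v. \<Union>v = C \<inter> q -` T \<and> (\<forall>u\<in>v. openin (top_of_set C) u) \<and> pairwise disjnt v \<and>
        (\<forall>u\<in>v. \<exists>g. homeomorphism u T q g))"
    by (intro exI[of _ T] conjI exI[of _ v] T(1,2) T(3)[folded pre] T(4,5) ballI hom)
qed

theorem mainTheorem5:
  fixes n :: nat
  assumes "2 \<le> n"
    and "CARD('m::{finite,linorder}) = n + 1"
  shows "embedded_submanifold (S_hat :: ('m clifford \<times> real) set) (Spin \<times> UNIV) \<and>
    universal_covering_group (S_hat_group :: ('m clifford \<times> real) monoid)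
      (\<lambda>(X, \<tau>). spin_cover X) (O_up_group :: 'm mat_full monoid)"
proof -
  have eq: "(case z of (X, \<tau>) \<Rightarrow> spin_cover X) = smat (fst z)" if "z \<in> S_hat" for z :: "'m clifford \<times> real"
    using that by (auto simp: S_hat_def spin_cover_Spin)
  interpret h: group_hom S_hat_group O_up_group "\<lambda>z :: 'm clifford \<times> real. smat (fst z)"
    by (rule group_hom_S_hat)
  have "(\<lambda>(X, \<tau>). spin_cover X) \<in> hom S_hat_group (O_up_group :: 'm mat_full monoid)"
  proof (rule homI)
    fix x y :: "'m clifford \<times> real"
    assume xy: "x \<in> carrier S_hat_group" "y \<in> carrier (S_hat_group :: ('m clifford \<times> real) monoid)"
    then show "(case x \<otimes>\<^bsub>S_hat_group\<^esub> y of (X, \<tau>) \<Rightarrow> spin_cover X) =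
        (case x of (X, \<tau>) \<Rightarrow> spin_cover X) \<otimes>\<^bsub>O_up_group\<^esub> (case y of (X, \<tau>) \<Rightarrow> spin_cover X)"
      using h.hom_mult[OF xy] h.G.m_closed[OF xy] eq unfolding S_hat_group_simps(1) by simp
  next
    fix x :: "'m clifford \<times> real" assume x: "x \<in> carrier (S_hat_group :: ('m clifford \<times> real) monoid)"
    then show "(case x of (X, \<tau>) \<Rightarrow> spin_cover X) \<in> carrier O_up_group"
      using h.hom_closed[OF x] eq unfolding S_hat_group_simps(1) by simp
  qed
  moreover have "smooth_on S_hat (\<lambda>z :: 'm clifford \<times> real. smat (fst z))"
    by (rule smooth_on_compose[OF smooth_on_smat[of UNIV] smooth_on_fst[OF smooth_on_id]]) auto
  then have "smooth_on S_hat (\<lambda>(X :: 'm clifford, \<tau> :: real). spin_cover X)"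
    by (rule smooth_on_cong) (simp add: eq)
  moreover have "covering_space S_hat (\<lambda>(X :: 'm clifford, \<tau> :: real). spin_cover X) O_up"
    by (rule covering_space_cong[OF covering_S_hat eq])
  moreover have "simply_connected (S_hat :: ('m clifford \<times> real) set)"
    by (rule simply_connected_S_hat) (use assms in simp)
  ultimately show ?thesis
    unfolding universal_covering_group_def S_hat_group_simps(1) O_up_group_simps(1)
    using embedded_S_hat(1) lie_group_S_hat lie_group_O_up by blast
qed

end
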